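(* Let $V\subset\mathbb{R}^n$ be a non-singular irreducible real algebraic variety with coordinate ring $A=\mathbb{R}[V]$. Then $\mathcal{R}^0(V)$ has the substitution property over $A$ along arcs in $\mathbb{R}[[t^*]]$: every $\mathbb{R}$-algebra homomorphism $A\to\mathbb{R}[[t^*]]$ admits one and only one extension to a homomorphism $\mathcal{R}^0(V)\to\mathbb{R}[[t^*]]$. Moreover, if $B$ is a subring of $\mathbb{R}(V)$ containing $\mathbb{R}[V]$ which has the substitution property over $A$ along arcs in $\mathbb{R}[[t^*]]$, then $B\subset\mathcal{R}^0(V)$.
   Context: $\mathbb{R}[[t^*]]$ denotes the valuation ring of the field of (formal) Puiseux series over $\mathbb{R}$, i.e. the ring of Puiseux series $\sum_{i\ge0}a_it^{i/m}$ ($m\ge1$) of non-negative order. $\mathcal{R}^0(V)$ is the ring of continuous rational functions on $V$ (continuous functions whose restriction to some non-empty Zariski open set is regular), viewed inside the field $\mathbb{R}(V)$ of rational functions. *)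

theory Defs
  imports "HOL-Analysis.Analysis"
begin

inductive_set polyfun :: "(real^'n::finite \<Rightarrow> real) set" where
  pf_const: "(\<lambda>x. c) \<in> polyfun"
| pf_coord: "(\<lambda>x. x $ i) \<in> polyfun"
| pf_add: "f \<in> polyfun \<Longrightarrow> g \<in> polyfun \<Longrightarrow> (\<lambda>x. f x + g x) \<in> polyfun"
| pf_mult: "f \<in> polyfun \<Longrightarrow> g \<in> polyfun \<Longrightarrow> (\<lambda>x. f x * g x) \<in> polyfun"

definition zero_set :: "(real^'n::finite \<Rightarrow> real) set \<Rightarrow> (real^'n) set" where
  "zero_set F = {x. \<forall>f\<in>F. f x = 0}"

definition algebraic_set :: "(real^'n::finite) set \<Rightarrow> bool" where
  "algebraic_set V \<longleftrightarrow> (\<exists>F. F \<subseteq> polyfun \<and> V = zero_set F)"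

definition irreducible_alg :: "(real^'n::finite) set \<Rightarrow> bool" where
  "irreducible_alg V \<longleftrightarrow> algebraic_set V \<and> V \<noteq> {} \<and>
     (\<forall>Z1 Z2. algebraic_set Z1 \<longrightarrow> algebraic_set Z2 \<longrightarrow> V \<subseteq> Z1 \<union> Z2 \<longrightarrow>
        V \<subseteq> Z1 \<or> V \<subseteq> Z2)"

definition vanishing :: "(real^'n::finite) set \<Rightarrow> (real^'n \<Rightarrow> real) set" where
  "vanishing V = {f \<in> polyfun. \<forall>x\<in>V. f x = 0}"

definition alg_dim :: "(real^'n::finite) set \<Rightarrow> nat" where
  "alg_dim V = Sup {k. \<exists>Z :: nat \<Rightarrow> (real^'n) set.
      (\<forall>i\<le>k. irreducible_alg (Z i) \<and> Z i \<subseteq> V) \<and> (\<forall>i<k. Z i \<subset> Z (Suc i))}"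

text \<open>Non-singular point (BCR 3.3.9): the gradients at x of the polynomials in
  I(V) span a space of dimension n - dim V.\<close>
definition nonsingular_at :: "(real^'n::finite) set \<Rightarrow> real^'n \<Rightarrow> bool" where
  "nonsingular_at V x \<longleftrightarrow>
     dim (span {v. \<exists>f\<in>vanishing V. (f has_derivative (\<lambda>h. v \<bullet> h)) (at x)})
       = CARD('n) - alg_dim V"

definition nonsingular :: "(real^'n::finite) set \<Rightarrow> bool" where
  "nonsingular V \<longleftrightarrow> (\<forall>x\<in>V. nonsingular_at V x)"

definition zopen_in :: "(real^'n::finite) set \<Rightarrow> (real^'n) set \<Rightarrow> bool" where
  "zopen_in V U \<longleftrightarrow> (\<exists>F. F \<subseteq> polyfun \<and> U = V - zero_set F)"

text \<open>An element of R(V) is represented as the class of all functions that agree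
  with p/q (q not identically zero on V) on some non-empty Zariski open subset
  of V (on which q does not vanish).\<close>
definition ratfun_class :: "(real^'n::finite) set \<Rightarrow> (real^'n \<Rightarrow> real) \<Rightarrow> (real^'n \<Rightarrow> real)
    \<Rightarrow> (real^'n \<Rightarrow> real) set" where
  "ratfun_class V p q = {g. \<exists>U. zopen_in V U \<and> U \<noteq> {} \<and>
       (\<forall>x\<in>U. q x \<noteq> 0 \<and> g x = p x / q x)}"

definition RV :: "(real^'n::finite) set \<Rightarrow> (real^'n \<Rightarrow> real) set set" where
  "RV V = {ratfun_class V p q | p q. p \<in> polyfun \<and> q \<in> polyfun \<and> (\<exists>x\<in>V. q x \<noteq> 0)}"

definition coord_ring :: "(real^'n::finite) set \<Rightarrow> (real^'n \<Rightarrow> real) set set" where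
  "coord_ring V = {ratfun_class V p (\<lambda>x. 1) | p. p \<in> polyfun}"

definition rf_const :: "(real^'n::finite) set \<Rightarrow> real \<Rightarrow> (real^'n \<Rightarrow> real) set" where
  "rf_const V r = ratfun_class V (\<lambda>x. r) (\<lambda>x. 1)"

text \<open>Continuous rational functions R^0(V): elements of R(V) having a representative
  which is continuous on V (such a function is regular on a non-empty Zariski open set).\<close>
definition R0 :: "(real^'n::finite) set \<Rightarrow> (real^'n \<Rightarrow> real) set set" where
  "R0 V = {c \<in> RV V. \<exists>g\<in>c. continuous_on V g}"

definition rf_add :: "('a \<Rightarrow> real) set \<Rightarrow> ('a \<Rightarrow> real) set \<Rightarrow> ('a \<Rightarrow> real) set" where
  "rf_add c d = {(\<lambda>x. a x + b x) | a b. a \<in> c \<and> b \<in> d}"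

definition rf_mult :: "('a \<Rightarrow> real) set \<Rightarrow> ('a \<Rightarrow> real) set \<Rightarrow> ('a \<Rightarrow> real) set" where
  "rf_mult c d = {(\<lambda>x. a x * b x) | a b. a \<in> c \<and> b \<in> d}"

definition rf_neg :: "('a \<Rightarrow> real) set \<Rightarrow> ('a \<Rightarrow> real) set" where
  "rf_neg c = {(\<lambda>x. - a x) | a. a \<in> c}"

definition is_subring_RV :: "(real^'n::finite) set \<Rightarrow> (real^'n \<Rightarrow> real) set set \<Rightarrow> bool" where
  "is_subring_RV V B \<longleftrightarrow> coord_ring V \<subseteq> B \<and> B \<subseteq> RV V \<and>
     (\<forall>c\<in>B. \<forall>d\<in>B. rf_add c d \<in> B \<and> rf_mult c d \<in> B \<and> rf_neg c \<in> B)"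

text \<open>A Puiseux series sum a_q t^q is its coefficient function on the rationals;
  non-negative order and support in (1/m)N for some m \<ge> 1.\<close>
definition puiseux :: "(rat \<Rightarrow> real) set" where
  "puiseux = {a. (\<forall>q. a q \<noteq> 0 \<longrightarrow> q \<ge> 0) \<and>
      (\<exists>m::nat. m \<ge> 1 \<and> (\<forall>q. a q \<noteq> 0 \<longrightarrow> of_nat m * q \<in> \<int>))}"

definition padd :: "(rat \<Rightarrow> real) \<Rightarrow> (rat \<Rightarrow> real) \<Rightarrow> (rat \<Rightarrow> real)" where
  "padd a b = (\<lambda>q. a q + b q)"

text \<open>Cauchy product; the index set is finite for elements of puiseux.\<close>
definition pmul :: "(rat \<Rightarrow> real) \<Rightarrow> (rat \<Rightarrow> real) \<Rightarrow> (rat \<Rightarrow> real)" where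
  "pmul a b = (\<lambda>q. \<Sum>r\<in>{r. a r \<noteq> 0 \<and> b (q - r) \<noteq> 0}. a r * b (q - r))"

definition pconst :: "real \<Rightarrow> (rat \<Rightarrow> real)" where
  "pconst c = (\<lambda>q. if q = 0 then c else 0)"

definition ring_hom_into_puiseux ::
    "(real^'n::finite) set \<Rightarrow> (real^'n \<Rightarrow> real) set set \<Rightarrow> ((real^'n \<Rightarrow> real) set \<Rightarrow> (rat \<Rightarrow> real)) \<Rightarrow> bool" where
  "ring_hom_into_puiseux V S \<phi> \<longleftrightarrow> (\<forall>c\<in>S. \<phi> c \<in> puiseux) \<and>
     \<phi> (rf_const V 1) = pconst 1 \<and>
     (\<forall>c\<in>S. \<forall>d\<in>S. \<phi> (rf_add c d) = padd (\<phi> c) (\<phi> d) \<and> \<phi> (rf_mult c d) = pmul (\<phi> c) (\<phi> d))"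

definition alg_hom_coord_ring ::
    "(real^'n::finite) set \<Rightarrow> ((real^'n \<Rightarrow> real) set \<Rightarrow> (rat \<Rightarrow> real)) \<Rightarrow> bool" where
  "alg_hom_coord_ring V \<phi> \<longleftrightarrow> ring_hom_into_puiseux V (coord_ring V) \<phi> \<and>
     (\<forall>r. \<phi> (rf_const V r) = pconst r)"

definition subst_prop :: "(real^'n::finite) set \<Rightarrow> (real^'n \<Rightarrow> real) set set \<Rightarrow> bool" where
  "subst_prop V B \<longleftrightarrow> (\<forall>\<phi>. alg_hom_coord_ring V \<phi> \<longrightarrow>
     (\<exists>\<psi>. ring_hom_into_puiseux V B \<psi> \<and> (\<forall>c\<in>coord_ring V. \<psi> c = \<phi> c) \<and>
        (\<forall>\<psi>'. ring_hom_into_puiseux V B \<psi>' \<and> (\<forall>c\<in>coord_ring V. \<psi>' c = \<phi> c) \<longrightarrow>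
           (\<forall>c\<in>B. \<psi>' c = \<psi> c))))"

end

theory Submission
  imports Defs "HOL-Computational_Algebra.Formal_Laurent_Series" "HOL-Computational_Algebra.Polynomial_Factorial"
    "HOL-Computational_Algebra.Field_as_Ring"
begin

text \<open>
  Puiseux series form a real closed field, so Tarski's transfer principle relates it to the reals.
  A homomorphism on the coordinate ring is evaluation at a finite Puiseux point \<open>\<gamma>\<close> of V. A continuous
  rational function p/q extends to \<open>\<gamma>\<close> because the existence of its limit along the non-zero locus of q
  at every point of V transfers; that this locus is dense uses non-singularity.

  For uniqueness, choose in an adapted chart around the real point below \<open>\<gamma>\<close> a direction e and the least j
  such that the derivative \<open>b = D\<^sub>e\<^sup>j q\<close> does not vanish at \<open>\<gamma>\<close>. By L'Hopital's rule, \<open>H = b F - D\<^sub>e\<^sup>j p\<close>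
  vanishes on V near that point wherever the sum w of the squares of the lower derivatives of q does.
  Lojasiewicz' inequality then makes \<open>H\<^bsup>2N+2\<^esup> / (w + H\<^sup>2 |x - x\<^sub>0|\<^bsup>2M\<^esup>)\<close> continuous for a fixed N and every M;
  as w vanishes at \<open>\<gamma>\<close>, the image of H is infinitely divisible, hence zero, and F is determined by p and q.

  Conversely, an element p/q of B takes a value at every point of V, through the constant arc. If these
  values were discontinuous, curve selection, again an instance of transfer, would give an arc along
  which the residue of the extension is a second extension along the constant arc.
\<close>

section \<open>Real closed fields and sign tables\<close>

text \<open>The obstacle is uniqueness. From F q = p the image of F is known only if q does not
  vanish at the arc, but the arc may lie entirely inside the zeros of q, and a homomorphism is not
  assumed to respect limits; so the limit that gives existence says nothing about a second
  extension. Every constraint has to come from identities between elements of R^0(V), which is why a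
  quotient must be shown to be continuous.

  Transfer is semantic: a formula is a pair of predicates, one for each field, and it counts as
  eliminated if the signs of finitely many polynomials decide both alike. A statement with a real
  parameter s can moreover be evaluated at s = t in the Puiseux field and read back for all small s
  > 0; this is the source of the Lojasiewicz exponent.

  Dimension is a supremum of chain lengths. Density of a Zariski open set is therefore proved by
  building a chain that would be too long, which requires that chains be bounded at all; that bound
  comes from counting monomials, without transcendence degrees.\<close>

class real_closed = linordered_field +
  assumes sum_ivt: "a < b \<Longrightarrow> (\<Sum>i\<le>n::nat. c i * a ^ i) < 0 \<Longrightarrow> 0 < (\<Sum>i\<le>n. c i * b ^ i) \<Longrightarrow>
    \<exists>x. a < x \<and> x < b \<and> (\<Sum>i\<le>n. c i * x ^ i) = 0"

lemma poly_ivt: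
  fixes p :: "'a::real_closed poly"
  assumes "a < b" "poly p a < 0" "0 < poly p b"
  shows "\<exists>c. a < c \<and> c < b \<and> poly p c = 0"
  using sum_ivt[of a b "coeff p" "degree p"] assms by (simp add: poly_altdef)

lemma real_closedI:
  assumes "\<And>(p::'a::linordered_field poly) a b. a < b \<Longrightarrow> poly p a < 0 \<Longrightarrow> 0 < poly p b \<Longrightarrow> \<exists>c. a < c \<and> c < b \<and> poly p c = 0"
    and "(a::'a) < b" "(\<Sum>i\<le>n::nat. c i * a ^ i) < 0" "0 < (\<Sum>i\<le>n. c i * b ^ i)"
  shows "\<exists>x. a < x \<and> x < b \<and> (\<Sum>i\<le>n. c i * x ^ i) = 0"
  using assms(1)[of a b "\<Sum>i\<le>n. monom (c i) i"] assms(2-) by (simp add: poly_sum poly_monom)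

instance real :: real_closed
  by standard (rule real_closedI, use poly_IVT_pos in blast)

text \<open>Integer valued, so that signs taken in two different fields can be compared.\<close>

definition ssgn :: "'a::linordered_field \<Rightarrow> int" where
  "ssgn x = (if x > 0 then 1 else if x < 0 then -1 else 0)"

lemma ssgn_0 [simp]: "ssgn x = 0 \<longleftrightarrow> x = 0"
  and ssgn_pos: "ssgn x = 1 \<longleftrightarrow> x > 0"
  and ssgn_neg: "ssgn x = -1 \<longleftrightarrow> x < 0"
  by (auto simp: ssgn_def)

lemma ssgn_zero [simp]: "ssgn 0 = 0" by simp

lemma ssgn_mult: "ssgn (x * y) = ssgn x * ssgn y"
  by (auto simp: ssgn_def zero_less_mult_iff mult_less_0_iff)

lemma ssgn_minus [simp]: "ssgn (- x) = - ssgn x"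
  by (auto simp: ssgn_def)

lemma ssgn_power: "ssgn (x ^ n) = ssgn x ^ n"
  by (induction n) (simp_all add: ssgn_mult, simp add: ssgn_def)

lemma ssgn_cancel_left: "ssgn c = ssgn d \<Longrightarrow> c \<noteq> 0 \<Longrightarrow> ssgn (c * x) = ssgn (d * y) \<Longrightarrow> ssgn x = ssgn y"
  by (auto simp: ssgn_mult)

section \<open>Signs, roots and derivatives of polynomials\<close>

lemma poly_no_root_ssgn:
  fixes p :: "'a::real_closed poly"
  assumes "a \<le> b" and nr: "\<And>c. a \<le> c \<Longrightarrow> c \<le> b \<Longrightarrow> poly p c \<noteq> 0"
  shows "ssgn (poly p a) = ssgn (poly p b)"
proof (rule ccontr)
  assume ne: "ssgn (poly p a) \<noteq> ssgn (poly p b)"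
  have "a < b" using ne assms(1) by (cases "a = b") auto
  have "poly p a \<noteq> 0" "poly p b \<noteq> 0" using nr assms(1) by auto
  then consider "poly p a < 0" "poly p b > 0" | "poly (-p) a < 0" "poly (-p) b > 0"
    using ne by (auto simp: ssgn_def split: if_splits)
  then show False
    using poly_ivt[OF \<open>a < b\<close>, of p] poly_ivt[OF \<open>a < b\<close>, of "-p"] nr
    by cases (force simp: less_imp_le)+
qed

lemma poly_no_root_ssgn_left:
  fixes p :: "'a::real_closed poly"
  assumes "a < b" "poly p a \<noteq> 0" and "\<And>c. a < c \<Longrightarrow> c \<le> b \<Longrightarrow> poly p c \<noteq> 0"
  shows "ssgn (poly p a) = ssgn (poly p b)"
  using poly_no_root_ssgn[of a b p] assms by (metis less_le)

text \<open>Continuity in epsilon-delta form over an arbitrary ordered field: p(x) - p(a) is (x - a)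
  times the quotient of a synthetic division, and that quotient is bounded near a.\<close>

lemma poly_local_sign:
  fixes p :: "'a::linordered_field poly"
  assumes "poly p a > 0"
  shows "\<exists>d>0. \<forall>x. \<bar>x - a\<bar> < d \<longrightarrow> poly p x > 0"
proof -
  have bd: "\<exists>C>0. \<forall>x. \<bar>x - a\<bar> \<le> 1 \<longrightarrow> \<bar>poly q x\<bar> \<le> C" for q :: "'a poly"
  proof (induction q)
    case 0 show ?case by (intro exI[of _ 1]) auto
  next
    case (pCons c q)
    then obtain C where C: "C > 0" "\<And>x. \<bar>x - a\<bar> \<le> 1 \<Longrightarrow> \<bar>poly q x\<bar> \<le> C" by blast
    show ?case
    proof (intro exI[of _ "\<bar>c\<bar> + (\<bar>a\<bar> + 1) * C + 1"] conjI allI impI)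
      show "0 < \<bar>c\<bar> + (\<bar>a\<bar> + 1) * C + 1" using C(1)
        by (smt (verit) abs_ge_zero add_nonneg_pos add_nonneg_nonneg less_imp_le mult_nonneg_nonneg zero_less_one)
      fix x assume x: "\<bar>x - a\<bar> \<le> 1"
      have "\<bar>x\<bar> \<le> \<bar>a\<bar> + 1" using x by linarith
      then have "\<bar>x * poly q x\<bar> \<le> (\<bar>a\<bar> + 1) * C"
        unfolding abs_mult using C(2)[OF x] C(1) by (intro mult_mono) auto
      then show "\<bar>poly (pCons c q) x\<bar> \<le> \<bar>c\<bar> + (\<bar>a\<bar> + 1) * C + 1" by simp
    qed
  qed
  define q where "q = synthetic_div p a"
  have pe: "poly p x = (x - a) * poly q x + poly p a" for x
    using arg_cong[OF synthetic_div_correct'[of a p], of "\<lambda>r. poly r x"]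
    by (simp add: q_def algebra_simps)
  obtain C where C: "C > 0" "\<And>x. \<bar>x - a\<bar> \<le> 1 \<Longrightarrow> \<bar>poly q x\<bar> \<le> C" using bd by blast
  show ?thesis
  proof (intro exI[of _ "min 1 (poly p a / C)"] conjI allI impI)
    show "0 < min 1 (poly p a / C)" using C assms by auto
    fix x assume x: "\<bar>x - a\<bar> < min 1 (poly p a / C)"
    have "\<bar>(x - a) * poly q x\<bar> \<le> \<bar>x - a\<bar> * C"
      unfolding abs_mult using C(2)[of x] x by (intro mult_left_mono) auto
    also have "\<dots> < poly p a" using x C(1) by (simp add: pos_less_divide_eq)
    finally show "poly p x > 0" unfolding pe[of x] by linarith
  qed
qed

text \<open>With p = (X - a)^m q and q(a) nonzero, p p' (X - a) is the square of (X - a)^m times q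
  (m q + (X - a) q'), and the latter has the value m q(a)^2 > 0 at a. So p p' changes sign from
  minus to plus at every root.\<close>

lemma poly_sign_near_root:
  fixes p :: "'a::linordered_field poly"
  assumes "p \<noteq> 0" "poly p a = 0"
  shows "\<exists>d>0. \<forall>x. \<bar>x - a\<bar> < d \<longrightarrow> x \<noteq> a \<longrightarrow> poly p x * poly (pderiv p) x * (x - a) > 0"
proof -
  define m where "m = order a p"
  have "m > 0" using assms by (simp add: m_def order_root)
  obtain q where q: "p = [:-a,1:]^m * q" "\<not> [:-a,1:] dvd q"
    using order_decomp[OF assms(1), of a] m_def by blast
  have qa: "poly q a \<noteq> 0" using q(2) by (simp add: poly_eq_0_iff_dvd)
  obtain k where k: "m = Suc k" using \<open>m > 0\<close> gr0_implies_Suc by blast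
  define r where "r = q * (smult (of_nat m) q + [:-a,1:] * pderiv q)"
  have "poly r a = of_nat m * (poly q a)\<^sup>2" by (simp add: r_def power2_eq_square)
  then have "poly r a > 0" using qa \<open>m > 0\<close> by simp
  then obtain d where d: "d > 0" "\<And>x. \<bar>x - a\<bar> < d \<Longrightarrow> poly r x > 0"
    using poly_local_sign by blast
  have pd: "pderiv p = [:-a,1:]^k * (smult (of_nat m) q + [:-a,1:] * pderiv q)"
    unfolding q(1) k pderiv_mult pderiv_power_Suc
    by (simp add: algebra_simps pderiv_pCons one_pCons[symmetric] del: mult_pCons_left mult_pCons_right)
  have "poly p x = (x - a) ^ k * (x - a) * poly q x" for x unfolding q(1) k by (simp add: algebra_simps)
  moreover have "poly (pderiv p) x = (x - a) ^ k * (of_nat m * poly q x + (x - a) * poly (pderiv q) x)" for x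
    unfolding pd by (simp add: algebra_simps)
  moreover have "poly r x = poly q x * (of_nat m * poly q x + (x - a) * poly (pderiv q) x)" for x
    unfolding r_def by (simp add: algebra_simps)
  ultimately have "poly p x * poly (pderiv p) x * (x - a) = ((x - a)^m)\<^sup>2 * poly r x" for x
    unfolding k by (simp add: power2_eq_square mult_ac)
  then show ?thesis using d by (intro exI[of _ d]) auto
qed

text \<open>Just after a root p p' is positive and just before the next root \<open>v\<close> it is
  negative, so it has a zero in between; p has none there, hence p' does.\<close>

lemma poly_rolle:
  fixes p :: "'a::real_closed poly"
  assumes "a < b" "poly p a = 0" "poly p b = 0"
  shows "\<exists>c. a < c \<and> c < b \<and> poly (pderiv p) c = 0"
proof (cases "p = 0")
  case True
  then show ?thesis using assms(1) dense[of a b] by auto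
next
  case False
  define Z where "Z = {x. a < x \<and> x \<le> b \<and> poly p x = 0}"
  have fin: "finite Z" using poly_roots_finite[OF False] by (rule rev_finite_subset) (auto simp: Z_def)
  have "b \<in> Z" using assms by (auto simp: Z_def)
  define v where "v = Min Z"
  have vZ: "v \<in> Z" unfolding v_def using fin \<open>b \<in> Z\<close> by (intro Min_in) auto
  have vmin: "\<And>x. x \<in> Z \<Longrightarrow> v \<le> x" unfolding v_def using fin by auto
  have v: "a < v" "v \<le> b" "poly p v = 0" using vZ by (auto simp: Z_def)
  have nr: "poly p x \<noteq> 0" if "a < x" "x < v" for x using vmin[of x] that v(2) by (auto simp: Z_def)
  obtain d1 where d1: "d1 > 0" "\<And>x. \<bar>x - a\<bar> < d1 \<Longrightarrow> x \<noteq> a \<Longrightarrow> poly p x * poly (pderiv p) x * (x - a) > 0"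
    using poly_sign_near_root[OF False assms(2)] by blast
  obtain d2 where d2: "d2 > 0" "\<And>x. \<bar>x - v\<bar> < d2 \<Longrightarrow> x \<noteq> v \<Longrightarrow> poly p x * poly (pderiv p) x * (x - v) > 0"
    using poly_sign_near_root[OF False v(3)] by blast
  define e where "e = min (min (d1/2) (d2/2)) ((v - a)/3)"
  have e: "e > 0" "e < d1" "e < d2" "3 * e \<le> v - a" using d1 d2 v(1) by (auto simp: e_def min_def field_simps)
  have "poly p (a+e) * poly (pderiv p) (a+e) * (a+e - a) > 0" using d1(2)[of "a+e"] e by auto
  then have 1: "poly (p * pderiv p) (a+e) > 0" using e(1) by (simp add: zero_less_mult_iff)
  have "poly p (v-e) * poly (pderiv p) (v-e) * (v-e - v) > 0" using d2(2)[of "v-e"] e by auto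
  then have 2: "poly (p * pderiv p) (v-e) < 0" using e(1) by (simp add: mult_less_0_iff)
  have lt: "a + e < v - e" using e by auto
  have "\<exists>c. a + e < c \<and> c < v - e \<and> poly (- (p * pderiv p)) c = 0"
    by (rule poly_ivt[OF lt]) (use 1 2 in auto)
  then obtain c where c: "a + e < c" "c < v - e" "poly p c * poly (pderiv p) c = 0" by auto
  have "poly p c \<noteq> 0" using nr[of c] c e by auto
  then show ?thesis using c e v by (intro exI[of _ c]) auto
qed

lemma poly_mvt:
  fixes p :: "'a::real_closed poly"
  assumes "a < b"
  shows "\<exists>c. a < c \<and> c < b \<and> poly p b - poly p a = (b - a) * poly (pderiv p) c"
proof -
  define m where "m = (poly p b - poly p a) / (b - a)"
  define q where "q = p - [:poly p a - m * a, m:]"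
  have "m * (b - a) = poly p b - poly p a" using assms by (simp add: m_def)
  then have "poly q a = 0" "poly q b = 0" by (simp_all add: q_def algebra_simps)
  then obtain c where "a < c" "c < b" "poly (pderiv q) c = 0" using poly_rolle[OF assms] by blast
  moreover have "pderiv q = pderiv p - [:m:]" by (simp add: q_def pderiv_diff pderiv_pCons)
  ultimately show ?thesis using assms by (intro exI[of _ c]) (auto simp: m_def field_simps)
qed

lemma poly_ssgn_from_root_left:
  fixes p :: "'a::real_closed poly"
  assumes "a < b" and nr: "\<And>c. a < c \<Longrightarrow> c \<le> b \<Longrightarrow> poly (pderiv p) c \<noteq> 0"
  shows "ssgn (poly p b - poly p a) = ssgn (poly (pderiv p) b)"
proof -
  obtain c where c: "a < c" "c < b" "poly p b - poly p a = (b - a) * poly (pderiv p) c"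
    using poly_mvt[OF assms(1)] by blast
  have "ssgn (poly (pderiv p) c) = ssgn (poly (pderiv p) b)"
    by (rule poly_no_root_ssgn) (use c nr in auto)
  moreover have "ssgn (b - a) = 1" using assms(1) by (simp add: ssgn_pos)
  ultimately show ?thesis unfolding c(3) ssgn_mult by simp
qed

lemma poly_ssgn_from_root_right:
  fixes p :: "'a::real_closed poly"
  assumes "a < b" and nr: "\<And>c. a \<le> c \<Longrightarrow> c < b \<Longrightarrow> poly (pderiv p) c \<noteq> 0"
  shows "ssgn (poly p b - poly p a) = ssgn (poly (pderiv p) a)"
proof -
  obtain c where c: "a < c" "c < b" "poly p b - poly p a = (b - a) * poly (pderiv p) c"
    using poly_mvt[OF assms(1)] by blast
  have "ssgn (poly (pderiv p) a) = ssgn (poly (pderiv p) c)"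
    by (rule poly_no_root_ssgn) (use c nr in auto)
  moreover have "ssgn (b - a) = 1" using assms(1) by (simp add: ssgn_pos)
  ultimately show ?thesis unfolding c(3) ssgn_mult by simp
qed

lemma poly_ge_lead_coeff:
  fixes p :: "'a::linordered_field poly"
  shows "lead_coeff p > 0 \<Longrightarrow> \<exists>B. \<forall>x\<ge>B. poly p x \<ge> lead_coeff p"
proof (induction p)
  case (pCons a p)
  show ?case
  proof (cases "p = 0")
    case False
    then have lc: "lead_coeff (pCons a p) = lead_coeff p" by simp
    with pCons obtain B where B: "\<And>x. x \<ge> B \<Longrightarrow> poly p x \<ge> lead_coeff p" by auto
    define l where "l = lead_coeff p"
    have l: "l > 0" using pCons(3) lc l_def by simp
    show ?thesis unfolding lc l_def[symmetric]
    proof (intro exI[of _ "max (max B 0) ((l - a)/l)"] allI impI)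
      fix x assume x: "x \<ge> max (max B 0) ((l - a)/l)"
      have "x * poly p x \<ge> x * l" using x B l_def by (intro mult_left_mono) auto
      moreover have "x * l \<ge> l - a" using x l by (auto simp: pos_divide_le_eq)
      ultimately show "poly (pCons a p) x \<ge> l" by simp
    qed
  qed (use pCons in auto)
qed simp

lemma poly_ssgn_pinfinity:
  fixes p :: "'a::linordered_field poly"
  shows "\<exists>B. \<forall>x\<ge>B. ssgn (poly p x) = ssgn (lead_coeff p)"
proof -
  consider "lead_coeff p = 0" | "lead_coeff p > 0" | "lead_coeff (-p) > 0" by (auto simp: lead_coeff_minus) force
  then show ?thesis
  proof cases
    case 2
    then obtain B where "\<And>x. x \<ge> B \<Longrightarrow> poly p x \<ge> lead_coeff p" using poly_ge_lead_coeff by blast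
    then have "poly p x > 0" if "x \<ge> B" for x using 2 that less_le_trans by blast
    then show ?thesis using 2 by (intro exI[of _ B]) (auto simp: ssgn_def)
  next
    case 3
    then obtain B where B: "\<And>x. x \<ge> B \<Longrightarrow> poly (-p) x \<ge> lead_coeff (-p)" using poly_ge_lead_coeff by blast
    have "poly p x < 0" if "x \<ge> B" for x using B[OF that] 3 by (simp add: lead_coeff_minus)
    then show ?thesis using 3 by (intro exI[of _ B]) (metis lead_coeff_minus neg_0_less_iff_less ssgn_neg)
  qed auto
qed

lemma poly_ssgn_minfinity:
  fixes p :: "'a::linordered_field poly"
  shows "\<exists>B. \<forall>x\<le>B. ssgn (poly p x) = ssgn (lead_coeff p) * (-1) ^ degree p"
proof -
  define q where "q = pcompose p [:0,-1:]"
  have lq: "lead_coeff q = lead_coeff p * (-1) ^ degree p" unfolding q_def by (subst lead_coeff_comp) auto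
  obtain B where B: "\<And>x. x \<ge> B \<Longrightarrow> ssgn (poly q x) = ssgn (lead_coeff q)" using poly_ssgn_pinfinity by blast
  have "ssgn (poly p x) = ssgn (lead_coeff p) * (-1) ^ degree p" if "x \<le> -B" for x
    using B[of "-x"] that lq by (simp add: q_def poly_pcompose ssgn_mult ssgn_power, simp add: ssgn_def)
  then show ?thesis by blast
qed

lemma poly_ssgn_no_root_below:
  fixes p :: "'a::real_closed poly"
  assumes "\<And>c. c \<le> y \<Longrightarrow> poly p c \<noteq> 0"
  shows "ssgn (poly p y) = ssgn (lead_coeff p) * (-1) ^ degree p"
proof -
  obtain B where B: "\<And>x. x \<le> B \<Longrightarrow> ssgn (poly p x) = ssgn (lead_coeff p) * (-1) ^ degree p"
    using poly_ssgn_minfinity by blast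
  show ?thesis using poly_no_root_ssgn[of "min B y" y p] assms B[of "min B y"] by auto
qed

lemma poly_ssgn_no_root_above:
  fixes p :: "'a::real_closed poly"
  assumes "\<And>c. y \<le> c \<Longrightarrow> poly p c \<noteq> 0"
  shows "ssgn (poly p y) = ssgn (lead_coeff p)"
proof -
  obtain B where B: "\<And>x. x \<ge> B \<Longrightarrow> ssgn (poly p x) = ssgn (lead_coeff p)"
    using poly_ssgn_pinfinity by blast
  show ?thesis using poly_no_root_ssgn[of y "max B y" p] assms B[of "max B y"] by auto
qed

text \<open>The members of \<open>G\<close> are pairs of corresponding roots in two fields. Matched
  points lie on corresponding roots or in corresponding gaps between them.\<close>

definition matched :: "('a::linorder \<times> 'b::linorder) set \<Rightarrow> 'a \<Rightarrow> 'b \<Rightarrow> bool" where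
  "matched G y y' \<longleftrightarrow> (\<forall>(z,z')\<in>G. (z < y \<longleftrightarrow> z' < y') \<and> (y < z \<longleftrightarrow> y' < z'))"

lemma matchedD:
  assumes "matched G y y'" "(z,z') \<in> G"
  shows "z < y \<longleftrightarrow> z' < y'" "y < z \<longleftrightarrow> y' < z'" "z = y \<longleftrightarrow> z' = y'" "z \<le> y \<longleftrightarrow> z' \<le> y'" "y \<le> z \<longleftrightarrow> y' \<le> z'"
proof -
  have *: "z < y \<longleftrightarrow> z' < y'" "y < z \<longleftrightarrow> y' < z'" using assms by (auto simp: matched_def)
  then show "z < y \<longleftrightarrow> z' < y'" "y < z \<longleftrightarrow> y' < z'" by auto
  show "z = y \<longleftrightarrow> z' = y'" using * by (metis less_irrefl linorder_neqE)
  show "z \<le> y \<longleftrightarrow> z' \<le> y'" "y \<le> z \<longleftrightarrow> y' \<le> z'" using * by (simp_all add: not_less[symmetric])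
qed

lemma matched_converse: "matched (G\<inverse>) y' y \<longleftrightarrow> matched G y y'"
  by (auto simp: matched_def)

lemma matched_subset: "matched G y y' \<Longrightarrow> G' \<subseteq> G \<Longrightarrow> matched G' y y'"
  by (auto simp: matched_def)

text \<open>A point off the grid lies in a gap, and the corresponding gap is inhabited: it is
  bounded by finitely many points of a dense order without end points.\<close>

lemma matched_ex:
  fixes G :: "('a::linorder \<times> 'b::{dense_linorder,no_top,no_bot}) set"
  assumes fin: "finite G" and mono: "\<And>z z'. (z,z') \<in> G \<Longrightarrow> matched G z z'"
  shows "\<exists>y'. matched G y y'"
proof (cases "y \<in> fst ` G")
  case True
  then show ?thesis using mono by force
next
  case False
  define A where "A = snd ` {x\<in>G. fst x < y}"
  define B where "B = snd ` {x\<in>G. y < fst x}"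
  have "finite A" "finite B" using fin by (auto simp: A_def B_def)
  moreover have "a < b" if "a \<in> A" "b \<in> B" for a b
    using that mono by (auto simp: A_def B_def) (metis less_trans matchedD(1))
  ultimately obtain c where c: "\<And>a. a \<in> A \<Longrightarrow> a < c" "\<And>b. b \<in> B \<Longrightarrow> c < b"
  proof -
    assume that: "\<And>c. (\<And>a. a \<in> A \<Longrightarrow> a < c) \<Longrightarrow> (\<And>b. b \<in> B \<Longrightarrow> c < b) \<Longrightarrow> thesis"
    assume A: "finite A" and B: "finite B" and AB: "\<And>a b. a \<in> A \<Longrightarrow> b \<in> B \<Longrightarrow> a < b"
    consider "A = {}" "B = {}" | "A = {}" "B \<noteq> {}" | "A \<noteq> {}" "B = {}" | "A \<noteq> {}" "B \<noteq> {}" by blast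
    then show thesis
    proof cases
      case 1 then show ?thesis using that by blast
    next
      case 2
      obtain c where "c < Min B" using lt_ex by blast
      then show ?thesis using that[of c] 2 B by auto
    next
      case 3
      obtain c where "Max A < c" using gt_ex by blast
      then show ?thesis using that[of c] 3 A by auto
    next
      case 4
      have "Max A < Min B" using AB A B 4 by auto
      then obtain c where "Max A < c" "c < Min B" using dense by blast
      then show ?thesis using that[of c] 4 A B by auto
    qed
  qed
  have "matched G y c"
    unfolding matched_def
  proof (safe)
    fix z z' assume z: "(z,z') \<in> G"
    have "z \<noteq> y" using False z by force
    have 1: "z < y \<Longrightarrow> z' < c" for y' using c(1)[of z'] z by (force simp: A_def)
    have 2: "y < z \<Longrightarrow> c < z'" using c(2)[of z'] z by (force simp: B_def)
    show "z < y \<Longrightarrow> z' < c" "y < z \<Longrightarrow> c < z'" using 1 2 by auto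
    show "z' < c \<Longrightarrow> z < y" "c < z' \<Longrightarrow> y < z" using 1 2 \<open>z \<noteq> y\<close> by (metis less_asym linorder_neqE)+
  qed
  then show ?thesis by blast
qed

section \<open>Specialisation of coefficients and pseudo-division\<close>

definition rhom :: "('c::comm_ring_1 \<Rightarrow> 'a::comm_ring_1) \<Rightarrow> bool" where
  "rhom h \<longleftrightarrow> h 1 = 1 \<and> (\<forall>x y. h (x + y) = h x + h y) \<and> (\<forall>x y. h (x * y) = h x * h y)"

lemma rhomD:
  assumes "rhom h"
  shows "h 1 = 1" "h 0 = 0" "h (x + y) = h x + h y" "h (x * y) = h x * h y" "h (- x) = - h x"
    "h (x ^ n) = h x ^ n" "h (of_nat m) = of_nat m" "h (sum g A) = (\<Sum>i\<in>A. h (g i))"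
proof -
  show 1: "h 1 = 1" and ad: "h (x + y) = h x + h y" and ml: "h (x * y) = h x * h y" for x y
    using assms by (auto simp: rhom_def)
  show 0: "h 0 = 0" using ad[of 0 0] by simp
  show "h (- x) = - h x" using ad[of x "-x"] 0 by (simp add: eq_neg_iff_add_eq_0 add.commute)
  show "h (x ^ n) = h x ^ n" by (induction n) (auto simp: 1 ml)
  show "h (of_nat m) = of_nat m" by (induction m) (auto simp: 0 1 ad)
  show "h (sum g A) = (\<Sum>i\<in>A. h (g i))" by (induction A rule: infinite_finite_induct) (auto simp: 0 ad)
qed

lemma map_poly_rhom:
  assumes "rhom h"
  shows "map_poly h (p + q) = map_poly h p + map_poly h q"
    "map_poly h (p * q) = map_poly h p * map_poly h q"
    "map_poly h (smult c p) = smult (h c) (map_poly h p)"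
    "map_poly h (- p) = - map_poly h p"
  using assms by (auto intro!: poly_eqI simp: coeff_map_poly coeff_mult rhomD)

text \<open>The formal derivative over a coefficient ring that may have zero divisors, as the rings
  of pairs of functions below do. Specialised into a field it becomes \<open>pderiv\<close>.\<close>

definition fderiv :: "'c::comm_ring_1 poly \<Rightarrow> 'c poly" where
  "fderiv p = (\<Sum>i<degree p. monom (of_nat (Suc i) * coeff p (Suc i)) i)"

lemma coeff_fderiv: "coeff (fderiv p) i = of_nat (Suc i) * coeff p (Suc i)"
  by (cases "i < degree p") (auto simp: fderiv_def coeff_sum coeff_eq_0 simp del: of_nat_Suc)

lemma degree_fderiv: "degree p > 0 \<Longrightarrow> degree (fderiv p) < degree p"
  by (rule degree_lessI) (auto simp: coeff_fderiv coeff_eq_0)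

lemma map_poly_fderiv:
  fixes h :: "'c::comm_ring_1 \<Rightarrow> 'a::idom"
  assumes "rhom h"
  shows "map_poly h (fderiv p) = pderiv (map_poly h p)"
  by (rule poly_eqI) (auto simp: coeff_map_poly coeff_pderiv coeff_fderiv rhomD[OF assms] simp del: of_nat_Suc)

text \<open>A leading coefficient may vanish under a specialisation; the truncation then specialises
  to the same polynomial and has smaller degree.\<close>

definition trunc_poly :: "'c::comm_ring_1 poly \<Rightarrow> 'c poly" where
  "trunc_poly p = p - monom (lead_coeff p) (degree p)"

lemma degree_trunc_poly: "degree p > 0 \<Longrightarrow> degree (trunc_poly p) < degree p"
  unfolding trunc_poly_def
  by (rule degree_lessI) (auto simp: coeff_eq_0)

lemma map_trunc_poly: "rhom h \<Longrightarrow> h (lead_coeff p) = 0 \<Longrightarrow> map_poly h (trunc_poly p) = map_poly h p"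
  using rhomD(3)[of h] rhomD(5)[of h]
  by (auto intro!: poly_eqI simp: trunc_poly_def coeff_map_poly rhomD diff_conv_add_uminus
      simp del: add_uminus_conv_diff)

text \<open>Each multiplication by the leading coefficient of q allows one leading term of p to be
  cancelled without division, so the remainder keeps its coefficients in the subring
  \<open>S\<close>.\<close>

lemma pseudo_remainder_ex:
  fixes p q :: "'c::comm_ring_1 poly"
  assumes "degree q > 0"
    and S: "\<And>x y. x \<in> S \<Longrightarrow> y \<in> S \<Longrightarrow> x + y \<in> S" "\<And>x y. x \<in> S \<Longrightarrow> y \<in> S \<Longrightarrow> x * y \<in> S" "\<And>x. x \<in> S \<Longrightarrow> - x \<in> S" "0 \<in> S"
    and q: "\<And>i. coeff q i \<in> S" and p: "\<And>i. coeff p i \<in> S"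
  shows "\<exists>s r m. smult (lead_coeff q ^ m) p = q * s + r \<and> degree r < degree q \<and> (\<forall>i. coeff r i \<in> S)"
  using p
proof (induction "degree p" arbitrary: p rule: less_induct)
  case less
  show ?case
  proof (cases "degree p < degree q")
    case True
    then show ?thesis using less.prems by (intro exI[of _ 0] exI[of _ p]) auto
  next
    case False
    define k where "k = degree p - degree q"
    define p1 where "p1 = smult (lead_coeff q) p - monom (lead_coeff p) k * q"
    have dk: "degree p = k + degree q" using False by (simp add: k_def)
    have "degree p1 < degree p"
    proof (rule degree_lessI)
      show "p1 \<noteq> 0 \<or> degree p > 0" using dk assms(1) by auto
      show "\<forall>j\<ge>degree p. coeff p1 j = 0"
      proof (intro allI impI)
        fix j assume j: "j \<ge> degree p"
        show "coeff p1 j = 0"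
        proof (cases "j = degree p")
          case True
          then show ?thesis using dk by (simp add: p1_def coeff_monom_mult)
        next
          case False
          then have "coeff p j = 0" "coeff q (j - k) = 0" using j dk by (auto intro!: coeff_eq_0)
          then show ?thesis by (simp add: p1_def coeff_monom_mult)
        qed
      qed
    qed
    moreover have "coeff p1 i \<in> S" for i
      using less.prems q S unfolding p1_def
      by (auto simp: coeff_monom_mult diff_conv_add_uminus simp del: add_uminus_conv_diff)
    ultimately obtain s r m where *: "smult (lead_coeff q ^ m) p1 = q * s + r" "degree r < degree q" "\<And>i. coeff r i \<in> S"
      using less.hyps by blast
    have "smult (lead_coeff q ^ Suc m) p = smult (lead_coeff q ^ m) p1 + smult (lead_coeff q ^ m) (monom (lead_coeff p) k * q)"
      by (simp add: p1_def smult_diff_right mult.commute)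
    also have "\<dots> = q * (s + smult (lead_coeff q ^ m) (monom (lead_coeff p) k)) + r"
      by (simp add: *(1) algebra_simps)
    finally show ?thesis using *(2,3) by blast
  qed
qed

lemma degree_map_poly_lead: "h 0 = 0 \<Longrightarrow> h (lead_coeff p) \<noteq> 0 \<Longrightarrow> degree (map_poly h p) = degree p"
  by (rule antisym, rule degree_le) (auto intro!: le_degree simp: coeff_map_poly coeff_eq_0)

locale sign_pair =
  fixes h :: "'c::comm_ring_1 \<Rightarrow> 'a::real_closed" and k :: "'c \<Rightarrow> 'b::real_closed"
  assumes h: "rhom h" and k: "rhom k"
begin

abbreviation "hp \<equiv> map_poly h"
abbreviation "kp \<equiv> map_poly k"

text \<open>The Cohen-Hoermander sign table, kept as a correspondence: \<open>G\<close> pairs the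
  roots in one field with those in the other, in order. That each pair is a common root of one
  member of \<open>P\<close> is what later allows reduction by pseudo-division there.\<close>

definition table :: "'c poly set \<Rightarrow> ('a \<times> 'b) set \<Rightarrow> bool" where
  "table P G \<longleftrightarrow> finite G \<and> (\<forall>z z'. (z,z') \<in> G \<longrightarrow> matched G z z') \<and>
     (\<forall>p\<in>P. hp p \<noteq> 0 \<longrightarrow> (\<forall>y. poly (hp p) y = 0 \<longrightarrow> y \<in> fst ` G)) \<and>
     (\<forall>p\<in>P. kp p \<noteq> 0 \<longrightarrow> (\<forall>y. poly (kp p) y = 0 \<longrightarrow> y \<in> snd ` G)) \<and>
     (\<forall>z z'. (z,z') \<in> G \<longrightarrow> (\<exists>q\<in>P. hp q \<noteq> 0 \<and> kp q \<noteq> 0 \<and> poly (hp q) z = 0 \<and> poly (kp q) z' = 0)) \<and>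
     (\<forall>y y'. matched G y y' \<longrightarrow> (\<forall>p\<in>P. ssgn (poly (hp p) y) = ssgn (poly (kp p) y')))"

end

lemma sign_pair_swap: "sign_pair h k \<Longrightarrow> sign_pair k h"
  by (auto simp: sign_pair_def)

lemma table_converse: "sign_pair h k \<Longrightarrow> sign_pair.table h k P G \<Longrightarrow> sign_pair.table k h P (G\<inverse>)"
  by (simp add: sign_pair.table_def[OF sign_pair_swap] sign_pair.table_def matched_converse
      fst_eq_Domain snd_eq_Range) metis

context sign_pair begin

text \<open>Leading coefficients vanish in both fields simultaneously because their signs agree, so
  they can be cut off until a nonvanishing one is reached.\<close>

lemma trunc_representative:
  assumes tr: "\<And>q. q \<in> P \<Longrightarrow> degree q > 0 \<Longrightarrow> trunc_poly q \<in> P"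
    and sg: "\<And>q. q \<in> P \<Longrightarrow> ssgn (h (lead_coeff q)) = ssgn (k (lead_coeff q))"
    and "q \<in> P" "hp q \<noteq> 0"
  shows "\<exists>q0\<in>P. hp q0 = hp q \<and> kp q0 = kp q \<and> h (lead_coeff q0) \<noteq> 0 \<and> k (lead_coeff q0) \<noteq> 0"
  using assms(3,4)
proof (induction "degree q" arbitrary: q rule: less_induct)
  case less
  show ?case
  proof (cases "h (lead_coeff q) = 0")
    case False
    then show ?thesis using sg[OF less.prems(1)] less.prems(1) by (metis ssgn_0)
  next
    case True
    then have kz: "k (lead_coeff q) = 0" using sg[OF less.prems(1)] by (metis ssgn_0)
    have "degree q > 0"
    proof (rule ccontr)
      assume "\<not> degree q > 0"
      then obtain c where "q = [:c:]" by (metis neq0_conv degree_eq_zeroE)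
      then show False using True less.prems(2) by (cases "c = 0") (auto simp: map_poly_pCons rhomD[OF h])
    qed
    moreover have "hp (trunc_poly q) = hp q" "kp (trunc_poly q) = kp q"
      using map_trunc_poly h k True kz by blast+
    ultimately show ?thesis using less.hyps[of "trunc_poly q"] degree_trunc_poly[of q] tr less.prems by auto
  qed
qed

text \<open>At a root of q the identity c^m p = q s + r reduces p to r, whose sign is in the table,
  up to a power of the leading coefficient c, whose sign agrees in the two fields.\<close>

lemma ssgn_at_matched_root:
  assumes T: "table P G"
    and tr: "\<And>q. q \<in> P \<Longrightarrow> degree q > 0 \<Longrightarrow> trunc_poly q \<in> P"
    and sg: "\<And>q. q \<in> P \<Longrightarrow> ssgn (h (lead_coeff q)) = ssgn (k (lead_coeff q))"
    and pr: "\<And>q. q \<in> P \<Longrightarrow> degree q > 0 \<Longrightarrow> \<exists>s m. \<exists>r\<in>P. smult (lead_coeff q ^ m) p = q * s + r"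
    and z: "(z,z') \<in> G"
  shows "ssgn (poly (hp p) z) = ssgn (poly (kp p) z')"
proof -
  obtain q1 where q1: "q1 \<in> P" "hp q1 \<noteq> 0" "kp q1 \<noteq> 0" "poly (hp q1) z = 0" "poly (kp q1) z' = 0"
    using T z unfolding table_def by metis
  obtain q where q: "q \<in> P" "hp q = hp q1" "kp q = kp q1" "h (lead_coeff q) \<noteq> 0" "k (lead_coeff q) \<noteq> 0"
    using trunc_representative[OF tr sg q1(1,2)] by blast
  have "degree (hp q) = degree q" using q(4) by (simp add: degree_map_poly_lead rhomD[OF h])
  moreover have "degree (hp q) > 0"
  proof (rule ccontr)
    assume "\<not> degree (hp q) > 0"
    then obtain c where "hp q = [:c:]" by (metis neq0_conv degree_eq_zeroE)
    then show False using q q1 by auto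
  qed
  ultimately obtain s m r where r: "r \<in> P" "smult (lead_coeff q ^ m) p = q * s + r" using pr[OF q(1)] by auto
  have "ssgn (poly (hp r) z) = ssgn (poly (kp r) z')" using T z r(1) unfolding table_def by blast
  moreover have "h (lead_coeff q) ^ m * poly (hp p) z = poly (hp r) z"
    using arg_cong[OF r(2), of "\<lambda>u. poly (hp u) z"] q q1
    by (simp add: map_poly_rhom[OF h] rhomD[OF h])
  moreover have "k (lead_coeff q) ^ m * poly (kp p) z' = poly (kp r) z'"
    using arg_cong[OF r(2), of "\<lambda>u. poly (kp u) z'"] q q1
    by (simp add: map_poly_rhom[OF k] rhomD[OF k])
  moreover have "ssgn (h (lead_coeff q) ^ m) = ssgn (k (lead_coeff q) ^ m)" using sg[OF q(1)] by (simp add: ssgn_power)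
  ultimately show ?thesis using q(4) ssgn_cancel_left by (metis power_not_zero)
qed

text \<open>Roots of p' are grid points, so between w and the adjacent grid points p' has a constant
  sign s. Hence p has sign -s at the left neighbour and s at the right one, or far out if a
  neighbour is missing. These signs carry over, and the intermediate value property gives a root in
  the corresponding gap.\<close>

lemma matched_new_root:
  assumes T: "table P G" and dp: "fderiv p \<in> P"
    and lc: "ssgn (h (lead_coeff p)) = ssgn (k (lead_coeff p))" "h (lead_coeff p) \<noteq> 0"
    and d: "degree p > 0"
    and S1: "\<And>z z'. (z,z') \<in> G \<Longrightarrow> ssgn (poly (hp p) z) = ssgn (poly (kp p) z')"
    and w: "poly (hp p) w = 0"
  shows "\<exists>w'. poly (kp p) w' = 0 \<and> matched G w w'"
proof (cases "w \<in> fst ` G")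
  case True
  then obtain w' where w': "(w,w') \<in> G" by auto
  then show ?thesis using S1[OF w'] w T unfolding table_def by (metis ssgn_0)
next
  case False
  have fin: "finite G" and mono: "\<And>z z'. (z,z') \<in> G \<Longrightarrow> matched G z z'" using T unfolding table_def by auto
  have klc: "k (lead_coeff p) \<noteq> 0" using lc by (metis ssgn_0)
  have degs: "degree (hp p) = degree p" "degree (kp p) = degree p"
    using lc(2) klc by (auto simp: degree_map_poly_lead rhomD[OF h] rhomD[OF k])
  have lcs: "lead_coeff (hp p) = h (lead_coeff p)" "lead_coeff (kp p) = k (lead_coeff p)"
    by (simp_all add: degs coeff_map_poly rhomD[OF h] rhomD[OF k])
  define r where "r = hp p"
  have hd: "hp (fderiv p) = pderiv r" by (simp add: r_def map_poly_fderiv[OF h])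
  have "pderiv r \<noteq> 0" using d degs by (simp add: r_def pderiv_eq_0_iff)
  then have droot: "poly (pderiv r) y = 0 \<Longrightarrow> y \<in> fst ` G" for y
    using T dp hd unfolding table_def by metis
  define s where "s = ssgn (poly (pderiv r) w)"
  have s0: "s \<noteq> 0" using droot[of w] False by (auto simp: s_def)
  \<comment> \<open>The left end of the corresponding gap: the partner of the largest grid point
    below \<open>w\<close>, or, if there is none, a point so far down that the leading term decides
    the sign.\<close>
  have "\<exists>a'. (\<forall>(z,z')\<in>G. (z < w \<longrightarrow> z' \<le> a') \<and> (w < z \<longrightarrow> a' < z')) \<and> ssgn (poly (kp p) a') = -s"
  proof (cases "\<exists>z\<in>fst ` G. z < w")
    case True
    define A where "A = {z\<in>fst ` G. z < w}"
    have A: "finite A" "A \<noteq> {}" using fin True by (auto simp: A_def)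
    define u where "u = Max A"
    have uA: "u \<in> A" using A Max_in u_def by blast
    then obtain u' where u': "(u,u') \<in> G" "u < w" by (auto simp: A_def)
    have umax: "z \<le> u" if "z \<in> fst ` G" "z < w" for z using A(1) that unfolding u_def A_def by auto
    have "ssgn (poly r w - poly r u) = s" unfolding s_def
      by (rule poly_ssgn_from_root_left[OF u'(2)]) (metis False droot umax not_less le_less)
    then have "ssgn (poly r u) = -s" using w r_def by simp
    then have "ssgn (poly (kp p) u') = -s" using S1[OF u'(1)] r_def by simp
    moreover have "z' \<le> u'" if "(z,z') \<in> G" "z < w" for z z'
      using umax[of z] that matchedD(4)[OF mono[OF u'(1)] that(1)] by force
    moreover have "u' < z'" if "(z,z') \<in> G" "w < z" for z z'
      using matchedD(2)[OF mono[OF u'(1)] that(1)] u' that by auto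
    ultimately show ?thesis by blast
  next
    case nob: False
    have below: "ssgn (poly r y) = -s" if "y < w" for y
    proof -
      have "ssgn (poly r w - poly r y) = s" unfolding s_def
        by (rule poly_ssgn_from_root_left[OF that]) (metis False droot nob le_less)
      then show ?thesis using w r_def by simp
    qed
    have "ssgn (poly r (w - 1)) = ssgn (lead_coeff r) * (-1) ^ degree r"
      by (rule poly_ssgn_no_root_below)
        (metis below s0 diff_less_eq less_add_one le_less_trans neg_equal_0_iff_equal ssgn_zero)
    then have sl: "ssgn (lead_coeff (kp p)) * (-1) ^ degree (kp p) = -s"
      using below[of "w - 1"] lcs degs lc(1) by (simp add: r_def)
    obtain B where B: "\<And>x. x \<le> B \<Longrightarrow> ssgn (poly (kp p) x) = -s"
      using poly_ssgn_minfinity[of "kp p"] sl by metis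
    obtain a' where a': "a' < Min (insert B (snd ` G))" using lt_ex by blast
    have "a' < B" "\<And>z'. z' \<in> snd ` G \<Longrightarrow> a' < z'" using a' fin by auto
    then show ?thesis using B[of a'] nob by (intro exI[of _ a']) force
  qed
  then obtain a' where a': "\<And>z z'. (z,z') \<in> G \<Longrightarrow> z < w \<Longrightarrow> z' \<le> a'" "\<And>z z'. (z,z') \<in> G \<Longrightarrow> w < z \<Longrightarrow> a' < z'"
      "ssgn (poly (kp p) a') = -s" by blast
  have "\<exists>b'. a' < b' \<and> (\<forall>(z,z')\<in>G. w < z \<longrightarrow> b' \<le> z') \<and> ssgn (poly (kp p) b') = s"
  proof (cases "\<exists>z\<in>fst ` G. w < z")
    case True
    define A where "A = {z\<in>fst ` G. w < z}"
    have A: "finite A" "A \<noteq> {}" using fin True by (auto simp: A_def)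
    define u where "u = Min A"
    have uA: "u \<in> A" using A Min_in u_def by blast
    then obtain u' where u': "(u,u') \<in> G" "w < u" by (auto simp: A_def)
    have umax: "u \<le> z" if "z \<in> fst ` G" "w < z" for z using A(1) that unfolding u_def A_def by auto
    have "ssgn (poly r u - poly r w) = s" unfolding s_def
      by (rule poly_ssgn_from_root_right[OF u'(2)]) (metis False droot umax not_less le_less)
    then have "ssgn (poly r u) = s" using w r_def by simp
    then have "ssgn (poly (kp p) u') = s" using S1[OF u'(1)] r_def by simp
    moreover have "u' \<le> z'" if "(z,z') \<in> G" "w < z" for z z'
      using umax[of z] that matchedD(5)[OF mono[OF u'(1)] that(1)] by force
    ultimately show ?thesis using a'(2)[OF u'] by blast
  next
    case nob: False
    have above: "ssgn (poly r y) = s" if "w < y" for y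
    proof -
      have "ssgn (poly r y - poly r w) = s" unfolding s_def
        by (rule poly_ssgn_from_root_right[OF that]) (metis False droot nob le_less)
      then show ?thesis using w r_def by simp
    qed
    have "ssgn (poly r (w + 1)) = ssgn (lead_coeff r)"
      by (rule poly_ssgn_no_root_above) (metis above s0 less_add_one less_le_trans ssgn_zero)
    then have sl: "ssgn (lead_coeff (kp p)) = s"
      using above[of "w + 1"] lcs degs lc(1) by (simp add: r_def)
    obtain B where B: "\<And>x. x \<ge> B \<Longrightarrow> ssgn (poly (kp p) x) = s"
      using poly_ssgn_pinfinity[of "kp p"] sl by metis
    obtain b' where b': "max a' B < b'" using gt_ex by blast
    then show ?thesis using B[of b'] nob by (intro exI[of _ b']) force
  qed
  then obtain b' where b': "a' < b'" "\<And>z z'. (z,z') \<in> G \<Longrightarrow> w < z \<Longrightarrow> b' \<le> z'" "ssgn (poly (kp p) b') = s" by blast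
  have "s = 1 \<or> s = -1" using s0 by (auto simp: s_def ssgn_def split: if_splits)
  then obtain w' where w': "a' < w'" "w' < b'" "poly (kp p) w' = 0"
    using poly_ivt[OF b'(1), of "kp p"] poly_ivt[OF b'(1), of "- kp p"] a'(3) b'(3)
    by (auto simp: ssgn_def split: if_splits)
  have "matched G w w'" unfolding matched_def
  proof safe
    fix z z' assume z: "(z,z') \<in> G"
    have "z \<noteq> w" using False z by force
    have 1: "z < w \<Longrightarrow> z' < w'" using a'(1)[OF z] w' by auto
    have 2: "w < z \<Longrightarrow> w' < z'" using b'(2)[OF z] w' by auto
    show "z < w \<Longrightarrow> z' < w'" "w < z \<Longrightarrow> w' < z'" using 1 2 by auto
    show "z' < w' \<Longrightarrow> z < w" "w' < z' \<Longrightarrow> w < z" using 1 2 \<open>z \<noteq> w\<close> by (metis less_asym linorder_neqE)+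
  qed
  then show ?thesis using w' by blast
qed

text \<open>Rolle puts a root of p', hence a grid point, strictly between the two roots, and its
  partner separates theirs.\<close>

lemma matched_new_pair_less:
  assumes T: "table P G" and dp: "fderiv p \<in> P"
    and lc: "h (lead_coeff p) \<noteq> 0" and d: "degree p > 0"
    and w: "poly (hp p) w = 0" "matched G w w'" and v: "poly (hp p) v = 0" "matched G v v'" and "w < v"
  shows "w' < v'"
proof -
  have deg: "degree (hp p) = degree p" using lc by (simp add: degree_map_poly_lead rhomD[OF h])
  have "pderiv (hp p) \<noteq> 0" using d deg by (simp add: pderiv_eq_0_iff)
  obtain c where c: "w < c" "c < v" "poly (pderiv (hp p)) c = 0" using poly_rolle[OF \<open>w < v\<close> w(1) v(1)] by blast
  then obtain c' where "(c,c') \<in> G" using T dp map_poly_fderiv[OF h, of p] \<open>pderiv (hp p) \<noteq> 0\<close>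
    unfolding table_def by (metis (no_types, lifting) fst_conv imageE prod.collapse)
  then show ?thesis using w(2) v(2) c matchedD by (metis less_trans)
qed

end

text \<open>Three cases: p constant; leading coefficient specialising to 0, when p behaves like its
  truncation; and the genuine one, where the roots of p are added to the grid.\<close>

lemma (in sign_pair) table_insert:
  assumes T: "table P G"
    and dp: "degree p > 0 \<Longrightarrow> fderiv p \<in> P" and tp: "degree p > 0 \<Longrightarrow> trunc_poly p \<in> P"
    and tr: "\<And>q. q \<in> P \<Longrightarrow> degree q > 0 \<Longrightarrow> trunc_poly q \<in> P"
    and sg: "\<And>q. q \<in> P \<Longrightarrow> ssgn (h (lead_coeff q)) = ssgn (k (lead_coeff q))"
    and sgp: "ssgn (h (lead_coeff p)) = ssgn (k (lead_coeff p))"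
    and pr: "\<And>q. q \<in> P \<Longrightarrow> degree q > 0 \<Longrightarrow> \<exists>s m. \<exists>r\<in>P. smult (lead_coeff q ^ m) p = q * s + r"
  shows "\<exists>G'. table (insert p P) G'"
proof -
  consider "degree p = 0" | "degree p > 0" "h (lead_coeff p) = 0" | "degree p > 0" "h (lead_coeff p) \<noteq> 0" by blast
  then show ?thesis
  proof cases
    case 1
    then obtain c where c: "p = [:c:]" by (metis degree_eq_zeroE)
    have "hp p = [:h c:]" "kp p = [:k c:]"
      unfolding c by (auto intro!: poly_eqI simp: coeff_map_poly rhomD[OF h] rhomD[OF k] coeff_pCons split: nat.split)
    moreover have "ssgn (h c) = ssgn (k c)" using sgp c by auto
    ultimately have "table (insert p P) G" using T unfolding table_def by auto
    then show ?thesis by blast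
  next
    case 2
    then have "k (lead_coeff p) = 0" using sgp by (metis ssgn_0)
    then have "hp (trunc_poly p) = hp p" "kp (trunc_poly p) = kp p" using map_trunc_poly h k 2 by blast+
    then have eqs: "\<exists>q'\<in>P. hp q' = hp q \<and> kp q' = kp q" if "q \<in> insert p P" for q
      using that tp[OF 2(1)] by blast
    have "table (insert p P) G"
      unfolding table_def
    proof (intro conjI ballI allI impI)
      show "finite G" "\<And>z z'. (z,z') \<in> G \<Longrightarrow> matched G z z'" using T unfolding table_def by auto
      show "y \<in> fst ` G" if "q \<in> insert p P" "hp q \<noteq> 0" "poly (hp q) y = 0" for q y
        using eqs[OF that(1)] that(2,3) T unfolding table_def by fastforce
      show "y \<in> snd ` G" if "q \<in> insert p P" "kp q \<noteq> 0" "poly (kp q) y = 0" for q y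
        using eqs[OF that(1)] that(2,3) T unfolding table_def by fastforce
      show "\<exists>q\<in>insert p P. hp q \<noteq> 0 \<and> kp q \<noteq> 0 \<and> poly (hp q) z = 0 \<and> poly (kp q) z' = 0"
        if "(z,z') \<in> G" for z z' using that T unfolding table_def by blast
      show "ssgn (poly (hp q) y) = ssgn (poly (kp q) y')" if "matched G y y'" "q \<in> insert p P" for y y' q
        using eqs[OF that(2)] that(1) T unfolding table_def by fastforce
    qed
    then show ?thesis by blast
  next
    case 3
    interpret sw: sign_pair k h using sign_pair_swap sign_pair_axioms by blast
    have Tc: "sw.table P (G\<inverse>)" using table_converse sign_pair_axioms T by blast
    have klc: "k (lead_coeff p) \<noteq> 0" using 3 sgp by (metis ssgn_0)
    have nz: "hp p \<noteq> 0" "kp p \<noteq> 0"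
      using 3(2) klc by (metis coeff_0 coeff_map_poly rhomD(2)[OF h] , metis coeff_0 coeff_map_poly rhomD(2)[OF k])
    have dnz: "pderiv (hp p) \<noteq> 0" "pderiv (kp p) \<noteq> 0"
      using 3 klc by (auto simp: pderiv_eq_0_iff degree_map_poly_lead rhomD[OF h] rhomD[OF k])
    have S1: "ssgn (poly (hp p) z) = ssgn (poly (kp p) z')" if "(z,z') \<in> G" for z z'
      by (rule ssgn_at_matched_root[OF T tr sg pr that])
    \<comment> \<open>All pairs of roots of p, one from each field, in matching position; the
      definition is symmetric in the two fields, so each result about it can be used in both
      directions.\<close>
    define N where "N = {(w,w'). poly (hp p) w = 0 \<and> poly (kp p) w' = 0 \<and> matched G w w'}"
    define G' where "G' = G \<union> N"
    have fin: "finite G" and mono: "\<And>z z'. (z,z') \<in> G \<Longrightarrow> matched G z z'" using T unfolding table_def by auto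
    have finN: "finite N"
      by (rule finite_subset[of _ "{w. poly (hp p) w = 0} \<times> {w. poly (kp p) w = 0}"])
        (auto simp: N_def poly_roots_finite nz)
    have S2: "\<exists>w'. (w,w') \<in> N" if "poly (hp p) w = 0" for w
      using matched_new_root[OF T dp[OF 3(1)] sgp 3(2,1) S1 that] that by (auto simp: N_def)
    have S2': "\<exists>w. (w,w') \<in> N" if "poly (kp p) w' = 0" for w'
    proof -
      have "ssgn (poly (kp p) z) = ssgn (poly (hp p) z')" if "(z,z') \<in> G\<inverse>" for z z' using S1 that by auto
      from sw.matched_new_root[OF Tc dp[OF 3(1)] sgp[symmetric] klc 3(1) this that]
      show ?thesis using that by (auto simp: N_def matched_converse)
    qed
    have less1: "w' < v'" if "(w,w') \<in> N" "(v,v') \<in> N" "w < v" for w w' v v'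
      using matched_new_pair_less[OF T dp[OF 3(1)] 3(2,1)] that by (auto simp: N_def)
    have less2: "w < v" if "(w,w') \<in> N" "(v,v') \<in> N" "w' < v'" for w w' v v'
      using sw.matched_new_pair_less[OF Tc dp[OF 3(1)] klc 3(1)] that by (auto simp: N_def matched_converse)
    have mono': "matched G' z z'" if "(z,z') \<in> G'" for z z'
    proof (cases "(z,z') \<in> N")
      case True
      then have "matched N z z'" using less1 less2 unfolding matched_def by blast
      moreover have "matched G z z'" using True by (auto simp: N_def)
      ultimately show ?thesis by (auto simp: matched_def G'_def)
    next
      case False
      then have z: "(z,z') \<in> G" using that G'_def by auto
      have "matched N z z'" using z unfolding matched_def N_def by (auto dest: matchedD)
      then show ?thesis using mono[OF z] by (auto simp: matched_def G'_def)
    qed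
    have S1': "ssgn (poly (hp p) z) = ssgn (poly (kp p) z')" if "(z,z') \<in> G'" for z z'
      using that S1 by (auto simp: G'_def N_def)
    have root: "w \<in> fst ` G'" if "poly (hp p) w = 0" for w using S2[OF that] by (force simp: G'_def)
    have root': "w \<in> snd ` G'" if "poly (kp p) w = 0" for w using S2'[OF that] by (force simp: G'_def)
    have droot: "w \<in> fst ` G'" if "poly (pderiv (hp p)) w = 0" for w
      using T dp[OF 3(1)] that dnz unfolding table_def map_poly_fderiv[OF h,symmetric] G'_def by blast
    have droot': "w \<in> snd ` G'" if "poly (pderiv (kp p)) w = 0" for w
      using T dp[OF 3(1)] that dnz unfolding table_def map_poly_fderiv[OF k,symmetric] G'_def by blast
    \<comment> \<open>Away from the grid the sign of p is read off from the nearest grid point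
      \<open>u\<close> to the left: it persists if p(u) is nonzero and is that of p' otherwise. With
      no grid point to the left, leading coefficient and parity of the degree decide.\<close>
    have main: "ssgn (poly (hp p) y) = ssgn (poly (kp p) y')" if M: "matched G' y y'" for y y'
    proof (cases "y \<in> fst ` G'")
      case True
      then obtain z' where z': "(y,z') \<in> G'" by auto
      then have "z' = y'" using matchedD(3)[OF M z'] by simp
      then show ?thesis using S1' z' by auto
    next
      case ny: False
      have ny': "y' \<notin> snd ` G'"
      proof
        assume "y' \<in> snd ` G'"
        then obtain z where "(z,y') \<in> G'" by auto
        then show False using matchedD(3)[OF M] ny by force
      qed
      show ?thesis
      proof (cases "\<exists>z\<in>fst ` G'. z < y")
        case True
        define A where "A = {z\<in>fst ` G'. z < y}"
        have A: "finite A" "A \<noteq> {}" using fin finN True by (auto simp: A_def G'_def)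
        define u where "u = Max A"
        have uA: "u \<in> A" using A Max_in u_def by blast
        then obtain u' where u': "(u,u') \<in> G'" "u < y" by (auto simp: A_def)
        have umax: "z \<le> u" if "z \<in> fst ` G'" "z < y" for z using A(1) that unfolding u_def A_def by auto
        have uy': "u' < y'" using matchedD(1)[OF M u'(1)] u'(2) by simp
        have gap: "c \<notin> fst ` G'" if "u < c" "c \<le> y" for c
          using that umax[of c] ny by (metis le_less not_less)
        have gap': "c \<notin> snd ` G'" if "u' < c" "c \<le> y'" for c
        proof
          assume "c \<in> snd ` G'"
          then obtain z where z: "(z,c) \<in> G'" by auto
          have "u < z" using matchedD(2)[OF mono'[OF u'(1)] z] that by simp
          moreover have "z \<le> y" using matchedD(4)[OF M z] that by simp
          ultimately show False using gap[of z] z by force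
        qed
        show ?thesis
        proof (cases "poly (hp p) u = 0")
          case False
          then have k0: "poly (kp p) u' \<noteq> 0" using S1'[OF u'(1)] by (metis ssgn_0)
          have "ssgn (poly (kp p) u') = ssgn (poly (kp p) y')"
            by (rule poly_no_root_ssgn_left[OF uy' k0]) (use gap' root' in blast)
          moreover have "ssgn (poly (hp p) u) = ssgn (poly (hp p) y)"
            by (rule poly_no_root_ssgn_left[OF u'(2) False]) (use gap root in blast)
          ultimately show ?thesis using S1'[OF u'(1)] by simp
        next
          case True
          then have u0: "poly (kp p) u' = 0" using S1'[OF u'(1)] by (metis ssgn_0)
          have "ssgn (poly (hp p) y - poly (hp p) u) = ssgn (poly (pderiv (hp p)) y)"
            by (rule poly_ssgn_from_root_left[OF u'(2)]) (use gap droot in blast)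
          moreover have "ssgn (poly (kp p) y' - poly (kp p) u') = ssgn (poly (pderiv (kp p)) y')"
            by (rule poly_ssgn_from_root_left[OF uy']) (use gap' droot' in blast)
          moreover have "ssgn (poly (pderiv (hp p)) y) = ssgn (poly (pderiv (kp p)) y')"
            using T dp[OF 3(1)] matched_subset[OF M, of G]
            unfolding table_def map_poly_fderiv[OF h,symmetric] map_poly_fderiv[OF k,symmetric] G'_def by blast
          ultimately show ?thesis using True u0 by simp
        qed
      next
        case False
        have 1: "c \<notin> fst ` G'" if "c \<le> y" for c using False ny that by (metis le_less)
        have 2: "c \<notin> snd ` G'" if "c \<le> y'" for c
        proof
          assume "c \<in> snd ` G'"
          then obtain z where z: "(z,c) \<in> G'" by auto
          then have "z \<le> y" using matchedD(4)[OF M z] that by simp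
          then show False using 1[of z] z by force
        qed
        have "ssgn (poly (hp p) y) = ssgn (lead_coeff (hp p)) * (-1) ^ degree (hp p)"
          by (rule poly_ssgn_no_root_below) (use 1 root in blast)
        moreover have "ssgn (poly (kp p) y') = ssgn (lead_coeff (kp p)) * (-1) ^ degree (kp p)"
          by (rule poly_ssgn_no_root_below) (use 2 root' in blast)
        moreover have "degree (hp p) = degree p" "degree (kp p) = degree p"
          using 3(2) klc by (auto simp: degree_map_poly_lead rhomD[OF h] rhomD[OF k])
        ultimately show ?thesis using sgp by (simp add: coeff_map_poly rhomD[OF h] rhomD[OF k])
      qed
    qed
    have "table (insert p P) G'"
      unfolding table_def
    proof (intro conjI ballI allI impI)
      show "finite G'" using fin finN by (simp add: G'_def)
      show "matched G' z z'" if "(z,z') \<in> G'" for z z' using mono' that .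
      show "y \<in> fst ` G'" if "q \<in> insert p P" "hp q \<noteq> 0" "poly (hp q) y = 0" for q y
        using that root T unfolding table_def G'_def by blast
      show "y \<in> snd ` G'" if "q \<in> insert p P" "kp q \<noteq> 0" "poly (kp q) y = 0" for q y
        using that root' T unfolding table_def G'_def by blast
      show "\<exists>q\<in>insert p P. hp q \<noteq> 0 \<and> kp q \<noteq> 0 \<and> poly (hp q) z = 0 \<and> poly (kp q) z' = 0"
        if "(z,z') \<in> G'" for z z'
        using that T nz unfolding table_def G'_def N_def by blast
      show "ssgn (poly (hp q) y) = ssgn (poly (kp q) y')" if "matched G' y y'" "q \<in> insert p P" for y y' q
        using that main T matched_subset[OF that(1), of G] unfolding table_def G'_def by blast
    qed
    then show ?thesis by blast
  qed
qed

text \<open>Insertion in order of increasing degree: the derivative and the truncation of the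
  polynomial being inserted, and its pseudo-remainders by those present, all have smaller degree and
  are already there.\<close>

lemma (in sign_pair) table_closed:
  assumes fin: "finite C"
    and dp: "\<And>p. p \<in> C \<Longrightarrow> degree p > 0 \<Longrightarrow> fderiv p \<in> C"
    and tp: "\<And>p. p \<in> C \<Longrightarrow> degree p > 0 \<Longrightarrow> trunc_poly p \<in> C"
    and pr: "\<And>p q. p \<in> C \<Longrightarrow> q \<in> C \<Longrightarrow> degree q > 0 \<Longrightarrow> degree q \<le> degree p \<Longrightarrow>
        \<exists>s m. \<exists>r\<in>C. degree r < degree q \<and> smult (lead_coeff q ^ m) p = q * s + r"
    and sg: "\<And>q. q \<in> C \<Longrightarrow> ssgn (h (lead_coeff q)) = ssgn (k (lead_coeff q))"
  shows "\<exists>G. table C G"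
proof -
  have "\<exists>G. table {p\<in>C. degree p < n} G" for n
  proof (induction n)
    case 0
    have "table {} {}" by (auto simp: table_def)
    then show ?case by auto
  next
    case (Suc n)
    have "\<exists>G. table ({p\<in>C. degree p < n} \<union> A) G" if "A \<subseteq> {p\<in>C. degree p = n}" for A
    proof -
      have "finite A" by (rule finite_subset[OF that]) (use fin in auto)
      then show ?thesis using that
      proof (induction A)
        case empty
        then show ?case using Suc.IH by simp
      next
        case (insert p A)
        then obtain G where G: "table ({p\<in>C. degree p < n} \<union> A) G" by auto
        have p: "p \<in> C" "degree p = n" using insert by auto
        have "\<exists>G'. table (insert p ({p\<in>C. degree p < n} \<union> A)) G'"
        proof (rule table_insert[OF G])
          show "fderiv p \<in> {p\<in>C. degree p < n} \<union> A" if "degree p > 0" using dp[OF p(1)] degree_fderiv[of p] p that by auto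
          show "trunc_poly p \<in> {p\<in>C. degree p < n} \<union> A" if "degree p > 0" using tp[OF p(1)] degree_trunc_poly[of p] p that by auto
          show "ssgn (h (lead_coeff p)) = ssgn (k (lead_coeff p))" using sg p by auto
          fix q assume q: "q \<in> {p\<in>C. degree p < n} \<union> A"
          then have q': "q \<in> C" "degree q \<le> n" using insert.prems by auto
          show "ssgn (h (lead_coeff q)) = ssgn (k (lead_coeff q))" using sg q' by auto
          assume d: "degree q > 0"
          show "trunc_poly q \<in> {p\<in>C. degree p < n} \<union> A" using tp[OF q'(1) d] degree_trunc_poly[OF d] q' by auto
          show "\<exists>s m. \<exists>r\<in>{p\<in>C. degree p < n} \<union> A. smult (lead_coeff q ^ m) p = q * s + r"
            using pr[OF p(1) q'(1) d] q' p by fastforce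
        qed
        then show ?case by simp
      qed
    qed
    from this[of "{p\<in>C. degree p = n}"] obtain G where "table ({p\<in>C. degree p < n} \<union> {p\<in>C. degree p = n}) G" by auto
    moreover have "{p\<in>C. degree p < n} \<union> {p\<in>C. degree p = n} = {p\<in>C. degree p < Suc n}" by auto
    ultimately show ?case by auto
  qed
  moreover obtain n where "\<And>p. p \<in> C \<Longrightarrow> degree p < n"
    using fin finite_nat_set_iff_bounded[of "degree ` C"] by auto
  then have "{p\<in>C. degree p < n} = C" by auto
  ultimately show ?thesis by metis
qed

section \<open>Transfer between two real closed fields\<close>

text \<open>One term read in two structures: a function of the parameters \<open>'p\<close> into the
  left field and one of the parameters \<open>'q\<close> into the right field. With pointwise
  operations, evaluation at a parameter on either side is a ring homomorphism.\<close>

datatype ('p,'a,'q,'b) cfun = CF (lft: "'p \<Rightarrow> 'a") (rgt: "'q \<Rightarrow> 'b")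

instantiation cfun :: (type, comm_ring_1, type, comm_ring_1) comm_ring_1
begin
definition "0 = CF (\<lambda>_. 0) (\<lambda>_. 0)"
definition "1 = CF (\<lambda>_. 1) (\<lambda>_. 1)"
definition "c + d = CF (\<lambda>p. lft c p + lft d p) (\<lambda>q. rgt c q + rgt d q)"
definition "c - d = CF (\<lambda>p. lft c p - lft d p) (\<lambda>q. rgt c q - rgt d q)"
definition "- c = CF (\<lambda>p. - lft c p) (\<lambda>q. - rgt c q)"
definition "c * d = CF (\<lambda>p. lft c p * lft d p) (\<lambda>q. rgt c q * rgt d q)"
instance
  by standard (auto simp: zero_cfun_def one_cfun_def plus_cfun_def minus_cfun_def uminus_cfun_def
      times_cfun_def algebra_simps fun_eq_iff cfun.expand)
end

lemma cfun_simps [simp]: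
  "lft (c + d) p = lft c p + lft d p" "rgt (c + d) q = rgt c q + rgt d q"
  "lft (c * d) p = lft c p * lft d p" "rgt (c * d) q = rgt c q * rgt d q"
  "lft (- c) p = - lft c p" "rgt (- c) q = - rgt c q"
  "lft 0 p = 0" "rgt 0 q = 0" "lft 1 p = 1" "rgt 1 q = 1"
  by (auto simp: zero_cfun_def one_cfun_def plus_cfun_def uminus_cfun_def times_cfun_def)

lemma rhom_lft: "rhom (\<lambda>c. lft c p)" and rhom_rgt: "rhom (\<lambda>c. rgt c q)"
  by (auto simp: rhom_def)

section \<open>Terms and their closure under the elimination steps\<close>

inductive_set pol :: "('p,'a::comm_ring_1,'q,'b::comm_ring_1) cfun set \<Rightarrow> ('p,'a,'q,'b) cfun set"
  for G where
  pol_gen: "c \<in> G \<Longrightarrow> c \<in> pol G"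
| pol_0: "0 \<in> pol G"
| pol_1: "1 \<in> pol G"
| pol_add: "c \<in> pol G \<Longrightarrow> d \<in> pol G \<Longrightarrow> c + d \<in> pol G"
| pol_mult: "c \<in> pol G \<Longrightarrow> d \<in> pol G \<Longrightarrow> c * d \<in> pol G"
| pol_minus: "c \<in> pol G \<Longrightarrow> - c \<in> pol G"

text \<open>One fixed pseudo-remainder for each pair of polynomials, as needed for the finiteness of
  the closure below.\<close>

definition prem :: "'c::comm_ring_1 set \<Rightarrow> 'c poly \<Rightarrow> 'c poly \<Rightarrow> 'c poly" where
  "prem S p q = (SOME r. \<exists>s m. smult (lead_coeff q ^ m) p = q * s + r \<and> degree r < degree q \<and> (\<forall>i. coeff r i \<in> S))"

inductive_set elim_closure :: "'c::comm_ring_1 set \<Rightarrow> 'c poly set \<Rightarrow> 'c poly set" for S D where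
  ec_base: "p \<in> D \<Longrightarrow> p \<in> elim_closure S D"
| ec_deriv: "p \<in> elim_closure S D \<Longrightarrow> degree p > 0 \<Longrightarrow> fderiv p \<in> elim_closure S D"
| ec_trunc: "p \<in> elim_closure S D \<Longrightarrow> degree p > 0 \<Longrightarrow> trunc_poly p \<in> elim_closure S D"
| ec_prem: "p \<in> elim_closure S D \<Longrightarrow> q \<in> elim_closure S D \<Longrightarrow> degree q > 0 \<Longrightarrow> degree q \<le> degree p \<Longrightarrow>
    prem S p q \<in> elim_closure S D"

locale elim_ring =
  fixes S :: "'c::comm_ring_1 set" and D :: "'c poly set"
  assumes S: "\<And>x y. x \<in> S \<Longrightarrow> y \<in> S \<Longrightarrow> x + y \<in> S" "\<And>x y. x \<in> S \<Longrightarrow> y \<in> S \<Longrightarrow> x * y \<in> S"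
      "\<And>x. x \<in> S \<Longrightarrow> - x \<in> S" "0 \<in> S" "1 \<in> S"
    and D: "\<And>p i. p \<in> D \<Longrightarrow> coeff p i \<in> S" and fin: "finite D"
begin

lemma prem_props:
  assumes "degree q > 0" "\<And>i. coeff q i \<in> S" "\<And>i. coeff p i \<in> S"
  shows "\<exists>s m. smult (lead_coeff q ^ m) p = q * s + prem S p q" "degree (prem S p q) < degree q"
    "coeff (prem S p q) i \<in> S"
  using someI_ex[of "\<lambda>r. \<exists>s m. smult (lead_coeff q ^ m) p = q * s + r \<and> degree r < degree q \<and> (\<forall>i. coeff r i \<in> S)"]
    pseudo_remainder_ex[OF assms(1), of S p, OF S(1-4) assms(2,3)]
  unfolding prem_def by blast+

lemma coeff_elim_closure: "p \<in> elim_closure S D \<Longrightarrow> coeff p i \<in> S"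
proof (induction arbitrary: i rule: elim_closure.induct)
  case (ec_deriv p)
  have "of_nat n \<in> S" for n by (induction n) (auto simp: S)
  then show ?case using ec_deriv by (auto simp: coeff_fderiv S simp del: of_nat_Suc)
next
  case (ec_trunc p)
  then show ?case by (auto simp: trunc_poly_def S)
next
  case (ec_prem p q)
  then show ?case using prem_props(3) by blast
qed (auto simp: D)

lemma prem_closure:
  assumes "p \<in> elim_closure S D" "q \<in> elim_closure S D" "degree q > 0"
  shows "\<exists>s m. smult (lead_coeff q ^ m) p = q * s + prem S p q" "degree (prem S p q) < degree q"
  using prem_props[OF assms(3)] coeff_elim_closure assms by blast+

text \<open>Every step lowers the degree: strictly below that of p for derivative and truncation,
  strictly below that of q, hence of p, for a remainder. So the members of degree at least N - (i +
  1) arise from \<open>D\<close> and from the finitely many members of degree at least N -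
  i.\<close>

lemma finite_elim_closure: "finite (elim_closure S D)"
proof -
  let ?C = "elim_closure S D"
  obtain N where N: "\<And>p. p \<in> D \<Longrightarrow> degree p < N"
    using fin finite_nat_set_iff_bounded[of "degree ` D"] by auto
  have le: "degree p < N" if "p \<in> ?C" for p
    using that
  proof (induction rule: elim_closure.induct)
    case (ec_deriv p) then show ?case using degree_fderiv less_trans by blast
  next
    case (ec_trunc p) then show ?case using degree_trunc_poly less_trans by blast
  next
    case (ec_prem p q) then show ?case using prem_closure(2)[of p q] by auto
  qed (use N in auto)
  have "finite {p\<in>?C. degree p \<ge> N - i}" for i
  proof (induction i)
    case 0
    have "{p\<in>?C. degree p \<ge> N - 0} = {}" using le by force
    then show ?case by (metis finite.emptyI)
  next
    case (Suc i)
    let ?L = "{p\<in>?C. degree p \<ge> N - i}"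
    have "p \<in> D \<union> fderiv ` ?L \<union> trunc_poly ` ?L \<union> (\<lambda>(p,q). prem S p q) ` (?L \<times> ?L)"
      if p: "p \<in> ?C" "degree p \<ge> N - Suc i" for p
      using p
    proof (cases rule: elim_closure.cases)
      case (ec_deriv p0)
      then have "p0 \<in> ?L" using degree_fderiv[of p0] p by auto
      then show ?thesis using ec_deriv by auto
    next
      case (ec_trunc p0)
      then have "p0 \<in> ?L" using degree_trunc_poly[of p0] p by auto
      then show ?thesis using ec_trunc by auto
    next
      case (ec_prem p0 q0)
      then have "q0 \<in> ?L" "p0 \<in> ?L" using prem_closure(2)[of p0 q0] p by auto
      then show ?thesis using ec_prem by auto
    qed auto
    then have "{p\<in>?C. degree p \<ge> N - Suc i} \<subseteq> D \<union> fderiv ` ?L \<union> trunc_poly ` ?L \<union> (\<lambda>(p,q). prem S p q) ` (?L \<times> ?L)"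
      by blast
    then show ?case by (rule finite_subset) (use Suc fin in auto)
  qed
  from this[of N] show ?thesis by simp
qed

end

text \<open>Quantifier elimination without syntax: if finitely many terms have equal signs at p and
  q, the two predicates agree there. The same finite set serves all parameters.\<close>

definition transferable :: "('p,'a::linordered_field,'q,'b::linordered_field) cfun set \<Rightarrow> ('p \<Rightarrow> bool) \<Rightarrow> ('q \<Rightarrow> bool) \<Rightarrow> bool" where
  "transferable G \<Phi> \<Psi> \<longleftrightarrow> (\<exists>D\<subseteq>pol G. finite D \<and>
     (\<forall>p q. (\<forall>c\<in>D. ssgn (lft c p) = ssgn (rgt c q)) \<longrightarrow> (\<Phi> p \<longleftrightarrow> \<Psi> q)))"

lemma transferableE:
  assumes "transferable G \<Phi> \<Psi>"
  obtains D where "D \<subseteq> pol G" "finite D"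
    "\<And>p q. (\<And>c. c \<in> D \<Longrightarrow> ssgn (lft c p) = ssgn (rgt c q)) \<Longrightarrow> \<Phi> p \<longleftrightarrow> \<Psi> q"
proof -
  obtain D where "D \<subseteq> pol G \<and> finite D \<and> (\<forall>p q. (\<forall>c\<in>D. ssgn (lft c p) = ssgn (rgt c q)) \<longrightarrow> (\<Phi> p \<longleftrightarrow> \<Psi> q))"
    using assms unfolding transferable_def by (elim exE) 
  then show thesis by (intro that[of D]) auto
qed

definition add_var :: "('p,'a::comm_ring_1,'q,'b::comm_ring_1) cfun set \<Rightarrow> ('p \<times> 'a,'a,'q \<times> 'b,'b) cfun set" where
  "add_var G = insert (CF snd snd) ((\<lambda>c. CF (\<lambda>x. lft c (fst x)) (\<lambda>x. rgt c (fst x))) ` G)"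

lemma pol_add_var:
  assumes "c \<in> pol (add_var G)"
  shows "\<exists>P. (\<forall>i. coeff P i \<in> pol G) \<and> (\<forall>p y. lft c (p,y) = poly (map_poly (\<lambda>c. lft c p) P) y) \<and>
      (\<forall>q y. rgt c (q,y) = poly (map_poly (\<lambda>c. rgt c q) P) y)"
  using assms
proof (induction rule: pol.induct)
  case (pol_gen c)
  then consider "c = CF snd snd" | d where "d \<in> G" "c = CF (\<lambda>x. lft d (fst x)) (\<lambda>x. rgt d (fst x))"
    by (auto simp: add_var_def)
  then show ?case
  proof cases
    case 1
    then show ?thesis
      by (intro exI[of _ "[:0,1:]"]) (auto simp: coeff_pCons map_poly_pCons pol.intros split: nat.split)
  next
    case 2
    then show ?thesis
      by (intro exI[of _ "[:d:]"]) (auto simp: coeff_pCons map_poly_pCons pol.intros split: nat.split)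
  qed
next
  case pol_0
  show ?case by (intro exI[of _ 0]) (auto intro: pol.intros)
next
  case pol_1
  show ?case by (intro exI[of _ 1]) (auto intro: pol.intros)
next
  case (pol_add c d)
  then obtain P Q where "\<forall>i. coeff P i \<in> pol G" "\<forall>i. coeff Q i \<in> pol G"
    "\<forall>p y. lft c (p,y) = poly (map_poly (\<lambda>c. lft c p) P) y" "\<forall>q y. rgt c (q,y) = poly (map_poly (\<lambda>c. rgt c q) P) y"
    "\<forall>p y. lft d (p,y) = poly (map_poly (\<lambda>c. lft c p) Q) y" "\<forall>q y. rgt d (q,y) = poly (map_poly (\<lambda>c. rgt c q) Q) y"
    by blast
  then show ?case
    by (intro exI[of _ "P + Q"]) (auto simp: map_poly_rhom[OF rhom_lft] map_poly_rhom[OF rhom_rgt] intro: pol.intros)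
next
  case (pol_mult c d)
  then obtain P Q where PQ: "\<forall>i. coeff P i \<in> pol G" "\<forall>i. coeff Q i \<in> pol G"
    "\<forall>p y. lft c (p,y) = poly (map_poly (\<lambda>c. lft c p) P) y" "\<forall>q y. rgt c (q,y) = poly (map_poly (\<lambda>c. rgt c q) P) y"
    "\<forall>p y. lft d (p,y) = poly (map_poly (\<lambda>c. lft c p) Q) y" "\<forall>q y. rgt d (q,y) = poly (map_poly (\<lambda>c. rgt c q) Q) y"
    by blast
  have sums: "sum f A \<in> pol G" if "\<And>i. i \<in> A \<Longrightarrow> f i \<in> pol G" for f and A :: "nat set"
    using that by (induction A rule: infinite_finite_induct) (auto intro: pol_0 pol.pol_add)
  have "coeff (P * Q) i \<in> pol G" for i
    unfolding coeff_mult by (rule sums, rule pol.pol_mult) (use PQ in auto)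
  then show ?case using PQ
    by (intro exI[of _ "P * Q"]) (auto simp: map_poly_rhom[OF rhom_lft] map_poly_rhom[OF rhom_rgt])
next
  case (pol_minus c)
  then obtain P where "\<forall>i. coeff P i \<in> pol G"
    "\<forall>p y. lft c (p,y) = poly (map_poly (\<lambda>c. lft c p) P) y" "\<forall>q y. rgt c (q,y) = poly (map_poly (\<lambda>c. rgt c q) P) y"
    by blast
  then show ?case
    by (intro exI[of _ "- P"]) (auto simp: map_poly_rhom[OF rhom_lft] map_poly_rhom[OF rhom_rgt] intro: pol.intros)
qed

text \<open>The signs of the leading coefficients of the elimination closure fix a sign table, and
  with it a correspondence under which each witness in one field has a matched witness in the other.
  These leading coefficients are terms without the quantified variable.\<close>

theorem transferable_ex:
  fixes G :: "('p,'a::real_closed,'q,'b::real_closed) cfun set"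
  assumes "transferable (add_var G) (\<lambda>x. \<Phi> (fst x) (snd x)) (\<lambda>x. \<Psi> (fst x) (snd x))"
  shows "transferable G (\<lambda>p. \<exists>y. \<Phi> p y) (\<lambda>q. \<exists>y. \<Psi> q y)"
proof -
  obtain D where D: "D \<subseteq> pol (add_var G)" "finite D"
    and D': "\<And>p q y y'. (\<And>c. c \<in> D \<Longrightarrow> ssgn (lft c (p,y)) = ssgn (rgt c (q,y'))) \<Longrightarrow> \<Phi> p y \<longleftrightarrow> \<Psi> q y'"
    using assms unfolding transferable_def by fastforce
  obtain Q where Q: "\<And>c. c \<in> D \<Longrightarrow> (\<forall>i. coeff (Q c) i \<in> pol G) \<and> (\<forall>p y. lft c (p,y) = poly (map_poly (\<lambda>c. lft c p) (Q c)) y) \<and>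
      (\<forall>q y. rgt c (q,y) = poly (map_poly (\<lambda>c. rgt c q) (Q c)) y)"
    using bchoice[of D "\<lambda>c P. (\<forall>i. coeff P i \<in> pol G) \<and> (\<forall>p y. lft c (p,y) = poly (map_poly (\<lambda>c. lft c p) P) y) \<and>
      (\<forall>q y. rgt c (q,y) = poly (map_poly (\<lambda>c. rgt c q) P) y)"] pol_add_var[of _ G] D by blast
  interpret elim_ring "pol G" "Q ` D"
    by standard (use D Q in \<open>auto intro: pol.intros\<close>)
  define C where "C = elim_closure (pol G) (Q ` D)"
  define E where "E = lead_coeff ` C"
  have fin: "finite C" using finite_elim_closure C_def by simp
  show ?thesis unfolding transferable_def
  proof (intro exI[of _ E] conjI allI impI)
    show "E \<subseteq> pol G" using coeff_elim_closure by (auto simp: E_def C_def)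
    show "finite E" using fin E_def by simp
    fix p q assume sg: "\<forall>c\<in>E. ssgn (lft c p) = ssgn (rgt c q)"
    interpret sign_pair "\<lambda>c. lft c p" "\<lambda>c. rgt c q"
      by (standard; rule rhom_lft rhom_rgt)
    have "\<exists>T. table C T"
    proof (rule table_closed[OF fin])
      fix p1 q1 assume "p1 \<in> C" "q1 \<in> C" "degree q1 > 0" "degree q1 \<le> degree p1"
      then show "\<exists>s m. \<exists>r\<in>C. degree r < degree q1 \<and> smult (lead_coeff q1 ^ m) p1 = q1 * s + r"
        using prem_closure[of p1 q1] ec_prem unfolding C_def by blast
    qed (use sg in \<open>auto simp: C_def E_def intro: elim_closure.intros\<close>)
    then obtain T where T: "table C T" by blast
    have fT: "finite T" and mono: "\<And>z z'. (z,z') \<in> T \<Longrightarrow> matched T z z'" using T unfolding table_def by auto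
    have key: "\<Phi> p y \<longleftrightarrow> \<Psi> q y'" if M: "matched T y y'" for y y'
    proof (rule D')
      fix c assume c: "c \<in> D"
      then have "Q c \<in> C" by (auto simp: C_def intro: ec_base)
      then show "ssgn (lft c (p,y)) = ssgn (rgt c (q,y'))"
        using T M Q[OF c] unfolding table_def by simp
    qed
    have "\<exists>y'. matched T y y'" for y using matched_ex[OF fT mono] by blast
    moreover have "\<exists>y. matched T y y'" for y'
      using matched_ex[of "T\<inverse>" y'] fT mono by (auto simp: matched_converse)
    ultimately show "(\<exists>y. \<Phi> p y) \<longleftrightarrow> (\<exists>y. \<Psi> q y)" using key by blast
  qed
qed

text \<open>Substitution: the variables of an eliminated formula may be replaced by terms.\<close>

lemma transferable_pull:
  fixes G :: "('r,'a::linordered_field,'s,'b::linordered_field) cfun set" and G' :: "('p,'a,'q,'b) cfun set"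
  assumes "transferable G' \<Phi> \<Psi>" and h: "\<And>c. c \<in> G' \<Longrightarrow> CF (\<lambda>p. lft c (f p)) (\<lambda>q. rgt c (g q)) \<in> pol G"
  shows "transferable G (\<lambda>p. \<Phi> (f p)) (\<lambda>q. \<Psi> (g q))"
proof -
  obtain D where D: "D \<subseteq> pol G'" "finite D"
    "\<And>p q. (\<And>c. c \<in> D \<Longrightarrow> ssgn (lft c p) = ssgn (rgt c q)) \<Longrightarrow> \<Phi> p \<longleftrightarrow> \<Psi> q"
    using transferableE[OF assms(1)] by metis
  define r :: "('p,'a,'q,'b) cfun \<Rightarrow> ('r,'a,'s,'b) cfun" where "r c = CF (\<lambda>p. lft c (f p)) (\<lambda>q. rgt c (g q))" for c
  have "r c \<in> pol G" if "c \<in> pol G'" for c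
    using that
  proof (induction rule: pol.induct)
    case (pol_gen c)
    then show ?case using h r_def by auto
  next
    case (pol_add c d)
    have "r (c + d) = r c + r d" by (simp add: r_def plus_cfun_def)
    then show ?case using pol_add by (simp add: pol.pol_add)
  next
    case (pol_mult c d)
    have "r (c * d) = r c * r d" by (simp add: r_def times_cfun_def)
    then show ?case using pol_mult by (simp add: pol.pol_mult)
  next
    case (pol_minus c)
    have "r (- c) = - r c" by (simp add: r_def uminus_cfun_def)
    then show ?case using pol_minus by (simp add: pol.pol_minus)
  qed (use pol_0 pol_1 in \<open>auto simp: r_def zero_cfun_def one_cfun_def\<close>)
  then have "r ` D \<subseteq> pol G" using D(1) by blast
  moreover have "\<Phi> (f p) \<longleftrightarrow> \<Psi> (g q)" if "\<forall>c\<in>r ` D. ssgn (lft c p) = ssgn (rgt c q)" for p q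
    by (rule D(3)) (use that in \<open>auto simp: r_def\<close>)
  ultimately show ?thesis unfolding transferable_def using D(2) by blast
qed

lemma transferable_not: "transferable G \<Phi> \<Psi> \<Longrightarrow> transferable G (\<lambda>p. \<not> \<Phi> p) (\<lambda>q. \<not> \<Psi> q)"
  unfolding transferable_def by blast

lemma transferable_conj:
  assumes "transferable G \<Phi> \<Psi>" "transferable G \<Phi>' \<Psi>'"
  shows "transferable G (\<lambda>p. \<Phi> p \<and> \<Phi>' p) (\<lambda>q. \<Psi> q \<and> \<Psi>' q)"
proof -
  obtain D where D: "D \<subseteq> pol G" "finite D"
    "\<And>p q. (\<And>c. c \<in> D \<Longrightarrow> ssgn (lft c p) = ssgn (rgt c q)) \<Longrightarrow> \<Phi> p \<longleftrightarrow> \<Psi> q"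
    using transferableE[OF assms(1)] by metis
  obtain D' where D': "D' \<subseteq> pol G" "finite D'"
    "\<And>p q. (\<And>c. c \<in> D' \<Longrightarrow> ssgn (lft c p) = ssgn (rgt c q)) \<Longrightarrow> \<Phi>' p \<longleftrightarrow> \<Psi>' q"
    using transferableE[OF assms(2)] by metis
  have "\<Phi> p \<and> \<Phi>' p \<longleftrightarrow> \<Psi> q \<and> \<Psi>' q" if "\<forall>c\<in>D \<union> D'. ssgn (lft c p) = ssgn (rgt c q)" for p q
    using D(3)[of p q] D'(3)[of p q] that by simp
  then show ?thesis unfolding transferable_def using D D' by (intro exI[of _ "D \<union> D'"]) simp
qed

lemma transferable_imp:
  "transferable G \<Phi> \<Psi> \<Longrightarrow> transferable G \<Phi>' \<Psi>' \<Longrightarrow> transferable G (\<lambda>p. \<Phi> p \<longrightarrow> \<Phi>' p) (\<lambda>q. \<Psi> q \<longrightarrow> \<Psi>' q)"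
  using transferable_not[OF transferable_conj[OF _ transferable_not], of G \<Phi> \<Psi> \<Phi>' \<Psi>'] by simp

lemma transferable_all:
  fixes G :: "('p,'a::real_closed,'q,'b::real_closed) cfun set"
  assumes "transferable (add_var G) (\<lambda>x. \<Phi> (fst x) (snd x)) (\<lambda>x. \<Psi> (fst x) (snd x))"
  shows "transferable G (\<lambda>p. \<forall>y. \<Phi> p y) (\<lambda>q. \<forall>y. \<Psi> q y)"
  using transferable_not[OF transferable_ex[OF transferable_not[OF assms]]] by simp

lemma transferable_atoms:
  assumes "CF a b \<in> pol G" "CF c d \<in> pol G"
  shows transferable_less: "transferable G (\<lambda>p. a p < c p) (\<lambda>q. b q < d q)"
    and transferable_le: "transferable G (\<lambda>p. a p \<le> c p) (\<lambda>q. b q \<le> d q)"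
    and transferable_eq: "transferable G (\<lambda>p. a p = c p) (\<lambda>q. b q = d q)"
proof -
  have *: "CF c d + - CF a b \<in> pol G" using assms by (intro pol_add pol_minus)
  then have **: "CF (\<lambda>p. c p - a p) (\<lambda>q. d q - b q) \<in> pol G"
    by (simp add: plus_cfun_def uminus_cfun_def)
  have sg: "ssgn x = ssgn y \<Longrightarrow> (0 < x \<longleftrightarrow> 0 < y) \<and> (0 \<le> x \<longleftrightarrow> 0 \<le> y) \<and> (0 = x \<longleftrightarrow> 0 = y)"
    for x :: 'b and y :: 'd by (auto simp: ssgn_def split: if_splits)
  show "transferable G (\<lambda>p. a p < c p) (\<lambda>q. b q < d q)"
    "transferable G (\<lambda>p. a p \<le> c p) (\<lambda>q. b q \<le> d q)"
    "transferable G (\<lambda>p. a p = c p) (\<lambda>q. b q = d q)"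
    unfolding transferable_def using ** 
    by (auto intro!: exI[of _ "{CF (\<lambda>p. c p - a p) (\<lambda>q. d q - b q)}"] dest!: sg)
qed

definition add_vec :: "('p,'a::comm_ring_1,'q,'b::comm_ring_1) cfun set \<Rightarrow> ('p \<times> ('a^'n::finite),'a,'q \<times> ('b^'n),'b) cfun set" where
  "add_vec G = (\<lambda>c. CF (\<lambda>x. lft c (fst x)) (\<lambda>x. rgt c (fst x))) ` G \<union>
     range (\<lambda>i. CF (\<lambda>x. snd x $ i) (\<lambda>x. snd x $ i))"

lemma vec_ex_update:
  fixes w :: "'c^'n"
  shows "(\<exists>v. (\<forall>i. i \<notin> {} \<longrightarrow> v $ i = w $ i) \<and> P v) \<longleftrightarrow> P w"
    and "(\<exists>y. \<exists>v. (\<forall>i. i \<notin> J \<longrightarrow> v $ i = (\<chi> i. if i = j then y else w $ i) $ i) \<and> P v) \<longleftrightarrow>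
        (\<exists>v. (\<forall>i. i \<notin> insert j J \<longrightarrow> v $ i = w $ i) \<and> P v)"
proof -
  show "(\<exists>v. (\<forall>i. i \<notin> {} \<longrightarrow> v $ i = w $ i) \<and> P v) \<longleftrightarrow> P w"
    by (metis empty_iff vec_eq_iff)
  have "(\<forall>i. i \<notin> insert j J \<longrightarrow> v $ i = w $ i) \<longleftrightarrow> (\<exists>y. \<forall>i. i \<notin> J \<longrightarrow> v $ i = (\<chi> i. if i = j then y else w $ i) $ i)" for v
    by (cases "j \<in> J") auto
  then show "(\<exists>y. \<exists>v. (\<forall>i. i \<notin> J \<longrightarrow> v $ i = (\<chi> i. if i = j then y else w $ i) $ i) \<and> P v) \<longleftrightarrow>
        (\<exists>v. (\<forall>i. i \<notin> insert j J \<longrightarrow> v $ i = w $ i) \<and> P v)" by blast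
qed

text \<open>A vector is quantified one coordinate at a time: the coordinates in \<open>J\<close> are
  bound, the others are read from a vector supplied as a parameter.\<close>

theorem transferable_exv:
  fixes G :: "('p,'a::real_closed,'q,'b::real_closed) cfun set"
  assumes "transferable (add_vec G) (\<lambda>x. \<Phi> (fst x) (snd x :: 'a^'n::finite)) (\<lambda>x. \<Psi> (fst x) (snd x :: 'b^'n))"
  shows "transferable G (\<lambda>p. \<exists>y. \<Phi> p y) (\<lambda>q. \<exists>y. \<Psi> q y)"
proof -
  let ?u = "\<lambda>x j y. (\<chi> i. if i = j then y else x $ i)"
  have gen: "transferable (add_vec G)
       (\<lambda>x. \<exists>v. (\<forall>i. i \<notin> J \<longrightarrow> v $ i = snd x $ i) \<and> \<Phi> (fst x) v)
       (\<lambda>x. \<exists>v. (\<forall>i. i \<notin> J \<longrightarrow> v $ i = snd x $ i) \<and> \<Psi> (fst x) v)" for J :: "'n set"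
    using finite[of J]
  proof (induction J rule: finite_induct)
    case empty
    show ?case unfolding vec_ex_update(1) using assms .
  next
    case (insert j J)
    let ?A = "\<lambda>x::'p \<times> ('a^'n). \<exists>v. (\<forall>i. i \<notin> J \<longrightarrow> v $ i = snd x $ i) \<and> \<Phi> (fst x) v"
    let ?B = "\<lambda>x::'q \<times> ('b^'n). \<exists>v. (\<forall>i. i \<notin> J \<longrightarrow> v $ i = snd x $ i) \<and> \<Psi> (fst x) v"
    have "transferable (add_var (add_vec G)) (\<lambda>x. ?A (fst (fst x), ?u (snd (fst x)) j (snd x)))
        (\<lambda>x. ?B (fst (fst x), ?u (snd (fst x)) j (snd x)))"
    proof (rule transferable_pull[OF insert.IH])
      fix c :: "('p \<times> ('a^'n),'a,'q \<times> ('b^'n),'b) cfun" assume "c \<in> add_vec G"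
      then consider d where "d \<in> G" "c = CF (\<lambda>x. lft d (fst x)) (\<lambda>x. rgt d (fst x))"
        | i where "c = CF (\<lambda>x. snd x $ i) (\<lambda>x. snd x $ i)" by (auto simp: add_vec_def)
      then show "CF (\<lambda>x. lft c (fst (fst x), ?u (snd (fst x)) j (snd x)))
          (\<lambda>x. rgt c (fst (fst x), ?u (snd (fst x)) j (snd x))) \<in> pol (add_var (add_vec G))"
      proof cases
        case 1
        then show ?thesis by (intro pol_gen) (force simp: add_var_def add_vec_def)
      next
        case 2
        then show ?thesis by (intro pol_gen, cases "i = j")
            (auto simp: add_var_def add_vec_def image_iff intro!: exI bexI[of _ "CF (\<lambda>x. snd x $ i) (\<lambda>x. snd x $ i)"])
      qed
    qed
    then have "transferable (add_vec G) (\<lambda>x. \<exists>y. ?A (fst x, ?u (snd x) j y)) (\<lambda>x. \<exists>y. ?B (fst x, ?u (snd x) j y))"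
      by (intro transferable_ex)
    then show ?case unfolding fst_conv snd_conv vec_ex_update(2) .
  qed
  \<comment> \<open>Once all coordinates are bound, any vector may be supplied; 0 is taken.\<close>
  have "transferable G (\<lambda>p. (\<lambda>x. \<exists>v. (\<forall>i. i \<notin> UNIV \<longrightarrow> v $ i = snd x $ i) \<and> \<Phi> (fst x) v) (p, 0))
    (\<lambda>q. (\<lambda>x. \<exists>v. (\<forall>i. i \<notin> UNIV \<longrightarrow> v $ i = snd x $ i) \<and> \<Psi> (fst x) v) (q, 0))"
    by (rule transferable_pull[OF gen])
      (auto simp: add_vec_def pol_gen intro: pol_0[unfolded zero_cfun_def])
  then show ?thesis by simp
qed

lemma transferable_allv:
  fixes G :: "('p,'a::real_closed,'q,'b::real_closed) cfun set"
  assumes "transferable (add_vec G) (\<lambda>x. \<Phi> (fst x) (snd x :: 'a^'n::finite)) (\<lambda>x. \<Psi> (fst x) (snd x :: 'b^'n))"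
  shows "transferable G (\<lambda>p. \<forall>y. \<Phi> p y) (\<lambda>q. \<forall>y. \<Psi> q y)"
  using transferable_not[OF transferable_exv[OF transferable_not[OF assms]]] by simp

section \<open>The field of formal Puiseux series\<close>

notation fls_nth (infixl "$$" 75)

text \<open>The Laurent series f read in the variable t^(1/m): the exponent i becomes i/m.\<close>

definition emb :: "nat \<Rightarrow> real fls \<Rightarrow> rat \<Rightarrow> real" where
  "emb m f = (\<lambda>q. if of_nat m * q \<in> \<int> then f $$ \<lfloor>of_nat m * q\<rfloor> else 0)"

lemma emb_of_int: "m \<ge> 1 \<Longrightarrow> emb m f (of_int i / of_nat m) = f $$ i"
  by (simp add: emb_def)

lemma emb_nonzeroE:
  assumes "emb m f q \<noteq> 0" "m \<ge> 1"
  obtains i where "q = of_int i / of_nat m" "f $$ i \<noteq> 0"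
proof -
  have "of_nat m * q \<in> \<int>" using assms by (auto simp: emb_def split: if_splits)
  then obtain i where i: "of_nat m * q = of_int i" by (auto elim: Ints_cases)
  then have "q = of_int i / of_nat m" using assms(2) by (simp add: field_simps)
  then show thesis using that assms emb_of_int by metis
qed

lemma emb_eqI:
  assumes "m \<ge> 1" "\<And>i. a (of_int i / of_nat m) = f $$ i" "\<And>q. of_nat m * q \<notin> \<int> \<Longrightarrow> a q = 0"
  shows "a = emb m f"
proof
  fix q show "a q = emb m f q"
  proof (cases "of_nat m * q \<in> \<int>")
    case True
    then obtain i where "of_nat m * q = of_int i" by (auto elim: Ints_cases)
    then have "q = of_int i / of_nat m" using assms(1) by (simp add: field_simps)
    then show ?thesis using assms by (simp add: emb_of_int)
  qed (use assms in \<open>auto simp: emb_def\<close>)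
qed

lemma emb_eq_iff: "m \<ge> 1 \<Longrightarrow> emb m f = emb m g \<longleftrightarrow> f = g"
  by (metis emb_of_int fls_eqI)

text \<open>t^(1/m) is the d-th power of t^(1/(m d)); this is how finitely many series get a common
  denominator.\<close>

lemma emb_refine:
  assumes "m \<ge> 1" "d \<ge> 1"
  shows "emb m f = emb (m * d) (fls_compose_power f d)"
proof (rule emb_eqI)
  show "m * d \<ge> 1" using assms by simp
  fix i
  show "emb m f (of_int i / of_nat (m * d)) = fls_compose_power f d $$ i"
  proof (cases "int d dvd i")
    case True
    then obtain j where "i = int d * j" by blast
    then have "of_int i / of_nat (m * d) = (of_int j / of_nat m :: rat)" using assms by (simp add: field_simps)
    then show ?thesis using True assms \<open>i = _\<close> by (simp add: emb_of_int fls_nth_compose_power)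
  next
    case False
    have "of_nat m * (of_int i / of_nat (m * d) :: rat) \<notin> \<int>"
    proof
      assume "of_nat m * (of_int i / of_nat (m * d) :: rat) \<in> \<int>"
      then obtain j where "of_nat m * (of_int i / of_nat (m * d) :: rat) = of_int j" by (auto elim: Ints_cases)
      then have "(of_int i :: rat) = of_int (int d * j)" using assms by (simp add: field_simps)
      then have "i = int d * j" by (simp only: of_int_eq_iff)
      then show False using False by simp
    qed
    then have "emb m f (of_int i / of_nat (m * d)) = 0" by (simp add: emb_def del: of_nat_mult)
    then show ?thesis using False assms by (simp add: fls_nth_compose_power)
  qed
next
  fix q :: rat assume q: "of_nat (m * d) * q \<notin> \<int>"
  have "of_nat m * q \<notin> \<int>"
  proof
    assume "of_nat m * q \<in> \<int>"
    then have "of_nat d * (of_nat m * q) \<in> \<int>" by (rule Ints_mult[OF Ints_of_nat])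
    then show False using q by (simp add: mult_ac)
  qed
  then show "emb m f q = 0" by (simp add: emb_def)
qed

lemma emb_add: "padd (emb m f) (emb m g) = emb m (f + g)"
  by (auto simp: emb_def fun_eq_iff padd_def)

lemma emb_mult:
  assumes m: "m \<ge> 1"
  shows "pmul (emb m f) (emb m g) = emb m (f * g)"
proof (rule emb_eqI[OF m])
  fix i
  let ?q = "of_int i / of_nat m :: rat"
  let ?h = "\<lambda>j. of_int j / of_nat m :: rat"
  have inj: "inj_on ?h A" for A using m by (auto simp: inj_on_def)
  have sub: "?q - ?h j = ?h (i - j)" for j by (simp add: diff_divide_distrib)
  have embs: "emb m g (?q - ?h j) = g $$ (i - j)" for j by (simp only: sub emb_of_int[OF m])
  have set: "{r. emb m f r \<noteq> 0 \<and> emb m g (?q - r) \<noteq> 0} = ?h ` {j. f $$ j \<noteq> 0 \<and> g $$ (i - j) \<noteq> 0}"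
  proof safe
    fix r assume r: "emb m f r \<noteq> 0" "emb m g (?q - r) \<noteq> 0"
    obtain j where j: "r = ?h j" "f $$ j \<noteq> 0" using emb_nonzeroE[OF r(1) m] by blast
    then show "r \<in> ?h ` {j. f $$ j \<noteq> 0 \<and> g $$ (i - j) \<noteq> 0}" using r(2) embs by auto
  qed (simp_all only: embs emb_of_int[OF m])
  have "pmul (emb m f) (emb m g) ?q = (\<Sum>j | f $$ j \<noteq> 0 \<and> g $$ (i - j) \<noteq> 0. f $$ j * g $$ (i - j))"
    unfolding pmul_def set by (subst sum.reindex[OF inj]) (simp only: o_def embs emb_of_int[OF m])
  also have "\<dots> = (\<Sum>j=fls_subdegree f..i - fls_subdegree g. f $$ j * g $$ (i - j))"
  proof (rule sum.mono_neutral_left)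
    show "{j. f $$ j \<noteq> 0 \<and> g $$ (i - j) \<noteq> 0} \<subseteq> {fls_subdegree f..i - fls_subdegree g}"
      by (auto dest!: fls_subdegree_leI)
  qed auto
  finally show "pmul (emb m f) (emb m g) ?q = (f * g) $$ i" by (simp add: fls_times_nth(2))
next
  fix q :: rat assume q: "of_nat m * q \<notin> \<int>"
  have "{r. emb m f r \<noteq> 0 \<and> emb m g (q - r) \<noteq> 0} = {}"
  proof safe
    fix r assume "emb m f r \<noteq> 0" "emb m g (q - r) \<noteq> 0"
    then have "of_nat m * r \<in> \<int>" "of_nat m * (q - r) \<in> \<int>" by (auto simp: emb_def split: if_splits)
    then have "of_nat m * r + of_nat m * (q - r) \<in> \<int>" by (rule Ints_add)
    then show "r \<in> {}" using q by (simp add: algebra_simps)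
  qed
  then show "pmul (emb m f) (emb m g) q = 0" by (simp only: pmul_def sum.empty)
qed

text \<open>Negative orders are included so that a field results; the valuation ring of the theorem
  is singled out by \<open>fin\<close> below.\<close>

typedef puis = "{a. \<exists>m\<ge>1. \<exists>f. a = emb m f}"
  by (auto intro!: exI[of _ 1])

definition pz :: "nat \<Rightarrow> real fls \<Rightarrow> puis" where "pz m f = Abs_puis (emb m f)"

abbreviation cf :: "puis \<Rightarrow> rat \<Rightarrow> real" where "cf \<equiv> Rep_puis"

lemma cf_pz: "m \<ge> 1 \<Longrightarrow> cf (pz m f) = emb m f"
  unfolding pz_def by (rule Abs_puis_inverse) blast

lemma pz_cases: obtains m f where "m \<ge> 1" "x = pz m f"
proof -
  obtain m f where m: "m \<ge> 1" "Rep_puis x = emb m f" using Rep_puis[of x] by auto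
  then have "x = pz m f" using Rep_puis_inverse[of x] unfolding pz_def by simp
  then show thesis by (rule that[OF m(1)])
qed

lemma pz_refine: "m \<ge> 1 \<Longrightarrow> d \<ge> 1 \<Longrightarrow> pz m f = pz (m * d) (fls_compose_power f d)"
  unfolding pz_def by (subst emb_refine[of m d]) auto

lemma pz_eq_iff: "m \<ge> 1 \<Longrightarrow> pz m f = pz m g \<longleftrightarrow> f = g"
  by (metis cf_pz emb_eq_iff)

text \<open>With a common denominator, identities in \<open>puis\<close> reduce to identities of
  Laurent series.\<close>

lemma pz_common: 
  assumes "finite X"
  shows "\<exists>m\<ge>1. \<forall>x\<in>X. \<exists>f. x = pz m f"
  using assms
proof (induction X)
  case (insert x X)
  then obtain m where m: "m \<ge> 1" "\<And>x. x \<in> X \<Longrightarrow> \<exists>f. x = pz m f" by blast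
  obtain d f where d: "d \<ge> 1" "x = pz d f" using pz_cases by blast
  have "x = pz (m * d) (fls_compose_power f m)" using pz_refine[OF d(1) m(1), of f] d by (simp add: mult.commute)
  moreover have "\<exists>f. y = pz (m * d) f" if "y \<in> X" for y using m(2)[OF that] pz_refine[OF m(1) d(1)] by metis
  moreover have "m * d \<ge> 1" using m d by simp
  ultimately show ?case by blast
qed auto

lemma pz_common2: obtains m f g where "m \<ge> 1" "x = pz m f" "y = pz m g"
  using pz_common[of "{x,y}"] by auto

lemma pz_common3: obtains m f g h where "m \<ge> 1" "x = pz m f" "y = pz m g" "z = pz m h"
  using pz_common[of "{x,y,z}"] by auto

section \<open>Ring operations and order of Puiseux series\<close>

instantiation puis :: comm_ring_1
begin
definition "0 = pz 1 0"
definition "1 = pz 1 1"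
definition "x + y = Abs_puis (padd (cf x) (cf y))"
definition "x * y = Abs_puis (pmul (cf x) (cf y))"
definition "- x = Abs_puis (\<lambda>q. - cf x q)"
definition "x - (y::puis) = x + - y"

lemma pz_add: "m \<ge> 1 \<Longrightarrow> pz m f + pz m g = pz m (f + g)"
  by (simp add: plus_puis_def cf_pz emb_add pz_def[symmetric])

lemma pz_mult: "m \<ge> 1 \<Longrightarrow> pz m f * pz m g = pz m (f * g)"
  by (simp add: times_puis_def cf_pz emb_mult pz_def[symmetric])

lemma pz_uminus: "m \<ge> 1 \<Longrightarrow> - pz m f = pz m (- f)"
proof -
  have "(\<lambda>q. - emb m f q) = emb m (- f)" by (auto simp: emb_def fun_eq_iff)
  then show "m \<ge> 1 \<Longrightarrow> - pz m f = pz m (- f)" by (simp add: uminus_puis_def cf_pz pz_def[symmetric])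
qed

lemma pz_0: "m \<ge> 1 \<Longrightarrow> pz m 0 = 0"
proof -
  have "emb m 0 = emb 1 0" by (auto simp: emb_def)
  then show "pz m 0 = 0" by (simp add: zero_puis_def pz_def)
qed

lemma pz_1: "m \<ge> 1 \<Longrightarrow> pz m 1 = 1"
  using pz_refine[of 1 m 1] by (simp add: one_puis_def)

instance
proof
  fix a b c :: puis
  obtain m f g h where m: "m \<ge> 1" "a = pz m f" "b = pz m g" "c = pz m h" using pz_common3 by blast
  note s = pz_add pz_mult pz_uminus minus_puis_def
  show "a + b + c = a + (b + c)" "a + b = b + a" "a * b * c = a * (b * c)" "a * b = b * a"
    "(a + b) * c = a * c + b * c" "a - b = a + - b" "- a + a = 0"
    using m by (auto simp: s algebra_simps pz_0)
  show "0 + a = a" "1 * a = a" using m by (auto simp: s pz_0[symmetric, of m] pz_1[symmetric, of m])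
  show "(0::puis) \<noteq> 1" unfolding zero_puis_def one_puis_def by (simp add: pz_eq_iff)
qed
end

lemma cf_0 [simp]: "cf 0 q = 0" and cf_add [simp]: "cf (x + y) q = cf x q + cf y q"
  and cf_minus [simp]: "cf (- x) q = - cf x q" and cf_diff [simp]: "cf (x - y) q = cf x q - cf y q"
proof -
  show "cf 0 q = 0" by (simp add: zero_puis_def cf_pz emb_def)
  show a: "cf (x + y) q = cf x q + cf y q" for y
    by (rule pz_common2[of x y]) (auto simp: pz_add cf_pz emb_def)
  show m: "cf (- x) q = - cf x q" for x by (rule pz_cases[of x]) (auto simp: pz_uminus cf_pz emb_def)
  show "cf (x - y) q = cf x q - cf y q" using a[of "- y"] m[of y] by simp
qed

lemma cf_1: "cf 1 = pconst 1"
  by (auto simp: one_puis_def cf_pz emb_def pconst_def fun_eq_iff elim!: Ints_cases)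

lemma cf_mult: "cf (x * y) = pmul (cf x) (cf y)"
  by (rule pz_common2[of x y]) (auto simp: pz_mult cf_pz emb_mult)

lemma puis_eqI: "(\<And>q. cf x q = cf y q) \<Longrightarrow> x = y"
  by (metis Rep_puis_inject ext)

text \<open>Positivity of the leading coefficient, so that t becomes a positive
  infinitesimal.\<close>

definition ppos :: "puis \<Rightarrow> bool" where "ppos x \<longleftrightarrow> (\<exists>q. cf x q > 0 \<and> (\<forall>r<q. cf x r = 0))"

lemma emb_first_nonzero:
  assumes m: "m \<ge> 1" and "f \<noteq> 0"
  shows "emb m f (of_int (fls_subdegree f) / of_nat m) \<noteq> 0" "\<And>r. r < of_int (fls_subdegree f) / of_nat m \<Longrightarrow> emb m f r = 0"
proof -
  show "emb m f (of_int (fls_subdegree f) / of_nat m) \<noteq> 0" using assms by (simp add: emb_of_int)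
  fix r :: rat assume r: "r < of_int (fls_subdegree f) / of_nat m"
  show "emb m f r = 0"
  proof (rule ccontr)
    assume "emb m f r \<noteq> 0"
    then obtain i where i: "r = of_int i / of_nat m" "f $$ i \<noteq> 0" using emb_nonzeroE m by blast
    then have "fls_subdegree f \<le> i" by (intro fls_subdegree_leI)
    then show False using i(1) r m by (simp add: field_simps)
  qed
qed

lemma ppos_pz:
  assumes m: "m \<ge> 1"
  shows "ppos (pz m f) \<longleftrightarrow> f $$ fls_subdegree f > 0"
proof (cases "f = 0")
  case True
  then show ?thesis using m by (simp add: ppos_def pz_0)
next
  case False
  let ?d = "of_int (fls_subdegree f) / of_nat m :: rat"
  note e = emb_first_nonzero[OF m False]
  show ?thesis
  proof
    assume "ppos (pz m f)"
    then obtain q where q: "emb m f q > 0" "\<And>r. r < q \<Longrightarrow> emb m f r = 0" by (auto simp: ppos_def cf_pz[OF m])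
    have "q = ?d" using q e by (metis less_irrefl linorder_neqE)
    then show "f $$ fls_subdegree f > 0" using q emb_of_int[OF m] by metis
  next
    assume "f $$ fls_subdegree f > 0"
    then show "ppos (pz m f)" unfolding ppos_def cf_pz[OF m] using e(2)
      by (intro exI[of _ ?d]) (auto simp: emb_of_int[OF m])
  qed
qed

lemma ppos_mult: "ppos x \<Longrightarrow> ppos y \<Longrightarrow> ppos (x * y)"
proof (rule pz_common2[of x y])
  fix m f g assume m: "m \<ge> (1::nat)" "x = pz m f" "y = pz m g" and "ppos x" "ppos y"
  then have f: "f $$ fls_subdegree f > 0" "g $$ fls_subdegree g > 0" by (auto simp: ppos_pz)
  then have "f \<noteq> 0" "g \<noteq> 0" by auto
  then have "fls_subdegree (f * g) = fls_subdegree f + fls_subdegree g" by (rule fls_subdegree_mult)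
  then have "(f * g) $$ fls_subdegree (f * g) = f $$ fls_subdegree f * g $$ fls_subdegree g"
    by (simp add: fls_times_nth(2))
  then show "ppos (x * y)" using m f by (simp add: pz_mult ppos_pz)
qed

lemma ppos_add: 
  assumes "ppos x" "ppos y" shows "ppos (x + y)"
proof -
  obtain q r where q: "cf x q > 0" "\<And>s. s < q \<Longrightarrow> cf x s = 0" and r: "cf y r > 0" "\<And>s. s < r \<Longrightarrow> cf y s = 0"
    using assms by (auto simp: ppos_def)
  have "cf (x + y) (min q r) > 0" using q r by (cases q r rule: linorder_cases) (auto simp: min_def)
  then show ?thesis unfolding ppos_def using q r by (intro exI[of _ "min q r"]) auto
qed

lemma ppos_trichotomy: "x = 0 \<or> ppos x \<or> ppos (- x)"
proof (rule pz_cases[of x])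
  fix m f assume m: "m \<ge> (1::nat)" "x = pz m f"
  show ?thesis
  proof (cases "f = 0")
    case False
    then have "f $$ fls_subdegree f \<noteq> 0" by simp
    then show ?thesis using m by (auto simp: ppos_pz pz_uminus)
  qed (use m pz_0 in auto)
qed

lemma not_ppos_0: "\<not> ppos 0" by (simp add: ppos_def)

instantiation puis :: linordered_field
begin
definition "x < y \<longleftrightarrow> ppos (y - x)"
definition "x \<le> (y::puis) \<longleftrightarrow> x < y \<or> x = y"
definition "\<bar>x::puis\<bar> = (if x < 0 then - x else x)"
definition "sgn x = (if x = 0 then 0 else if 0 < x then 1 else -1 :: puis)"
definition "inverse x = (if x = 0 then 0 else SOME y. x * y = (1::puis))"
definition "x div (y::puis) = x * inverse y"

instance
proof
  fix a b c :: puis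
  show "a \<le> a" "\<bar>a\<bar> = (if a < 0 then - a else a)" "sgn a = (if a = 0 then 0 else if 0 < a then 1 else - 1)"
    "inverse (0::puis) = 0" "a div b = a * inverse b"
    by (auto simp: less_eq_puis_def abs_puis_def sgn_puis_def inverse_puis_def divide_puis_def)
  have asym: "\<not> (a < b \<and> b < a)" for a b :: puis
    using ppos_add[of "b - a" "a - b"] not_ppos_0 by (auto simp: less_puis_def)
  show "a < b \<longleftrightarrow> a \<le> b \<and> \<not> b \<le> a" using asym[of a b] not_ppos_0 by (auto simp: less_eq_puis_def less_puis_def)
  show "a \<le> b \<Longrightarrow> b \<le> a \<Longrightarrow> a = b" using asym[of a b] by (auto simp: less_eq_puis_def)
  show "a \<le> b \<Longrightarrow> b \<le> c \<Longrightarrow> a \<le> c"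
    using ppos_add[of "b - a" "c - b"] by (auto simp: less_eq_puis_def less_puis_def algebra_simps)
  show "a \<le> b \<or> b \<le> a" using ppos_trichotomy[of "a - b"] by (auto simp: less_eq_puis_def less_puis_def)
  show "a \<le> b \<Longrightarrow> c + a \<le> c + b" by (auto simp: less_eq_puis_def less_puis_def)
  show "a < b \<Longrightarrow> 0 < c \<Longrightarrow> c * a < c * b"
    using ppos_mult[of c "b - a"] by (auto simp: less_puis_def algebra_simps)
  assume "a \<noteq> 0"
  obtain m f where m: "m \<ge> 1" "a = pz m f" using pz_cases by blast
  have "f \<noteq> 0" using \<open>a \<noteq> 0\<close> m pz_0 by auto
  then have "a * pz m (inverse f) = 1" using m by (simp add: pz_mult pz_1)
  then have "a * inverse a = 1" unfolding inverse_puis_def using \<open>a \<noteq> 0\<close> someI[of "\<lambda>y. a * y = 1"] by simp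
  then show "inverse a * a = 1" by (simp add: mult.commute)
qed
end

section \<open>Constants, monomials and the residue map\<close>

definition rk :: "real \<Rightarrow> puis" where "rk r = pz 1 (fls_const r)"

lemma cf_rk: "cf (rk r) = pconst r"
  by (auto simp: rk_def cf_pz emb_def pconst_def fun_eq_iff elim!: Ints_cases)

lemma rk_simps [simp]: "rk 0 = 0" "rk 1 = 1" "rk (a + b) = rk a + rk b" "rk (a * b) = rk a * rk b"
    "rk (- a) = - rk a" "rk (a - b) = rk a - rk b"
proof -
  show 0: "rk 0 = 0" "rk 1 = 1" and a: "rk (a + b) = rk a + rk b" and "rk (a * b) = rk a * rk b" for a b
    by (auto simp: rk_def pz_0 pz_1 pz_add pz_mult fls_plus_const fls_const_mult_const)
  show m: "rk (- a) = - rk a" for a using a[of a "- a"] 0 by (simp add: eq_neg_iff_add_eq_0 add.commute)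
  show "rk (a - b) = rk a - rk b" using a[of a "- b"] m[of b] by simp
qed

lemma rk_power [simp]: "rk (a ^ n) = rk a ^ n"
  by (induction n) auto

lemma rk_less [simp]: "rk a < rk b \<longleftrightarrow> a < b"
proof -
  have "ppos (rk c) \<longleftrightarrow> c > 0" for c by (auto simp: ppos_def cf_rk pconst_def)
  then show ?thesis by (simp add: less_puis_def flip: rk_simps)
qed

lemma rk_eq [simp]: "rk a = rk b \<longleftrightarrow> a = b"
  by (metis less_irrefl linorder_neqE rk_less)

lemma rk_le [simp]: "rk a \<le> rk b \<longleftrightarrow> a \<le> b"
  by (auto simp: le_less)

definition tpow :: "rat \<Rightarrow> puis" where "tpow r = Abs_puis (\<lambda>q. if q = r then 1 else 0)"

lemma cf_tpow: "cf (tpow r) = (\<lambda>q. if q = r then 1 else 0)"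
proof -
  obtain a b where ab: "quotient_of r = (a,b)" by (cases "quotient_of r") auto
  then have b: "b > 0" and r: "r = of_int a / of_int b" using quotient_of_denom_pos quotient_of_div by blast+
  have "(\<lambda>q. if q = r then 1 else 0) = emb (nat b) (fls_X_intpow a)"
  proof (rule emb_eqI)
    show "nat b \<ge> 1" using b by simp
    fix i show "(if of_int i / of_nat (nat b) = r then 1 else 0) = (fls_X_intpow a :: real fls) $$ i"
      using b by (simp add: r)
  next
    fix q :: rat assume "of_nat (nat b) * q \<notin> \<int>"
    then show "(if q = r then 1 else 0) = 0" using b by (auto simp: r)
  qed
  then show ?thesis unfolding tpow_def using b by (subst Abs_puis_inverse) (auto intro!: exI[of _ "nat b"])
qed

lemma cf_tpow_mult: "cf (tpow r * x) q = cf x (q - r)"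
proof -
  have "{s. (if s = r then 1 else 0::real) \<noteq> 0 \<and> cf x (q - s) \<noteq> 0} = (if cf x (q - r) \<noteq> 0 then {r} else {})" by auto
  then show ?thesis by (simp add: cf_mult pmul_def cf_tpow)
qed

lemma tpow_add: "tpow r * tpow s = tpow (r + s)"
  by (rule puis_eqI) (auto simp: cf_tpow_mult cf_tpow)

lemma tpow_0: "tpow 0 = 1"
  by (rule puis_eqI) (auto simp: cf_tpow cf_1 pconst_def)

lemma tpow_power: "tpow r ^ n = tpow (of_nat n * r)"
  by (induction n) (auto simp: tpow_0 tpow_add algebra_simps)

lemma tpow_pos: "tpow r > 0"
  by (auto simp: less_puis_def ppos_def cf_tpow intro!: exI[of _ r])

lemma puis_first_coeff:
  assumes "x \<noteq> 0"
  obtains v where "cf x v \<noteq> 0" "\<And>q. q < v \<Longrightarrow> cf x q = 0"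
proof -
  obtain m f where m: "m \<ge> 1" "x = pz m f" using pz_cases by blast
  then have "f \<noteq> 0" using assms pz_0 by auto
  then show thesis using that emb_first_nonzero[OF m(1)] cf_pz[OF m(1)] m(2) by metis
qed

text \<open>The valuation ring. On it \<open>st\<close>, the value at t = 0, is the residue
  homomorphism onto the reals; outside it \<open>st\<close> is still defined but not
  multiplicative.\<close>

definition fin :: "puis \<Rightarrow> bool" where "fin x \<longleftrightarrow> (\<forall>q<0. cf x q = 0)"

abbreviation st :: "puis \<Rightarrow> real" where "st x \<equiv> cf x 0"

lemma fin_iff_puiseux: "fin x \<longleftrightarrow> cf x \<in> puiseux"
proof
  assume f: "fin x"
  obtain m g where m: "m \<ge> 1" "x = pz m g" using pz_cases by blast
  then have "\<forall>q. cf x q \<noteq> 0 \<longrightarrow> of_nat m * q \<in> \<int>" by (auto simp: cf_pz emb_def)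
  moreover have "\<forall>q. cf x q \<noteq> 0 \<longrightarrow> q \<ge> 0" using f unfolding fin_def by (meson not_less)
  ultimately show "cf x \<in> puiseux" using m(1) unfolding puiseux_def by blast
next
  assume "cf x \<in> puiseux"
  then have "\<forall>q. cf x q \<noteq> 0 \<longrightarrow> q \<ge> 0" unfolding puiseux_def by blast
  then show "fin x" unfolding fin_def by (meson not_less)
qed

lemma puiseux_in_puis:
  assumes "a \<in> puiseux"
  shows "\<exists>x. fin x \<and> cf x = a"
proof -
  obtain m where m: "m \<ge> 1" "\<And>q. a q \<noteq> 0 \<Longrightarrow> of_nat m * q \<in> \<int>" and nn: "\<And>q. a q \<noteq> 0 \<Longrightarrow> q \<ge> 0"
    using assms by (auto simp: puiseux_def)
  define f where "f = Abs_fls (\<lambda>i. a (of_int i / of_nat m))"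
  have "\<forall>\<^sub>\<infinity>n. a (of_int (- int n) / of_nat m) = 0"
    unfolding MOST_nat
  proof (intro exI[of _ 0] allI impI)
    fix n :: nat assume "0 < n"
    then have "\<not> (of_int (- int n) / of_nat m \<ge> (0::rat))" using m(1) by (simp add: divide_le_0_iff not_le)
    then show "a (of_int (- int n) / of_nat m) = 0" using nn by blast
  qed
  then have "a = emb m f" using m by (intro emb_eqI) (auto simp: f_def)
  then have "cf (pz m f) = a" using cf_pz m by simp
  then show ?thesis using fin_iff_puiseux assms by metis
qed

lemma fin_iff_pz: "fin x \<longleftrightarrow> (\<exists>m\<ge>1. \<exists>F. x = pz m (fps_to_fls F))"
proof
  assume f: "fin x"
  obtain m g where m: "m \<ge> 1" "x = pz m g" using pz_cases by blast
  have "g $$ i = 0" if "i < 0" for i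
    using f that m emb_of_int[OF m(1), of g i] by (simp add: fin_def cf_pz divide_less_0_iff)
  then have "fls_subdegree g \<ge> 0" by (metis fls_subdegree_ge0I not_less)
  then show "\<exists>m\<ge>1. \<exists>F. x = pz m (fps_to_fls F)" using m by (metis fls_regpart_to_fls_trivial)
next
  assume "\<exists>m\<ge>1. \<exists>F. x = pz m (fps_to_fls F)"
  then obtain m F where m: "m \<ge> 1" "x = pz m (fps_to_fls F)" by blast
  show "fin x" unfolding fin_def
  proof (intro allI impI, rule ccontr)
    fix q :: rat assume q: "q < 0" "cf x q \<noteq> 0"
    then obtain i where i: "q = of_int i / of_nat m" "fps_to_fls F $$ i \<noteq> 0" using emb_nonzeroE m cf_pz by metis
    then have "i < 0" using q m by (simp add: divide_less_0_iff)
    then show False using i by simp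
  qed
qed

lemma pz_common_fin:
  assumes "finite X" "\<And>x. x \<in> X \<Longrightarrow> fin x"
  obtains m where "m \<ge> 1" "\<And>x. x \<in> X \<Longrightarrow> \<exists>F. x = pz m (fps_to_fls F)"
proof -
  obtain m where m: "m \<ge> 1" "\<And>x. x \<in> X \<Longrightarrow> \<exists>f. x = pz m f" using pz_common[OF assms(1)] by blast
  have "\<exists>F. x = pz m (fps_to_fls F)" if x: "x \<in> X" for x
  proof -
    obtain g where g: "x = pz m g" using m x by blast
    have "g $$ i = 0" if "i < 0" for i
      using assms(2)[OF x] that g m(1) emb_of_int[OF m(1), of g i] by (simp add: fin_def cf_pz divide_less_0_iff)
    then have "fls_subdegree g \<ge> 0" by (metis fls_subdegree_ge0I not_less)
    then show ?thesis using g by (metis fls_regpart_to_fls_trivial)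
  qed
  then show thesis using that m by blast
qed

lemma fin_st_ops:
  assumes "fin x" "fin y"
  shows "fin (x + y)" "fin (x * y)" "fin (- x)" "fin (x - y)" "st (x * y) = st x * st y"
proof -
  obtain m where m: "m \<ge> 1" "\<And>z. z \<in> {x,y} \<Longrightarrow> \<exists>F. z = pz m (fps_to_fls F)"
    using pz_common_fin[of "{x,y}"] assms by blast
  obtain F G where FG: "x = pz m (fps_to_fls F)" "y = pz m (fps_to_fls G)" using m(2) by blast
  have xy: "x * y = pz m (fps_to_fls (F * G))" using FG m by (simp add: pz_mult fls_times_fps_to_fls)
  show "fin (x * y)" using xy m fin_iff_pz by blast
  have st: "st (pz m (fps_to_fls H)) = fps_nth H 0" for H using m emb_of_int[OF m(1), of _ 0] by (simp add: cf_pz)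
  show "st (x * y) = st x * st y" by (simp only: xy st) (simp add: FG st)
qed (use assms in \<open>auto simp: fin_def\<close>)

lemma fin_rk [simp]: "fin (rk r)" and st_rk [simp]: "st (rk r) = r"
  by (auto simp: fin_def cf_rk pconst_def)

lemma fin_0 [simp]: "fin 0" and fin_1 [simp]: "fin 1" and st_1 [simp]: "st 1 = 1"
  using fin_rk[of 0] fin_rk[of 1] st_rk[of 1] by simp_all

lemma fin_st_power: "fin x \<Longrightarrow> fin (x ^ n) \<and> st (x ^ n) = st x ^ n"
  by (induction n) (auto simp: fin_st_ops)

lemma fin_st_sum: "(\<And>i. i \<in> A \<Longrightarrow> fin (f i)) \<Longrightarrow> fin (sum f A) \<and> st (sum f A) = (\<Sum>i\<in>A. st (f i))"
  by (induction A rule: infinite_finite_induct) (auto simp: fin_st_ops)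

lemma st_pos_imp: "fin x \<Longrightarrow> st x > 0 \<Longrightarrow> x > 0"
  by (auto simp: less_puis_def ppos_def fin_def intro!: exI[of _ 0])

text \<open>In absolute value, a leading term of negative order exceeds every real constant.\<close>

lemma fin_bounded: "\<bar>x\<bar> \<le> rk c \<Longrightarrow> fin x"
proof (rule ccontr)
  assume b: "\<bar>x\<bar> \<le> rk c" and "\<not> fin x"
  then have "x \<noteq> 0" by auto
  then obtain v where v: "cf x v \<noteq> 0" "\<And>q. q < v \<Longrightarrow> cf x q = 0" using puis_first_coeff by blast
  have "v < 0" using \<open>\<not> fin x\<close> v by (meson fin_def not_less order_less_le_trans)
  then have c: "cf (rk c) q = 0" if "q \<le> v" for q using that by (auto simp: cf_rk pconst_def)
  have "x \<le> rk c" "- x \<le> rk c" using b by (auto simp: abs_le_iff)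
  then have "\<not> ppos (x - rk c)" "\<not> ppos (- x - rk c)"
    by (simp_all add: less_puis_def[symmetric] not_less)
  moreover have "cf (x - rk c) v = cf x v" "cf (- x - rk c) v = - cf x v" 
    "\<And>q. q < v \<Longrightarrow> cf (x - rk c) q = 0 \<and> cf (- x - rk c) q = 0" using c v by auto
  ultimately show False using v(1) unfolding ppos_def by (metis linorder_neqE neg_0_less_iff_less)
qed

lemma infinite_inverse:
  assumes "\<not> fin x"
  shows "fin (1 / x)" "st (1 / x) = 0"
proof -
  have big: "\<bar>x\<bar> > rk c" for c using fin_bounded assms by (meson not_less)
  then have "\<bar>x\<bar> > 1" "x \<noteq> 0" using big[of 1] by auto
  then have "\<bar>1 / x\<bar> \<le> rk 1" by (simp add: field_simps)
  then show f: "fin (1 / x)" by (rule fin_bounded)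
  show "st (1 / x) = 0"
  proof (rule ccontr)
    assume n: "st (1 / x) \<noteq> 0"
    \<comment> \<open>\<open>c\<close> makes the residue of c |1/x| equal to 2; subtracting 1 leaves
      a positive series, which says |x| < c and contradicts that x is infinite.\<close>
    define w c where "w = \<bar>1/x\<bar>" and "c = 2 / \<bar>st (1/x)\<bar>"
    define y where "y = rk c * w - 1"
    have "st \<bar>z\<bar> = \<bar>st z\<bar>" "fin \<bar>z\<bar>" if "fin z" "st z \<noteq> 0" for z
      using that st_pos_imp[of z] st_pos_imp[of "- z"] fin_st_ops(3)[OF that(1,1)]
      by (auto simp: abs_if not_less)
    then have "fin w" "st w = \<bar>st (1/x)\<bar>" using f n unfolding w_def by blast+
    moreover from this have "st w * c = 2" using n by (simp add: c_def)
    ultimately have "fin y" "st y = 1" unfolding y_def by (auto simp: fin_st_ops mult.commute)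
    then have "y > 0" using st_pos_imp by simp
    then have "rk c > \<bar>x\<bar>" using \<open>x \<noteq> 0\<close> by (simp add: y_def w_def field_simps)
    then show False using big less_asym by blast
  qed
qed

section \<open>Hensel's lemma\<close>

declare sum.cong [fundef_cong]

text \<open>The n-th coefficients of the two lifted factors. \<open>E\<close> is what products of
  lower coefficients miss at order n; for \<open>v\<close> inverse to h modulo g, the pair returned
  solves G h + g H = E with G reduced modulo g.\<close>

function hensel_seq :: "(nat \<Rightarrow> real poly) \<Rightarrow> real poly \<Rightarrow> real poly \<Rightarrow> real poly \<Rightarrow> nat \<Rightarrow> real poly \<times> real poly" where
  "hensel_seq P g h v n = (if n = 0 then (g, h) else
     (let E = P n - (\<Sum>i\<in>{1..<n}. fst (hensel_seq P g h v i) * snd (hensel_seq P g h v (n - i)));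
          A = (E * v) mod g
      in (A, (E - A * h) div g)))"
  by pat_completeness auto
termination
  by (relation "Wellfounded.measure (\<lambda>(P,g,h,v,n). n)") auto

declare hensel_seq.simps [simp del]

text \<open>Coprimality solves G h + g H = E at each order; reduction modulo g bounds the degree of
  G, and comparing degrees in the equation bounds that of H. Hence the leading terms come from order
  zero alone.\<close>

lemma hensel_sequences:
  fixes P :: "nat \<Rightarrow> real poly"
  assumes P0: "P 0 = g * h" and cop: "coprime g h" and mon: "lead_coeff g = 1" "lead_coeff h = 1"
    and deg: "degree g > 0" "degree h > 0" and Pk: "\<And>k. k > 0 \<Longrightarrow> degree (P k) < degree g + degree h"
  shows "\<exists>G H. G 0 = g \<and> H 0 = h \<and> (\<forall>k>0. degree (G k) < degree g \<and> degree (H k) < degree h) \<and>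
     (\<forall>k. P k = (\<Sum>i\<le>k. G i * H (k - i)))"
proof -
  obtain u v where uv: "u * g + v * h = 1"
    using bezout_coefficients_fst_snd[of g h] cop by (metis coprime_imp_gcd_eq_1)
  define G H where "G k = fst (hensel_seq P g h v k)" and "H k = snd (hensel_seq P g h v k)" for k
  define E where "E n = P n - (\<Sum>i\<in>{1..<n}. G i * H (n - i))" for n
  have 0: "G 0 = g" "H 0 = h" by (simp_all add: G_def H_def hensel_seq.simps[of _ _ _ _ 0])
  have Gn: "G n = (E n * v) mod g" and Hn: "H n = (E n - G n * h) div g" if "n > 0" for n
    using that by (simp_all add: G_def H_def E_def hensel_seq.simps[of P g h v n] Let_def)
  have main: "degree (G n) < degree g \<and> degree (H n) < degree h \<and> G n * h + g * H n = E n" if "n > 0" for n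
    using that
  proof (induction n rule: less_induct)
    case (less n)
    have dG: "degree (G n) < degree g"
      using deg degree_mod_less'[of g "E n * v"] unfolding Gn[OF less.prems] by (cases "E n * v mod g = 0"; cases "g = 0") auto
    have "degree (E n) < degree g + degree h"
    proof -
      have "degree (\<Sum>i\<in>{1..<n}. G i * H (n - i)) < degree g + degree h"
      proof (rule degree_sum_less)
        fix i assume "i \<in> {1..<n}"
        then have "degree (G i) < degree g" "degree (H (n - i)) < degree h" using less.IH by auto
        then show "degree (G i * H (n - i)) < degree g + degree h"
          using degree_mult_le[of "G i" "H (n - i)"] by linarith
      qed (use deg in auto)
      then show ?thesis unfolding E_def using Pk[OF less.prems] by (metis degree_diff_less)
    qed
    moreover have "degree (G n * h) < degree g + degree h"
      using dG degree_mult_le[of "G n" h] by linarith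
    ultimately have dd: "degree (E n - G n * h) < degree g + degree h" by (metis degree_diff_less)
    have dv: "g dvd E n - G n * h"
    proof -
      have "E n - G n * h = E n * (u * g + v * h) - G n * h" by (simp add: uv)
      also have "\<dots> = E n * u * g + (E n * v - (E n * v) mod g) * h" unfolding Gn[OF less.prems] by (simp add: algebra_simps)
      also have "\<dots> = g * (E n * u + (E n * v) div g * h)"
        by (simp add: minus_mod_eq_mult_div algebra_simps)
      finally show ?thesis by simp
    qed
    then have eq: "g * H n = E n - G n * h" unfolding Hn[OF less.prems] by simp
    have "degree (H n) < degree h"
    proof (cases "H n = 0")
      case False
      then have "degree (g * H n) = degree g + degree (H n)" using deg by (intro degree_mult_eq) auto
      then show ?thesis using dd eq by simp
    qed (use deg in simp)
    then show ?case using dG eq by (simp add: algebra_simps)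
  qed
  have "P k = (\<Sum>i\<le>k. G i * H (k - i))" for k
  proof (cases "k = 0")
    case True
    then show ?thesis using P0 0 by simp
  next
    case False
    have "(\<Sum>i\<le>k. G i * H (k - i)) = g * H k + (\<Sum>i\<in>{1..<k}. G i * H (k - i)) + G k * h"
    proof -
      have "{..k} = insert 0 (insert k {1..<k})" using False by auto
      then show ?thesis using False 0 by (simp add: algebra_simps)
    qed
    then show ?thesis using main[of k] False by (simp add: E_def algebra_simps)
  qed
  then show ?thesis using 0 main by blast
qed

definition fpz :: "nat \<Rightarrow> real fps \<Rightarrow> puis" where "fpz m F = pz m (fps_to_fls F)"

lemma fpz_simps:
  assumes "m \<ge> 1"
  shows "fpz m (F + G) = fpz m F + fpz m G" "fpz m (F * G) = fpz m F * fpz m G" "fpz m 0 = 0" "fpz m 1 = 1"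
    "fpz m F = fpz m G \<longleftrightarrow> F = G" "st (fpz m F) = fps_nth F 0" "fpz m (sum f A) = (\<Sum>i\<in>A. fpz m (f i))"
proof -
  show a: "fpz m (F + G) = fpz m F + fpz m G" for F G using assms by (simp add: fpz_def pz_add)
  show "fpz m (F * G) = fpz m F * fpz m G" using assms by (simp add: fpz_def pz_mult fls_times_fps_to_fls)
  show z: "fpz m 0 = 0" and "fpz m 1 = 1" using assms by (simp_all add: fpz_def pz_0 pz_1)
  show "fpz m F = fpz m G \<longleftrightarrow> F = G" using assms by (simp add: fpz_def pz_eq_iff)
  show "st (fpz m F) = fps_nth F 0" using emb_of_int[OF assms, of _ 0] assms by (simp add: fpz_def cf_pz)
  show "fpz m (sum f A) = (\<Sum>i\<in>A. fpz m (f i))" by (induction A rule: infinite_finite_induct) (auto simp: a z)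
qed

text \<open>With a common denominator m the polynomial q becomes a power series in s = t^(1/m) whose
  coefficients \<open>P k\<close> are real polynomials; its constant term is g h, and this
  factorisation is lifted order by order.\<close>

lemma hensel_puis:
  fixes q :: "puis poly"
  assumes fin: "\<And>i. fin (coeff q i)" and mq: "lead_coeff q = 1"
    and gh: "map_poly st q = g * h" and cop: "coprime g h" and mon: "lead_coeff g = 1" "lead_coeff h = 1"
    and deg: "degree g > 0" "degree h > 0"
  shows "\<exists>G H. q = G * H \<and> lead_coeff G = 1 \<and> lead_coeff H = 1 \<and> degree G = degree g \<and> degree H = degree h"
proof -
  define n where "n = degree q"
  have co: "coeff (g * h) i = st (coeff q i)" for i unfolding gh[symmetric] by (simp add: coeff_map_poly)
  have n: "n = degree g + degree h"
  proof -
    have "degree (g * h) = degree g + degree h" using deg by (intro degree_mult_eq) auto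
    moreover have "degree (g * h) = n"
    proof (rule antisym)
      show "degree (g * h) \<le> n" by (rule degree_le) (simp add: co coeff_eq_0 n_def)
      show "n \<le> degree (g * h)" by (rule le_degree) (simp add: co mq n_def)
    qed
    ultimately show ?thesis by simp
  qed
  obtain m where m: "m \<ge> 1" "\<And>x. x \<in> coeff q ` {..n} \<Longrightarrow> \<exists>F. x = pz m (fps_to_fls F)"
    using pz_common_fin[of "coeff q ` {..n}"] fin by blast
  then have "\<forall>i. \<exists>F. i \<le> n \<longrightarrow> coeff q i = fpz m F" unfolding fpz_def by blast
  then obtain F where F: "\<And>i. i \<le> n \<Longrightarrow> coeff q i = fpz m (F i)" by metis
  note s = fpz_simps[OF m(1)]
  define P where "P k = (\<Sum>i\<le>n. monom (fps_nth (F i) k) i)" for k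
  have cP: "coeff (P k) i = (if i \<le> n then fps_nth (F i) k else 0)" for k i
    by (simp add: P_def coeff_sum)
  have Fn: "F n = 1" using F[of n] mq s(4,5) unfolding n_def by (metis order_refl)
  have P0: "P 0 = g * h"
  proof (rule poly_eqI)
    fix i show "coeff (P 0) i = coeff (g * h) i"
      using F[of i] by (cases "i \<le> n") (auto simp: cP co s coeff_eq_0 n_def)
  qed
  have Pk: "degree (P k) < degree g + degree h" if "k > 0" for k
  proof -
    have "n > 0" using n deg by simp
    then show ?thesis unfolding n[symmetric]
      by (intro degree_lessI) (use that Fn in \<open>auto simp: cP le_less\<close>)
  qed
  obtain G H where GH: "G 0 = g" "H 0 = h" "\<And>k. k > 0 \<Longrightarrow> degree (G k) < degree g \<and> degree (H k) < degree h"
    "\<And>k. P k = (\<Sum>i\<le>k. G i * H (k - i))"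
    using hensel_sequences[of P g h, OF P0 cop mon deg Pk] by blast
  \<comment> \<open>The way back: a sequence of real polynomials, read as the coefficients of the
    powers of s, becomes a polynomial over the Puiseux series.\<close>
  define L where "L A d = (\<Sum>j\<le>d. monom (fpz m (Abs_fps (\<lambda>k. coeff (A k) j))) j)" for A :: "nat \<Rightarrow> real poly" and d
  have cL: "coeff (L A d) j = fpz m (Abs_fps (\<lambda>k. coeff (A k) j))" if "\<And>k. degree (A k) \<le> d" for A d j
  proof (cases "j \<le> d")
    case False
    then have "Abs_fps (\<lambda>k. coeff (A k) j) = 0" using that by (intro fps_ext) (auto intro!: coeff_eq_0 le_less_trans[OF that])
    then show ?thesis using False by (simp add: L_def coeff_sum s)
  qed (simp add: L_def coeff_sum)
  have dG: "degree (G k) \<le> degree g" and dH: "degree (H k) \<le> degree h" for k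
    using GH(1,2) GH(3)[of k] by (cases "k = 0"; force)+
  have mono: "degree (L A d) = d \<and> lead_coeff (L A d) = 1"
    if "\<And>k. degree (A k) \<le> d" "coeff (A 0) d = 1" "\<And>k. k > 0 \<Longrightarrow> degree (A k) < d" for A d
  proof -
    have "Abs_fps (\<lambda>k. coeff (A k) d) = 1" using that(2,3) by (intro fps_ext) (auto simp: coeff_eq_0)
    then have c: "coeff (L A d) d = 1" using cL[OF that(1)] s by simp
    moreover have "degree (L A d) \<le> d" unfolding L_def by (intro degree_sum_le) (auto intro: order.trans[OF degree_monom_le])
    ultimately have "degree (L A d) = d" by (metis le_antisym le_degree zero_neq_one)
    then show ?thesis using c by simp
  qed
  have "q = L G (degree g) * L H (degree h)"
  proof (rule poly_eqI)
    fix j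
    have "coeff (L G (degree g) * L H (degree h)) j =
        fpz m (\<Sum>a\<le>j. Abs_fps (\<lambda>k. coeff (G k) a) * Abs_fps (\<lambda>k. coeff (H k) (j - a)))"
      by (simp add: coeff_mult cL[OF dG] cL[OF dH] s)
    also have "(\<Sum>a\<le>j. Abs_fps (\<lambda>k. coeff (G k) a) * Abs_fps (\<lambda>k. coeff (H k) (j - a))) = Abs_fps (\<lambda>k. coeff (P k) j)"
    proof (rule fps_ext)
      fix k
      have "fps_nth (\<Sum>a\<le>j. Abs_fps (\<lambda>k. coeff (G k) a) * Abs_fps (\<lambda>k. coeff (H k) (j - a))) k =
          (\<Sum>a\<le>j. \<Sum>i\<le>k. coeff (G i) a * coeff (H (k - i)) (j - a))"
        by (simp add: fps_sum_nth fps_mult_nth atLeast0AtMost)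
      also have "\<dots> = coeff (P k) j"
        unfolding GH(4) coeff_sum coeff_mult by (rule sum.swap)
      finally show "fps_nth (\<Sum>a\<le>j. Abs_fps (\<lambda>k. coeff (G k) a) * Abs_fps (\<lambda>k. coeff (H k) (j - a))) k
          = fps_nth (Abs_fps (\<lambda>k. coeff (P k) j)) k" by simp
    qed
    also have "fpz m (Abs_fps (\<lambda>k. coeff (P k) j)) = coeff q j"
    proof (cases "j \<le> n")
      case True
      then have "Abs_fps (\<lambda>k. coeff (P k) j) = F j" by (simp add: cP fps_eq_iff)
      then show ?thesis using F True by simp
    next
      case False
      then have "Abs_fps (\<lambda>k. coeff (P k) j) = 0" by (simp add: cP fps_eq_iff)
      then show ?thesis using False s by (simp add: coeff_eq_0 n_def)
    qed
    finally show "coeff q j = coeff (L G (degree g) * L H (degree h)) j" by simp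
  qed
  moreover have "degree (L G (degree g)) = degree g \<and> lead_coeff (L G (degree g)) = 1"
    by (rule mono) (use dG GH mon in auto)
  moreover have "degree (L H (degree h)) = degree h \<and> lead_coeff (L H (degree h)) = 1"
    by (rule mono) (use dH GH mon in auto)
  ultimately show ?thesis by metis
qed

section \<open>The intermediate value property for Puiseux series\<close>

lemma poly_fin_st:
  assumes "\<And>i. fin (coeff q i)" "fin y"
  shows "fin (poly q y)" "st (poly q y) = poly (map_poly st q) (st y)"
proof -
  have t: "fin (coeff q i * y ^ i) \<and> st (coeff q i * y ^ i) = st (coeff q i) * st y ^ i" for i
    using assms by (auto simp: fin_st_ops fin_st_power)
  then have *: "fin (poly q y) \<and> st (poly q y) = (\<Sum>i\<le>degree q. st (coeff q i) * st y ^ i)"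
    unfolding poly_altdef using fin_st_sum[of "{..degree q}" "\<lambda>i. coeff q i * y ^ i"] by simp
  have "poly (map_poly st q) (st y) = (\<Sum>i\<le>degree q. coeff (map_poly st q) i * st y ^ i)"
  proof -
    have "degree (map_poly st q) \<le> degree q" by (rule degree_le) (simp add: coeff_map_poly coeff_eq_0)
    then show ?thesis unfolding poly_altdef by (intro sum.mono_neutral_left) (auto simp: coeff_eq_0)
  qed
  then show "fin (poly q y)" "st (poly q y) = poly (map_poly st q) (st y)" using * by (auto simp: coeff_map_poly)
qed

text \<open>For the Tschirnhaus shift, which removes the second highest coefficient.\<close>

lemma coeff_pcompose_shift:
  fixes p :: "'a::field_char_0 poly"
  assumes "degree p = Suc n" "lead_coeff p = 1"
  shows "coeff (pcompose p [:e,1:]) n = coeff p n + of_nat (Suc n) * e"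
proof -
  define r where "r = p - monom 1 (Suc n) - monom (coeff p n) n"
  have p: "p = monom 1 (Suc n) + monom (coeff p n) n + r" by (simp add: r_def)
  have dr: "coeff r i = 0" if "i \<ge> n" for i
    using that assms by (cases "i = n"; cases "i = Suc n") (auto simp: r_def coeff_eq_0)
  have "coeff (pcompose r [:e,1:]) n = 0"
  proof (cases "r = 0")
    case False
    then have "degree r < n" using dr by (metis leading_coeff_0_iff not_less)
    then show ?thesis by (intro coeff_eq_0) (simp add: degree_pcompose)
  qed auto
  moreover have m: "pcompose (monom c k) [:e,1:] = smult c ([:e,1:] ^ k)" for c k
    by (induction k) (auto simp: monom_0 monom_Suc pcompose_pCons)
  ultimately show ?thesis
    by (subst p) (simp only: pcompose_add coeff_add m, simp add: coeff_linear_poly_power del: power_Suc)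
qed

text \<open>A slope of the Newton polygon: \<open>rho\<close> is the least val(a_i)/(n - i) over
  nonzero coefficients a_i with i < n. Substituting t^rho y and dividing by t^(n rho) makes all
  coefficients finite, and where the minimum is attained the residue is nonzero.\<close>

lemma puis_scaled:
  fixes p :: "puis poly"
  assumes dp: "degree p = n" "lead_coeff p = 1" and ne: "\<exists>i<n. coeff p i \<noteq> 0"
  shows "\<exists>r q. r > 0 \<and> (\<forall>y. poly q y = poly p (r * y) / r ^ n) \<and> degree q = n \<and> lead_coeff q = 1 \<and>
     (\<forall>i. fin (coeff q i)) \<and> (\<exists>i<n. st (coeff q i) \<noteq> 0) \<and> (\<forall>i. coeff p i = 0 \<longrightarrow> coeff q i = 0)"
proof -
  have "\<forall>x. \<exists>v. x \<noteq> 0 \<longrightarrow> cf x v \<noteq> 0 \<and> (\<forall>q<v. cf x q = 0)" using puis_first_coeff by metis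
  then obtain val where val: "\<And>x. x \<noteq> 0 \<Longrightarrow> cf x (val x) \<noteq> 0" "\<And>x q. x \<noteq> 0 \<Longrightarrow> q < val x \<Longrightarrow> cf x q = 0" by metis
  define I where "I = {i. i < n \<and> coeff p i \<noteq> 0}"
  define s where "s i = val (coeff p i) / of_nat (n - i)" for i
  have I: "finite I" "I \<noteq> {}" using ne by (auto simp: I_def)
  define rho where "rho = Min (s ` I)"
  have "rho \<in> s ` I" using I rho_def by (metis Min_in finite_imageI image_is_empty)
  then obtain i0 where i0: "i0 \<in> I" "rho = s i0" by blast
  have rle: "rho * of_nat (n - i) \<le> val (coeff p i)" if "i \<in> I" for i
  proof -
    have "rho \<le> s i" using I that rho_def by simp
    then show ?thesis using that by (simp add: s_def I_def field_simps)
  qed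
  have req: "rho * of_nat (n - i0) = val (coeff p i0)" using i0 by (simp add: s_def I_def)
  define c where "c i = tpow (- (of_nat (n - i) * rho)) * coeff p i" for i
  define q where "q = (\<Sum>i\<le>n. monom (c i) i)"
  have cq: "coeff q i = (if i \<le> n then c i else 0)" for i by (simp add: q_def coeff_sum)
  have cn: "c n = 1" using dp by (simp add: c_def tpow_0)
  have cc: "cf (c i) v = cf (coeff p i) (v + of_nat (n - i) * rho)" for i v by (simp add: c_def cf_tpow_mult)
  have "degree q = n" by (rule antisym) (auto intro!: degree_le le_degree simp: cq cn)
  moreover have "lead_coeff q = 1" using \<open>degree q = n\<close> by (simp add: cq cn)
  moreover have "fin (coeff q i)" for i
  proof (cases "i \<in> I")
    case True
    have "cf (c i) v = 0" if "v < 0" for v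
      unfolding cc by (rule val(2)) (use rle[OF True] True that in \<open>auto simp: I_def mult.commute\<close>)
    then show ?thesis using True by (auto simp: cq I_def fin_def)
  next
    case False
    then consider "i = n" | "i > n" | "coeff p i = 0" by (cases i n rule: linorder_cases) (auto simp: I_def)
    then show ?thesis
    proof cases
      case 1
      then show ?thesis by (simp add: cq cn)
    qed (auto simp: cq c_def)
  qed
  moreover have "st (coeff q i0) \<noteq> 0" "i0 < n"
    using i0 req val(1)[of "coeff p i0"] by (auto simp: cq cc I_def mult.commute)
  moreover have "coeff p i = 0 \<longrightarrow> coeff q i = 0" for i by (simp add: cq c_def)
  moreover have "poly q y = poly p (tpow rho * y) / tpow rho ^ n" for y
  proof -
    have "c i * y ^ i * tpow rho ^ n = coeff p i * (tpow rho * y) ^ i" if "i \<le> n" for i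
    proof -
      have "tpow (- (of_nat (n - i) * rho)) * tpow rho ^ n = tpow rho ^ i"
        unfolding tpow_power tpow_add using that by (simp add: of_nat_diff algebra_simps)
      then show ?thesis unfolding c_def power_mult_distrib by (simp add: mult_ac)
    qed
    then have "poly q y * tpow rho ^ n = poly p (tpow rho * y)"
      by (simp add: q_def poly_sum poly_monom sum_distrib_right poly_altdef[of p] dp)
    then show ?thesis using tpow_pos[of rho] by (simp add: field_simps)
  qed
  ultimately show ?thesis using tpow_pos[of rho] by blast
qed

text \<open>Induction on the degree. With the second coefficient removed and the variable scaled,
  the residue polynomial is not a power of one linear factor. If it has a real root it splits into
  coprime factors, these lift by Hensel, and one of the lifts changes sign; if it has none, the
  polynomial is positive everywhere.\<close>

lemma puis_monic_ivt:
  fixes p :: "puis poly"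
  assumes "degree p = n" "lead_coeff p = 1" "a < b" "poly p a * poly p b < 0"
  shows "\<exists>c. a < c \<and> c < b \<and> poly p c = 0"
  using assms
proof (induction n arbitrary: p a b rule: less_induct)
  case (less n)
  have n0: "n \<noteq> 0"
  proof
    assume "n = 0"
    then have "p = [:1:]" using less.prems by (metis degree_eq_zeroE lead_coeff_pCons(2))
    then show False using less.prems by simp
  qed
  then obtain n' where n': "n = Suc n'" by (cases n) auto
  define e where "e = - coeff p n' / of_nat n"
  define p1 where "p1 = pcompose p [:e,1:]"
  have p1: "poly p1 y = poly p (y + e)" for y by (simp add: p1_def poly_pcompose add.commute)
  have d1: "degree p1 = n" using less.prems by (simp add: p1_def degree_pcompose)
  have l1: "lead_coeff p1 = 1" using less.prems unfolding p1_def by (subst lead_coeff_comp) auto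
  have "of_nat n * e = - coeff p n'" using n0 by (simp add: e_def)
  then have c1: "coeff p1 n' = 0" using coeff_pcompose_shift[of p n' e] less.prems n' by (simp add: p1_def del: of_nat_Suc)
  have sc: "poly p1 (a - e) * poly p1 (b - e) < 0" "a - e < b - e" using less.prems by (simp_all add: p1)
  have "\<exists>c. a - e < c \<and> c < b - e \<and> poly p1 c = 0"
  proof (cases "\<exists>i<n. coeff p1 i \<noteq> 0")
    case False
    then have "p1 = monom 1 n" using d1 l1 by (intro poly_eqI) (metis coeff_eq_0 coeff_monom linorder_neqE_nat)
    then have pm: "poly p1 y = y ^ n" for y by (simp add: poly_monom)
    have "a - e < 0" 
    proof (rule ccontr)
      assume "\<not> a - e < 0"
      then have "poly p1 (a - e) \<ge> 0" "poly p1 (b - e) \<ge> 0" using sc(2) pm by auto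
      then show False using sc(1) by (meson mult_nonneg_nonneg not_less)
    qed
    moreover have "b - e > 0"
    proof (rule ccontr)
      assume "\<not> b - e > 0"
      then have "(- (a - e)) ^ n \<ge> 0" "(- (b - e)) ^ n \<ge> 0" using sc(2) by (intro zero_le_power; simp)+
      then have "((- (a - e)) * (- (b - e))) ^ n \<ge> 0" unfolding power_mult_distrib by (rule mult_nonneg_nonneg)
      moreover have "(- (a - e)) * (- (b - e)) = (a - e) * (b - e)" by (simp add: algebra_simps)
      ultimately have "(a - e) ^ n * (b - e) ^ n \<ge> 0" by (metis power_mult_distrib)
      then show False using sc(1) pm by simp
    qed
    ultimately show ?thesis using pm n0 by (intro exI[of _ 0]) auto
  next
    case True
    obtain r q where r: "r > 0" and q: "\<And>y. poly q y = poly p1 (r * y) / r ^ n" "degree q = n" "lead_coeff q = 1"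
      "\<And>i. fin (coeff q i)" "\<exists>i<n. st (coeff q i) \<noteq> 0" "\<And>i. coeff p1 i = 0 \<Longrightarrow> coeff q i = 0"
      using puis_scaled[OF d1 l1 True] by blast
    define a' b' where "a' = (a - e) / r" and "b' = (b - e) / r"
    have ab': "a' < b'" "r * a' = a - e" "r * b' = b - e" using sc r by (auto simp: a'_def b'_def divide_strict_right_mono)
    have "poly q a' * poly q b' = poly p1 (a - e) * poly p1 (b - e) / (r ^ n * r ^ n)" by (simp add: q(1) ab')
    then have sq: "poly q a' * poly q b' < 0" using sc(1) r by (simp add: divide_neg_pos)
    have "\<exists>c. a' < c \<and> c < b' \<and> poly q c = 0"
    proof -
      define qb where "qb = map_poly st q"
      have cqb: "coeff qb i = st (coeff q i)" for i by (simp add: qb_def coeff_map_poly)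
      have dqb: "degree qb = n"
        by (rule antisym, rule degree_le) (use q(2,3) in \<open>auto intro!: le_degree simp: cqb coeff_eq_0\<close>)
      have lqb: "lead_coeff qb = 1" using q(2,3) dqb by (simp add: cqb)
      show ?thesis
      proof (cases "\<exists>c. poly qb c = 0")
        \<comment> \<open>No residue root: the degree is even, finite arguments have positive
          residue value, and infinite ones are handled by the reversed polynomial at 1/y, whose
          residue value is the leading coefficient 1.\<close>
        case False
        have pos: "poly qb y > 0" for y
          using poly_ssgn_no_root_above[of y qb] False lqb by (simp add: ssgn_def split: if_splits)
        have "ssgn (poly qb 0) = ssgn (lead_coeff qb) * (-1) ^ degree qb"
          using False by (intro poly_ssgn_no_root_below) auto
        then have ev: "even n" using pos[of 0] lqb dqb by (cases "even n") (auto simp: ssgn_def)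
        have "poly q y > 0" for y
        proof (cases "fin y")
          case True
          then show ?thesis using poly_fin_st[of q y] q(4) pos qb_def st_pos_imp by metis
        next
          case False
          define z where "z = 1 / y"
          have y0: "y \<noteq> 0" using False by auto
          have z: "fin z" "st z = 0" using infinite_inverse[OF False] by (auto simp: z_def)
          have fr: "fin (coeff (reflect_poly q) i)" for i using q(4) by (simp add: coeff_reflect_poly)
          have "st (poly (reflect_poly q) z) = poly (map_poly st (reflect_poly q)) 0"
            using poly_fin_st(2)[OF fr z(1)] z(2) by simp
          also have "\<dots> = 1" using q(3) by (simp add: poly_0_coeff_0 coeff_map_poly)
          finally have "poly (reflect_poly q) z > 0" using st_pos_imp poly_fin_st(1)[OF fr z(1)] by simp
          moreover have "poly (reflect_poly q) z = z ^ n * poly q y"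
            using poly_reflect_poly_nz[of z q] y0 q(2) by (simp add: z_def)
          moreover have "z ^ n > 0" using ev y0 by (simp add: z_def zero_less_power_eq)
          ultimately show ?thesis by (metis zero_less_mult_pos)
        qed
        then show ?thesis using sq by (meson less_asym mult_pos_pos)
      next
        case True
        then obtain c where c: "poly qb c = 0" by blast
        have qb0: "qb \<noteq> 0" using lqb by auto
        define k where "k = order c qb"
        have k0: "k > 0" using c qb0 by (simp add: k_def order_root)
        obtain h where h: "qb = [:-c,1:] ^ k * h" "\<not> [:-c,1:] dvd h" using order_decomp[OF qb0, of c] k_def by blast
        have h0: "h \<noteq> 0" using h qb0 by auto
        have dg: "degree ([:-c,1:] ^ k) = k" by (simp add: degree_power_eq)
        have lg: "lead_coeff ([:-c,1:] ^ k) = 1" by (simp add: lead_coeff_power)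
        have lh: "lead_coeff h = 1" using lqb unfolding h(1) lead_coeff_mult lg by simp
        have dh: "n = k + degree h" using dqb unfolding h(1) using h0 by (subst (asm) degree_mult_eq) (auto simp: dg)
        \<comment> \<open>Otherwise the residue polynomial is (X - c)^n; its second coefficient - n
          c vanishes, which forces c = 0, against the nonzero lower residue obtained from the
          scaling.\<close>
        have "degree h > 0"
        proof (rule ccontr)
          assume "\<not> degree h > 0"
          then have "h = [:1:]" using lh by (metis degree_eq_zeroE lead_coeff_pCons(2) neq0_conv)
          then have qbe: "qb = [:-c,1:] ^ n" using h(1) dh by simp
          have "coeff qb n' = of_nat n * (- c)" unfolding qbe n' using coeff_linear_poly_power[of n' "Suc n'" "-c" 1] by simp
          moreover have "coeff qb n' = 0" using q(6)[OF c1] by (simp add: cqb)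
          ultimately have "c = 0" using n0 by simp
          then have "qb = monom 1 n" using qbe by (simp add: monom_altdef)
          then show False using q(5) by (auto simp flip: cqb)
        qed
        moreover have "coprime ([:-c,1:] ^ k) h"
          using h(2) by (simp add: prime_elem_imp_coprime prime_elem_linear_field_poly)
        ultimately obtain G H where GH: "q = G * H" "lead_coeff G = 1" "lead_coeff H = 1" "degree G = k" "degree H = degree h"
          using hensel_puis[of q "[:-c,1:] ^ k" h] q(3,4) h(1) lg lh k0 dg qb_def by metis
        have "(poly G a' * poly G b') * (poly H a' * poly H b') < 0" using sq GH(1) by (simp add: mult_ac)
        then have "poly G a' * poly G b' < 0 \<or> poly H a' * poly H b' < 0" by (auto simp: mult_less_0_iff)
        then show ?thesis
        proof
          assume "poly G a' * poly G b' < 0"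
          then show ?thesis using less.IH[of k G a' b'] GH ab' dh \<open>degree h > 0\<close> by auto
        next
          assume "poly H a' * poly H b' < 0"
          then show ?thesis using less.IH[of "degree h" H a' b'] GH ab' dh k0 by auto
        qed
      qed
    qed
    then obtain c where c: "a' < c" "c < b'" "poly q c = 0" by blast
    then have "poly p1 (r * c) = 0" using q(1)[of c] r by simp
    moreover have "a - e < r * c" "r * c < b - e" using c ab' r by (metis mult_strict_left_mono)+
    ultimately show ?thesis by blast
  qed
  then obtain c where "a - e < c" "c < b - e" "poly p1 c = 0" by blast
  then show ?case using p1[of c] by (intro exI[of _ "c + e"]) (auto simp: algebra_simps)
qed

instance puis :: real_closed
proof (standard, rule real_closedI)
  fix p :: "puis poly" and a b :: puis assume ab: "a < b" "poly p a < 0" "0 < poly p b"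
  define l where "l = lead_coeff p"
  have "p \<noteq> 0" using ab by auto
  then have l: "l \<noteq> 0" by (simp add: l_def)
  define q where "q = smult (1 / l) p"
  have "lead_coeff q = 1" using l by (simp add: q_def l_def)
  moreover have "poly q a * poly q b = poly p a * poly p b / (l * l)" by (simp add: q_def)
  moreover have "l * l > 0" using l by (auto simp: zero_less_mult_iff neq_iff)
  ultimately have "lead_coeff q = 1" "poly q a * poly q b < 0" using ab by (simp_all add: divide_neg_pos mult_neg_pos)
  then obtain c where "a < c" "c < b" "poly q c = 0" using puis_monic_ivt[OF refl _ ab(1)] by blast
  then show "\<exists>c. a < c \<and> c < b \<and> poly p c = 0" using l by (auto simp: q_def)
qed

section \<open>Polynomial functions\<close>

no_notation fps_nth (infixl "$" 75)

text \<open>Restricted to the variables in \<open>J\<close>, so that the basis theorem can be proved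
  by adding one variable at a time.\<close>

inductive_set pfun_in :: "'n set \<Rightarrow> (real^'n::finite \<Rightarrow> real) set" for J where
  pfi_const: "(\<lambda>x. c) \<in> pfun_in J"
| pfi_coord: "i \<in> J \<Longrightarrow> (\<lambda>x. x $ i) \<in> pfun_in J"
| pfi_add: "f \<in> pfun_in J \<Longrightarrow> g \<in> pfun_in J \<Longrightarrow> (\<lambda>x. f x + g x) \<in> pfun_in J"
| pfi_mult: "f \<in> pfun_in J \<Longrightarrow> g \<in> pfun_in J \<Longrightarrow> (\<lambda>x. f x * g x) \<in> pfun_in J"

inductive_set idl :: "'n set \<Rightarrow> (real^'n::finite \<Rightarrow> real) set \<Rightarrow> (real^'n \<Rightarrow> real) set" for J S where
  idl_zero: "(\<lambda>x. 0) \<in> idl J S"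
| idl_base: "f \<in> S \<Longrightarrow> f \<in> idl J S"
| idl_add: "f \<in> idl J S \<Longrightarrow> g \<in> idl J S \<Longrightarrow> (\<lambda>x. f x + g x) \<in> idl J S"
| idl_mult: "c \<in> pfun_in J \<Longrightarrow> f \<in> idl J S \<Longrightarrow> (\<lambda>x. c x * f x) \<in> idl J S"

lemma idl_subset: "f \<in> idl J S \<Longrightarrow> S \<subseteq> idl J T \<Longrightarrow> f \<in> idl J T"
  by (induction rule: idl.induct) (auto intro: idl.intros)

lemma idl_mono: "f \<in> idl J S \<Longrightarrow> S \<subseteq> T \<Longrightarrow> f \<in> idl J T"
  by (erule idl_subset) (auto intro: idl.intros)

lemma idl_in_pfun: "f \<in> idl J S \<Longrightarrow> S \<subseteq> pfun_in J \<Longrightarrow> f \<in> pfun_in J"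
  by (induction rule: idl.induct) (auto intro: pfun_in.intros)

lemma pfun_in_mono: "f \<in> pfun_in J \<Longrightarrow> J \<subseteq> J' \<Longrightarrow> f \<in> pfun_in J'"
  by (induction rule: pfun_in.induct) (auto intro: pfun_in.intros)

lemma pfun_in_UNIV: "pfun_in UNIV = polyfun"
proof safe
  show "f \<in> polyfun" if "f \<in> pfun_in UNIV" for f :: "real^'n \<Rightarrow> real"
    using that by induction (auto intro: polyfun.intros)
  show "f \<in> pfun_in UNIV" if "f \<in> polyfun" for f :: "real^'n \<Rightarrow> real"
    using that by induction (auto intro: pfun_in.intros)
qed

text \<open>\<open>d\<close> only bounds the degree in \<open>x $ j\<close>, and no uniqueness of
  the coefficients is claimed: the objects are functions and not formal polynomials.\<close>

definition var_rep :: "'n set \<Rightarrow> 'n \<Rightarrow> nat \<Rightarrow> (nat \<Rightarrow> real^'n::finite \<Rightarrow> real) \<Rightarrow> (real^'n \<Rightarrow> real) \<Rightarrow> bool" where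
  "var_rep J j d c g \<longleftrightarrow> (\<forall>k. c k \<in> pfun_in J) \<and> (\<forall>k>d. c k = (\<lambda>x. 0)) \<and> g = (\<lambda>x. \<Sum>k\<le>d. c k x * (x $ j) ^ k)"

lemma var_rep_weaken:
  assumes "var_rep J j d c g" "d \<le> d'"
  shows "var_rep J j d' c g"
proof -
  have "(\<Sum>k\<le>d'. c k x * (x $ j) ^ k) = (\<Sum>k\<le>d. c k x * (x $ j) ^ k)" for x
    using assms by (intro sum.mono_neutral_right) (auto simp: var_rep_def)
  then show ?thesis using assms by (auto simp: var_rep_def)
qed

lemma var_rep_add:
  assumes "var_rep J j d c g" "var_rep J j d c' g'"
  shows "var_rep J j d (\<lambda>k x. c k x + c' k x) (\<lambda>x. g x + g' x)"
  using assms by (auto simp: var_rep_def sum.distrib algebra_simps intro: pfun_in.intros)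

lemma var_rep_cmult:
  assumes "var_rep J j d c g" "u \<in> pfun_in J"
  shows "var_rep J j d (\<lambda>k x. u x * c k x) (\<lambda>x. u x * g x)"
  using assms by (auto simp: var_rep_def sum_distrib_left algebra_simps intro: pfun_in.intros)

lemma var_rep_shift:
  assumes "var_rep J j d c g"
  shows "var_rep J j (e + d) (\<lambda>k x. if k < e then 0 else c (k - e) x) (\<lambda>x. (x $ j) ^ e * g x)"
proof -
  have "(\<Sum>k\<le>e + d. (if k < e then 0 else c (k - e) x) * (x $ j) ^ k) = (x $ j) ^ e * g x" for x
  proof -
    have "(\<Sum>k\<le>e + d. (if k < e then 0 else c (k - e) x) * (x $ j) ^ k) =
      (\<Sum>k\<in>{e..e + d}. c (k - e) x * (x $ j) ^ k)"
      by (rule sum.mono_neutral_cong_right) auto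
    also have "\<dots> = (\<Sum>k\<le>d. c k x * (x $ j) ^ (k + e))"
      by (rule sum.reindex_bij_witness[of _ "\<lambda>k. k + e" "\<lambda>k. k - e"]) auto
    also have "\<dots> = (x $ j) ^ e * g x" using assms by (simp add: var_rep_def sum_distrib_left power_add algebra_simps)
    finally show ?thesis .
  qed
  moreover have "(\<lambda>x. if k < e then 0 else c (k - e) x) \<in> pfun_in J" for k
    using assms by (cases "k < e") (auto simp: var_rep_def intro: pfun_in.intros)
  moreover have "(\<lambda>x. if k < e then 0 else c (k - e) x) = (\<lambda>x. 0)" if "k > e + d" for k
    using assms that by (auto simp: var_rep_def fun_eq_iff)
  ultimately show ?thesis by (auto simp: var_rep_def)
qed

lemma var_rep_ex: "g \<in> pfun_in (insert j J) \<Longrightarrow> \<exists>d c. var_rep J j d c g"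
proof (induction rule: pfun_in.induct)
  case (pfi_const c)
  have "var_rep J j 0 (\<lambda>k x. if k = 0 then c else 0) (\<lambda>x. c)" by (auto simp: var_rep_def intro: pfun_in.intros)
  then show ?case by blast
next
  case (pfi_coord i)
  show ?case
  proof (cases "i = j")
    case True
    have "var_rep J j 1 (\<lambda>k x. if k = 1 then 1 else 0) (\<lambda>x. x $ j)" by (auto simp: var_rep_def intro: pfun_in.intros)
    then show ?thesis using True by blast
  next
    case False
    then have "i \<in> J" using pfi_coord by simp
    have "(\<lambda>x. if k = 0 then x $ i else 0) \<in> pfun_in J" for k :: nat
      using \<open>i \<in> J\<close> by (cases "k = 0") (auto intro: pfun_in.intros)
    then have "var_rep J j 0 (\<lambda>k x. if k = 0 then x $ i else 0) (\<lambda>x. x $ i)"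
      by (auto simp: var_rep_def)
    then show ?thesis by blast
  qed
next
  case (pfi_add f g)
  then obtain d c d' c' where "var_rep J j d c f" "var_rep J j d' c' g" by blast
  then have "var_rep J j (max d d') c f" "var_rep J j (max d d') c' g" by (auto intro: var_rep_weaken)
  then show ?case using var_rep_add by blast
next
  case (pfi_mult f g)
  then obtain d c d' c' where f: "var_rep J j d c f" and g: "var_rep J j d' c' g" by blast
  have "\<exists>e. var_rep J j (n + d') e (\<lambda>x. (\<Sum>k\<le>n. c k x * (x $ j) ^ k) * g x)" for n
  proof (induction n)
    case 0
    have "var_rep J j d' (\<lambda>k x. c 0 x * c' k x) (\<lambda>x. c 0 x * g x)"
      by (rule var_rep_cmult[OF g]) (use f in \<open>auto simp: var_rep_def\<close>)
    then show ?case by auto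
  next
    case (Suc n)
    then obtain e where "var_rep J j (n + d') e (\<lambda>x. (\<Sum>k\<le>n. c k x * (x $ j) ^ k) * g x)" by blast
    then have 1: "var_rep J j (Suc n + d') e (\<lambda>x. (\<Sum>k\<le>n. c k x * (x $ j) ^ k) * g x)" by (rule var_rep_weaken) simp
    have cp: "c (Suc n) \<in> pfun_in J" using f by (auto simp: var_rep_def)
    note 2 = var_rep_add[OF 1 var_rep_cmult[OF var_rep_shift[OF g, of "Suc n"] cp]]
    have "(\<lambda>x. (\<Sum>k\<le>n. c k x * (x $ j) ^ k) * g x + c (Suc n) x * ((x $ j) ^ Suc n * g x)) =
      (\<lambda>x. (\<Sum>k\<le>Suc n. c k x * (x $ j) ^ k) * g x)" by (auto simp: algebra_simps)
    then show ?case using 2 by metis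
  qed
  from this[of d] show ?case using f by (auto simp: var_rep_def)
qed

definition noeth :: "'n::finite set \<Rightarrow> bool" where
  "noeth J \<longleftrightarrow> (\<forall>f. (\<forall>k::nat. f k \<in> pfun_in J) \<longrightarrow> (\<exists>N. f N \<in> idl J (f ` {..<N})))"

lemma noeth_empty: "noeth ({} :: 'n::finite set)"
  unfolding noeth_def
proof (intro allI impI)
  fix f :: "nat \<Rightarrow> real^'n \<Rightarrow> real" assume f: "\<forall>k. f k \<in> pfun_in {}"
  have const: "\<exists>c. g = (\<lambda>x. c)" if "g \<in> pfun_in {}" for g :: "real^'n \<Rightarrow> real"
    using that by induction auto
  obtain a b where ab: "f 0 = (\<lambda>x. a)" "f 1 = (\<lambda>x. b)" using const f by metis
  show "\<exists>N. f N \<in> idl {} (f ` {..<N})"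
  proof (cases "a = 0")
    case True
    then show ?thesis using ab by (intro exI[of _ 0]) (auto intro: idl.intros)
  next
    case False
    have "(\<lambda>x. (b / a) * f 0 x) \<in> idl {} (f ` {..<1})" by (intro idl_mult idl_base pfi_const) auto
    then show ?thesis using ab False by (intro exI[of _ 1]) simp
  qed
qed

text \<open>Hilbert's basis theorem. If the ideals never stabilise, choose repeatedly an element of
  least degree in \<open>x $ j\<close> outside the ideal of the elements chosen before. Once a
  leading coefficient lies in the ideal of the earlier ones, subtracting a combination gives an
  element of smaller degree that is still outside.\<close>

lemma noeth_insert:
  fixes J :: "'n::finite set"
  assumes "noeth J" shows "noeth (insert j J)"
  unfolding noeth_def
proof (intro allI impI, rule ccontr)
  fix f :: "nat \<Rightarrow> real^'n \<Rightarrow> real"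
  assume f: "\<forall>k. f k \<in> pfun_in (insert j J)" and no: "\<nexists>N. f N \<in> idl (insert j J) (f ` {..<N})"
  let ?K = "insert j J"
  define I where "I = idl ?K (range f)"
  have Ip: "I \<subseteq> pfun_in ?K" unfolding I_def using idl_in_pfun f by blast
  have fin: "\<exists>N. g \<in> idl ?K (f ` {..<N})" if "g \<in> I" for g
    using that unfolding I_def
  proof (induction rule: idl.induct)
    case (idl_base g)
    then obtain n where "g = f n" by blast
    then show ?case by (intro exI[of _ "Suc n"]) (auto intro: idl.intros)
  next
    case (idl_add g h)
    then obtain M N where "g \<in> idl ?K (f ` {..<M})" "h \<in> idl ?K (f ` {..<N})" by blast
    then have "g \<in> idl ?K (f ` {..<max M N})" "h \<in> idl ?K (f ` {..<max M N})" by (auto elim!: idl_mono)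
    then show ?case using idl.idl_add by blast
  qed (auto intro: idl.intros)
  \<comment> \<open>Finitely many elements of \<open>I\<close> lie in the ideal of some initial
    segment of \<open>f\<close>, and that ideal misses the next \<open>f N\<close>.\<close>
  have ex: "\<exists>g\<in>I. g \<notin> idl ?K (g' ` {..<n})" if g': "\<And>k. k < n \<Longrightarrow> g' k \<in> I" for g' and n :: nat
  proof -
    have "\<exists>N. \<forall>k<n. g' k \<in> idl ?K (f ` {..<N})" using g'
    proof (induction n)
      case (Suc n)
      then obtain N where "\<forall>k<n. g' k \<in> idl ?K (f ` {..<N})" by auto
      moreover obtain M where "g' n \<in> idl ?K (f ` {..<M})" using fin Suc.prems by blast
      ultimately have "\<forall>k<Suc n. g' k \<in> idl ?K (f ` {..<max M N})"
        by (auto simp: less_Suc_eq elim!: idl_mono)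
      then show ?case by blast
    qed auto
    then obtain N where N: "\<And>k. k < n \<Longrightarrow> g' k \<in> idl ?K (f ` {..<N})" by blast
    have "f N \<notin> idl ?K (g' ` {..<n})"
    proof
      assume "f N \<in> idl ?K (g' ` {..<n})"
      then have "f N \<in> idl ?K (f ` {..<N})" by (rule idl_subset) (use N in auto)
      then show False using no by blast
    qed
    moreover have "f N \<in> I" unfolding I_def by (intro idl_base) auto
    ultimately show ?thesis by blast
  qed
  define deg where "deg g = (LEAST d. \<exists>c. var_rep J j d c g)" for g
  have deg: "\<exists>c. var_rep J j (deg g) c g" if "g \<in> I" for g
    unfolding deg_def by (rule LeastI_ex) (use var_rep_ex Ip that in blast)
  have deg_le: "deg g \<le> d" if "var_rep J j d c g" for g d c
    unfolding deg_def using that by (intro Least_le) blast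
  define Q where "Q g n r \<longleftrightarrow> r \<in> I \<and> r \<notin> idl ?K (g ` {..<n}) \<and> (\<forall>h\<in>I. h \<notin> idl ?K (g ` {..<n}) \<longrightarrow> deg r \<le> deg h)"
    for g :: "nat \<Rightarrow> real^'n \<Rightarrow> real" and n r
  have "\<exists>g. \<forall>n. Q g n (g n)"
  proof (rule dependent_wf_choice[of less_than])
    fix g h :: "nat \<Rightarrow> real^'n \<Rightarrow> real" and n r assume "\<And>z. (z, n) \<in> less_than \<Longrightarrow> g z = h z"
    then have "g ` {..<n} = h ` {..<n}" by (intro image_cong) auto
    then show "Q g n r = Q h n r" by (simp add: Q_def)
  next
    fix n and g :: "nat \<Rightarrow> real^'n \<Rightarrow> real" assume "\<And>y. (y, n) \<in> less_than \<Longrightarrow> Q g y (g y)"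
    then have "\<exists>r. r \<in> I \<and> r \<notin> idl ?K (g ` {..<n})" using ex[of n g] by (auto simp: Q_def)
    then obtain r where "r \<in> I \<and> r \<notin> idl ?K (g ` {..<n})" "\<And>h. h \<in> I \<and> h \<notin> idl ?K (g ` {..<n}) \<Longrightarrow> deg r \<le> deg h"
      using ex_has_least_nat[of "\<lambda>r. r \<in> I \<and> r \<notin> idl ?K (g ` {..<n})" _ deg] by blast
    then show "\<exists>r. Q g n r" unfolding Q_def by blast
  qed simp
  then obtain g where Qg: "\<forall>n. Q g n (g n)" by (elim exE)
  then have g: "\<And>n. g n \<in> I" "\<And>n. g n \<notin> idl ?K (g ` {..<n})"
    "\<And>n h. h \<in> I \<Longrightarrow> h \<notin> idl ?K (g ` {..<n}) \<Longrightarrow> deg (g n) \<le> deg h" unfolding Q_def by simp_all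
  define d where "d n = deg (g n)" for n
  have "\<forall>n. \<exists>c. var_rep J j (d n) c (g n)" using deg g(1) d_def by simp
  then obtain c where c: "\<And>n. var_rep J j (d n) (c n) (g n)" by metis
  have dm: "d i \<le> d n" if "i \<le> n" for i n
    unfolding d_def by (rule g(3)[OF g(1)]) (use g(2)[of n] idl_mono that in \<open>metis image_mono lessThan_subset_iff\<close>)
  define a where "a n = c n (d n)" for n
  have "\<forall>n. a n \<in> pfun_in J" using c by (auto simp: a_def var_rep_def)
  then obtain N where N: "a N \<in> idl J (a ` {..<N})" using assms unfolding noeth_def by blast
  \<comment> \<open>Every element of the ideal of earlier leading coefficients is the coefficient of
    order \<open>d N\<close> in a combination of earlier chosen elements: degrees do not decrease,
    so the missing power of \<open>x $ j\<close> can be multiplied in.\<close>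
  have "\<exists>h e. h \<in> idl ?K (g ` {..<N}) \<and> var_rep J j (d N) e h \<and> e (d N) = b" if "b \<in> idl J (a ` {..<N})" for b
    using that
  proof (induction rule: idl.induct)
    case idl_zero
    show ?case by (intro exI[of _ "\<lambda>x. 0"] exI[of _ "\<lambda>k x. 0"]) (auto simp: var_rep_def intro: idl.intros pfun_in.intros)
  next
    case (idl_base b)
    then obtain i where i: "i < N" "b = a i" by auto
    define s where "s = d N - d i"
    have s: "s + d i = d N" using dm[of i N] i by (simp add: s_def)
    have pw: "(\<lambda>x. (x $ j) ^ k) \<in> pfun_in ?K" for k by (induction k) (auto intro: pfun_in.intros)
    have "(\<lambda>x. (x $ j) ^ s * g i x) \<in> idl ?K (g ` {..<N})" using i by (intro idl.idl_mult pw idl.idl_base) auto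
    moreover note var_rep_shift[OF c, of s i, unfolded s]
    moreover have "(\<lambda>x. if d N < s then 0 else c i (d N - s) x) = b" using s[symmetric] i by (auto simp: a_def)
    ultimately show ?case by blast
  next
    case (idl_add b b')
    then obtain h e h' e' where "h \<in> idl ?K (g ` {..<N})" "var_rep J j (d N) e h" "e (d N) = b"
      "h' \<in> idl ?K (g ` {..<N})" "var_rep J j (d N) e' h'" "e' (d N) = b'" by blast
    then show ?case
      by (intro exI[of _ "\<lambda>x. h x + h' x"] exI[of _ "\<lambda>k x. e k x + e' k x"]) (auto intro: idl.intros var_rep_add)
  next
    case (idl_mult u b)
    then obtain h e where he: "h \<in> idl ?K (g ` {..<N})" "var_rep J j (d N) e h" "e (d N) = b" by blast
    have "u \<in> pfun_in ?K" using idl_mult pfun_in_mono by blast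
    then show ?case using he idl_mult(1)
      by (intro exI[of _ "\<lambda>x. u x * h x"] exI[of _ "\<lambda>k x. u x * e k x"]) (auto intro: idl.intros var_rep_cmult)
  qed
  then obtain h e where h: "h \<in> idl ?K (g ` {..<N})" "var_rep J j (d N) e h" "e (d N) = a N" using N by blast
  define r where "r = (\<lambda>x. g N x + (-1) * h x)"
  have mh: "(\<lambda>x. (-1) * h x) \<in> idl ?K (g ` {..<N})" using h by (intro idl_mult pfi_const)
  have "g ` {..<N} \<subseteq> I" using g by auto
  then have "h \<in> I" using h(1) unfolding I_def by (metis idl_subset)
  then have "r \<in> I" unfolding r_def using g(1)[of N] unfolding I_def by (intro idl_add idl_mult pfi_const)
  moreover have nr: "r \<notin> idl ?K (g ` {..<N})"
  proof
    assume "r \<in> idl ?K (g ` {..<N})"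
    then have "(\<lambda>x. r x + h x) \<in> idl ?K (g ` {..<N})" using h by (intro idl_add)
    then show False using g(2)[of N] by (simp add: r_def)
  qed
  ultimately have le: "d N \<le> deg r" using g(3) d_def by simp
  have vr: "var_rep J j (d N) (\<lambda>k x. c N k x + (-1) * e k x) r"
    unfolding r_def by (rule var_rep_add[OF c var_rep_cmult[OF h(2) pfi_const]])
  have top: "c N (d N) x + (-1) * e (d N) x = 0" for x using h(3) by (simp add: a_def)
  show False
  proof (cases "d N")
    case 0
    have "r = (\<lambda>x. 0)" using vr top 0 by (auto simp: var_rep_def fun_eq_iff)
    then show False using nr idl_zero by metis
  next
    case (Suc k)
    have "var_rep J j k (\<lambda>k x. c N k x + (-1) * e k x) r"
      unfolding var_rep_def
    proof (intro conjI allI impI)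
      show "(\<lambda>x. c N i x + - 1 * e i x) \<in> pfun_in J" for i using vr by (auto simp: var_rep_def)
      show "(\<lambda>x. c N i x + - 1 * e i x) = (\<lambda>x. 0)" if "i > k" for i
        using vr top that Suc by (cases "i = d N") (auto simp: var_rep_def fun_eq_iff)
      have "r = (\<lambda>x. \<Sum>i\<le>d N. (c N i x + - 1 * e i x) * x $ j ^ i)" using vr by (simp add: var_rep_def)
      then show "r = (\<lambda>x. \<Sum>i\<le>k. (c N i x + - 1 * e i x) * x $ j ^ i)" using top unfolding Suc by (simp add: fun_eq_iff)
    qed
    then have "deg r \<le> k" by (rule deg_le)
    then show False using le Suc by simp
  qed
qed

text \<open>Serves twice: to cut out an algebraic set by finitely many equations, and to close up
  the sequence of iterated derivatives into a linear differential equation.\<close>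

theorem polyfun_acc:
  fixes f :: "nat \<Rightarrow> real^'n::finite \<Rightarrow> real"
  assumes "\<And>k. f k \<in> polyfun"
  shows "\<exists>N c. (\<forall>k. c k \<in> polyfun) \<and> (\<forall>x. f N x = (\<Sum>k<N. c k x * f k x))"
proof -
  have "noeth J" for J :: "'n set"
    using finite[of J] by (induction J rule: finite_induct) (auto intro: noeth_empty noeth_insert)
  from this[of UNIV] obtain N where N: "f N \<in> idl UNIV (f ` {..<N})"
    using assms unfolding noeth_def pfun_in_UNIV by blast
  have "\<exists>c. (\<forall>k. c k \<in> polyfun) \<and> (\<forall>x. g x = (\<Sum>k<N. c k x * f k x))" if "g \<in> idl UNIV (f ` {..<N})" for g
    using that
  proof (induction rule: idl.induct)
    case idl_zero
    show ?case by (intro exI[of _ "\<lambda>k x. 0"]) (auto intro: polyfun.intros)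
  next
    case (idl_base g)
    then obtain i where i: "i < N" "g = f i" by auto
    have "(\<lambda>x. if k = i then 1 else 0) \<in> polyfun" for k by (rule pf_const)
    moreover have "(\<Sum>k<N. (if k = i then 1 else 0) * f k x) = g x" for x
      using i by (simp add: if_distrib[of "\<lambda>u. u * _"] cong: if_cong)
    ultimately show ?case by (intro exI[of _ "\<lambda>k x. if k = i then 1 else 0"] conjI allI) (simp_all add: pf_const)
  next
    case (idl_add g h)
    then obtain c c' where "\<And>k. c k \<in> polyfun" "\<And>k. c' k \<in> polyfun"
      "\<And>x. g x = (\<Sum>k<N. c k x * f k x)" "\<And>x. h x = (\<Sum>k<N. c' k x * f k x)" by blast
    then show ?case
      by (intro exI[of _ "\<lambda>k x. c k x + c' k x"]) (auto simp: sum.distrib algebra_simps intro: polyfun.intros)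
  next
    case (idl_mult u g)
    then obtain c where c: "\<And>k. c k \<in> polyfun" "\<And>x. g x = (\<Sum>k<N. c k x * f k x)" by blast
    have "u \<in> polyfun" using idl_mult pfun_in_UNIV by blast
    then show ?case using c
      by (intro exI[of _ "\<lambda>k x. u x * c k x"]) (auto simp: sum_distrib_left algebra_simps intro: polyfun.intros)
  qed
  then show ?thesis using N by blast
qed

lemma polyfun_minus: "f \<in> polyfun \<Longrightarrow> (\<lambda>x. - f x) \<in> polyfun"
  using pf_mult[OF pf_const[of "-1"], of f] by simp

lemma polyfun_diff: "f \<in> polyfun \<Longrightarrow> g \<in> polyfun \<Longrightarrow> (\<lambda>x. f x - g x) \<in> polyfun"
  using pf_add[of f "\<lambda>x. - g x"] polyfun_minus[of g] by simp

lemma polyfun_power: "f \<in> polyfun \<Longrightarrow> (\<lambda>x. f x ^ n) \<in> polyfun"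
  by (induction n) (auto intro: polyfun.intros)

lemma polyfun_sum: "(\<And>k. k \<in> A \<Longrightarrow> c k \<in> polyfun) \<Longrightarrow> (\<lambda>x. \<Sum>k\<in>A. c k x) \<in> polyfun"
  by (induction A rule: infinite_finite_induct) (auto intro: polyfun.intros)

lemma polyfun_prod: "(\<And>k. k \<in> A \<Longrightarrow> c k \<in> polyfun) \<Longrightarrow> (\<lambda>x. \<Prod>k\<in>A. c k x) \<in> polyfun"
  by (induction A rule: infinite_finite_induct) (auto intro: polyfun.intros)

lemma polyfun_inner: "(\<lambda>x. v \<bullet> (x - a)) \<in> polyfun"
  unfolding inner_vec_def by (auto intro!: polyfun_sum pf_mult pf_const polyfun_diff pf_coord)

lemmas polyfun_intros = polyfun.intros polyfun_minus polyfun_diff polyfun_power polyfun_sum polyfun_prod polyfun_inner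

text \<open>Over the reals finitely many equations merge into one, the sum of their squares;
  finiteness comes from the chain condition.\<close>

lemma algebraic_set_hypersurface:
  fixes V :: "(real^'n::finite) set"
  assumes "algebraic_set V"
  shows "\<exists>g\<in>polyfun. (\<forall>x. g x \<ge> 0) \<and> V = {x. g x = 0}"
proof -
  obtain F where F: "F \<subseteq> polyfun" "V = zero_set F" using assms by (auto simp: algebraic_set_def)
  have "\<exists>F0\<subseteq>F. finite F0 \<and> zero_set F0 \<subseteq> zero_set F"
  proof (rule ccontr)
    assume no: "\<not> ?thesis"
    define Q where "Q f n r \<longleftrightarrow> r \<in> F \<and> (\<exists>x\<in>zero_set (f ` {..<n}). r x \<noteq> 0)" for f :: "nat \<Rightarrow> real^'n \<Rightarrow> real" and n r
    have "\<exists>f. \<forall>n. Q f n (f n)"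
    proof (rule dependent_wf_choice[of less_than])
      fix g h :: "nat \<Rightarrow> real^'n \<Rightarrow> real" and n r assume "\<And>z. (z, n) \<in> less_than \<Longrightarrow> g z = h z"
      then have "g ` {..<n} = h ` {..<n}" by (intro image_cong) auto
      then show "Q g n r = Q h n r" by (simp add: Q_def)
    next
      fix n and g :: "nat \<Rightarrow> real^'n \<Rightarrow> real" assume "\<And>y. (y, n) \<in> less_than \<Longrightarrow> Q g y (g y)"
      then have "g ` {..<n} \<subseteq> F" by (auto simp: Q_def)
      then have "\<not> zero_set (g ` {..<n}) \<subseteq> zero_set F" using no by blast
      then show "\<exists>r. Q g n r" unfolding Q_def zero_set_def by blast
    qed simp
    then obtain f where Qf: "\<forall>n. Q f n (f n)" by (elim exE)
    then have f: "\<And>n. f n \<in> F" "\<And>n. \<exists>x\<in>zero_set (f ` {..<n}). f n x \<noteq> 0" unfolding Q_def by simp_all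
    then obtain N c where "\<forall>x. f N x = (\<Sum>k<N. c k x * f k x)" using polyfun_acc[of f] F by blast
    moreover obtain x where "x \<in> zero_set (f ` {..<N})" "f N x \<noteq> 0" using f(2) by blast
    ultimately show False by (auto simp: zero_set_def)
  qed
  then obtain F0 where F0: "F0 \<subseteq> F" "finite F0" "zero_set F0 \<subseteq> zero_set F" by blast
  define g where "g x = (\<Sum>f\<in>F0. (f x)\<^sup>2)" for x
  have "(\<lambda>x. \<Sum>f\<in>F0. (f x)\<^sup>2) \<in> polyfun" using F0 F by (intro polyfun_sum polyfun_power) auto
  then have "g \<in> polyfun" by (simp add: g_def[abs_def])
  moreover have "g x \<ge> 0" for x by (auto simp: g_def intro: sum_nonneg)
  moreover have "g x = 0 \<longleftrightarrow> x \<in> V" for x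
  proof -
    have "zero_set F0 = V" using F0 F(2) by (auto simp: zero_set_def)
    moreover have "g x = 0 \<longleftrightarrow> x \<in> zero_set F0"
      unfolding g_def using F0(2) by (subst sum_nonneg_eq_0_iff) (auto simp: zero_set_def)
    ultimately show ?thesis by simp
  qed
  ultimately show ?thesis by blast
qed

section \<open>Partial derivatives and gradients\<close>

definition pdv :: "(real^'n::finite \<Rightarrow> real) \<Rightarrow> 'n \<Rightarrow> real^'n \<Rightarrow> real" where
  "pdv f i x = frechet_derivative f (at x) (axis i 1)"

definition grad :: "(real^'n::finite \<Rightarrow> real) \<Rightarrow> real^'n \<Rightarrow> real^'n" where
  "grad f x = (\<chi> i. pdv f i x)"

lemma polyfun_differentiable: "f \<in> polyfun \<Longrightarrow> f differentiable (at x)"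
  by (induction rule: polyfun.induct)
    (auto intro!: differentiable_add differentiable_mult bounded_linear_imp_differentiable bounded_linear_vec_nth)

lemma polyfun_has_derivative:
  assumes "f \<in> polyfun"
  shows "(f has_derivative (\<lambda>h. grad f x \<bullet> h)) (at x)"
proof -
  let ?D = "frechet_derivative f (at x)"
  have D: "(f has_derivative ?D) (at x)" using polyfun_differentiable[OF assms] frechet_derivative_works by blast
  then have "linear ?D" using has_derivative_linear by blast
  have "?D h = grad f x \<bullet> h" for h
  proof -
    have "?D h = ?D (\<Sum>i\<in>UNIV. (h $ i) *\<^sub>R axis i 1)" by (simp add: basis_expansion flip: scalar_mult_eq_scaleR)
    also have "\<dots> = (\<Sum>i\<in>UNIV. h $ i * ?D (axis i 1))" using \<open>linear ?D\<close> by (simp add: linear_sum linear_scale)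
    finally show ?thesis by (simp add: grad_def pdv_def inner_vec_def mult.commute)
  qed
  then show ?thesis using D by presburger
qed

lemma grad_unique: "(f has_derivative (\<lambda>h. v \<bullet> h)) (at x) \<Longrightarrow> f \<in> polyfun \<Longrightarrow> v = grad f x"
  using has_derivative_unique[OF _ polyfun_has_derivative[of f x]] by (metis vector_eq_rdot)

lemma pdv_polyfun: "f \<in> polyfun \<Longrightarrow> pdv f i \<in> polyfun"
proof (induction rule: polyfun.induct)
  case (pf_const c)
  have "pdv (\<lambda>x. c) i = (\<lambda>x. 0)" by (auto simp: pdv_def)
  then show ?case using polyfun.pf_const by simp
next
  case (pf_coord j)
  have "frechet_derivative (\<lambda>x. x $ j) (at x) = (\<lambda>x::real^'a. x $ j)" for x
    by (rule frechet_derivative_at[symmetric]) (simp add: bounded_linear_imp_has_derivative bounded_linear_vec_nth)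
  then have "pdv (\<lambda>x. x $ j) i = (\<lambda>x. axis i 1 $ j)" by (auto simp: pdv_def)
  then show ?case using polyfun.pf_const by simp
next
  case (pf_add f g)
  have "pdv (\<lambda>x. f x + g x) i = (\<lambda>x. pdv f i x + pdv g i x)"
  proof
    fix x
    have "((\<lambda>x. f x + g x) has_derivative (\<lambda>h. grad f x \<bullet> h + grad g x \<bullet> h)) (at x)"
      using pf_add by (intro has_derivative_add polyfun_has_derivative)
    then have "frechet_derivative (\<lambda>x. f x + g x) (at x) = (\<lambda>h. grad f x \<bullet> h + grad g x \<bullet> h)"
      using frechet_derivative_at by metis
    then show "pdv (\<lambda>x. f x + g x) i x = pdv f i x + pdv g i x"
      by (simp add: pdv_def[of "\<lambda>x. f x + g x"] inner_axis grad_def)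
  qed
  then show ?case using pf_add by (auto intro: polyfun_intros)
next
  case (pf_mult f g)
  have "pdv (\<lambda>x. f x * g x) i = (\<lambda>x. f x * pdv g i x + pdv f i x * g x)"
  proof
    fix x
    have "((\<lambda>x. f x * g x) has_derivative (\<lambda>h. f x * (grad g x \<bullet> h) + (grad f x \<bullet> h) * g x)) (at x)"
      using pf_mult by (intro has_derivative_mult polyfun_has_derivative)
    then have "frechet_derivative (\<lambda>x. f x * g x) (at x) = (\<lambda>h. f x * (grad g x \<bullet> h) + (grad f x \<bullet> h) * g x)"
      using frechet_derivative_at by metis
    then show "pdv (\<lambda>x. f x * g x) i x = f x * pdv g i x + pdv f i x * g x"
      by (simp add: pdv_def[of "\<lambda>x. f x * g x"] inner_axis grad_def)
  qed
  then show ?case using pf_mult by (auto intro: polyfun_intros)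
qed

lemma polyfun_continuous_on: "f \<in> polyfun \<Longrightarrow> continuous_on S f"
  using polyfun_differentiable differentiable_imp_continuous_within
  by (metis continuous_at_imp_continuous_on)

section \<open>Adapted charts of a non-singular variety\<close>

text \<open>The conormal space of V at x; being a linear subspace already, it equals the span in
  \<open>nonsingular_at\<close>.\<close>

definition gspace :: "(real^'n::finite) set \<Rightarrow> real^'n \<Rightarrow> (real^'n) set" where
  "gspace V x = (\<lambda>f. grad f x) ` vanishing V"

lemma gspace_alt: "{v. \<exists>f\<in>vanishing V. (f has_derivative (\<lambda>h. v \<bullet> h)) (at x)} = gspace V x"
  by (auto simp: gspace_def vanishing_def dest: grad_unique intro: polyfun_has_derivative)

lemma vanishing_ops:
  "(\<lambda>x. 0) \<in> vanishing V" "f \<in> vanishing V \<Longrightarrow> g \<in> vanishing V \<Longrightarrow> (\<lambda>x. f x + g x) \<in> vanishing V"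
  "f \<in> vanishing V \<Longrightarrow> (\<lambda>x. c * f x) \<in> vanishing V"
  by (auto simp: vanishing_def intro: polyfun_intros)

lemma grad_ops:
  assumes "f \<in> polyfun" "g \<in> polyfun"
  shows "grad (\<lambda>x. f x + g x) x = grad f x + grad g x" "grad (\<lambda>x. c * f x) x = c *\<^sub>R grad f x"
    "grad (\<lambda>x. 0) x = 0"
proof -
  have "((\<lambda>x. f x + g x) has_derivative (\<lambda>h. (grad f x + grad g x) \<bullet> h)) (at x)"
    using has_derivative_add[OF polyfun_has_derivative[OF assms(1), of x] polyfun_has_derivative[OF assms(2), of x]]
    by (simp add: inner_add_left)
  from grad_unique[OF this pf_add[OF assms]] show "grad (\<lambda>x. f x + g x) x = grad f x + grad g x" by simp
  have "((\<lambda>x. c * f x) has_derivative (\<lambda>h. (c *\<^sub>R grad f x) \<bullet> h)) (at x)"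
    using has_derivative_mult_right[OF polyfun_has_derivative[OF assms(1), of x], of c] by simp
  from grad_unique[OF this pf_mult[OF pf_const assms(1)]] show "grad (\<lambda>x. c * f x) x = c *\<^sub>R grad f x" by simp
  have "((\<lambda>x. 0) has_derivative (\<lambda>h. 0 \<bullet> h)) (at x)" by simp
  from grad_unique[OF this pf_const] show "grad (\<lambda>x. 0) x = 0" by simp
qed

lemma subspace_gspace: "subspace (gspace V x)"
proof (rule subspaceI)
  show "0 \<in> gspace V x"
    unfolding gspace_def by (rule image_eqI[of _ _ "\<lambda>x. 0"]) (simp_all add: grad_ops(3)[OF pf_const pf_const] vanishing_ops(1))
  fix u v c assume "u \<in> gspace V x"
  then obtain f where f: "f \<in> vanishing V" "u = grad f x" by (auto simp: gspace_def)
  then have fp: "f \<in> polyfun" by (auto simp: vanishing_def)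
  show "c *\<^sub>R u \<in> gspace V x" 
    unfolding gspace_def by (rule image_eqI[of _ _ "\<lambda>x. c * f x"]) (simp_all add: grad_ops(2)[OF fp fp] vanishing_ops(3) f)
  assume "v \<in> gspace V x"
  then obtain g where g: "g \<in> vanishing V" "v = grad g x" by (auto simp: gspace_def)
  then have gp: "g \<in> polyfun" by (auto simp: vanishing_def)
  show "u + v \<in> gspace V x" 
    unfolding gspace_def by (rule image_eqI[of _ _ "\<lambda>x. f x + g x"]) (simp_all add: grad_ops(1)[OF fp gp] vanishing_ops(2) f g)
qed

text \<open>Polynomial coordinates \<Psi> near x0 with local inverse X, carrying V into the linear
  space T. D e is the derivative in the chart direction e times the square of \<Delta>, which in the
  construction is the Jacobian determinant; this factor makes it act on polynomials. The differences
  in \<open>dimT\<close> are truncated: they reduce to \<open>alg_dim V\<close> only once chains are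
  known to have length at most n.\<close>

locale chart =
  fixes V :: "(real^'n::finite) set" and x0 :: "real^'n" and T :: "(real^'n) set" and r :: real
    and X \<Psi> :: "real^'n \<Rightarrow> real^'n" and U :: "(real^'n) set" and \<Delta> :: "real^'n \<Rightarrow> real"
    and D :: "real^'n \<Rightarrow> (real^'n \<Rightarrow> real) \<Rightarrow> real^'n \<Rightarrow> real"
  assumes algV: "algebraic_set V" and x0V: "x0 \<in> V"
    and subT: "subspace T" and dimT: "dim T = CARD('n) - (CARD('n) - alg_dim V)"
    and r: "r > 0" and contX: "continuous_on (ball 0 r) X" and X0: "X 0 = x0"
    and PsiX: "\<And>y. y \<in> ball 0 r \<Longrightarrow> \<Psi> (X y) = y"
    and openU: "open U" and x0U: "x0 \<in> U" and XPsi: "\<And>x. x \<in> U \<Longrightarrow> \<Psi> x \<in> ball 0 r \<and> X (\<Psi> x) = x"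
    and Psi_poly: "\<And>v. (\<lambda>x. v \<bullet> \<Psi> x) \<in> polyfun"
    and D_poly: "\<And>e f. f \<in> polyfun \<Longrightarrow> D e f \<in> polyfun"
    and Delta_poly: "\<Delta> \<in> polyfun" and Delta_nz: "\<And>y. y \<in> ball 0 r \<Longrightarrow> \<Delta> (X y) \<noteq> 0"
    and D_deriv: "\<And>f y e s. f \<in> polyfun \<Longrightarrow> y + s *\<^sub>R e \<in> ball 0 r \<Longrightarrow>
        ((\<lambda>s. f (X (y + s *\<^sub>R e))) has_real_derivative D e f (X (y + s *\<^sub>R e)) / (\<Delta> (X (y + s *\<^sub>R e)))\<^sup>2) (at s)"
    and D_stable: "\<And>e f. e \<in> T \<Longrightarrow> f \<in> vanishing V \<Longrightarrow> D e f \<in> vanishing V"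
    and VT: "\<And>x. x \<in> V \<Longrightarrow> \<Psi> x \<in> T"

text \<open>The coordinates along an orthonormal basis B of the conormal space at x0 are replaced by
  equations of V having these gradients. The derivative at x0 stays the identity, so the inverse
  function theorem applies, and on V the new coordinates vanish.\<close>

lemma chart_exists:
  fixes V :: "(real^'n::finite) set"
  assumes algV: "algebraic_set V" and ns: "nonsingular V" and x0V: "x0 \<in> V"
  shows "\<exists>T r X \<Psi> U \<Delta> D. chart V x0 T r X \<Psi> U \<Delta> D"
proof -
  define c where "c = CARD('n) - alg_dim V"
  have dimG: "dim (gspace V x) = c" if "x \<in> V" for x
    using ns that unfolding nonsingular_def nonsingular_at_def gspace_alt c_def
    by (metis span_eq_iff subspace_gspace)
  obtain B where B: "B \<subseteq> gspace V x0" "pairwise orthogonal B" "\<And>x. x \<in> B \<Longrightarrow> norm x = 1"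
    "independent B" "card B = dim (gspace V x0)" "span B = gspace V x0"
    using orthonormal_basis_subspace[OF subspace_gspace] by blast
  have finB: "finite B" using B(4) independent_imp_finite by blast
  have ortho: "v \<bullet> w = (if v = w then 1 else 0)" if "v \<in> B" "w \<in> B" for v w
    using B(2,3) that by (auto simp: pairwise_def orthogonal_def norm_eq_1)
  have "\<forall>v\<in>B. \<exists>f\<in>vanishing V. v = grad f x0" using B(1) unfolding gspace_def by blast
  then obtain \<phi> where \<phi>: "\<And>v. v \<in> B \<Longrightarrow> \<phi> v \<in> vanishing V" "\<And>v. v \<in> B \<Longrightarrow> grad (\<phi> v) x0 = v" by metis
  have \<phi>p: "\<phi> v \<in> polyfun" if "v \<in> B" for v using \<phi>(1)[OF that] by (simp add: vanishing_def)
  define \<Psi> where "\<Psi> x = (x - x0) + (\<Sum>v\<in>B. (\<phi> v x - v \<bullet> (x - x0)) *\<^sub>R v)" for x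
  define A where "A x h = h + (\<Sum>v\<in>B. (grad (\<phi> v) x \<bullet> h - v \<bullet> h) *\<^sub>R v)" for x h
  have der: "(\<Psi> has_derivative A x) (at x)" for x
  proof -
    have "(\<Psi> has_derivative (\<lambda>h. (h - 0) + (\<Sum>v\<in>B. (grad (\<phi> v) x \<bullet> h - v \<bullet> (h - 0)) *\<^sub>R v))) (at x)"
      unfolding \<Psi>_def[abs_def]
      by (intro has_derivative_add has_derivative_sum has_derivative_scaleR_left has_derivative_diff
          has_derivative_inner_right has_derivative_ident has_derivative_const polyfun_has_derivative \<phi>p)
    then show ?thesis by (simp add: A_def[abs_def])
  qed
  have linA: "linear (A x)" for x using der has_derivative_linear by blast
  have blA: "bounded_linear (A x)" for x using der has_derivative_bounded_linear by blast
  have vA: "v \<bullet> A x h = grad (\<phi> v) x \<bullet> h" if "v \<in> B" for v x h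
  proof -
    have "v \<bullet> (\<Sum>w\<in>B. (grad (\<phi> w) x \<bullet> h - w \<bullet> h) *\<^sub>R w) = (\<Sum>w\<in>B. (grad (\<phi> w) x \<bullet> h - w \<bullet> h) * (v \<bullet> w))"
      by (simp add: inner_sum_right)
    also have "\<dots> = (\<Sum>w\<in>B. if w = v then grad (\<phi> v) x \<bullet> h - v \<bullet> h else 0)"
      by (rule sum.cong) (auto simp: ortho that)
    also have "\<dots> = grad (\<phi> v) x \<bullet> h - v \<bullet> h" using finB that by simp
    finally show ?thesis by (simp add: A_def inner_add_right)
  qed
  have vPsi: "v \<bullet> \<Psi> x = \<phi> v x" if "v \<in> B" for v x
  proof -
    have "v \<bullet> (\<Sum>w\<in>B. (\<phi> w x - w \<bullet> (x - x0)) *\<^sub>R w) = (\<Sum>w\<in>B. (\<phi> w x - w \<bullet> (x - x0)) * (v \<bullet> w))"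
      by (simp add: inner_sum_right)
    also have "\<dots> = (\<Sum>w\<in>B. if w = v then \<phi> v x - v \<bullet> (x - x0) else 0)"
      by (rule sum.cong) (auto simp: ortho that)
    also have "\<dots> = \<phi> v x - v \<bullet> (x - x0)" using finB that by simp
    finally show ?thesis by (simp add: \<Psi>_def inner_add_right)
  qed
  have A0: "A x0 = id" using \<phi>(2) by (auto simp: A_def fun_eq_iff)
  have P0: "\<Psi> x0 = 0" using \<phi>(1) x0V by (auto simp: \<Psi>_def vanishing_def)
  define M where "M x = matrix (A x)" for x
  have MA: "M x *v h = A x h" for x h unfolding M_def using linA by (simp add: matrix_works)
  define \<Delta> where "\<Delta> x = det (M x)" for x
  \<comment> \<open>Cramer's numerators: if the derivative of \<Psi> at x sends w to e, then
    \<Delta> w = N. The additional factor \<Delta> in \<open>D\<close> makes D e f vanish wherever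
    \<Delta> does, so that the ideal of V is preserved on all of V and not only near x0.\<close>
  define N where "N e x = (\<chi> k. det (\<chi> i j. if j = k then e $ i else M x $ i $ j))" for e x
  define D where "D e f x = \<Delta> x * (grad f x \<bullet> N e x)" for e f x
  have Mp: "(\<lambda>x. M x $ i $ j) \<in> polyfun" for i j
  proof -
    have "M x $ i $ j = axis j 1 $ i + (\<Sum>v\<in>B. (pdv (\<phi> v) j x - v $ j) * v $ i)" for x
      by (simp add: M_def matrix_def A_def inner_axis grad_def)
    then show ?thesis using \<phi>p by (auto intro!: polyfun_intros pdv_polyfun)
  qed
  have detp: "(\<lambda>x. det (Q x)) \<in> polyfun" if "\<And>i j. (\<lambda>x. Q x $ i $ j) \<in> polyfun" for Q :: "real^'n \<Rightarrow> real^'n^'n"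
    unfolding det_def by (intro polyfun_sum pf_mult pf_const polyfun_prod that)
  have Deltap: "\<Delta> \<in> polyfun" using detp[of M] Mp by (simp add: \<Delta>_def[abs_def])
  have Np: "(\<lambda>x. N e x $ k) \<in> polyfun" for e k
  proof -
    have "(\<lambda>x. (if j = k then e $ i else M x $ i $ j)) \<in> polyfun" for i j
      using Mp by (cases "j = k") (auto intro: pf_const)
    then have "(\<lambda>x. det (\<chi> i j. if j = k then e $ i else M x $ i $ j)) \<in> polyfun" by (intro detp) simp
    then show ?thesis by (simp add: N_def)
  qed
  have Dp: "D e f \<in> polyfun" if "f \<in> polyfun" for e f
  proof -
    have "(\<lambda>x. \<Delta> x * (\<Sum>i\<in>UNIV. pdv f i x * N e x $ i)) \<in> polyfun"
      by (intro pf_mult polyfun_sum Deltap Np pdv_polyfun that)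
    then show ?thesis by (simp add: D_def[abs_def] inner_vec_def grad_def)
  qed
  have Dw: "D e f x = (\<Delta> x)\<^sup>2 * (grad f x \<bullet> w)" if "\<Delta> x \<noteq> 0" "A x w = e" for e f x w
  proof -
    have "M x *v w = e" using MA that by simp
    then have "w = (\<chi> k. det (\<chi> i j. if j = k then e $ i else M x $ i $ j) / det (M x))"
      using cramer[of "M x" w e] that(1) by (simp add: \<Delta>_def)
    then have "\<Delta> x *\<^sub>R w = N e x" using that(1) by (simp add: vec_eq_iff N_def \<Delta>_def)
    then have "grad f x \<bullet> N e x = \<Delta> x * (grad f x \<bullet> w)" by (metis inner_scaleR_right)
    then show ?thesis by (simp add: D_def power2_eq_square)
  qed
  have inj: "inj (A x)" if "\<Delta> x \<noteq> 0" for x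
    using that det_nz_iff_inj[OF linA] by (simp add: \<Delta>_def M_def)
  define T where "T = {y. \<forall>v\<in>B. v \<bullet> y = 0}"
  have subT: "subspace T" unfolding T_def by (rule subspaceI) (auto simp: inner_add_right)
  have orthdim: "dim {y. \<forall>x\<in>G. x \<bullet> y = 0} = CARD('n) - c" if "dim G = c" "subspace G" for G :: "(real^'n) set"
    using dim_subspace_orthogonal_to_vectors[of G UNIV] that by (simp add: orthogonal_def)
  have Tspan: "T = {y. \<forall>x\<in>gspace V x0. x \<bullet> y = 0}"
  proof -
    have "x \<bullet> y = 0" if y: "y \<in> T" and "x \<in> span B" for x y
      using that(2) by (induction rule: span_induct_alt) (use y in \<open>auto simp: T_def inner_add_left\<close>)
    then show ?thesis using B(1,6) by (auto simp: T_def)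
  qed
  have dimT: "dim T = CARD('n) - c" unfolding Tspan by (rule orthdim[OF dimG[OF x0V] subspace_gspace])
  have stable: "D e f \<in> vanishing V" if e: "e \<in> T" and f: "f \<in> vanishing V" for e f
  proof -
    have fp: "f \<in> polyfun" using f by (simp add: vanishing_def)
    have "D e f x = 0" if x: "x \<in> V" for x
    proof (cases "\<Delta> x = 0")
      case False
      have "surj (A x)" using inj[OF False] linA linear_injective_imp_surjective by blast
      then obtain w where w: "A x w = e" by (metis surjD)
      define T' where "T' = {h. \<forall>v\<in>B. grad (\<phi> v) x \<bullet> h = 0}"
      have subT': "subspace T'" unfolding T'_def by (rule subspaceI) (auto simp: inner_add_right)
      have "A x ` T' \<subseteq> T" using vA by (auto simp: T_def T'_def)
      moreover have "dim (A x ` T') = dim T'"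
        by (rule dim_image_eq[OF linA]) (use inj[OF False] in \<open>auto simp: inj_on_def inj_def\<close>)
      ultimately have le: "dim T' \<le> CARD('n) - c" using dim_subset[of "A x ` T'" T] dimT by simp
      \<comment> \<open>The tangent space of V at x. It lies in the kernel \<open>T'\<close> of the
        gradients of the chosen equations, whose dimension is no larger by nonsingularity at x0 and
        x; so the two coincide and w is a tangent vector.\<close>
      define W where "W = {h. \<forall>u\<in>gspace V x. u \<bullet> h = 0}"
      have subW: "subspace W" unfolding W_def by (rule subspaceI) (auto simp: inner_add_right)
      have "W \<subseteq> T'" using \<phi>(1) by (auto simp: W_def T'_def gspace_def)
      moreover have "dim W = CARD('n) - c" unfolding W_def by (rule orthdim[OF dimG[OF x] subspace_gspace])
      ultimately have "W = T'" using subspace_dim_equal[OF subW subT'] le by simp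
      moreover have "w \<in> T'" using w e vA by (auto simp: T'_def T_def)
      ultimately have "grad f x \<bullet> w = 0" using f by (auto simp: W_def gspace_def)
      then show ?thesis using Dw[OF False w] by simp
    qed (simp add: D_def)
    then show ?thesis using Dp fp by (simp add: vanishing_def)
  qed
  define F' where "F' x = Blinfun (A x)" for x
  have F'A: "blinfun_apply (F' x) = A x" for x unfolding F'_def by (rule bounded_linear_Blinfun_apply[OF blA])
  have contF: "continuous_on UNIV F'"
  proof (rule continuous_on_blinfun_componentwise)
    fix i :: "real^'n"
    have "continuous_on UNIV (\<lambda>x. grad (\<phi> v) x)" if "v \<in> B" for v
      unfolding grad_def by (intro continuous_on_vec_lambda polyfun_continuous_on pdv_polyfun \<phi>p that)
    then show "continuous_on UNIV (\<lambda>x. blinfun_apply (F' x) i)"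
      unfolding F'A A_def by (intro continuous_intros) auto
  qed
  have inv0: "id_blinfun o\<^sub>L F' x0 = id_blinfun"
    by (rule blinfun_eqI) (simp add: F'A A0)
  obtain U0 W g g' where ift: "open U0" "U0 \<subseteq> UNIV" "x0 \<in> U0" "open W" "\<Psi> x0 \<in> W" "homeomorphism U0 W \<Psi> g"
    "\<And>y. y \<in> W \<Longrightarrow> (g has_derivative (g' y)) (at y)"
    "\<And>y. y \<in> W \<Longrightarrow> g' y = inv (blinfun_apply (F' (g y)))"
    "\<And>y. y \<in> W \<Longrightarrow> bij (blinfun_apply (F' (g y)))"
    using inverse_function_theorem[of UNIV \<Psi> F' x0 id_blinfun] der F'A contF inv0 by (metis UNIV_I open_UNIV)
  obtain r where r: "r > 0" "ball 0 r \<subseteq> W" using ift(4,5) P0 open_contains_ball by metis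
  define U where "U = U0 \<inter> \<Psi> -` ball 0 r"
  have contPsi: "continuous_on UNIV \<Psi>"
    using der by (metis continuous_at_imp_continuous_on has_derivative_continuous)
  have gP: "g (\<Psi> x) = x" if "x \<in> U0" for x using ift(6) that by (simp add: homeomorphism_def)
  have Pg: "\<Psi> (g y) = y" if "y \<in> W" for y using ift(6) that by (simp add: homeomorphism_def)
  have "chart V x0 T r g \<Psi> U \<Delta> D"
  proof
    show "algebraic_set V" "x0 \<in> V" "subspace T" "r > 0" by fact+
    show "dim T = CARD('n) - (CARD('n) - alg_dim V)" using dimT c_def by simp
    show "continuous_on (ball 0 r) g" using ift(6) r(2) by (meson continuous_on_subset homeomorphism_def)
    show "g 0 = x0" using gP[OF ift(3)] P0 by simp
    show "\<Psi> (g y) = y" if "y \<in> ball 0 r" for y using Pg r(2) that by blast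
    show "open U" unfolding U_def using ift(1) contPsi by (intro open_Int open_vimage) (auto simp: continuous_on_eq_continuous_at)
    show "x0 \<in> U" using ift(3) P0 r(1) by (simp add: U_def)
    show "\<Psi> x \<in> ball 0 r \<and> g (\<Psi> x) = x" if "x \<in> U" for x using that gP by (auto simp: U_def)
    show "(\<lambda>x. v \<bullet> \<Psi> x) \<in> polyfun" for v
    proof -
      have "v \<bullet> \<Psi> x = v \<bullet> (x - x0) + (\<Sum>w\<in>B. (\<phi> w x - w \<bullet> (x - x0)) * (v \<bullet> w))" for x
        by (simp add: \<Psi>_def inner_add_right inner_sum_right)
      then show ?thesis using \<phi>p by (auto intro!: polyfun_intros)
    qed
    show "D e f \<in> polyfun" if "f \<in> polyfun" for e f using Dp that .
    show "\<Delta> \<in> polyfun" by fact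
    have bij: "bij (A (g y))" if "y \<in> ball 0 r" for y using ift(9) F'A that r(2) by auto
    show nz: "\<Delta> (g y) \<noteq> 0" if "y \<in> ball 0 r" for y
      using bij[OF that] det_nz_iff_inj[OF linA] by (simp add: \<Delta>_def M_def bij_is_inj)
    show "((\<lambda>s. f (g (y + s *\<^sub>R e))) has_real_derivative D e f (g (y + s *\<^sub>R e)) / (\<Delta> (g (y + s *\<^sub>R e)))\<^sup>2) (at s)"
      if f: "f \<in> polyfun" and y: "y + s *\<^sub>R e \<in> ball 0 r" for f y e s
    proof -
      define z where "z = y + s *\<^sub>R e"
      have zW: "z \<in> W" using y r(2) z_def by blast
      define w where "w = g' z e"
      have w: "A (g z) w = e" unfolding w_def using ift(8)[OF zW] ift(9)[OF zW] F'A
        by (metis bij_is_surj surj_f_inv_f)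
      have "((\<lambda>s. y + s *\<^sub>R e) has_derivative (\<lambda>h. h *\<^sub>R e)) (at s)" by (auto intro!: derivative_eq_intros)
      then have "((\<lambda>s. g (y + s *\<^sub>R e)) has_derivative (\<lambda>h. g' z (h *\<^sub>R e))) (at s)"
        using has_derivative_compose[of "\<lambda>s. y + s *\<^sub>R e" _ s UNIV g "g' z"] ift(7)[OF zW] by (simp add: z_def)
      then have "((\<lambda>s. f (g (y + s *\<^sub>R e))) has_derivative (\<lambda>h. grad f (g z) \<bullet> g' z (h *\<^sub>R e))) (at s)"
        using has_derivative_compose[of "\<lambda>s. g (y + s *\<^sub>R e)" _ s UNIV f] polyfun_has_derivative[OF f, of "g z"]
        by (simp add: z_def)
      moreover have "g' z (h *\<^sub>R e) = h *\<^sub>R w" for h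
        using ift(7)[OF zW] w_def by (metis has_derivative_linear linear_scale)
      ultimately have "((\<lambda>s. f (g (y + s *\<^sub>R e))) has_real_derivative grad f (g z) \<bullet> w) (at s)"
        by (simp add: has_field_derivative_def mult_commute_abs)
      moreover have "grad f (g z) \<bullet> w = D e f (g z) / (\<Delta> (g z))\<^sup>2"
        using Dw[OF _ w, of f] nz[of z] y z_def by simp
      ultimately show ?thesis by (simp add: z_def)
    qed
    show "D e f \<in> vanishing V" if "e \<in> T" "f \<in> vanishing V" for e f using stable that .
    show "\<Psi> x \<in> T" if "x \<in> V" for x using that vPsi \<phi>(1) by (auto simp: T_def vanishing_def)
  qed
  then show ?thesis by blast
qed

section \<open>Identity theorem and Taylor expansion in a chart\<close>

context chart begin

lemma Dk_poly: "f \<in> polyfun \<Longrightarrow> (D e ^^ k) f \<in> polyfun"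
  by (induction k) (auto intro: D_poly)

lemma Dk_vanishing: "e \<in> T \<Longrightarrow> f \<in> vanishing V \<Longrightarrow> (D e ^^ k) f \<in> vanishing V"
  by (induction k) (auto intro: D_stable)

lemma continuous_on_poly_X:
  assumes "f \<in> polyfun" shows "continuous_on (ball 0 r) (\<lambda>y. f (X y))"
  using continuous_on_compose2[OF polyfun_continuous_on[OF assms, of UNIV] contX] by auto

lemma segment_in_ball:
  assumes "y \<in> ball (0::real^'n) r" "y + e \<in> ball 0 r" "0 \<le> s" "s \<le> 1"
  shows "y + s *\<^sub>R e \<in> ball 0 r"
proof -
  have "(1 - s) *\<^sub>R y + s *\<^sub>R (y + e) \<in> ball 0 r"
    using assms convex_ball[of 0 r] unfolding convex_def by (metis diff_add_cancel diff_ge_0_iff_ge)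
  then show ?thesis by (simp add: algebra_simps)
qed

lemma small_segment_in_ball:
  fixes y e :: "real^'n"
  assumes "y \<in> ball 0 r"
  obtains d where "d > 0" "\<And>s. \<bar>s\<bar> < d \<Longrightarrow> y + s *\<^sub>R e \<in> ball 0 r"
proof (rule that[of "(r - norm y) / (norm e + 1)"])
  have ne: "norm e + 1 > 0" by (simp add: add_nonneg_pos)
  show "(r - norm y) / (norm e + 1) > 0" using assms ne by simp
  fix s :: real assume s: "\<bar>s\<bar> < (r - norm y) / (norm e + 1)"
  have "norm (y + s *\<^sub>R e) \<le> norm y + \<bar>s\<bar> * norm e" using norm_triangle_ineq[of y "s *\<^sub>R e"] by simp
  also have "\<dots> \<le> norm y + \<bar>s\<bar> * (norm e + 1)" by (simp add: mult_left_mono)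
  also have "\<dots> < r" using s ne by (simp add: pos_less_divide_eq)
  finally show "y + s *\<^sub>R e \<in> ball 0 r" by simp
qed

text \<open>By the ascending chain condition the iterated derivatives along a segment solve a linear
  differential equation, so Gronwall's inequality replaces analyticity.\<close>
lemma chart_identity:
  assumes f: "f \<in> polyfun" and y: "y \<in> ball 0 r" and ye: "y + e \<in> ball 0 r"
    and z: "\<And>k. (D e ^^ k) f (X y) = 0"
  shows "f (X (y + e)) = 0"
proof -
  define F where "F k = (D e ^^ k) f" for k
  have Fp: "F k \<in> polyfun" for k unfolding F_def by (rule Dk_poly[OF f])
  obtain N c where c: "\<And>k. c k \<in> polyfun" "\<And>x. F N x = (\<Sum>k<N. c k x * F k x)"
    using polyfun_acc[of F] Fp by blast
  define p where "p s = X (y + s *\<^sub>R e)" for s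
  have inb: "y + s *\<^sub>R e \<in> ball 0 r" if "s \<in> {0..1}" for s using segment_in_ball[OF y ye] that by auto
  have cp: "continuous_on {0..1} (\<lambda>s. g (p s))" if "g \<in> polyfun" for g
    unfolding p_def using inb
    by (intro continuous_on_compose2[OF continuous_on_poly_X[OF that]] continuous_intros) auto
  \<comment> \<open>Bounds the coefficients of the differential equation. It is continuous on the
    segment, so the sum \<open>E\<close> of the squares of the first N derivatives grows at most
    exponentially.\<close>
  define h where "h s = (1 + (\<Sum>k<N. \<bar>c k (p s)\<bar>)) / (\<Delta> (p s))\<^sup>2" for s
  have nz: "\<Delta> (p s) \<noteq> 0" if "s \<in> {0..1}" for s unfolding p_def using Delta_nz inb[OF that] by blast
  have "continuous_on {0..1} h" unfolding h_def
    by (intro continuous_intros cp c Delta_poly) (use nz in auto)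
  then obtain K where K: "\<And>s. s \<in> {0..1} \<Longrightarrow> h s \<le> K"
    using compact_continuous_image[of "{0..1}" h] bounded_imp_bdd_above[OF compact_imp_bounded]
    by (metis compact_Icc bdd_above.unfold image_eqI)
  define E where "E s = (\<Sum>k<N. (F k (p s))\<^sup>2)" for s
  have E0: "E s \<ge> 0" for s by (auto simp: E_def intro: sum_nonneg)
  have FE: "\<bar>F k (p s)\<bar> \<le> sqrt (E s)" if "k < N" for k s
  proof -
    have "(F k (p s))\<^sup>2 \<le> E s" unfolding E_def by (rule member_le_sum) (use that in auto)
    then show ?thesis by (simp add: real_le_rsqrt)
  qed
  have dF: "((\<lambda>s. F k (p s)) has_real_derivative F (Suc k) (p s) / (\<Delta> (p s))\<^sup>2) (at s)" if "s \<in> {0..1}" for k s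
    unfolding p_def using D_deriv[OF Fp inb[OF that], of k] by (simp add: F_def)
  define E' where "E' s = (\<Sum>k<N. 2 * F k (p s) * (F (Suc k) (p s) / (\<Delta> (p s))\<^sup>2))" for s
  have dE: "(E has_real_derivative E' s) (at s)" if "s \<in> {0..1}" for s
    unfolding E_def[abs_def] E'_def by (auto intro!: derivative_eq_intros dF[OF that] sum.cong)
  have bE: "E' s \<le> 2 * N * K * E s" if s: "s \<in> {0..1}" for s
  proof -
    have "2 * F k (p s) * (F (Suc k) (p s) / (\<Delta> (p s))\<^sup>2) \<le> 2 * (K * E s)" if "k < N" for k
    proof -
      have "\<bar>F (Suc k) (p s)\<bar> \<le> (1 + (\<Sum>k<N. \<bar>c k (p s)\<bar>)) * sqrt (E s)"
      proof (cases "Suc k < N")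
        case True
        have "sqrt (E s) \<le> (1 + (\<Sum>k<N. \<bar>c k (p s)\<bar>)) * sqrt (E s)"
          using E0 by (simp add: mult_left_le_one_le sum_nonneg mult_le_cancel_right1 algebra_simps)
        then show ?thesis using FE[OF True, of s] by linarith
      next
        case False
        then have "Suc k = N" using that by simp
        then have "\<bar>F (Suc k) (p s)\<bar> \<le> (\<Sum>k<N. \<bar>c k (p s) * F k (p s)\<bar>)" using c(2)[of "p s"] by (simp add: sum_abs)
        also have "\<dots> \<le> (\<Sum>k<N. \<bar>c k (p s)\<bar> * sqrt (E s))"
          by (intro sum_mono) (auto simp: abs_mult intro!: mult_left_mono FE)
        also have "\<dots> \<le> (1 + (\<Sum>k<N. \<bar>c k (p s)\<bar>)) * sqrt (E s)"
          using E0[of s] by (simp add: sum_distrib_right[symmetric] distrib_right)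
        finally show ?thesis .
      qed
      then have "\<bar>F k (p s)\<bar> * \<bar>F (Suc k) (p s)\<bar> \<le> sqrt (E s) * ((1 + (\<Sum>k<N. \<bar>c k (p s)\<bar>)) * sqrt (E s))"
        using FE[OF that, of s] E0 by (intro mult_mono) auto
      also have "\<dots> = (1 + (\<Sum>k<N. \<bar>c k (p s)\<bar>)) * E s"
      proof -
        have "sqrt (E s) * (c * sqrt (E s)) = c * (sqrt (E s) * sqrt (E s))" for c by simp
        then show ?thesis using E0[of s] by (simp del: mult.left_commute)
      qed
      finally have "F k (p s) * F (Suc k) (p s) \<le> (1 + (\<Sum>k<N. \<bar>c k (p s)\<bar>)) * E s"
        by (metis abs_ge_self abs_mult order_trans)
      then have "F k (p s) * F (Suc k) (p s) / (\<Delta> (p s))\<^sup>2 \<le> (1 + (\<Sum>k<N. \<bar>c k (p s)\<bar>)) * E s / (\<Delta> (p s))\<^sup>2"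
        by (intro divide_right_mono) auto
      also have "\<dots> = h s * E s" by (simp add: h_def)
      also have "\<dots> \<le> K * E s" using K[OF s] E0[of s] by (intro mult_right_mono) auto
      finally show ?thesis by simp
    qed
    then have "E' s \<le> (\<Sum>k<N. 2 * (K * E s))" unfolding E'_def by (intro sum_mono) auto
    then show ?thesis by (simp add: algebra_simps)
  qed
  define C where "C = 2 * N * K"
  define G where "G s = exp (- C * s) * E s" for s
  have "G 1 \<le> G 0"
  proof -
    have "\<exists>y. (G has_real_derivative y) (at s) \<and> y \<le> 0" if "0 \<le> s" "s \<le> 1" for s
    proof -
      have s: "s \<in> {0..1}" using that by auto
      have "(G has_real_derivative exp (- C * s) * (E' s - C * E s)) (at s)"
        unfolding G_def[abs_def] by (auto intro!: derivative_eq_intros dE[OF s] simp: algebra_simps)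
      moreover have "exp (- C * s) * (E' s - C * E s) \<le> 0"
        using bE[OF s] by (intro mult_nonneg_nonpos) (auto simp: C_def)
      ultimately show ?thesis by blast
    qed
    then show ?thesis by (intro DERIV_nonpos_imp_nonincreasing[of 0 1 G]) auto
  qed
  moreover have "G 0 = 0" using z by (simp add: G_def E_def p_def F_def)
  ultimately have "exp (- C) * E 1 \<le> 0" by (simp add: G_def)
  then have "E 1 = 0" using E0[of 1] by (simp add: mult_le_0_iff)
  then have all0: "\<And>k. k < N \<Longrightarrow> F k (p 1) = 0" unfolding E_def by (subst (asm) sum_nonneg_eq_0_iff) auto
  have "F 0 (p 1) = 0"
  \<comment> \<open>For N = 0 the empty combination says that f itself is the zero function.\<close>
  proof (cases "N = 0")
    case True
    then show ?thesis using c(2) by simp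
  qed (use all0 in simp)
  then show ?thesis by (simp add: F_def p_def)
qed

lemma chart_local_zero:
  assumes f: "f \<in> polyfun" and y: "y \<in> ball 0 r" and d: "d > 0"
    and z: "\<And>s. \<bar>s\<bar> < d \<Longrightarrow> y + s *\<^sub>R e \<in> ball 0 r \<and> f (X (y + s *\<^sub>R e)) = 0"
  shows "(D e ^^ k) f (X y) = 0"
proof -
  have "\<forall>s. \<bar>s\<bar> < d \<longrightarrow> (D e ^^ k) f (X (y + s *\<^sub>R e)) = 0" for k
  proof (induction k)
    case 0
    then show ?case using z by simp
  next
    case (Suc k)
    show ?case
    proof (intro allI impI)
      fix s :: real assume s: "\<bar>s\<bar> < d"
      let ?g = "\<lambda>s. (D e ^^ k) f (X (y + s *\<^sub>R e))"
      have "(?g has_real_derivative D e ((D e ^^ k) f) (X (y + s *\<^sub>R e)) / (\<Delta> (X (y + s *\<^sub>R e)))\<^sup>2) (at s)"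
        using D_deriv[OF Dk_poly[OF f]] z[OF s] by blast
      moreover have "(?g has_real_derivative 0) (at s)"
      proof (rule has_field_derivative_transform_within_open[of "\<lambda>_. 0" _ _ "{-d<..<d}"])
        show "0 = (D e ^^ k) f (X (y + x *\<^sub>R e))" if "x \<in> {-d<..<d}" for x
          using Suc that by (simp add: abs_less_iff)
      qed (use s in \<open>auto simp: abs_less_iff\<close>)
      ultimately have "D e ((D e ^^ k) f) (X (y + s *\<^sub>R e)) / (\<Delta> (X (y + s *\<^sub>R e)))\<^sup>2 = 0"
        using DERIV_unique by blast
      then show "(D e ^^ Suc k) f (X (y + s *\<^sub>R e)) = 0" using Delta_nz z[OF s] by simp
    qed
  qed
  from this[of k] show ?thesis using d by (metis abs_zero scaleR_zero_left add.right_neutral)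
qed

text \<open>The iterated derivatives in direction y of an equation g of V vanish on V again, in
  particular at x0 = X 0; so the identity theorem carries g = 0 along the segment to X y.\<close>

lemma XT_in_V: "y \<in> T \<Longrightarrow> y \<in> ball 0 r \<Longrightarrow> X y \<in> V"
proof -
  assume y: "y \<in> T" "y \<in> ball 0 r"
  obtain g where g: "g \<in> polyfun" "V = {x. g x = 0}" using algebraic_set_hypersurface[OF algV] by blast
  have gv: "g \<in> vanishing V" using g by (auto simp: vanishing_def)
  have "g (X (0 + y)) = 0"
  proof (rule chart_identity[OF g(1)])
    show "(D y ^^ k) g (X 0) = 0" for k using Dk_vanishing[OF y(1) gv, of k] x0V X0 by (simp add: vanishing_def)
  qed (use y r in auto)
  then show "X y \<in> V" using g by simp
qed

definition slice :: "(real^'n) set \<Rightarrow> (real^'n) set" where "slice S = X ` (S \<inter> ball 0 r)"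

text \<open>If f is nonzero at one point, it is nonzero on a short piece of the line towards any
  other; there g vanishes, hence by the identity theorem at the other end as well.\<close>

lemma slice_prime:
  assumes S: "subspace S" and f: "f \<in> polyfun" and g: "g \<in> polyfun" and fg: "\<And>x. x \<in> slice S \<Longrightarrow> f x * g x = 0"
  shows "(\<forall>x\<in>slice S. f x = 0) \<or> (\<forall>x\<in>slice S. g x = 0)"
proof (rule ccontr)
  assume "\<not> ?thesis"
  then obtain y1 y2 where y1: "y1 \<in> S" "y1 \<in> ball 0 r" "f (X y1) \<noteq> 0" and y2: "y2 \<in> S" "y2 \<in> ball 0 r" "g (X y2) \<noteq> 0"
    unfolding slice_def by blast
  define e where "e = y2 - y1"
  have eS: "e \<in> S" using y1 y2 S by (simp add: e_def subspace_diff)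
  define W where "W = ball 0 r \<inter> (\<lambda>y. f (X y)) -` (- {0})"
  have "open W" unfolding W_def
    by (rule continuous_open_preimage[OF continuous_on_poly_X[OF f]]) auto
  then have "open ((\<lambda>s. y1 + s *\<^sub>R e) -` W)"
    by (intro open_vimage) (auto intro!: continuous_intros)
  moreover have "0 \<in> (\<lambda>s. y1 + s *\<^sub>R e) -` W" using y1 by (simp add: W_def)
  ultimately obtain d where d: "d > 0" "ball 0 d \<subseteq> (\<lambda>s. y1 + s *\<^sub>R e) -` W"
    using open_contains_ball by metis
  have "g (X (y1 + e)) = 0"
  proof (rule chart_identity[OF g y1(2)])
    show "y1 + e \<in> ball 0 r" using y2 by (simp add: e_def)
    show "(D e ^^ k) g (X y1) = 0" for k
    proof (rule chart_local_zero[OF g y1(2) d(1)])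
      fix s :: real assume "\<bar>s\<bar> < d"
      then have s: "s \<in> ball 0 d" by (simp add: dist_real_def)
      then have *: "y1 + s *\<^sub>R e \<in> ball 0 r" "f (X (y1 + s *\<^sub>R e)) \<noteq> 0" using d(2) by (auto simp: W_def)
      have "y1 + s *\<^sub>R e \<in> S" using y1 eS S by (simp add: subspace_add subspace_scale)
      then show "y1 + s *\<^sub>R e \<in> ball 0 r \<and> g (X (y1 + s *\<^sub>R e)) = 0"
        using * fg[of "X (y1 + s *\<^sub>R e)"] by (auto simp: slice_def)
    qed
  qed
  then show False using y2 by (simp add: e_def)
qed

text \<open>L'Hopital once per order, each time replacing f by D e f and putting a factor (j + 1)
  \<Delta>^2 into the denominator; in this way \<Delta> is never differentiated.\<close>

lemma chart_taylor:
  assumes f: "f \<in> polyfun" and y: "y \<in> ball 0 r" and z: "\<And>i. i < j \<Longrightarrow> (D e ^^ i) f (X y) = 0"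
  shows "((\<lambda>s. f (X (y + s *\<^sub>R e)) / s ^ j) \<longlongrightarrow> (D e ^^ j) f (X y) / (fact j * (\<Delta> (X y))\<^sup>2 ^ j)) (at_right 0)"
  using f z
proof (induction j arbitrary: f)
  case 0
  have ev: "((\<lambda>s. y + s *\<^sub>R e) \<longlongrightarrow> y) (at_right 0)" by (auto intro!: tendsto_eq_intros)
  have "isCont (\<lambda>y. f (X y)) y"
    using continuous_on_poly_X[OF 0(1)] y by (simp add: continuous_on_eq_continuous_at)
  then have "((\<lambda>s. f (X (y + s *\<^sub>R e))) \<longlongrightarrow> f (X y)) (at_right 0)" using ev isCont_tendsto_compose by fast
  then show ?case by simp
next
  case (Suc j)
  obtain d where d: "d > 0" "\<And>s. \<bar>s\<bar> < d \<Longrightarrow> y + s *\<^sub>R e \<in> ball 0 r"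
    using small_segment_in_ball[of y e] y by blast
  have evd: "\<forall>\<^sub>F s in at_right (0::real). 0 < s \<and> \<bar>s\<bar> < d"
    unfolding eventually_at_right_field using d(1) by (intro exI[of _ d]) auto
  define g where "g = D e f"
  have gp: "g \<in> polyfun" using D_poly Suc.prems by (simp add: g_def)
  have it: "(D e ^^ i) g = (D e ^^ Suc i) f" for i by (simp add: g_def funpow_swap1)
  have lim0: "((\<lambda>s. f (X (y + s *\<^sub>R e))) \<longlongrightarrow> 0) (at_right 0)" and
    limD: "((\<lambda>s. \<Delta> (X (y + s *\<^sub>R e))) \<longlongrightarrow> \<Delta> (X y)) (at_right 0)"
  proof -
    have ev: "((\<lambda>s. y + s *\<^sub>R e) \<longlongrightarrow> y) (at_right 0)" by (auto intro!: tendsto_eq_intros)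
    have "isCont (\<lambda>y. f (X y)) y" "isCont (\<lambda>y. \<Delta> (X y)) y"
      using continuous_on_poly_X[OF Suc.prems(1)] continuous_on_poly_X[OF Delta_poly] y by (auto simp: continuous_on_eq_continuous_at)
    then show "((\<lambda>s. f (X (y + s *\<^sub>R e))) \<longlongrightarrow> 0) (at_right 0)" "((\<lambda>s. \<Delta> (X (y + s *\<^sub>R e))) \<longlongrightarrow> \<Delta> (X y)) (at_right 0)"
      using ev isCont_tendsto_compose[of y "\<lambda>y. f (X y)"] isCont_tendsto_compose[of y "\<lambda>y. \<Delta> (X y)"] Suc.prems(2)[of 0] by fastforce+
  qed
  have IH: "((\<lambda>s. g (X (y + s *\<^sub>R e)) / s ^ j) \<longlongrightarrow> (D e ^^ Suc j) f (X y) / (fact j * (\<Delta> (X y))\<^sup>2 ^ j)) (at_right 0)"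
  proof -
    have "(D e ^^ i) g (X y) = 0" if "i < j" for i unfolding it using Suc.prems(2)[of "Suc i"] that by simp
    from Suc.IH[OF gp this] show ?thesis unfolding it .
  qed
  show ?case
  proof (rule lhopital_right_0[where f' = "\<lambda>s. g (X (y + s *\<^sub>R e)) / (\<Delta> (X (y + s *\<^sub>R e)))\<^sup>2" and g' = "\<lambda>s. real (Suc j) * s ^ j"])
    show "((\<lambda>s. f (X (y + s *\<^sub>R e))) \<longlongrightarrow> 0) (at_right 0)" by fact
    show "((\<lambda>s::real. s ^ Suc j) \<longlongrightarrow> 0) (at_right 0)" by (auto intro!: tendsto_eq_intros)
    show "\<forall>\<^sub>F s in at_right (0::real). s ^ Suc j \<noteq> 0" "\<forall>\<^sub>F s in at_right (0::real). real (Suc j) * s ^ j \<noteq> 0"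
      using evd by (eventually_elim, simp)+
    show "\<forall>\<^sub>F s in at_right 0. ((\<lambda>s. f (X (y + s *\<^sub>R e))) has_real_derivative g (X (y + s *\<^sub>R e)) / (\<Delta> (X (y + s *\<^sub>R e)))\<^sup>2) (at s)"
      using evd by eventually_elim (use d(2) Suc.prems(1) in \<open>auto simp: g_def intro!: D_deriv\<close>)
    show "\<forall>\<^sub>F s in at_right 0. ((\<lambda>s. s ^ Suc j) has_real_derivative real (Suc j) * s ^ j) (at s)"
      using DERIV_pow[of "Suc j"] by (intro always_eventually allI) simp
    have "((\<lambda>s. (g (X (y + s *\<^sub>R e)) / s ^ j) / ((\<Delta> (X (y + s *\<^sub>R e)))\<^sup>2 * real (Suc j))) \<longlongrightarrow>
       ((D e ^^ Suc j) f (X y) / (fact j * (\<Delta> (X y))\<^sup>2 ^ j)) / ((\<Delta> (X y))\<^sup>2 * real (Suc j))) (at_right 0)"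
      by (intro tendsto_intros IH limD) (use Delta_nz[OF y] in auto)
    then show "((\<lambda>s. g (X (y + s *\<^sub>R e)) / (\<Delta> (X (y + s *\<^sub>R e)))\<^sup>2 / (real (Suc j) * s ^ j)) \<longlongrightarrow>
        (D e ^^ Suc j) f (X y) / (fact (Suc j) * (\<Delta> (X y))\<^sup>2 ^ Suc j)) (at_right 0)"
      by (simp add: field_simps)
  qed
qed

text \<open>The curve through x in direction e stays in V since e is in T. Along it F q = p, so by
  continuity of F the leading coefficients of q and p at x satisfy the same relation.\<close>

lemma chart_lhopital:
  assumes p: "p \<in> polyfun" and q: "q \<in> polyfun" and F: "continuous_on V F" and Fq: "\<And>x. x \<in> V \<Longrightarrow> F x * q x = p x"
    and e: "e \<in> T" and x: "x \<in> V" "x \<in> U" and z: "\<And>i. i < j \<Longrightarrow> (D e ^^ i) q x = 0"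
  shows "F x * (D e ^^ j) q x = (D e ^^ j) p x"
proof -
  define y where "y = \<Psi> x"
  have y: "y \<in> ball 0 r" "X y = x" "y \<in> T" using XPsi[OF x(2)] VT[OF x(1)] by (auto simp: y_def)
  obtain d where d: "d > 0" "\<And>s. \<bar>s\<bar> < d \<Longrightarrow> y + s *\<^sub>R e \<in> ball 0 r"
    using small_segment_in_ball[of y e] y by blast
  have evd: "\<forall>\<^sub>F s in at_right (0::real). 0 < s \<and> \<bar>s\<bar> < d"
    unfolding eventually_at_right_field using d(1) by (intro exI[of _ d]) auto
  have inV: "X (y + s *\<^sub>R e) \<in> V" if "\<bar>s\<bar> < d" for s
    using XT_in_V d(2)[OF that] y(3) e subT by (simp add: subspace_add subspace_scale)
  have "((\<lambda>s. X (y + s *\<^sub>R e)) \<longlongrightarrow> X y) (at_right 0)"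
  proof -
    have ev: "((\<lambda>s. y + s *\<^sub>R e) \<longlongrightarrow> y) (at_right 0)" by (auto intro!: tendsto_eq_intros)
    have "isCont X y" using contX y by (simp add: continuous_on_eq_continuous_at)
    then show ?thesis using ev isCont_tendsto_compose by fast
  qed
  then have limF: "((\<lambda>s. F (X (y + s *\<^sub>R e))) \<longlongrightarrow> F x) (at_right 0)"
  proof -
    have "\<forall>\<^sub>F s in at_right 0. X (y + s *\<^sub>R e) \<in> V" using evd by eventually_elim (use inV in blast)
    then show ?thesis using continuous_on_tendsto_compose[OF F \<open>((\<lambda>s. X (y + s *\<^sub>R e)) \<longlongrightarrow> X y) (at_right 0)\<close>] x y(2) by simp
  qed
  have lead: "F x * (D e ^^ k) q x = (D e ^^ k) p x"
    if "\<And>i. i < k \<Longrightarrow> (D e ^^ i) q x = 0 \<and> (D e ^^ i) p x = 0" for k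
  proof -
    let ?w = "fact k * (\<Delta> x)\<^sup>2 ^ k :: real"
    have w: "?w \<noteq> 0" using Delta_nz[OF y(1)] y(2) by auto
    have Lq: "((\<lambda>s. q (X (y + s *\<^sub>R e)) / s ^ k) \<longlongrightarrow> (D e ^^ k) q x / ?w) (at_right 0)"
      using chart_taylor[OF q y(1), of k e] that y(2) by simp
    have Lp: "((\<lambda>s. p (X (y + s *\<^sub>R e)) / s ^ k) \<longlongrightarrow> (D e ^^ k) p x / ?w) (at_right 0)"
      using chart_taylor[OF p y(1), of k e] that y(2) by simp
    have "((\<lambda>s. F (X (y + s *\<^sub>R e)) * (q (X (y + s *\<^sub>R e)) / s ^ k)) \<longlongrightarrow> F x * ((D e ^^ k) q x / ?w)) (at_right 0)"
      by (intro tendsto_mult limF Lq)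
    moreover have "\<forall>\<^sub>F s in at_right 0. F (X (y + s *\<^sub>R e)) * (q (X (y + s *\<^sub>R e)) / s ^ k) = p (X (y + s *\<^sub>R e)) / s ^ k"
    proof (rule eventually_mono[OF evd])
      fix s assume "0 < s \<and> \<bar>s\<bar> < d"
      then show "F (X (y + s *\<^sub>R e)) * (q (X (y + s *\<^sub>R e)) / s ^ k) = p (X (y + s *\<^sub>R e)) / s ^ k"
        using Fq[OF inV[of s]] by auto
    qed
    ultimately have "((\<lambda>s. p (X (y + s *\<^sub>R e)) / s ^ k) \<longlongrightarrow> F x * ((D e ^^ k) q x / ?w)) (at_right 0)"
      by (rule Lim_transform_eventually)
    then have "F x * ((D e ^^ k) q x / ?w) = (D e ^^ k) p x / ?w"
      using Lp tendsto_unique trivial_limit_at_right_real by blast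
    then show ?thesis using w by auto
  qed
  \<comment> \<open>The lower derivatives of p vanish too: by induction each equals F(x) times the
    one of q.\<close>
  have "\<forall>i<j. (D e ^^ i) p x = 0"
  proof (intro allI impI)
    fix i show "i < j \<Longrightarrow> (D e ^^ i) p x = 0"
    proof (induction i rule: less_induct)
      case (less i)
      then show ?case using lead[of i] z by (metis less_trans mult_zero_right)
    qed
  qed
  then show ?thesis using lead[of j] z by blast
qed

end

section \<open>Dimension and density\<close>

text \<open>The degree is bounded in each variable separately, so that the exponents form a box that
  is easily counted.\<close>

inductive_set deg_le :: "nat \<Rightarrow> (real^'n::finite \<Rightarrow> real) set" for E where
  dl_zero: "(\<lambda>x. 0) \<in> deg_le E"
| dl_mon: "(\<And>i. \<alpha> i \<le> E) \<Longrightarrow> (\<lambda>x. c * (\<Prod>i\<in>UNIV. x $ i ^ \<alpha> i)) \<in> deg_le E"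
| dl_add: "f \<in> deg_le E \<Longrightarrow> g \<in> deg_le E \<Longrightarrow> (\<lambda>x. f x + g x) \<in> deg_le E"

lemma deg_le_mono: "f \<in> deg_le E \<Longrightarrow> E \<le> E' \<Longrightarrow> f \<in> deg_le E'"
proof (induction rule: deg_le.induct)
  case (dl_mon \<alpha> c)
  then show ?case by (intro deg_le.dl_mon) (meson order_trans)
qed (auto intro: deg_le.intros)

lemma deg_le_mult:
  assumes "f \<in> deg_le E" "g \<in> deg_le E'"
  shows "(\<lambda>x. f x * g x) \<in> deg_le (E + E')"
  using assms(1)
proof (induction rule: deg_le.induct)
  case dl_zero
  then show ?case by (simp add: deg_le.dl_zero)
next
  case (dl_mon \<alpha> c)
  show ?case using assms(2)
  proof (induction rule: deg_le.induct)
    case dl_zero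
    then show ?case by (simp add: deg_le.dl_zero)
  next
    case (dl_mon \<beta> d)
    have "(\<lambda>x. c * (\<Prod>i\<in>UNIV. x $ i ^ \<alpha> i) * (d * (\<Prod>i\<in>UNIV. x $ i ^ \<beta> i))) =
      (\<lambda>x::real^'a. (c * d) * (\<Prod>i\<in>UNIV. x $ i ^ (\<alpha> i + \<beta> i)))"
      by (simp add: power_add prod.distrib fun_eq_iff)
    then show ?case using dl_mon \<open>\<And>i. \<alpha> i \<le> E\<close> by (simp only:) (intro deg_le.dl_mon add_mono)
  next
    case (dl_add f g)
    then show ?case using deg_le.dl_add by (simp add: distrib_left)
  qed
next
  case (dl_add f g)
  then show ?case using deg_le.dl_add by (simp add: distrib_right)
qed

lemma polyfun_deg_le: "f \<in> polyfun \<Longrightarrow> \<exists>E. f \<in> deg_le E"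
proof (induction rule: polyfun.induct)
  case (pf_const c)
  have "(\<lambda>x::real^'a. c * (\<Prod>i\<in>UNIV. x $ i ^ 0)) \<in> deg_le 0" by (intro dl_mon) simp
  then show ?case by auto
next
  case (pf_coord j)
  have "(\<Prod>i\<in>UNIV. x $ i ^ (if i = j then 1 else 0)) = x $ j" for x :: "real^'a"
  proof -
    have "(\<Prod>i\<in>UNIV. x $ i ^ (if i = j then 1 else 0)) = (\<Prod>i\<in>UNIV. if i = j then x $ i else 1)"
      by (intro prod.cong) auto
    then show ?thesis by simp
  qed
  moreover have "(\<lambda>x::real^'a. 1 * (\<Prod>i\<in>UNIV. x $ i ^ (if i = j then 1 else 0))) \<in> deg_le 1" by (intro dl_mon) simp
  ultimately show ?case by auto
next
  case (pf_add f g)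
  then obtain E E' where "f \<in> deg_le E" "g \<in> deg_le E'" by blast
  then have "f \<in> deg_le (max E E')" "g \<in> deg_le (max E E')" by (auto elim: deg_le_mono)
  then show ?case using dl_add by blast
next
  case (pf_mult f g)
  then show ?case using deg_le_mult by blast
qed

lemma deg_le_rep:
  "f \<in> deg_le E \<Longrightarrow> \<exists>C. \<forall>x. f x = (\<Sum>\<alpha>\<in>{\<alpha>. \<forall>i. \<alpha> i \<le> E}. C \<alpha> * (\<Prod>i\<in>UNIV. x $ i ^ \<alpha> i))"
proof (induction rule: deg_le.induct)
  case dl_zero
  show ?case by (intro exI[of _ "\<lambda>_. 0"]) simp
next
  case (dl_mon \<alpha> c)
  have fin: "finite {\<alpha> :: 'a \<Rightarrow> nat. \<forall>i. \<alpha> i \<le> E}"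
    using finite_PiE[of "UNIV :: 'a set" "\<lambda>_. {..E}"] by (simp add: PiE_UNIV_domain Pi_def)
  have "(\<Sum>\<beta>\<in>{\<beta>. \<forall>i. \<beta> i \<le> E}. (if \<beta> = \<alpha> then c else 0) * (\<Prod>i\<in>UNIV. x $ i ^ \<beta> i)) = c * (\<Prod>i\<in>UNIV. x $ i ^ \<alpha> i)"
    for x :: "real^'a"
    using fin dl_mon by (simp add: if_distrib[of "\<lambda>u. u * _"] cong: if_cong)
  then show ?case by (intro exI[of _ "\<lambda>\<beta>. if \<beta> = \<alpha> then c else 0"]) auto
next
  case (dl_add f g)
  then obtain C C' where "\<forall>x. f x = (\<Sum>\<alpha>\<in>{\<alpha>. \<forall>i. \<alpha> i \<le> E}. C \<alpha> * (\<Prod>i\<in>UNIV. x $ i ^ \<alpha> i))"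
    "\<forall>x. g x = (\<Sum>\<alpha>\<in>{\<alpha>. \<forall>i. \<alpha> i \<le> E}. C' \<alpha> * (\<Prod>i\<in>UNIV. x $ i ^ \<alpha> i))" by blast
  then show ?case by (intro exI[of _ "\<lambda>\<alpha>. C \<alpha> + C' \<alpha>"]) (simp add: sum.distrib distrib_right)
qed

lemma underdetermined_system:
  assumes "finite L" "finite A" "card A > card L"
  shows "\<exists>c::'a \<Rightarrow> real. (\<exists>a\<in>A. c a \<noteq> 0) \<and> (\<forall>l\<in>L. (\<Sum>a\<in>A. c a * B a l) = 0)"
  using assms
proof (induction L arbitrary: A B rule: finite_induct)
  case empty
  then obtain a where "a \<in> A" by fastforce
  then show ?case by (intro exI[of _ "\<lambda>_. 1"]) auto
next
  case (insert l L)
  show ?case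
  proof (cases "\<forall>a\<in>A. B a l = 0")
    case True
    obtain c where "\<exists>a\<in>A. c a \<noteq> 0" "\<forall>l\<in>L. (\<Sum>a\<in>A. c a * B a l) = 0"
      using insert.IH[of A B] insert.prems insert.hyps by auto
    then show ?thesis using True by (intro exI[of _ c]) auto
  next
    case False
    then obtain a0 where a0: "a0 \<in> A" "B a0 l \<noteq> 0" by blast
    define B' where "B' a k = B a k - B a l / B a0 l * B a0 k" for a k
    have "card (A - {a0}) > card L" using insert.prems insert.hyps a0 by (simp add: card_Diff_singleton)
    then obtain c where c: "\<exists>a\<in>A - {a0}. c a \<noteq> 0" "\<forall>k\<in>L. (\<Sum>a\<in>A - {a0}. c a * B' a k) = 0"
      using insert.IH[of "A - {a0}" B'] insert.prems by auto
    define s where "s = (\<Sum>a\<in>A - {a0}. c a * (B a l / B a0 l))"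
    define c' where "c' a = (if a = a0 then - s else c a)" for a
    have eq: "(\<Sum>a\<in>A. c' a * B a k) = (\<Sum>a\<in>A - {a0}. c a * B' a k)" for k
    proof -
      have "(\<Sum>a\<in>A. c' a * B a k) = - s * B a0 k + (\<Sum>a\<in>A - {a0}. c' a * B a k)"
        using insert.prems a0 by (subst sum.remove[of A a0]) (auto simp: c'_def)
      also have "(\<Sum>a\<in>A - {a0}. c' a * B a k) = (\<Sum>a\<in>A - {a0}. c a * B a k)"
        by (rule sum.cong) (auto simp: c'_def)
      also have "- s * B a0 k + (\<Sum>a\<in>A - {a0}. c a * B a k) = (\<Sum>a\<in>A - {a0}. c a * B' a k)"
        unfolding s_def B'_def right_diff_distrib sum_subtractf sum_distrib_right mult_minus_left
        by (simp add: mult.assoc)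
      finally show ?thesis .
    qed
    have "(\<Sum>a\<in>A - {a0}. c a * B' a l) = 0" using a0 by (simp add: B'_def)
    moreover have "\<exists>a\<in>A. c' a \<noteq> 0" using c(1) by (auto simp: c'_def)
    ultimately show ?thesis using eq c(2) by (intro exI[of _ c']) auto
  qed
qed

section \<open>Bound on chains of irreducible algebraic sets\<close>

lemma irreducible_alg_prime:
  assumes "irreducible_alg Z" "f \<in> polyfun" "g \<in> polyfun" "\<And>x. x \<in> Z \<Longrightarrow> f x * g x = 0"
  shows "(\<forall>x\<in>Z. f x = 0) \<or> (\<forall>x\<in>Z. g x = 0)"
proof -
  have "algebraic_set (zero_set {f})" "algebraic_set (zero_set {g})"
    using assms unfolding algebraic_set_def by blast+
  moreover have "Z \<subseteq> zero_set {f} \<union> zero_set {g}" using assms(4) by (auto simp: zero_set_def)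
  ultimately have "Z \<subseteq> zero_set {f} \<or> Z \<subseteq> zero_set {g}" using assms(1) unfolding irreducible_alg_def by blast
  then show ?thesis by (auto simp: zero_set_def)
qed

text \<open>A substitute for transcendence degree: the m^i monomials in f_0, ..., f_(i-1) with
  exponents below m are linearly independent on Z i, while their degrees grow only linearly in
  m.\<close>

lemma chain_independent:
  fixes Z :: "nat \<Rightarrow> (real^'n::finite) set"
  assumes irr: "\<And>i. i \<le> k \<Longrightarrow> irreducible_alg (Z i)" and sub: "\<And>i. i < k \<Longrightarrow> Z i \<subset> Z (Suc i)" and m: "m > 0"
    and f: "\<And>i. i < k \<Longrightarrow> f i \<in> deg_le E" "\<And>i. i < k \<Longrightarrow> f i \<in> polyfun"
      "\<And>i x. i < k \<Longrightarrow> x \<in> Z i \<Longrightarrow> f i x = 0" "\<And>i. i < k \<Longrightarrow> \<exists>x\<in>Z (Suc i). f i x \<noteq> 0"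
  shows "i \<le> k \<Longrightarrow> \<exists>b. (\<forall>a. b a \<in> polyfun) \<and> (\<forall>a<m^i. b a \<in> deg_le (i * (m * E))) \<and>
    (\<forall>c. (\<forall>x\<in>Z i. (\<Sum>a<m^i. c a * b a x) = 0) \<longrightarrow> (\<forall>a<m^i. c a = (0::real)))"
proof (induction i)
  case 0
  have "(\<lambda>x::real^'n. 1 * (\<Prod>i\<in>UNIV. x $ i ^ 0)) \<in> deg_le 0" by (intro dl_mon) simp
  moreover obtain x where "x \<in> Z 0" using irr[of 0] by (auto simp: irreducible_alg_def)
  ultimately show ?case by (intro exI[of _ "\<lambda>a x. 1"]) (auto intro: pf_const)
next
  case (Suc i)
  then have ik: "i < k" by simp
  obtain b where bb: "(\<forall>a. b a \<in> polyfun) \<and> (\<forall>a<m^i. b a \<in> deg_le (i * (m * E))) \<and>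
    (\<forall>c. (\<forall>x\<in>Z i. (\<Sum>a<m^i. c a * b a x) = 0) \<longrightarrow> (\<forall>a<m^i. c a = (0::real)))"
    using Suc.IH ik by auto
  then have b: "\<And>a. b a \<in> polyfun" "\<And>a. a < m^i \<Longrightarrow> b a \<in> deg_le (i * (m * E))"
    "\<And>c a. (\<And>x. x \<in> Z i \<Longrightarrow> (\<Sum>a<m^i. c a * b a x) = 0) \<Longrightarrow> a < m^i \<Longrightarrow> c a = (0::real)" by blast+
  define q where "q = m ^ i"
  have q: "q > 0" using m by (simp add: q_def)
  \<comment> \<open>The digit a div m^i is the exponent of the new function f_i, and a mod m^i
    indexes the products already built.\<close>
  define b' where "b' a x = f i x ^ (a div q) * b (a mod q) x" for a x
  have pw: "(\<lambda>x. f i x ^ j) \<in> deg_le (j * E)" for j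
  proof (induction j)
    case 0
    have "(\<lambda>x::real^'n. 1 * (\<Prod>i\<in>UNIV. x $ i ^ 0)) \<in> deg_le 0" by (intro dl_mon) simp
    then show ?case by simp
  next
    case (Suc j)
    then show ?case using deg_le_mult[OF f(1)[OF ik] Suc.IH] by simp
  qed
  have "b' a \<in> polyfun" for a unfolding b'_def[abs_def] by (intro pf_mult polyfun_power f(2)[OF ik] b(1))
  moreover have "b' a \<in> deg_le (Suc i * (m * E))" if "a < m ^ Suc i" for a
  proof -
    have "a div q < m" using that q by (simp add: q_def less_mult_imp_div_less)
    moreover have "a mod q < q" using q by simp
    ultimately have "b' a \<in> deg_le ((a div q) * E + i * (m * E))" "(a div q) * E + i * (m * E) \<le> Suc i * (m * E)"
      unfolding b'_def[abs_def] using deg_le_mult[OF pw b(2)] q_def by auto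
    then show ?thesis by (rule deg_le_mono)
  qed
  moreover have "c a = 0" if c: "\<And>x. x \<in> Z (Suc i) \<Longrightarrow> (\<Sum>a<m ^ Suc i. c a * b' a x) = 0" and a: "a < m ^ Suc i" for c a
  proof -
    define Bj where "Bj j x = (\<Sum>a<q. c (j * q + a) * b a x)" for j x
    have Bjp: "Bj j \<in> polyfun" for j unfolding Bj_def[abs_def] by (intro polyfun_sum pf_mult pf_const b(1))
    have split: "(\<Sum>a<m ^ Suc i. c a * b' a x) = (\<Sum>j<m. f i x ^ j * Bj j x)" for x
    proof -
      have "(\<Sum>a<m ^ Suc i. c a * b' a x) = (\<Sum>j<m. \<Sum>a\<in>{j * q..<j * q + q}. c a * b' a x)"
        using sum.nat_group[of "\<lambda>a. c a * b' a x" q m] by (simp add: q_def)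
      also have "\<dots> = (\<Sum>j<m. f i x ^ j * Bj j x)"
      proof (rule sum.cong[OF refl])
        fix j
        have "(\<Sum>a\<in>{j * q..<j * q + q}. c a * b' a x) = (\<Sum>a<q. c (j * q + a) * b' (j * q + a) x)"
          by (rule sum.reindex_bij_witness[of _ "\<lambda>a. j * q + a" "\<lambda>a. a - j * q"]) auto
        also have "\<dots> = (\<Sum>a<q. f i x ^ j * (c (j * q + a) * b a x))"
          by (rule sum.cong) (use q in \<open>auto simp: b'_def\<close>)
        finally show "(\<Sum>a\<in>{j * q..<j * q + q}. c a * b' a x) = f i x ^ j * Bj j x"
          by (simp add: Bj_def sum_distrib_left)
      qed
      finally show ?thesis .
    qed
    \<comment> \<open>The coefficients of the powers of f_i are removed from the lowest upwards:
      irreducibility of Z (i + 1) allows division by f_i^j, and restriction to Z i, where f_i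
      vanishes, leaves only the block j.\<close>
    have zero: "\<forall>a<q. c (j * q + a) = 0" if "j < m" for j
      using that
    proof (induction j rule: less_induct)
      case (less j)
      have Bz: "Bj j' x = 0" if "j' < j" for j' x using less that by (simp add: Bj_def)
      define R where "R x = (\<Sum>l\<in>{j..<m}. f i x ^ (l - j) * Bj l x)" for x
      have Rp: "R \<in> polyfun" unfolding R_def[abs_def] by (intro polyfun_sum pf_mult polyfun_power f(2)[OF ik] Bjp)
      have "f i x ^ j * R x = 0" if x: "x \<in> Z (Suc i)" for x
      proof -
        have "f i x ^ j * R x = (\<Sum>l\<in>{j..<m}. f i x ^ l * Bj l x)"
          unfolding R_def sum_distrib_left by (rule sum.cong) (auto simp: power_add[symmetric] mult.assoc[symmetric])
        also have "\<dots> = (\<Sum>l<m. f i x ^ l * Bj l x)"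
          by (rule sum.mono_neutral_left) (use Bz in auto)
        also have "\<dots> = 0" using c[OF x] split by simp
        finally show ?thesis .
      qed
      then have "(\<forall>x\<in>Z (Suc i). f i x ^ j = 0) \<or> (\<forall>x\<in>Z (Suc i). R x = 0)"
        using irreducible_alg_prime[OF irr[OF Suc.prems] polyfun_power[OF f(2)[OF ik]] Rp] by blast
      then have R0: "\<forall>x\<in>Z (Suc i). R x = 0" using f(4)[OF ik] by auto
      have "Bj j x = 0" if x: "x \<in> Z i" for x
      proof -
        have "R x = (\<Sum>l\<in>{j..<m}. if l = j then Bj j x else 0)"
          unfolding R_def by (rule sum.cong) (use f(3)[OF ik x] in auto)
        then have "R x = Bj j x" using less.prems by simp
        then show ?thesis using R0 x sub[OF ik] by auto
      qed
      then show ?case using b(3)[of "\<lambda>a. c (j * q + a)"] unfolding Bj_def q_def by blast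
    qed
    have "a = (a div q) * q + a mod q" by simp
    moreover have "a div q < m" using a q by (simp add: q_def less_mult_imp_div_less)
    moreover have "a mod q < q" using q by simp
    ultimately show ?thesis using zero by metis
  qed
  ultimately show ?case by blast
qed

text \<open>A chain of length n + 1 would give m^(n + 1) independent functions of degree O(m), while
  there are only O(m^n) monomials of that degree.\<close>

lemma chain_length_le:
  fixes Z :: "nat \<Rightarrow> (real^'n::finite) set"
  assumes irr: "\<And>i. i \<le> k \<Longrightarrow> irreducible_alg (Z i)" and sub: "\<And>i. i < k \<Longrightarrow> Z i \<subset> Z (Suc i)"
  shows "k \<le> CARD('n)"
proof (rule ccontr)
  assume "\<not> k \<le> CARD('n)"
  define n where "n = CARD('n)"
  have nk: "Suc n \<le> k" using \<open>\<not> k \<le> CARD('n)\<close> by (simp add: n_def)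
  have "\<exists>f\<in>polyfun. (\<forall>x\<in>Z i. f x = 0) \<and> (\<exists>x\<in>Z (Suc i). f x \<noteq> 0)" if i: "i < k" for i
  proof -
    obtain F where F: "F \<subseteq> polyfun" "Z i = zero_set F"
      using irr[of i] i by (auto simp: irreducible_alg_def algebraic_set_def)
    obtain x where "x \<in> Z (Suc i)" "x \<notin> Z i" using sub[OF i] by blast
    then obtain f where "f \<in> F" "f x \<noteq> 0" using F by (auto simp: zero_set_def)
    then show ?thesis using F \<open>x \<in> Z (Suc i)\<close> by (intro bexI[of _ f]) (auto simp: zero_set_def)
  qed
  then have "\<exists>f. \<forall>i. i < k \<longrightarrow> f i \<in> polyfun \<and> (\<forall>x\<in>Z i. f i x = 0) \<and> (\<exists>x\<in>Z (Suc i). f i x \<noteq> 0)"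
    by (intro choice) blast
  then obtain f where f: "\<And>i. i < k \<Longrightarrow> f i \<in> polyfun" "\<And>i x. i < k \<Longrightarrow> x \<in> Z i \<Longrightarrow> f i x = 0"
    "\<And>i. i < k \<Longrightarrow> \<exists>x\<in>Z (Suc i). f i x \<noteq> 0" by blast
  have "\<exists>E. \<forall>i<j. f i \<in> deg_le E" if "j \<le> k" for j
    using that
  proof (induction j)
    case (Suc j)
    then obtain E E' where E: "\<forall>i<j. f i \<in> deg_le E" "f j \<in> deg_le E'" using polyfun_deg_le f(1) by (metis Suc_le_lessD Suc_leD)
    then have "\<forall>i<Suc j. f i \<in> deg_le (max E E')" by (auto simp: less_Suc_eq elim!: deg_le_mono)
    then show ?case by blast
  qed simp
  then obtain E where E: "\<And>i. i < k \<Longrightarrow> f i \<in> deg_le E" by blast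
  \<comment> \<open>With C = (n + 1) E + 1 this m exceeds C^n, while the number of monomials is at
    most (C m)^n = C^n m^n, hence below m^(n + 1).\<close>
  define m where "m = (Suc n * E + 1) ^ n + 1"
  have m: "m > 0" by (simp add: m_def)
  obtain b where b: "\<And>a. a < m ^ Suc n \<Longrightarrow> b a \<in> deg_le (Suc n * (m * E))"
    "\<And>c a. (\<And>x. x \<in> Z (Suc n) \<Longrightarrow> (\<Sum>a<m^Suc n. c a * b a x) = 0) \<Longrightarrow> a < m^Suc n \<Longrightarrow> c a = (0::real)"
    using chain_independent[of k Z m f E, OF irr sub m E f nk] by blast
  define L where "L = {\<alpha> :: 'n \<Rightarrow> nat. \<forall>i. \<alpha> i \<le> Suc n * (m * E)}"
  have Leq: "L = PiE UNIV (\<lambda>_. {..Suc n * (m * E)})" by (auto simp: L_def PiE_UNIV_domain)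
  have finL: "finite L" unfolding Leq by (intro finite_PiE) auto
  have "card L = (Suc n * (m * E) + 1) ^ n" unfolding Leq by (simp add: card_PiE n_def)
  also have "\<dots> \<le> (m * (Suc n * E + 1)) ^ n"
    using m by (intro power_mono) (auto simp: algebra_simps)
  also have "\<dots> = m ^ n * (Suc n * E + 1) ^ n" by (rule power_mult_distrib)
  also have "\<dots> < m ^ n * m" using m by (intro mult_strict_left_mono) (auto simp: m_def)
  finally have card: "card L < card {..<m ^ Suc n}" by (simp add: mult.commute)
  have "\<forall>a. \<exists>C. a < m ^ Suc n \<longrightarrow> (\<forall>x. b a x = (\<Sum>\<alpha>\<in>L. C \<alpha> * (\<Prod>i\<in>UNIV. x $ i ^ \<alpha> i)))"
    using deg_le_rep b(1) unfolding L_def by blast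
  then obtain C where C: "\<And>a x. a < m ^ Suc n \<Longrightarrow> b a x = (\<Sum>\<alpha>\<in>L. C a \<alpha> * (\<Prod>i\<in>UNIV. x $ i ^ \<alpha> i))" by metis
  obtain c where c: "\<exists>a\<in>{..<m ^ Suc n}. c a \<noteq> 0" "\<forall>\<alpha>\<in>L. (\<Sum>a<m ^ Suc n. c a * C a \<alpha>) = 0"
    using underdetermined_system[OF finL _ card, of C] by auto
  have "(\<Sum>a<m ^ Suc n. c a * b a x) = 0" for x
  proof -
    have "(\<Sum>a<m ^ Suc n. c a * b a x) = (\<Sum>a<m ^ Suc n. \<Sum>\<alpha>\<in>L. (c a * C a \<alpha>) * (\<Prod>i\<in>UNIV. x $ i ^ \<alpha> i))"
      by (rule sum.cong) (auto simp: C sum_distrib_left mult.assoc)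
    also have "\<dots> = (\<Sum>\<alpha>\<in>L. (\<Sum>a<m ^ Suc n. c a * C a \<alpha>) * (\<Prod>i\<in>UNIV. x $ i ^ \<alpha> i))"
      by (subst sum.swap) (simp add: sum_distrib_right)
    also have "\<dots> = 0" using c(2) by simp
    finally show ?thesis .
  qed
  then show False using b(2)[of c] c(1) by blast
qed

section \<open>Zariski closures and density\<close>

definition zcl :: "(real^'n::finite) set \<Rightarrow> (real^'n) set" where
  "zcl S = zero_set {f \<in> polyfun. \<forall>x\<in>S. f x = 0}"

lemma zcl_props:
  shows "S \<subseteq> zcl S" "algebraic_set (zcl S)" "f \<in> polyfun \<Longrightarrow> (\<And>x. x \<in> S \<Longrightarrow> f x = 0) \<Longrightarrow> x \<in> zcl S \<Longrightarrow> f x = 0"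
    "algebraic_set Z \<Longrightarrow> S \<subseteq> Z \<Longrightarrow> zcl S \<subseteq> Z"
proof -
  show "algebraic_set (zcl S)" unfolding zcl_def algebraic_set_def
    by (intro exI[of _ "{f \<in> polyfun. \<forall>x\<in>S. f x = 0}"]) simp
  show "zcl S \<subseteq> Z" if Z: "algebraic_set Z" "S \<subseteq> Z"
  proof -
    obtain F where F: "F \<subseteq> polyfun" "Z = zero_set F" using Z(1) by (auto simp: algebraic_set_def)
    then have "F \<subseteq> {f \<in> polyfun. \<forall>x\<in>S. f x = 0}" using Z(2) by (auto simp: zero_set_def)
    then show ?thesis unfolding F(2) zcl_def zero_set_def by auto
  qed
qed (auto simp: zcl_def zero_set_def)

text \<open>Each of the two covering algebraic sets is given by a single equation, and the product
  of the two equations vanishes on S.\<close>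

lemma irreducible_zcl:
  fixes S :: "(real^'n::finite) set"
  assumes ne: "S \<noteq> {}" and prime: "\<And>f g. f \<in> polyfun \<Longrightarrow> g \<in> polyfun \<Longrightarrow> (\<And>x. x \<in> S \<Longrightarrow> f x * g x = 0) \<Longrightarrow>
      (\<forall>x\<in>S. f x = 0) \<or> (\<forall>x\<in>S. g x = 0)"
  shows "irreducible_alg (zcl S)"
  unfolding irreducible_alg_def
proof (intro conjI allI impI)
  show "algebraic_set (zcl S)" "zcl S \<noteq> {}" using zcl_props ne by blast+
  fix Z1 Z2 :: "(real^'n) set" assume Z: "algebraic_set Z1" "algebraic_set Z2" "zcl S \<subseteq> Z1 \<union> Z2"
  obtain f where f: "f \<in> polyfun" "Z1 = {x. f x = 0}" using algebraic_set_hypersurface[OF Z(1)] by blast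
  obtain g where g: "g \<in> polyfun" "Z2 = {x. g x = 0}" using algebraic_set_hypersurface[OF Z(2)] by blast
  have "f x * g x = 0" if "x \<in> S" for x
  proof -
    have "x \<in> Z1 \<union> Z2" using that zcl_props(1)[of S] Z(3) by blast
    then show ?thesis using f(2) g(2) by auto
  qed
  then have "S \<subseteq> Z1 \<or> S \<subseteq> Z2" using prime[OF f(1) g(1)] f g by blast
  then show "zcl S \<subseteq> Z1 \<or> zcl S \<subseteq> Z2" using zcl_props(4) Z by blast
qed

lemma subspace_flag:
  fixes T :: "'a::euclidean_space set"
  assumes "subspace T"
  shows "\<exists>S. S (dim T) = T \<and> (\<forall>i\<le>dim T. subspace (S i)) \<and> (\<forall>i<dim T. S i \<subset> S (Suc i))"
  using assms
proof (induction "dim T" arbitrary: T)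
  case 0
  then show ?case unfolding 0(1)[symmetric] by (intro exI[of _ "\<lambda>_. T"]) simp
next
  case (Suc d)
  obtain T' where T': "subspace T'" "T' \<subseteq> span T" "dim T' = d"
    using choose_subspace_of_subspace[of d T] Suc(2) by auto
  then obtain S where S: "S d = T'" "\<forall>i\<le>d. subspace (S i)" "\<forall>i<d. S i \<subset> S (Suc i)" using Suc(1)[of T'] by auto
  have "T' \<subset> T" using T' Suc by (metis less_irrefl lessI psubsetI span_eq_iff)
  then show ?case using S Suc(2)[symmetric] Suc(3)
    by (intro exI[of _ "\<lambda>i. if i \<le> d then S i else T"]) (auto simp: le_Suc_eq less_Suc_eq)
qed

text \<open>The bound on chain lengths makes the supremum in \<open>alg_dim\<close> an actual upper
  bound.\<close>

lemma alg_dim_bound: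
  fixes Z :: "nat \<Rightarrow> (real^'n::finite) set"
  assumes "\<And>i. i \<le> k \<Longrightarrow> irreducible_alg (Z i) \<and> Z i \<subseteq> V" "\<And>i. i < k \<Longrightarrow> Z i \<subset> Z (Suc i)"
  shows "k \<le> alg_dim V"
proof -
  let ?S = "{k. \<exists>Z :: nat \<Rightarrow> (real^'n) set.
      (\<forall>i\<le>k. irreducible_alg (Z i) \<and> Z i \<subseteq> V) \<and> (\<forall>i<k. Z i \<subset> Z (Suc i))}"
  have "k \<in> ?S" using assms by blast
  moreover have "bdd_above ?S"
    using chain_length_le by (intro bdd_aboveI[of _ "CARD('n)"]) blast
  ultimately show ?thesis unfolding alg_dim_def by (rule cSup_upper)
qed

context chart begin

text \<open>If q vanished on V near x0 but not on all of V, then the Zariski closures of the slices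
  along a full flag of T, topped by V itself, would form a chain longer than the dimension.\<close>

theorem chart_dense:
  assumes irr: "irreducible_alg V" and q: "q \<in> polyfun" and W: "open W" "x0 \<in> W" and z: "\<And>x. x \<in> V \<inter> W \<Longrightarrow> q x = 0" and x: "x \<in> V"
  shows "q x = 0"
proof (rule ccontr)
  assume qx: "q x \<noteq> 0"
  define d where "d = dim T"
  obtain S where S: "S d = T" "\<And>i. i \<le> d \<Longrightarrow> subspace (S i)" "\<And>i. i < d \<Longrightarrow> S i \<subset> S (Suc i)"
    using subspace_flag[OF subT] d_def by blast
  define Z where "Z i = (if i \<le> d then zcl (slice (S i)) else V)" for i
  have ST: "S i \<subseteq> T" if "i \<le> d" for i
    using that
  proof (induction "d - i" arbitrary: i)
    case 0
    then show ?case using S(1) by simp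
  next
    case (Suc n)
    have "i < d" using Suc(2) by linarith
    moreover have "S (Suc i) \<subseteq> T" using Suc(1)[of "Suc i"] Suc(2) by simp
    ultimately show ?case using S(3)[of i] by blast
  qed
  have slV: "slice (S i) \<subseteq> V" if "i \<le> d" for i using XT_in_V ST[OF that] by (auto simp: slice_def)
  have qslice: "q (X y) = 0" if y: "y \<in> T" "y \<in> ball 0 r" for y
  proof -
    have "open (X -` W \<inter> ball 0 r)" using contX W(1) by (meson continuous_on_open_vimage open_ball)
    then have "open ((\<lambda>s::real. s *\<^sub>R y) -` (X -` W \<inter> ball 0 r))" by (intro open_vimage) (auto intro!: continuous_intros)
    moreover have "0 \<in> (\<lambda>s::real. s *\<^sub>R y) -` (X -` W \<inter> ball 0 r)" using X0 W(2) r by simp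
    ultimately obtain t where t: "t > 0" "ball 0 t \<subseteq> (\<lambda>s::real. s *\<^sub>R y) -` (X -` W \<inter> ball 0 r)"
      using open_contains_ball by metis
    have "q (X (0 + y)) = 0"
    proof (rule chart_identity[OF q])
      show "(D y ^^ k) q (X 0) = 0" for k
      proof (rule chart_local_zero[OF q _ t(1)])
        fix s :: real assume "\<bar>s\<bar> < t"
        then have "s \<in> ball 0 t" by (simp add: dist_real_def)
        then have *: "s *\<^sub>R y \<in> ball 0 r" "X (s *\<^sub>R y) \<in> W" using t(2) by auto
        then have "X (s *\<^sub>R y) \<in> V" using XT_in_V y subT subspace_scale by blast
        then show "0 + s *\<^sub>R y \<in> ball 0 r \<and> q (X (0 + s *\<^sub>R y)) = 0" using * z by auto
      qed (use r in auto)
    qed (use y r in auto)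
    then show ?thesis by simp
  qed
  have "Suc d \<le> alg_dim V"
  proof (rule alg_dim_bound[of "Suc d" Z])
    fix i assume i: "i \<le> Suc d"
    show "irreducible_alg (Z i) \<and> Z i \<subseteq> V"
    proof (cases "i \<le> d")
      case True
      have "X 0 \<in> slice (S i)" unfolding slice_def using S(2)[OF True] r by (simp add: subspace_0)
      then have "irreducible_alg (zcl (slice (S i)))"
        using slice_prime[OF S(2)[OF True]] by (intro irreducible_zcl) blast+
      moreover have "zcl (slice (S i)) \<subseteq> V" using zcl_props(4) algV slV[OF True] by blast
      ultimately show ?thesis using True by (simp add: Z_def)
    qed (use irr in \<open>auto simp: Z_def\<close>)
  next
    fix i assume "i < Suc d"
    then consider "i < d" | "i = d" by linarith
    then show "Z i \<subset> Z (Suc i)"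
    proof cases
      case 1
      have "slice (S i) \<subseteq> slice (S (Suc i))" using S(3)[OF 1] by (auto simp: slice_def)
      then have "zcl (slice (S i)) \<subseteq> zcl (slice (S (Suc i)))" using zcl_props(1,2,4) by (meson order_trans)
      moreover have "zcl (slice (S i)) \<noteq> zcl (slice (S (Suc i)))"
      proof
        assume eq: "zcl (slice (S i)) = zcl (slice (S (Suc i)))"
        \<comment> \<open>A direction b in the next member of the flag, orthogonal to the present
          one: the polynomial b . \<Psi> vanishes on the smaller slice but not at X (\<tau> b),
          which separates the closures.\<close>
        obtain e where e: "e \<in> S (Suc i)" "e \<notin> S i" using S(3)[OF 1] by blast
        have sub: "subspace (S i)" "subspace (S (Suc i))" using S(2) 1 by auto
        obtain a b where ab: "a \<in> span (S i)" "\<And>w. w \<in> span (S i) \<Longrightarrow> orthogonal b w" "e = a + b"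
          using orthogonal_subspace_decomp_exists[of "S i" e] by blast
        have aS: "a \<in> S i" using ab(1) sub(1) by (metis span_eq_iff)
        have bne: "b \<noteq> 0" using ab(3) aS e(2) by auto
        have bS: "b \<in> S (Suc i)" using ab(3) aS e(1) S(3)[OF 1] sub(2)
          by (metis add_diff_cancel_left' psubsetD subspace_diff)
        have van: "b \<bullet> \<Psi> x = 0" if "x \<in> slice (S i)" for x
          using that PsiX ab(2) by (auto simp: slice_def orthogonal_def span_base)
        define \<tau> where "\<tau> = r / (2 * norm b)"
        have \<tau>: "\<tau> *\<^sub>R b \<in> ball 0 r" "\<tau> \<noteq> 0" using r bne by (auto simp: \<tau>_def)
        have "X (\<tau> *\<^sub>R b) \<in> slice (S (Suc i))" unfolding slice_def using \<tau> bS sub(2) subspace_scale by blast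
        then have "X (\<tau> *\<^sub>R b) \<in> zcl (slice (S i))" using eq zcl_props(1) by blast
        then have "b \<bullet> \<Psi> (X (\<tau> *\<^sub>R b)) = 0"
          using zcl_props(3)[OF Psi_poly[of b], of "slice (S i)" "X (\<tau> *\<^sub>R b)"] van by blast
        then show False using PsiX[OF \<tau>(1)] \<tau>(2) bne by simp
      qed
      ultimately show ?thesis using 1 by (auto simp: Z_def)
    next
      case 2
      \<comment> \<open>The last inclusion is strict because q vanishes on the slice along T but not
        at x.\<close>
      have "zcl (slice T) \<subseteq> V" using zcl_props(4) algV slV[of d] S(1) by auto
      moreover have "q z = 0" if "z \<in> slice T" for z using that qslice by (auto simp: slice_def)
      then have "x \<notin> zcl (slice T)" using qx zcl_props(3)[OF q, of "slice T" x] by blast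
      ultimately show ?thesis using 2 S(1) x by (auto simp: Z_def)
    qed
  qed
  moreover have "alg_dim V \<le> CARD('n)"
    unfolding alg_dim_def
  proof (rule cSup_least)
    show "{k. \<exists>Z. (\<forall>i\<le>k. irreducible_alg (Z i) \<and> Z i \<subseteq> V) \<and> (\<forall>i<k. Z i \<subset> Z (Suc i))} \<noteq> {}"
      using irr by (auto intro!: exI[of _ 0] exI[of _ "\<lambda>_. V"])
  qed (use chain_length_le in blast)
  ultimately show False using dimT d_def by simp
qed

end

text \<open>This can fail at singular points: an irreducible real curve may have an isolated point,
  and the complement of that point is a nonempty Zariski open subset.\<close>

theorem nonsingular_dense:
  fixes V :: "(real^'n::finite) set"
  assumes "irreducible_alg V" "nonsingular V" "q \<in> polyfun" "\<exists>x\<in>V. q x \<noteq> 0" "x0 \<in> V" "open W" "x0 \<in> W"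
  shows "\<exists>x\<in>V \<inter> W. q x \<noteq> 0"
proof -
  have "algebraic_set V" using assms(1) by (simp add: irreducible_alg_def)
  then obtain T r X \<Psi> U \<Delta> D where "chart V x0 T r X \<Psi> U \<Delta> D" using chart_exists assms by blast
  then show ?thesis using chart.chart_dense[of V x0 T r X \<Psi> U \<Delta> D q W] assms by blast
qed

section \<open>Classes of rational functions\<close>

text \<open>Germs at the generic point: functions agreeing with F on a nonempty principal open set.
  F is arbitrary here; the elements of R(V) are the classes of quotients p/q.\<close>

definition cl :: "(real^'n::finite) set \<Rightarrow> (real^'n \<Rightarrow> real) \<Rightarrow> (real^'n \<Rightarrow> real) set" where
  "cl V F = {g. \<exists>q\<in>polyfun. (\<exists>x\<in>V. q x \<noteq> 0) \<and> (\<forall>x\<in>V. q x \<noteq> 0 \<longrightarrow> g x = F x)}"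

text \<open>The relation F q = p is required on all of V, zeros of q included, and F is continuous
  there; so F is the continuous extension and not merely the quotient.\<close>

definition regul_rep :: "(real^'n::finite) set \<Rightarrow> (real^'n \<Rightarrow> real) \<Rightarrow> (real^'n \<Rightarrow> real) \<Rightarrow> (real^'n \<Rightarrow> real) \<Rightarrow> bool" where
  "regul_rep V F p q \<longleftrightarrow> continuous_on V F \<and> p \<in> polyfun \<and> q \<in> polyfun \<and> (\<exists>x\<in>V. q x \<noteq> 0) \<and> (\<forall>x\<in>V. F x * q x = p x)"

definition regul :: "(real^'n::finite) set \<Rightarrow> (real^'n \<Rightarrow> real) \<Rightarrow> bool" where
  "regul V F \<longleftrightarrow> (\<exists>p q. regul_rep V F p q)"

lemma clI: "q \<in> polyfun \<Longrightarrow> \<exists>x\<in>V. q x \<noteq> 0 \<Longrightarrow> (\<And>x. x \<in> V \<Longrightarrow> q x \<noteq> 0 \<Longrightarrow> g x = F x) \<Longrightarrow> g \<in> cl V F"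
  unfolding cl_def by blast

lemma clE:
  assumes "g \<in> cl V F"
  obtains q where "q \<in> polyfun" "\<exists>x\<in>V. q x \<noteq> 0" "\<And>x. x \<in> V \<Longrightarrow> q x \<noteq> 0 \<Longrightarrow> g x = F x"
  using assms unfolding cl_def by blast

lemma zopen_nonempty_iff:
  "(\<exists>U. zopen_in V U \<and> U \<noteq> {} \<and> (\<forall>x\<in>U. P x)) \<longleftrightarrow> (\<exists>q\<in>polyfun. (\<exists>x\<in>V. q x \<noteq> 0) \<and> (\<forall>x\<in>V. q x \<noteq> 0 \<longrightarrow> P x))"
proof
  assume "\<exists>U. zopen_in V U \<and> U \<noteq> {} \<and> (\<forall>x\<in>U. P x)"
  then obtain F x where F: "F \<subseteq> polyfun" "x \<in> V - zero_set F" "\<forall>x\<in>V - zero_set F. P x" by (auto simp: zopen_in_def)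
  then obtain q where q: "q \<in> F" "q x \<noteq> 0" by (auto simp: zero_set_def)
  then have "\<forall>y\<in>V. q y \<noteq> 0 \<longrightarrow> P y" using F(3) by (auto simp: zero_set_def)
  then show "\<exists>q\<in>polyfun. (\<exists>x\<in>V. q x \<noteq> 0) \<and> (\<forall>x\<in>V. q x \<noteq> 0 \<longrightarrow> P x)" using F q by blast
next
  assume "\<exists>q\<in>polyfun. (\<exists>x\<in>V. q x \<noteq> 0) \<and> (\<forall>x\<in>V. q x \<noteq> 0 \<longrightarrow> P x)"
  then obtain q where q: "q \<in> polyfun" "\<exists>x\<in>V. q x \<noteq> 0" "\<forall>x\<in>V. q x \<noteq> 0 \<longrightarrow> P x" by blast
  then show "\<exists>U. zopen_in V U \<and> U \<noteq> {} \<and> (\<forall>x\<in>U. P x)"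
    by (intro exI[of _ "V - zero_set {q}"]) (auto simp: zopen_in_def zero_set_def intro!: exI[of _ "{q}"])
qed

locale variety =
  fixes V :: "(real^'n::finite) set"
  assumes irr: "irreducible_alg V" and ns: "nonsingular V"
begin

lemma algV: "algebraic_set V" using irr by (simp add: irreducible_alg_def)

lemma dense: "q \<in> polyfun \<Longrightarrow> \<exists>x\<in>V. q x \<noteq> 0 \<Longrightarrow> x0 \<in> V \<Longrightarrow> open W \<Longrightarrow> x0 \<in> W \<Longrightarrow> \<exists>x\<in>V. x \<in> W \<and> q x \<noteq> 0"
  using nonsingular_dense[OF irr ns] by (metis IntD1 IntD2)

lemma nz_mult: "p \<in> polyfun \<Longrightarrow> q \<in> polyfun \<Longrightarrow> \<exists>x\<in>V. p x \<noteq> 0 \<Longrightarrow> \<exists>x\<in>V. q x \<noteq> 0 \<Longrightarrow> \<exists>x\<in>V. p x * q x \<noteq> 0"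
  using irreducible_alg_prime[OF irr] by blast

text \<open>By density of the nonzero locus of q in the Euclidean topology.\<close>

lemma continuous_eqI:
  assumes F: "continuous_on V F" and G: "continuous_on V G" and q: "q \<in> polyfun" "\<exists>x\<in>V. q x \<noteq> 0"
    and eq: "\<And>x. x \<in> V \<Longrightarrow> q x \<noteq> 0 \<Longrightarrow> F x = (G x :: real)" and x: "x \<in> V"
  shows "F x = G x"
proof (rule ccontr)
  assume ne: "F x \<noteq> G x"
  have "continuous_on V (\<lambda>x. F x - G x)" using F G by (intro continuous_intros)
  then obtain W where W: "open W" "W \<inter> V = (\<lambda>x. F x - G x) -` (- {0}) \<inter> V"
    using continuous_on_open_invariant[of V "\<lambda>x. F x - G x"] by (metis open_Compl closed_singleton)
  have "x \<in> W" using W(2) ne x by auto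
  then obtain z where z: "z \<in> V" "z \<in> W" "q z \<noteq> 0" using dense[OF q x W(1)] by blast
  then have "z \<in> (\<lambda>x. F x - G x) -` (- {0}) \<inter> V" using W(2) by blast
  then show False using eq[OF z(1,3)] by simp
qed

lemma cl_cong:
  assumes "q \<in> polyfun" "\<exists>x\<in>V. q x \<noteq> 0" "\<And>x. x \<in> V \<Longrightarrow> q x \<noteq> 0 \<Longrightarrow> F x = G x"
  shows "cl V F = cl V G"
proof -
  have sub: "cl V F \<subseteq> cl V G" if eq: "\<And>x. x \<in> V \<Longrightarrow> q x \<noteq> 0 \<Longrightarrow> F x = G x" for F G :: "real^'n \<Rightarrow> real"
  proof
    fix g assume "g \<in> cl V F"
    then obtain s where s: "s \<in> polyfun" "\<exists>x\<in>V. s x \<noteq> 0" "\<And>x. x \<in> V \<Longrightarrow> s x \<noteq> 0 \<Longrightarrow> g x = F x" by (rule clE) blast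
    show "g \<in> cl V G" 
      by (rule clI[OF pf_mult[OF s(1) assms(1)] nz_mult[OF s(1) assms(1) s(2) assms(2)]]) (use s(3) eq in auto)
  qed
  show ?thesis using sub[of F G] sub[of G F] assms(3) by (simp add: subset_antisym)
qed

lemma cl_self: "F \<in> cl V F"
proof -
  obtain x where "x \<in> V" using irr by (auto simp: irreducible_alg_def)
  then show ?thesis unfolding cl_def by (auto intro!: bexI[of _ "\<lambda>x. 1"] pf_const)
qed

lemma cl_eqD: "cl V F = cl V G \<Longrightarrow> \<exists>q\<in>polyfun. (\<exists>x\<in>V. q x \<noteq> 0) \<and> (\<forall>x\<in>V. q x \<noteq> 0 \<longrightarrow> F x = G x)"
  using cl_self[of F] by (simp add: cl_def)

lemma cl_mem: "g \<in> cl V F \<Longrightarrow> cl V g = cl V F"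
  by (erule clE, rule cl_cong)

lemma cl_continuous_inj:
  "cl V F = cl V G \<Longrightarrow> continuous_on V F \<Longrightarrow> continuous_on V G \<Longrightarrow> x \<in> V \<Longrightarrow> F x = G x"
  using cl_eqD continuous_eqI by blast

lemma rf_add_cl: "rf_add (cl V F) (cl V G) = cl V (\<lambda>x. F x + G x)"
proof safe
  fix h assume "h \<in> rf_add (cl V F) (cl V G)"
  then obtain a b where h: "h = (\<lambda>x. a x + b x)" "a \<in> cl V F" "b \<in> cl V G" by (auto simp: rf_add_def)
  obtain p where p: "p \<in> polyfun" "\<exists>x\<in>V. p x \<noteq> 0" "\<And>x. x \<in> V \<Longrightarrow> p x \<noteq> 0 \<Longrightarrow> a x = F x" using h(2) by (rule clE) blast
  obtain q where q: "q \<in> polyfun" "\<exists>x\<in>V. q x \<noteq> 0" "\<And>x. x \<in> V \<Longrightarrow> q x \<noteq> 0 \<Longrightarrow> b x = G x" using h(3) by (rule clE) blast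
  show "h \<in> cl V (\<lambda>x. F x + G x)"
    by (rule clI[OF pf_mult[OF p(1) q(1)] nz_mult[OF p(1) q(1) p(2) q(2)]]) (use p(3) q(3) h(1) in auto)
next
  fix h assume h: "h \<in> cl V (\<lambda>x. F x + G x)"
  then obtain q where q: "q \<in> polyfun" "\<exists>x\<in>V. q x \<noteq> 0" "\<And>x. x \<in> V \<Longrightarrow> q x \<noteq> 0 \<Longrightarrow> h x = F x + G x" by (rule clE) blast
  have "(\<lambda>x. h x - F x) \<in> cl V G" by (rule clI[OF q(1,2)]) (use q(3) in simp)
  moreover have "h = (\<lambda>x. F x + (h x - F x))" by auto
  ultimately show "h \<in> rf_add (cl V F) (cl V G)" unfolding rf_add_def using cl_self[of F]
    by (intro CollectI exI[of _ F] exI[of _ "\<lambda>x. h x - F x"] conjI)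
qed

lemma rf_mult_cl: "rf_mult (cl V F) (cl V G) = cl V (\<lambda>x. F x * G x)"
proof safe
  fix h assume "h \<in> rf_mult (cl V F) (cl V G)"
  then obtain a b where h: "h = (\<lambda>x. a x * b x)" "a \<in> cl V F" "b \<in> cl V G" by (auto simp: rf_mult_def)
  obtain p where p: "p \<in> polyfun" "\<exists>x\<in>V. p x \<noteq> 0" "\<And>x. x \<in> V \<Longrightarrow> p x \<noteq> 0 \<Longrightarrow> a x = F x" using h(2) by (rule clE) blast
  obtain q where q: "q \<in> polyfun" "\<exists>x\<in>V. q x \<noteq> 0" "\<And>x. x \<in> V \<Longrightarrow> q x \<noteq> 0 \<Longrightarrow> b x = G x" using h(3) by (rule clE) blast
  show "h \<in> cl V (\<lambda>x. F x * G x)"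
    by (rule clI[OF pf_mult[OF p(1) q(1)] nz_mult[OF p(1) q(1) p(2) q(2)]]) (use p(3) q(3) h(1) in auto)
next
  fix h assume h: "h \<in> cl V (\<lambda>x. F x * G x)"
  then obtain q where q: "q \<in> polyfun" "\<exists>x\<in>V. q x \<noteq> 0" "\<forall>x\<in>V. q x \<noteq> 0 \<longrightarrow> h x = F x * G x" by (auto simp: cl_def)
  \<comment> \<open>Every member h of the class of the product must itself be a product: F times G
    on the open set, and h times 1 off it.\<close>
  define a where "a x = (if x \<in> V \<and> q x \<noteq> 0 then F x else h x)" for x
  define b where "b x = (if x \<in> V \<and> q x \<noteq> 0 then G x else 1)" for x
  have "a \<in> cl V F" "b \<in> cl V G" unfolding cl_def using q by (auto simp: a_def b_def intro!: bexI[of _ q])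
  moreover have "h = (\<lambda>x. a x * b x)" using q by (auto simp: a_def b_def fun_eq_iff)
  ultimately show "h \<in> rf_mult (cl V F) (cl V G)" unfolding rf_mult_def by blast
qed

lemma ratfun_class_cl:
  assumes "q \<in> polyfun" "\<exists>x\<in>V. q x \<noteq> 0"
  shows "ratfun_class V p q = cl V (\<lambda>x. p x / q x)"
proof safe
  fix g assume "g \<in> ratfun_class V p q"
  then show "g \<in> cl V (\<lambda>x. p x / q x)" unfolding ratfun_class_def zopen_nonempty_iff cl_def by blast
next
  fix g assume "g \<in> cl V (\<lambda>x. p x / q x)"
  then obtain s where s: "s \<in> polyfun" "\<exists>x\<in>V. s x \<noteq> 0" "\<forall>x\<in>V. s x \<noteq> 0 \<longrightarrow> g x = p x / q x" by (auto simp: cl_def)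
  then show "g \<in> ratfun_class V p q" unfolding ratfun_class_def zopen_nonempty_iff
    using nz_mult[OF s(1) assms(1) s(2) assms(2)] by (auto intro!: bexI[of _ "\<lambda>x. s x * q x"] pf_mult assms(1))
qed

lemma nonempty: "\<exists>x. x \<in> V" using irr by (auto simp: irreducible_alg_def)

lemma coord_ring_cl: "coord_ring V = cl V ` polyfun"
proof -
  have "ratfun_class V p (\<lambda>x. 1) = cl V p" for p
    using ratfun_class_cl[OF pf_const[of 1], of p] nonempty by auto
  then show ?thesis unfolding coord_ring_def by auto
qed

lemma rf_const_cl: "rf_const V c = cl V (\<lambda>x. c)"
  unfolding rf_const_def using ratfun_class_cl[OF pf_const[of 1], of "\<lambda>x. c"] nonempty by auto

text \<open>A continuous representative satisfies g q = p on an open set, hence by density on all of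
  V.\<close>

lemma R0_cl: "R0 V = {cl V F | F. regul V F}"
proof safe
  fix c assume "c \<in> R0 V"
  then obtain g p q where c: "c = ratfun_class V p q" "p \<in> polyfun" "q \<in> polyfun" "\<exists>x\<in>V. q x \<noteq> 0"
    "g \<in> c" "continuous_on V g" by (auto simp: R0_def RV_def)
  have cc: "c = cl V (\<lambda>x. p x / q x)" using c ratfun_class_cl by simp
  then have cg: "c = cl V g" using cl_mem c(5) by blast
  obtain s where s: "s \<in> polyfun" "\<exists>x\<in>V. s x \<noteq> 0" "\<forall>x\<in>V. s x \<noteq> 0 \<longrightarrow> g x = p x / q x"
    using c(5) cc by (auto simp: cl_def)
  have "g x * q x = p x" if "x \<in> V" for x
  proof (rule continuous_eqI[of "\<lambda>x. g x * q x" p "\<lambda>x. s x * q x"])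
    show "continuous_on V (\<lambda>x. g x * q x)" "continuous_on V p"
      using c(2,3,6) polyfun_continuous_on continuous_on_mult by blast+
    show "(\<lambda>x. s x * q x) \<in> polyfun" "\<exists>x\<in>V. s x * q x \<noteq> 0" using s c nz_mult by (auto intro: pf_mult)
  qed (use s that in auto)
  then have "regul V g" unfolding regul_def regul_rep_def using c by blast
  then show "\<exists>F. c = cl V F \<and> regul V F" using cg by blast
next
  fix F assume "regul V F"
  then obtain p q where F: "continuous_on V F" "p \<in> polyfun" "q \<in> polyfun" "\<exists>x\<in>V. q x \<noteq> 0" "\<forall>x\<in>V. F x * q x = p x"
    by (auto simp: regul_def regul_rep_def)
  have "p x / q x = F x" if "x \<in> V" "q x \<noteq> 0" for x using F(5) that by (auto simp: field_simps)
  then have "cl V F = ratfun_class V p q"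
    using ratfun_class_cl[OF F(3,4)] cl_cong[OF F(3,4), of "\<lambda>x. p x / q x" F] by simp
  then show "cl V F \<in> R0 V" unfolding R0_def RV_def using F cl_self[of F] by blast
qed

lemma regul_poly: "p \<in> polyfun \<Longrightarrow> regul_rep V p p (\<lambda>x. 1)"
  unfolding regul_rep_def using nonempty by (auto intro: polyfun_continuous_on pf_const)

lemma regul_rep_add:
  assumes "regul_rep V F p q" "regul_rep V G s t"
  shows "regul_rep V (\<lambda>x. F x + G x) (\<lambda>x. p x * t x + s x * q x) (\<lambda>x. q x * t x)"
  unfolding regul_rep_def
proof (intro conjI ballI)
  show "continuous_on V (\<lambda>x. F x + G x)" using assms by (intro continuous_on_add) (auto simp: regul_rep_def)
  show "(\<lambda>x. p x * t x + s x * q x) \<in> polyfun" "(\<lambda>x. q x * t x) \<in> polyfun"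
    using assms by (auto simp: regul_rep_def intro!: polyfun.intros)
  show "\<exists>x\<in>V. q x * t x \<noteq> 0" using assms nz_mult[of q t] unfolding regul_rep_def by blast
  fix x assume x: "x \<in> V"
  have "(F x + G x) * (q x * t x) = (F x * q x) * t x + (G x * t x) * q x" by (simp add: algebra_simps)
  then show "(F x + G x) * (q x * t x) = p x * t x + s x * q x" using assms x by (simp only: regul_rep_def)
qed

lemma regul_rep_mult:
  assumes "regul_rep V F p q" "regul_rep V G s t"
  shows "regul_rep V (\<lambda>x. F x * G x) (\<lambda>x. p x * s x) (\<lambda>x. q x * t x)"
  unfolding regul_rep_def
proof (intro conjI ballI)
  show "continuous_on V (\<lambda>x. F x * G x)" using assms by (intro continuous_on_mult) (auto simp: regul_rep_def)
  show "(\<lambda>x. p x * s x) \<in> polyfun" "(\<lambda>x. q x * t x) \<in> polyfun"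
    using assms by (auto simp: regul_rep_def intro!: polyfun.intros)
  show "\<exists>x\<in>V. q x * t x \<noteq> 0" using assms nz_mult[of q t] unfolding regul_rep_def by blast
  fix x assume x: "x \<in> V"
  have "F x * G x * (q x * t x) = (F x * q x) * (G x * t x)" by (simp add: algebra_simps)
  then show "F x * G x * (q x * t x) = p x * s x" using assms x by (simp only: regul_rep_def)
qed

lemma regul_intros:
  "p \<in> polyfun \<Longrightarrow> regul V p" "regul V F \<Longrightarrow> regul V G \<Longrightarrow> regul V (\<lambda>x. F x + G x)"
  "regul V F \<Longrightarrow> regul V G \<Longrightarrow> regul V (\<lambda>x. F x * G x)"
  unfolding regul_def using regul_poly regul_rep_add regul_rep_mult by blast+

end

section \<open>Extension of polynomials and limits to Puiseux series\<close>

text \<open>A relation, because a polynomial function carries no distinguished expression. That the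
  value at Puiseux points of V does not depend on the expression is
  \<open>pext_eq_on_V\<close>.\<close>

inductive pext :: "(real^'n::finite \<Rightarrow> real) \<Rightarrow> (puis^'n \<Rightarrow> puis) \<Rightarrow> bool" where
  pext_const: "pext (\<lambda>x. c) (\<lambda>x. rk c)"
| pext_coord: "pext (\<lambda>x. x $ i) (\<lambda>x. x $ i)"
| pext_add: "pext f P \<Longrightarrow> pext g Q \<Longrightarrow> pext (\<lambda>x. f x + g x) (\<lambda>x. P x + Q x)"
| pext_mult: "pext f P \<Longrightarrow> pext g Q \<Longrightarrow> pext (\<lambda>x. f x * g x) (\<lambda>x. P x * Q x)"

lemma pext_ex: "f \<in> polyfun \<Longrightarrow> \<exists>P. pext f P"
  by (induction rule: polyfun.induct) (auto intro: pext.intros)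

lemma pext_polyfun: "pext f P \<Longrightarrow> f \<in> polyfun"
  by (induction rule: pext.induct) (auto intro: polyfun.intros)

definition rkv :: "real^'n \<Rightarrow> puis^'n" where "rkv x = (\<chi> i. rk (x $ i))"

definition stv :: "puis^'n \<Rightarrow> real^'n" where "stv x = (\<chi> i. st (x $ i))"

definition finv :: "puis^'n \<Rightarrow> bool" where "finv x \<longleftrightarrow> (\<forall>i. fin (x $ i))"

lemma pext_rkv: "pext f P \<Longrightarrow> P (rkv x) = rk (f x)"
  by (induction rule: pext.induct) (auto simp: rkv_def)

lemma pext_fin: "pext f P \<Longrightarrow> finv x \<Longrightarrow> fin (P x) \<and> st (P x) = f (stv x)"
  by (induction rule: pext.induct) (auto simp: finv_def stv_def fin_st_ops)

text \<open>The squared distance, a polynomial expression meaningful over both fields.\<close>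

definition dsq :: "('a::comm_ring_1)^'n::finite \<Rightarrow> 'a^'n \<Rightarrow> 'a" where
  "dsq x y = (\<Sum>i\<in>UNIV. (x $ i - y $ i)\<^sup>2)"

lemma dsq_dist: "dsq x y = (dist x y)\<^sup>2" for x y :: "real^'n::finite"
  by (simp add: dsq_def dist_vec_def L2_set_def dist_real_def sum_nonneg)

section \<open>Terms with real constants and the limit formula\<close>

definition has_consts :: "('p,real,'q,puis) cfun set \<Rightarrow> bool" where
  "has_consts G \<longleftrightarrow> (\<forall>r. CF (\<lambda>_. r) (\<lambda>_. rk r) \<in> G)"

lemma has_consts_add: "has_consts G \<Longrightarrow> has_consts (add_var G)" "has_consts G \<Longrightarrow> has_consts (add_vec G)"
  unfolding has_consts_def add_var_def add_vec_def by (force intro: image_eqI[of _ _ "CF (\<lambda>_. _) (\<lambda>_. rk _)"])+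

lemma pol_CF_const: "has_consts G \<Longrightarrow> CF (\<lambda>_. r) (\<lambda>_. rk r) \<in> pol G"
  by (auto simp: has_consts_def intro: pol_gen)

lemma pol_CF_ops:
  assumes "CF a b \<in> pol G" "CF c d \<in> pol G"
  shows "CF (\<lambda>p. a p + c p) (\<lambda>q. b q + d q) \<in> pol G" "CF (\<lambda>p. a p * c p) (\<lambda>q. b q * d q) \<in> pol G"
    "CF (\<lambda>p. a p - c p) (\<lambda>q. b q - d q) \<in> pol G"
  using pol_add[OF assms] pol_mult[OF assms] pol_add[OF assms(1) pol_minus[OF assms(2)]]
  by (simp_all add: plus_cfun_def times_cfun_def uminus_cfun_def)

lemma pol_CF_power: "CF a b \<in> pol G \<Longrightarrow> CF (\<lambda>p. a p ^ n) (\<lambda>q. b q ^ n) \<in> pol G"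
  by (induction n) (use pol_1[unfolded one_cfun_def] in \<open>auto intro: pol_CF_ops\<close>)

lemma pol_CF_sum: "(\<And>i. i \<in> A \<Longrightarrow> CF (a i) (b i) \<in> pol G) \<Longrightarrow> CF (\<lambda>p. \<Sum>i\<in>A. a i p) (\<lambda>q. \<Sum>i\<in>A. b i q) \<in> pol G"
  by (induction A rule: infinite_finite_induct) (use pol_0[unfolded zero_cfun_def] in \<open>auto intro: pol_CF_ops\<close>)

lemma pol_CF_zero: "CF (\<lambda>_. 0) (\<lambda>_. 0) \<in> pol G"
  using pol_0[unfolded zero_cfun_def] .

lemma pol_CF_lift:
  fixes G :: "('p,'a::comm_ring_1,'q,'b::comm_ring_1) cfun set" and H :: "('p \<times> 'c,'a,'q \<times> 'd,'b) cfun set"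
  assumes "CF a b \<in> pol G" and H: "\<And>c. c \<in> G \<Longrightarrow> CF (\<lambda>x. lft c (fst x)) (\<lambda>x. rgt c (fst x)) \<in> H"
  shows "CF (\<lambda>x. a (fst x)) (\<lambda>x. b (fst x)) \<in> pol H"
proof -
  have "CF (\<lambda>x. lft c (fst x)) (\<lambda>x. rgt c (fst x)) \<in> pol H" if "c \<in> pol G" for c
    using that
  proof (induction rule: pol.induct)
    case (pol_add c d)
    then show ?case using pol_CF_ops(1) by fastforce
  next
    case (pol_mult c d)
    then show ?case using pol_CF_ops(2) by fastforce
  next
    case (pol_minus c)
    then show ?case using pol.pol_minus by (fastforce simp: uminus_cfun_def)
  qed (use H pol_0 pol_1 in \<open>auto simp: zero_cfun_def one_cfun_def intro: pol_gen\<close>)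
  from this[OF assms(1)] show ?thesis by simp
qed

lemma pol_CF_fst:
  assumes "CF a b \<in> pol G"
  shows "CF (\<lambda>x. a (fst x)) (\<lambda>x. b (fst x)) \<in> pol (add_var G)" "CF (\<lambda>x. a (fst x)) (\<lambda>x. b (fst x)) \<in> pol (add_vec G)"
  by (rule pol_CF_lift[OF assms]; simp add: add_var_def add_vec_def)+

lemma pol_CF_var: "CF (\<lambda>x. snd x) (\<lambda>x. snd x) \<in> pol (add_var G)"
  by (rule pol_gen) (simp add: add_var_def)

lemma pol_CF_vec: "CF (\<lambda>x. snd x $ i) (\<lambda>x. snd x $ i) \<in> pol (add_vec G)"
  by (rule pol_gen) (auto simp: add_vec_def)

lemma pol_CF_pext:
  fixes v :: "'p \<Rightarrow> real^'n::finite" and w :: "'q \<Rightarrow> puis^'n"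
  assumes "pext f P" "has_consts G" "\<And>i. CF (\<lambda>p. v p $ i) (\<lambda>q. w q $ i) \<in> pol G"
  shows "CF (\<lambda>p. f (v p)) (\<lambda>q. P (w q)) \<in> pol G"
  using assms(1) by (induction rule: pext.induct) (use assms(2,3) in \<open>auto intro: pol_CF_const pol_CF_ops\<close>)

lemma pol_CF_dsq:
  fixes v v' :: "'p \<Rightarrow> 'a::comm_ring_1^'n::finite" and w w' :: "'q \<Rightarrow> 'b::comm_ring_1^'n"
  assumes "\<And>i. CF (\<lambda>p. v p $ i) (\<lambda>q. w q $ i) \<in> pol G" "\<And>i. CF (\<lambda>p. v' p $ i) (\<lambda>q. w' q $ i) \<in> pol G"
  shows "CF (\<lambda>p. dsq (v p) (v' p)) (\<lambda>q. dsq (w q) (w' q)) \<in> pol G"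
  unfolding dsq_def by (intro pol_CF_sum pol_CF_power pol_CF_ops assms)

lemma pol_CF_rkv: "has_consts G \<Longrightarrow> CF (\<lambda>p. x0 $ i) (\<lambda>q. rkv x0 $ i) \<in> pol G"
  by (simp add: rkv_def pol_CF_const)

definition lim_at :: "(('a::linordered_field)^'n::finite \<Rightarrow> 'a) \<Rightarrow> ('a^'n \<Rightarrow> 'a) \<Rightarrow> ('a^'n \<Rightarrow> 'a) \<Rightarrow> 'a^'n \<Rightarrow> 'a \<Rightarrow> bool" where
  "lim_at g p q x y \<longleftrightarrow> (\<forall>e. 0 < e \<longrightarrow> (\<exists>d. 0 < d \<and> (\<forall>z. g z = 0 \<and> dsq z x < d \<and> \<not> q z = 0 \<longrightarrow> (p z - y * q z)\<^sup>2 < e * (q z)\<^sup>2)))"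

lemma transferable_lim_at:
  fixes v :: "'p \<Rightarrow> real^'n::finite" and w :: "'q \<Rightarrow> puis^'n"
  assumes "has_consts G" "pext g g'" "pext p p'" "pext q q'" "\<And>i. CF (\<lambda>p. v p $ i) (\<lambda>q. w q $ i) \<in> pol G" "CF y y' \<in> pol G"
  shows "transferable G (\<lambda>s. lim_at g p q (v s) (y s)) (\<lambda>s. lim_at g' p' q' (w s) (y' s))"
  unfolding lim_at_def
  apply (rule transferable_all, rule transferable_imp, rule transferable_less)
    apply (intro pol_CF_zero pol_CF_var)+
  apply (rule transferable_ex, rule transferable_conj, rule transferable_less)
    apply (intro pol_CF_zero pol_CF_var)+
  apply (rule transferable_allv, rule transferable_imp, rule transferable_conj, rule transferable_eq)
     apply (rule pol_CF_pext[OF assms(2)], intro has_consts_add assms(1), rule pol_CF_vec, rule pol_CF_zero)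
   apply (rule transferable_conj, rule transferable_less)
     apply (rule pol_CF_dsq, rule pol_CF_vec)
     apply (rule pol_CF_fst, rule pol_CF_fst, rule pol_CF_fst, rule assms(5))
    apply (rule pol_CF_fst, rule pol_CF_var)
   apply (rule transferable_not, rule transferable_eq)
    apply (rule pol_CF_pext[OF assms(4)], intro has_consts_add assms(1), rule pol_CF_vec, rule pol_CF_zero)
  apply (rule transferable_less)
   apply (rule pol_CF_power, rule pol_CF_ops(3))
    apply (rule pol_CF_pext[OF assms(3)], intro has_consts_add assms(1), rule pol_CF_vec)
   apply (rule pol_CF_ops(2))
    apply (rule pol_CF_fst, rule pol_CF_fst, rule pol_CF_fst, rule assms(6))
   apply (rule pol_CF_pext[OF assms(4)], intro has_consts_add assms(1), rule pol_CF_vec)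
  apply (rule pol_CF_ops(2), rule pol_CF_fst, rule pol_CF_fst, rule pol_CF_var)
  apply (rule pol_CF_power, rule pol_CF_pext[OF assms(4)], intro has_consts_add assms(1), rule pol_CF_vec)
  done

definition consts0 :: "(unit,real,unit,puis) cfun set" where "consts0 = range (\<lambda>r. CF (\<lambda>_. r) (\<lambda>_. rk r))"

lemma has_consts0: "has_consts consts0" by (auto simp: has_consts_def consts0_def)

lemma ssgn_rk: "ssgn (rk r) = ssgn r"
  using rk_less[of 0 r] rk_less[of r 0] by (simp add: ssgn_def)

lemma pol_consts0: "c \<in> pol consts0 \<Longrightarrow> rgt c () = rk (lft c ())"
  by (induction rule: pol.induct) (auto simp: consts0_def)

text \<open>For a closed formula the eliminated terms are real constants, and \<open>rk\<close>
  preserves their signs.\<close>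

theorem transfer_closed:
  assumes "transferable consts0 (\<lambda>_. \<Phi>) (\<lambda>_. \<Psi>)"
  shows "\<Phi> \<longleftrightarrow> \<Psi>"
proof -
  obtain D where D: "D \<subseteq> pol consts0" "\<And>p q. (\<And>c. c \<in> D \<Longrightarrow> ssgn (lft c p) = ssgn (rgt c q)) \<Longrightarrow> \<Phi> \<longleftrightarrow> \<Psi>"
    using transferableE[OF assms] by metis
  show ?thesis by (rule D(2)[of "()" "()"]) (use D(1) pol_consts0 ssgn_rk in force)
qed

section \<open>Germs at the infinitesimal t\<close>

definition tt :: puis where "tt = tpow 1"

lemma tt_props: "tt > 0" "fin tt" "st tt = 0"
  by (auto simp: tt_def tpow_pos fin_def cf_tpow)

text \<open>Both are the sign of the lowest nonzero coefficient.\<close>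

lemma poly_germ_sign:
  "\<exists>d>0. \<forall>s. 0 < s \<longrightarrow> s < d \<longrightarrow> ssgn (poly p s) = ssgn (poly (map_poly rk p) tt)"
proof (induction p)
  case 0
  show ?case by (intro exI[of _ 1]) simp
next
  case (pCons a p)
  have fp: "fin (poly (map_poly rk p) tt)"
    by (rule poly_fin_st(1)) (auto simp: coeff_map_poly tt_props)
  have mp: "map_poly rk (pCons a p) = pCons (rk a) (map_poly rk p)"
    by (auto intro!: poly_eqI simp: coeff_map_poly coeff_pCons split: nat.split)
  show ?case
  proof (cases "a = 0")
    case True
    obtain d where d: "d > 0" "\<And>s. 0 < s \<Longrightarrow> s < d \<Longrightarrow> ssgn (poly p s) = ssgn (poly (map_poly rk p) tt)" using pCons by blast
    have "ssgn tt = 1" using tt_props(1) by (simp add: ssgn_pos)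
    then show ?thesis using True d unfolding mp
      by (intro exI[of _ d]) (auto simp: ssgn_mult, simp add: ssgn_def)
  next
    case False
    have K: "fin (rk a + tt * poly (map_poly rk p) tt)" "st (rk a + tt * poly (map_poly rk p) tt) = a"
      using fp tt_props by (auto simp: fin_st_ops)
    have sK: "ssgn (rk a + tt * poly (map_poly rk p) tt) = ssgn a"
    proof (cases "a > 0")
      case True
      then show ?thesis using st_pos_imp[OF K(1)] K(2) by (simp add: ssgn_def)
    next
      case f: False
      then have "- (rk a + tt * poly (map_poly rk p) tt) > 0"
        using False K fin_st_ops(3)[OF K(1) K(1)] by (intro st_pos_imp) auto
      then have "rk a + tt * poly (map_poly rk p) tt < 0" by (simp only: neg_0_less_iff_less)
      then show ?thesis using f False by (simp add: ssgn_def)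
    qed
    let ?q = "if a > 0 then pCons a p else - pCons a p"
    have "poly ?q 0 > 0" using False by auto
    then obtain d where d: "d > 0" "\<And>s. \<bar>s - 0\<bar> < d \<Longrightarrow> poly ?q s > 0" using poly_local_sign by blast
    have "ssgn (poly (pCons a p) s) = ssgn a" if "0 < s" "s < d" for s
      using d(2)[of s] that False by (auto simp: ssgn_def split: if_splits)
    then show ?thesis using d(1) sK unfolding mp by (intro exI[of _ d]) auto
  qed
qed

text \<open>Truth of a formula in one variable s depends on the signs of finitely many polynomials
  in s, and each has for all small s > 0 the sign it has at t.\<close>

theorem transfer_germ:
  assumes "transferable (add_var consts0) (\<lambda>x. \<Phi> (snd x)) (\<lambda>x. \<Psi> (snd x))" "\<Psi> tt"
  shows "\<exists>d>0. \<forall>s. 0 < s \<longrightarrow> s < d \<longrightarrow> \<Phi> s"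
proof -
  obtain D where D: "D \<subseteq> pol (add_var consts0)" "finite D"
    "\<And>p q. (\<And>c. c \<in> D \<Longrightarrow> ssgn (lft c p) = ssgn (rgt c q)) \<Longrightarrow> \<Phi> (snd p) \<longleftrightarrow> \<Psi> (snd q)"
    using transferableE[OF assms(1)] by metis
  have one: "\<exists>d>0. \<forall>s. 0 < s \<longrightarrow> s < d \<longrightarrow> ssgn (lft c ((),s)) = ssgn (rgt c ((),tt))" if cD: "c \<in> D" for c
  proof -
    have "c \<in> pol (add_var consts0)" using D(1) cD by blast
    from pol_add_var[OF this] obtain P where P: "\<And>i. coeff P i \<in> pol consts0" "\<And>y. lft c ((),y) = poly (map_poly (\<lambda>c. lft c ()) P) y"
      "\<And>y. rgt c ((),y) = poly (map_poly (\<lambda>c. rgt c ()) P) y" by blast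
    have "map_poly (\<lambda>c. rgt c ()) P = map_poly rk (map_poly (\<lambda>c. lft c ()) P)"
      by (rule poly_eqI) (simp add: coeff_map_poly pol_consts0[OF P(1)])
    then show ?thesis using P poly_germ_sign[of "map_poly (\<lambda>c. lft c ()) P"] by simp
  qed
  have "\<exists>d>0. \<forall>c\<in>D. \<forall>s. 0 < s \<longrightarrow> s < d \<longrightarrow> ssgn (lft c ((),s)) = ssgn (rgt c ((),tt))"
    using D(2) one
  proof (induction D)
    case (insert c D)
    obtain d d' where "d > 0" "\<forall>c\<in>D. \<forall>s. 0 < s \<longrightarrow> s < d \<longrightarrow> ssgn (lft c ((),s)) = ssgn (rgt c ((),tt))"
      "d' > 0" "\<forall>s. 0 < s \<longrightarrow> s < d' \<longrightarrow> ssgn (lft c ((),s)) = ssgn (rgt c ((),tt))"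
      using insert by (metis insert_iff)
    then show ?case by (intro exI[of _ "min d d'"]) auto
  qed (auto intro: exI[of _ 1])
  then obtain d where "d > 0" "\<And>c s. c \<in> D \<Longrightarrow> 0 < s \<Longrightarrow> s < d \<Longrightarrow> ssgn (lft c ((),s)) = ssgn (rgt c ((),tt))" by blast
  then show ?thesis using D(3)[of "((),_)" "((),tt)"] assms(2) by (metis snd_conv)
qed

lemmas transferable_intros = transferable_all transferable_allv transferable_ex transferable_exv transferable_imp
  transferable_conj transferable_not transferable_less transferable_le transferable_eq
lemmas pol_CF_intros = pol_CF_zero pol_CF_ops pol_CF_power pol_CF_var pol_CF_vec pol_CF_fst pol_CF_dsq
  has_consts_add has_consts0

section \<open>Limits at Puiseux points of the variety\<close>

locale puiseux_variety = variety V for V :: "(real^'n::finite) set" +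
  fixes g gK assumes gext: "pext g gK" and Vg: "V = {x. g x = 0}"
begin

text \<open>Continuity of F gives existence of the limit, density of the nonzero locus of q its
  uniqueness.\<close>

lemma real_lim_at:
  assumes R: "regul_rep V F p q" and x: "x \<in> V"
  shows "lim_at g p q x y \<longleftrightarrow> y = F x"
proof -
  have F: "continuous_on V F" and q: "q \<in> polyfun" "\<exists>x\<in>V. q x \<noteq> 0" and Fq: "\<And>x. x \<in> V \<Longrightarrow> F x * q x = p x"
    using R by (auto simp: regul_rep_def)
  have lim: "lim_at g p q x (F x)"
    unfolding lim_at_def
  proof (intro allI impI)
    fix e :: real assume e: "0 < e"
    then obtain d where d: "d > 0" "\<And>z. z \<in> V \<Longrightarrow> dist z x < d \<Longrightarrow> dist (F z) (F x) < sqrt e"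
      using F x unfolding continuous_on_iff by (metis real_sqrt_gt_0_iff)
    show "\<exists>d>0. \<forall>z. g z = 0 \<and> dsq z x < d \<and> \<not> q z = 0 \<longrightarrow> (p z - F x * q z)\<^sup>2 < e * (q z)\<^sup>2"
    proof (intro exI[of _ "d\<^sup>2"] conjI allI impI)
      fix z assume z: "g z = 0 \<and> dsq z x < d\<^sup>2 \<and> \<not> q z = 0"
      then have zV: "z \<in> V" using Vg by simp
      have "dist z x < d" using z d(1) power2_less_imp_less[of "dist z x" d] by (simp add: dsq_dist)
      then have "\<bar>F z - F x\<bar> < sqrt e" using d(2)[OF zV] by (simp add: dist_real_def)
      then have "\<bar>F z - F x\<bar>\<^sup>2 < (sqrt e)\<^sup>2" by (intro power_strict_mono) auto
      then have "(F z - F x)\<^sup>2 < e" using e by simp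
      then have "(F z - F x)\<^sup>2 * (q z)\<^sup>2 < e * (q z)\<^sup>2" using z by (intro mult_strict_right_mono) auto
      then show "(p z - F x * q z)\<^sup>2 < e * (q z)\<^sup>2"
        unfolding Fq[OF zV, symmetric] by (simp add: power_mult_distrib[symmetric] left_diff_distrib)
    qed (use d in auto)
  qed
  moreover have "y = F x" if y: "lim_at g p q x y"
  proof (rule ccontr)
    assume ne: "y \<noteq> F x"
    define e where "e = ((y - F x) / 2)\<^sup>2"
    have "e > 0" using ne by (simp add: e_def)
    then obtain d d' where d: "d > 0" "\<And>z. g z = 0 \<Longrightarrow> dsq z x < d \<Longrightarrow> q z \<noteq> 0 \<Longrightarrow> (p z - y * q z)\<^sup>2 < e * (q z)\<^sup>2"
      "d' > 0" "\<And>z. g z = 0 \<Longrightarrow> dsq z x < d' \<Longrightarrow> q z \<noteq> 0 \<Longrightarrow> (p z - F x * q z)\<^sup>2 < e * (q z)\<^sup>2"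
      using y lim unfolding lim_at_def by metis
    obtain z where z: "z \<in> V" "z \<in> ball x (sqrt (min d d'))" "q z \<noteq> 0"
      using dense[OF q x, of "ball x (sqrt (min d d'))"] d by auto
    have "(dist z x)\<^sup>2 < (sqrt (min d d'))\<^sup>2" using z(2) by (intro power_strict_mono) (auto simp: dist_commute)
    then have "dsq z x < min d d'" using d(1,3) by (simp add: dsq_dist)
    then have "(p z - y * q z)\<^sup>2 < e * (q z)\<^sup>2" "(p z - F x * q z)\<^sup>2 < e * (q z)\<^sup>2" using d z Vg by auto
    then have "\<bar>p z - y * q z\<bar> < \<bar>(y - F x) / 2 * q z\<bar>" "\<bar>p z - F x * q z\<bar> < \<bar>(y - F x) / 2 * q z\<bar>"
      unfolding e_def power_mult_distrib[symmetric] by (metis power2_abs abs_ge_zero power2_less_imp_less)+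
    moreover have "\<bar>(y - F x) * q z\<bar> \<le> \<bar>p z - y * q z\<bar> + \<bar>p z - F x * q z\<bar>" by (simp add: left_diff_distrib)
    ultimately show False by (simp add: abs_mult)
  qed
  ultimately show ?thesis by blast
qed

definition ext_rep :: "(real^'n \<Rightarrow> real) \<Rightarrow> (puis^'n \<Rightarrow> puis) \<Rightarrow> (puis^'n \<Rightarrow> puis) \<Rightarrow> bool" where
  "ext_rep F P Q \<longleftrightarrow> (\<exists>p q. regul_rep V F p q \<and> pext p P \<and> pext q Q)"

lemma ext_rep_ex: "regul V F \<Longrightarrow> \<exists>P Q. ext_rep F P Q"
  unfolding regul_def ext_rep_def using pext_ex by (metis regul_rep_def)

text \<open>Here and in the next lemmas a first-order sentence about limits, which over the reals
  reduces to a fact about F by \<open>real_lim_at\<close>, is transferred to all Puiseux points of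
  V, including those where Q vanishes.\<close>

lemma lim_ex:
  assumes "ext_rep F P Q" "gK x = 0"
  shows "\<exists>y. lim_at gK P Q x y"
proof -
  obtain p q where r: "regul_rep V F p q" "pext p P" "pext q Q" using assms by (auto simp: ext_rep_def)
  have tr: "(\<forall>x. g x = 0 \<longrightarrow> (\<exists>y. lim_at g p q x y)) \<longleftrightarrow> (\<forall>x. gK x = 0 \<longrightarrow> (\<exists>y. lim_at gK P Q x y))"
    by (rule transfer_closed)
      (intro transferable_intros transferable_lim_at pol_CF_intros pol_CF_pext[OF gext] gext r)
  have "\<exists>y. lim_at g p q x y" if "g x = 0" for x using real_lim_at[OF r(1), of x] that Vg by auto
  then have "\<forall>x. gK x = 0 \<longrightarrow> (\<exists>y. lim_at gK P Q x y)" unfolding tr[symmetric] by blast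
  then show ?thesis using assms(2) by blast
qed

lemma lim_unique:
  assumes "ext_rep F P Q" "ext_rep F' P' Q'" "\<And>x. x \<in> V \<Longrightarrow> F x = F' x" "gK x = 0" "lim_at gK P Q x y" "lim_at gK P' Q' x y'"
  shows "y = y'"
proof -
  obtain p q p' q' where r: "regul_rep V F p q" "pext p P" "pext q Q" "regul_rep V F' p' q'" "pext p' P'" "pext q' Q'"
    using assms by (auto simp: ext_rep_def)
  have tr: "(\<forall>x y y'. g x = 0 \<and> lim_at g p q x y \<and> lim_at g p' q' x y' \<longrightarrow> y = y') \<longleftrightarrow>
      (\<forall>x y y'. gK x = 0 \<and> lim_at gK P Q x y \<and> lim_at gK P' Q' x y' \<longrightarrow> y = y')"
    by (rule transfer_closed)
      (intro transferable_intros transferable_lim_at pol_CF_intros pol_CF_pext[OF gext] gext r)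
  have "y = y'" if h: "g x = 0 \<and> lim_at g p q x y \<and> lim_at g p' q' x y'" for x y y'
  proof -
    have x: "x \<in> V" using h Vg by simp
    show ?thesis using h real_lim_at[OF r(1) x] real_lim_at[OF r(4) x] assms(3)[OF x] by simp
  qed
  then have "\<forall>x y y'. gK x = 0 \<and> lim_at gK P Q x y \<and> lim_at gK P' Q' x y' \<longrightarrow> y = y'" unfolding tr[symmetric] by blast
  then show ?thesis using assms(4-6) by blast
qed

lemma lim_add:
  assumes "ext_rep F1 P1 Q1" "ext_rep F2 P2 Q2" "ext_rep F P Q" "\<And>x. x \<in> V \<Longrightarrow> F x = F1 x + F2 x"
    "gK x = 0" "lim_at gK P1 Q1 x y1" "lim_at gK P2 Q2 x y2"
  shows "lim_at gK P Q x (y1 + y2)"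
proof -
  obtain p q p1 q1 p2 q2 where r: "regul_rep V F p q" "pext p P" "pext q Q" "regul_rep V F1 p1 q1" "pext p1 P1" "pext q1 Q1"
    "regul_rep V F2 p2 q2" "pext p2 P2" "pext q2 Q2"
    using assms by (auto simp: ext_rep_def)
  have tr: "(\<forall>x y1 y2. g x = 0 \<and> lim_at g p1 q1 x y1 \<and> lim_at g p2 q2 x y2 \<longrightarrow> lim_at g p q x (y1 + y2)) \<longleftrightarrow>
      (\<forall>x y1 y2. gK x = 0 \<and> lim_at gK P1 Q1 x y1 \<and> lim_at gK P2 Q2 x y2 \<longrightarrow> lim_at gK P Q x (y1 + y2))"
    by (rule transfer_closed)
      (intro transferable_intros transferable_lim_at pol_CF_intros pol_CF_pext[OF gext] gext r)
  have "lim_at g p q x (y1 + y2)" if h: "g x = 0 \<and> lim_at g p1 q1 x y1 \<and> lim_at g p2 q2 x y2" for x y1 y2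
  proof -
    have x: "x \<in> V" using h Vg by simp
    show ?thesis using h real_lim_at[OF r(1) x] real_lim_at[OF r(4) x] real_lim_at[OF r(7) x] assms(4)[OF x] by simp
  qed
  then have "\<forall>x y1 y2. gK x = 0 \<and> lim_at gK P1 Q1 x y1 \<and> lim_at gK P2 Q2 x y2 \<longrightarrow> lim_at gK P Q x (y1 + y2)"
    unfolding tr[symmetric] by blast
  then show ?thesis using assms(5-7) by blast
qed

lemma lim_mult:
  assumes "ext_rep F1 P1 Q1" "ext_rep F2 P2 Q2" "ext_rep F P Q" "\<And>x. x \<in> V \<Longrightarrow> F x = F1 x * F2 x"
    "gK x = 0" "lim_at gK P1 Q1 x y1" "lim_at gK P2 Q2 x y2"
  shows "lim_at gK P Q x (y1 * y2)"
proof -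
  obtain p q p1 q1 p2 q2 where r: "regul_rep V F p q" "pext p P" "pext q Q" "regul_rep V F1 p1 q1" "pext p1 P1" "pext q1 Q1"
    "regul_rep V F2 p2 q2" "pext p2 P2" "pext q2 Q2"
    using assms by (auto simp: ext_rep_def)
  have tr: "(\<forall>x y1 y2. g x = 0 \<and> lim_at g p1 q1 x y1 \<and> lim_at g p2 q2 x y2 \<longrightarrow> lim_at g p q x (y1 * y2)) \<longleftrightarrow>
      (\<forall>x y1 y2. gK x = 0 \<and> lim_at gK P1 Q1 x y1 \<and> lim_at gK P2 Q2 x y2 \<longrightarrow> lim_at gK P Q x (y1 * y2))"
    by (rule transfer_closed)
      (intro transferable_intros transferable_lim_at pol_CF_intros pol_CF_pext[OF gext] gext r)
  have "lim_at g p q x (y1 * y2)" if h: "g x = 0 \<and> lim_at g p1 q1 x y1 \<and> lim_at g p2 q2 x y2" for x y1 y2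
  proof -
    have x: "x \<in> V" using h Vg by simp
    show ?thesis using h real_lim_at[OF r(1) x] real_lim_at[OF r(4) x] real_lim_at[OF r(7) x] assms(4)[OF x] by simp
  qed
  then have "\<forall>x y1 y2. gK x = 0 \<and> lim_at gK P1 Q1 x y1 \<and> lim_at gK P2 Q2 x y2 \<longrightarrow> lim_at gK P Q x (y1 * y2)"
    unfolding tr[symmetric] by blast
  then show ?thesis using assms(5-7) by blast
qed

lemma lim_poly:
  assumes "pext p P" "gK x = 0"
  shows "lim_at gK P (\<lambda>_. rk 1) x (P x)"
proof -
  have R: "regul_rep V p p (\<lambda>x. 1)" using regul_poly pext_polyfun[OF assms(1)] by blast
  have tr: "(\<forall>x. g x = 0 \<longrightarrow> lim_at g p (\<lambda>_. 1) x (p x)) \<longleftrightarrow> (\<forall>x. gK x = 0 \<longrightarrow> lim_at gK P (\<lambda>_. rk 1) x (P x))"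
    by (rule transfer_closed)
      (intro transferable_intros transferable_lim_at pol_CF_intros pol_CF_pext[OF gext] pol_CF_pext[OF assms(1)] gext assms(1) pext_const)
  have "lim_at g p (\<lambda>_. 1) x (p x)" if "g x = 0" for x using real_lim_at[OF R, of x] that Vg by auto
  then have "\<forall>x. gK x = 0 \<longrightarrow> lim_at gK P (\<lambda>_. rk 1) x (P x)" unfolding tr[symmetric] by blast
  then show ?thesis using assms(2) by blast
qed

lemma stv_in_V: "finv x \<Longrightarrow> gK x = 0 \<Longrightarrow> stv x \<in> V"
  using pext_fin[OF gext, of x] Vg by simp

lemma dsq_stv:
  assumes "finv x"
  shows "fin (dsq x (rkv (stv x)))" "st (dsq x (rkv (stv x))) = 0"
proof -
  have "fin ((x $ i - rkv (stv x) $ i)\<^sup>2) \<and> st ((x $ i - rkv (stv x) $ i)\<^sup>2) = 0" for i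
    using assms fin_st_power[of "x $ i - rkv (stv x) $ i" 2] by (simp add: finv_def rkv_def stv_def fin_st_ops)
  then show "fin (dsq x (rkv (stv x)))" "st (dsq x (rkv (stv x))) = 0"
    unfolding dsq_def using fin_st_sum[of UNIV "\<lambda>i. (x $ i - rkv (stv x) $ i)\<^sup>2"] by auto
qed

lemma st_less_imp: "fin x \<Longrightarrow> st x < c \<Longrightarrow> x < rk c"
  using st_pos_imp[of "rk c - x"] fin_st_ops(4)[of "rk c" x] by simp

lemma fin_sqrt_bound: "y\<^sup>2 \<le> rk c \<Longrightarrow> fin y"
proof (rule fin_bounded[of _ "\<bar>c\<bar> + 1"])
  assume y: "y\<^sup>2 \<le> rk c"
  show "\<bar>y\<bar> \<le> rk (\<bar>c\<bar> + 1)"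
  proof (rule ccontr)
    assume "\<not> \<bar>y\<bar> \<le> rk (\<bar>c\<bar> + 1)"
    then have "(rk (\<bar>c\<bar> + 1))\<^sup>2 < \<bar>y\<bar>\<^sup>2" using rk_le[of 0 "\<bar>c\<bar> + 1"] by (intro power_strict_mono) auto
    then have "rk ((\<bar>c\<bar> + 1)\<^sup>2) < rk c" using y by (simp del: rk_simps)
    then have "(\<bar>c\<bar> + 1)\<^sup>2 < c" by (simp only: rk_less)
    moreover have "(\<bar>c\<bar> + 1) * 1 \<le> (\<bar>c\<bar> + 1) * (\<bar>c\<bar> + 1)" by (intro mult_left_mono) auto
    ultimately show False by (simp add: power2_eq_square)
  qed
qed

text \<open>Continuity of F at the residue point x0, with given real e and d, is a transferable
  sentence. The point x is within every real d of x0, so y is within every real e of F(x0).\<close>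

lemma lim_st:
  assumes E: "ext_rep F P Q" and x: "finv x" "gK x = 0" and y: "lim_at gK P Q x y"
  shows "fin y" "st y = F (stv x)"
proof -
  obtain p q where r: "regul_rep V F p q" "pext p P" "pext q Q" using E by (auto simp: ext_rep_def)
  define x0 where "x0 = stv x"
  have x0: "x0 \<in> V" using stv_in_V x by (simp add: x0_def)
  have F: "continuous_on V F" using r by (auto simp: regul_rep_def)
  have bnd: "(y - rk (F x0))\<^sup>2 < rk e" if e: "e > 0" for e
  proof -
    obtain d where d: "d > 0" "\<And>z. z \<in> V \<Longrightarrow> dist z x0 < d \<Longrightarrow> dist (F z) (F x0) < sqrt e"
      using F x0 e unfolding continuous_on_iff by (metis real_sqrt_gt_0_iff)
    have real: "(y - F x0)\<^sup>2 < e" if "g z = 0 \<and> dsq z x0 < d\<^sup>2 \<and> lim_at g p q z y" for z y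
    proof -
      have zV: "z \<in> V" using that Vg by simp
      have "dist z x0 < d" using that d(1) power2_less_imp_less[of "dist z x0" d] by (simp add: dsq_dist)
      then have "\<bar>y - F x0\<bar> < sqrt e" using d(2)[OF zV] real_lim_at[OF r(1) zV] that by (simp add: dist_real_def)
      then have "\<bar>y - F x0\<bar>\<^sup>2 < (sqrt e)\<^sup>2" by (intro power_strict_mono) auto
      then show ?thesis using e by simp
    qed
    have "(\<forall>z y. g z = 0 \<and> dsq z x0 < d\<^sup>2 \<and> lim_at g p q z y \<longrightarrow> (y - F x0)\<^sup>2 < e) \<longleftrightarrow>
      (\<forall>z y. gK z = 0 \<and> dsq z (rkv x0) < rk (d\<^sup>2) \<and> lim_at gK P Q z y \<longrightarrow> (y - rk (F x0))\<^sup>2 < rk e)"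
      by (rule transfer_closed)
        (intro transferable_intros transferable_lim_at pol_CF_intros pol_CF_pext[OF gext] gext r pol_CF_const pol_CF_rkv)
    moreover have "dsq x (rkv x0) < rk (d\<^sup>2)" unfolding x0_def
      by (rule st_less_imp) (use dsq_stv[OF x(1)] d in auto)
    ultimately show ?thesis using real x y by blast
  qed
  have f: "fin (y - rk (F x0))" using fin_sqrt_bound[of "y - rk (F x0)" 1] bnd[of 1] by simp
  then show fy: "fin y" using fin_st_ops(1)[OF f fin_rk[of "F x0"]] by simp
  show "st y = F (stv x)"
  proof (rule ccontr)
    assume ne: "st y \<noteq> F (stv x)"
    define c where "c = st (y - rk (F x0))"
    have c: "c \<noteq> 0" using ne by (simp add: c_def x0_def)
    have "rk (c\<^sup>2 / 2) < (y - rk (F x0))\<^sup>2"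
    proof -
      have *: "fin ((y - rk (F x0))\<^sup>2)" "st ((y - rk (F x0))\<^sup>2) = c\<^sup>2" using fin_st_power[OF f, of 2] by (auto simp: c_def)
      have "(y - rk (F x0))\<^sup>2 - rk (c\<^sup>2 / 2) > 0"
        by (rule st_pos_imp) (use * fin_st_ops(4)[OF *(1) fin_rk[of "c\<^sup>2 / 2"]] c in auto)
      then show ?thesis by simp
    qed
    then show False using bnd[of "c\<^sup>2 / 2"] c by auto
  qed
qed

text \<open>If y has order v > 0 then y^(2 N) has order at least 2 N v, above the order 1 of t once
  N > 1/v.\<close>

lemma small_power:
  assumes "fin y" "st y = 0"
  shows "\<exists>N\<ge>1. y ^ (2 * N) < tt"
proof (cases "y = 0")
  case True
  then show ?thesis using tt_props by (intro exI[of _ 1]) auto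
next
  case False
  obtain v where v: "cf y v \<noteq> 0" "\<And>q. q < v \<Longrightarrow> cf y q = 0" using puis_first_coeff[OF False] by blast
  have "v > 0" using v(1) assms by (metis fin_def linorder_neqE)
  obtain N :: nat where N: "1 / v < of_nat N" using reals_Archimedean2 by blast
  then have Nv: "of_nat N * v > 1" using \<open>v > 0\<close> by (simp add: field_simps)
  then have N1: "N \<ge> 1" by (cases N) auto
  define u where "u = tpow (- v) * y"
  have "fin u" using v(2) by (auto simp: u_def fin_def cf_tpow_mult)
  have "y = tpow v * u" by (rule puis_eqI) (simp add: u_def cf_tpow_mult)
  then have yN: "y ^ (2 * N) = tpow (of_nat (2 * N) * v) * u ^ (2 * N)" by (simp add: power_mult_distrib tpow_power)
  have fu: "fin (u ^ (2 * N))" using fin_st_power \<open>fin u\<close> by blast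
  have "cf (y ^ (2 * N)) q = 0" if "q \<le> 1" for q
  proof -
    have "q - of_nat (2 * N) * v < 0" using that Nv by simp
    then show ?thesis unfolding yN cf_tpow_mult using fu by (simp add: fin_def)
  qed
  then have "ppos (tt - y ^ (2 * N))" unfolding ppos_def by (intro exI[of _ 1]) (auto simp: tt_def cf_tpow)
  then show ?thesis using N1 by (intro exI[of _ N]) (simp add: less_puis_def)
qed

text \<open>On the compact set {w \<le> s} in V near x0 a maximum of H^2 exists for each real s > 0,
  hence also for s = t. There the maximum point is finite and its residue is a zero of w, so the
  value of H is infinitesimal and some even power of it is below t. Read back for small real s, with
  s = w(x), this is the inequality.\<close>

lemma lojasiewicz:
  assumes E: "regul_rep V H p q" and w: "w \<in> polyfun" "\<And>x. w x \<ge> 0" and x0: "x0 \<in> V" "w x0 = 0" and rho: "\<rho> > 0"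
    and z: "\<And>x. x \<in> V \<Longrightarrow> dsq x x0 \<le> \<rho> \<Longrightarrow> w x = 0 \<Longrightarrow> H x = 0"
  shows "\<exists>N\<ge>1. \<exists>d>0. \<forall>x\<in>V. dsq x x0 \<le> \<rho> \<longrightarrow> 0 < w x \<longrightarrow> w x < d \<longrightarrow> H x ^ (2 * N) < w x"
proof -
  have cH: "continuous_on V H" "p \<in> polyfun" "q \<in> polyfun" using E by (auto simp: regul_rep_def)
  obtain W P Q where ext: "pext w W" "pext p P" "pext q Q" using pext_ex w cH by metis
  have ER: "ext_rep H P Q" unfolding ext_rep_def using E ext by blast
  define \<Phi> where "\<Phi> s \<longleftrightarrow> (\<exists>xm ym. g xm = 0 \<and> dsq xm x0 \<le> \<rho> \<and> w xm \<le> s \<and> lim_at g p q xm ym \<and>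
     (\<forall>x y. g x = 0 \<and> dsq x x0 \<le> \<rho> \<and> w x \<le> s \<and> lim_at g p q x y \<longrightarrow> y\<^sup>2 \<le> ym\<^sup>2))" for s
  have "\<Phi> s" if s: "s > 0" for s
  proof -
    define C where "C = {x \<in> cball x0 (sqrt \<rho>). x \<in> V \<and> w x \<le> s}"
    have "closed V" unfolding Vg
      by (intro closed_Collect_eq polyfun_continuous_on[OF pext_polyfun[OF gext]] continuous_on_const)
    moreover have "closed {x. w x \<le> s}" using polyfun_continuous_on[OF w(1)] by (intro closed_Collect_le) auto
    ultimately have "compact (cball x0 (sqrt \<rho>) \<inter> (V \<inter> {x. w x \<le> s}))" by (intro compact_Int_closed closed_Int) auto
    moreover have Ceq: "C = cball x0 (sqrt \<rho>) \<inter> (V \<inter> {x. w x \<le> s})" by (auto simp: C_def)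
    ultimately have "compact C" by simp
    moreover have "x0 \<in> C" using x0 s rho by (auto simp: C_def)
    moreover have "continuous_on C (\<lambda>x. (H x)\<^sup>2)"
      by (intro continuous_on_power continuous_on_subset[OF cH(1)]) (auto simp: C_def)
    ultimately obtain xm where xm: "xm \<in> C" "\<And>x. x \<in> C \<Longrightarrow> (H x)\<^sup>2 \<le> (H xm)\<^sup>2"
      using continuous_attains_sup[of C "\<lambda>x. (H x)\<^sup>2"] by blast
    have inC: "x \<in> C \<longleftrightarrow> g x = 0 \<and> dsq x x0 \<le> \<rho> \<and> w x \<le> s" for x
    proof -
      have "dist x0 x \<le> sqrt \<rho> \<longleftrightarrow> (dist x x0)\<^sup>2 \<le> \<rho>"
        using rho by (metis dist_commute real_le_rsqrt real_sqrt_le_iff real_sqrt_unique zero_le_dist sqrt_le_D)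
      then show ?thesis using Vg by (auto simp: C_def dsq_dist)
    qed
    show ?thesis unfolding \<Phi>_def
    proof (intro exI[of _ xm] exI[of _ "H xm"] conjI allI impI)
      have xmV: "xm \<in> V" using xm(1) C_def by auto
      show "g xm = 0" "dsq xm x0 \<le> \<rho>" "w xm \<le> s" using xm(1) inC by auto
      show "lim_at g p q xm (H xm)" using real_lim_at[OF E xmV] by simp
      fix x y assume xy: "g x = 0 \<and> dsq x x0 \<le> \<rho> \<and> w x \<le> s \<and> lim_at g p q x y"
      then have "x \<in> C" "x \<in> V" using inC Vg by auto
      then show "y\<^sup>2 \<le> (H xm)\<^sup>2" using xy real_lim_at[OF E] xm(2) by metis
    qed
  qed
  moreover have "(\<forall>s. 0 < s \<longrightarrow> \<Phi> s) \<longleftrightarrow> (\<forall>s. 0 < s \<longrightarrow> (\<exists>xm ym. gK xm = 0 \<and> dsq xm (rkv x0) \<le> rk \<rho> \<and> W xm \<le> s \<and> lim_at gK P Q xm ym \<and>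
     (\<forall>x y. gK x = 0 \<and> dsq x (rkv x0) \<le> rk \<rho> \<and> W x \<le> s \<and> lim_at gK P Q x y \<longrightarrow> y\<^sup>2 \<le> ym\<^sup>2)))"
    unfolding \<Phi>_def
    by (rule transfer_closed)
      (intro transferable_intros transferable_lim_at pol_CF_intros pol_CF_pext[OF gext] pol_CF_pext[OF ext(1)] gext ext pol_CF_const pol_CF_rkv)
  ultimately obtain xm ym where m: "gK xm = 0" "dsq xm (rkv x0) \<le> rk \<rho>" "W xm \<le> tt" "lim_at gK P Q xm ym"
    "\<And>x y. gK x = 0 \<Longrightarrow> dsq x (rkv x0) \<le> rk \<rho> \<Longrightarrow> W x \<le> tt \<Longrightarrow> lim_at gK P Q x y \<Longrightarrow> y\<^sup>2 \<le> ym\<^sup>2"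
    using tt_props(1) by blast
  have fm: "finv xm" unfolding finv_def
  proof
    fix i
    have "(xm $ i - rkv x0 $ i)\<^sup>2 \<le> dsq xm (rkv x0)" unfolding dsq_def by (rule member_le_sum) auto
    then have "fin (xm $ i - rkv x0 $ i)" using fin_sqrt_bound m(2) order_trans by blast
    then show "fin (xm $ i)" using fin_st_ops(1)[OF _ fin_rk[of "x0 $ i"]] by (fastforce simp: rkv_def)
  qed
  define x1 where "x1 = stv xm"
  have x1: "x1 \<in> V" using stv_in_V fm m by (simp add: x1_def)
  have fW: "fin (W xm)" "st (W xm) = w x1" using pext_fin[OF ext(1) fm] by (auto simp: x1_def)
  have "w x1 \<le> 0"
  proof (rule ccontr)
    assume "\<not> w x1 \<le> 0"
    then have "W xm - tt > 0" using fW tt_props fin_st_ops(4)[OF fW(1) tt_props(2)] by (intro st_pos_imp) auto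
    then show False using m(3) by simp
  qed
  then have wx1: "w x1 = 0" using w(2)[of x1] by simp
  have "dsq x1 x0 \<le> \<rho>"
  proof (rule ccontr)
    assume n: "\<not> dsq x1 x0 \<le> \<rho>"
    have t: "fin ((xm $ i - rkv x0 $ i)\<^sup>2) \<and> st ((xm $ i - rkv x0 $ i)\<^sup>2) = (x1 $ i - x0 $ i)\<^sup>2" for i
      using fm fin_st_power[of "xm $ i - rkv x0 $ i" 2] by (simp add: finv_def rkv_def stv_def x1_def fin_st_ops)
    then have f: "fin (dsq xm (rkv x0))" "st (dsq xm (rkv x0)) = dsq x1 x0"
      unfolding dsq_def using fin_st_sum[of UNIV "\<lambda>i. (xm $ i - rkv x0 $ i)\<^sup>2"] by auto
    then have "dsq xm (rkv x0) - rk \<rho> > 0" using n fin_st_ops(4)[OF f(1) fin_rk[of \<rho>]] by (intro st_pos_imp) auto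
    then show False using m(2) by simp
  qed
  then have "H x1 = 0" using z x1 wx1 by blast
  then have "fin ym" "st ym = 0" using lim_st[OF ER fm m(1,4)] by (auto simp: x1_def)
  then obtain N where N: "N \<ge> 1" "ym ^ (2 * N) < tt" using small_power by blast
  define \<Theta> where "\<Theta> s \<longleftrightarrow> (\<forall>x y. g x = 0 \<and> dsq x x0 \<le> \<rho> \<and> w x \<le> s \<and> lim_at g p q x y \<longrightarrow> y ^ (2 * N) < s)" for s
  define \<Theta>' where "\<Theta>' s \<longleftrightarrow> (\<forall>x y. gK x = 0 \<and> dsq x (rkv x0) \<le> rk \<rho> \<and> W x \<le> s \<and> lim_at gK P Q x y \<longrightarrow> y ^ (2 * N) < s)" for s
  have tr: "transferable (add_var consts0) (\<lambda>s. \<Theta> (snd s)) (\<lambda>s. \<Theta>' (snd s))"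
    unfolding \<Theta>_def \<Theta>'_def
    by (intro transferable_intros transferable_lim_at pol_CF_intros pol_CF_pext[OF gext] pol_CF_pext[OF ext(1)] gext ext pol_CF_const pol_CF_rkv)
  have "\<Theta>' tt" unfolding \<Theta>'_def
  proof (intro allI impI)
    fix x y assume "gK x = 0 \<and> dsq x (rkv x0) \<le> rk \<rho> \<and> W x \<le> tt \<and> lim_at gK P Q x y"
    then have "y\<^sup>2 \<le> ym\<^sup>2" using m(5) by blast
    then have "(y\<^sup>2) ^ N \<le> (ym\<^sup>2) ^ N" by (rule power_mono) auto
    then show "y ^ (2 * N) < tt" using N(2) by (simp add: power_mult)
  qed
  then obtain d where d: "d > 0" "\<And>s. 0 < s \<Longrightarrow> s < d \<Longrightarrow> \<Theta> s" using transfer_germ[OF tr] by blast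
  have "H x ^ (2 * N) < w x" if "x \<in> V" "dsq x x0 \<le> \<rho>" "0 < w x" "w x < d" for x
    using d(2)[OF that(3,4)] that real_lim_at[OF E that(1)] Vg unfolding \<Theta>_def by blast
  then show ?thesis using N(1) d(1) by blast
qed

text \<open>Accumulation at x0 says that a point exists for every d > 0; transferred and used with
  the infinitesimal d = t it gives a Puiseux point whose residue is x0.\<close>

lemma curve_selection:
  assumes p: "pext p P" and q: "pext q Q" and x0: "x0 \<in> V" and e: "e > 0"
    and acc: "\<And>d. d > 0 \<Longrightarrow> \<exists>x\<in>V. dsq x x0 < d \<and> q x \<noteq> 0 \<and> e * (q x)\<^sup>2 \<le> (p x - a * q x)\<^sup>2"
  shows "\<exists>\<gamma>. finv \<gamma> \<and> gK \<gamma> = 0 \<and> stv \<gamma> = x0 \<and> Q \<gamma> \<noteq> 0 \<and> rk e * (Q \<gamma>)\<^sup>2 \<le> (P \<gamma> - rk a * Q \<gamma>)\<^sup>2"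
proof -
  have "(\<forall>d. 0 < d \<longrightarrow> (\<exists>x. g x = 0 \<and> dsq x x0 < d \<and> \<not> q x = 0 \<and> e * (q x)\<^sup>2 \<le> (p x - a * q x)\<^sup>2)) \<longleftrightarrow>
    (\<forall>d. 0 < d \<longrightarrow> (\<exists>x. gK x = 0 \<and> dsq x (rkv x0) < d \<and> \<not> Q x = 0 \<and> rk e * (Q x)\<^sup>2 \<le> (P x - rk a * Q x)\<^sup>2))"
    by (rule transfer_closed)
      (intro transferable_intros pol_CF_intros pol_CF_pext[OF gext] pol_CF_pext[OF p] pol_CF_pext[OF q] pol_CF_const pol_CF_rkv)
  then obtain x where x: "gK x = 0" "dsq x (rkv x0) < tt" "Q x \<noteq> 0" "rk e * (Q x)\<^sup>2 \<le> (P x - rk a * Q x)\<^sup>2"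
    using acc tt_props(1) Vg by blast
  have comp: "fin (x $ i) \<and> st (x $ i) = x0 $ i" for i
  proof -
    define u where "u = x $ i - rkv x0 $ i"
    have "u\<^sup>2 \<le> dsq x (rkv x0)" unfolding dsq_def u_def by (rule member_le_sum) auto
    then have ut: "u\<^sup>2 < tt" using x(2) by simp
    have "tt < rk 1" using tt_props st_less_imp[of tt 1] by simp
    then have fu: "fin u" using fin_sqrt_bound[of u 1] ut by simp
    have "st u = 0"
    proof (rule ccontr)
      assume "st u \<noteq> 0"
      then have "u\<^sup>2 - tt > 0" using fin_st_power[OF fu, of 2] tt_props fin_st_ops(4)[of "u\<^sup>2" tt] by (intro st_pos_imp) auto
      then show False using ut by simp
    qed
    moreover have "x $ i = u + rk (x0 $ i)" by (simp add: u_def rkv_def)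
    ultimately show ?thesis using fu fin_st_ops(1)[OF fu fin_rk] by simp
  qed
  then have "finv x" "stv x = x0" by (auto simp: finv_def stv_def vec_eq_iff)
  then show ?thesis using x by blast
qed

end

section \<open>The substitution property\<close>

lemma cf_inject: "cf x = cf y \<Longrightarrow> x = y"
  by (simp add: Rep_puis_inject)

lemma cf_padd: "cf (x + y) = padd (cf x) (cf y)"
  by (auto simp: padd_def)

context puiseux_variety begin

definition at_point :: "puis^'n \<Rightarrow> ((real^'n \<Rightarrow> real) set \<Rightarrow> rat \<Rightarrow> real) \<Rightarrow> bool" where
  "at_point \<gamma> \<phi> \<longleftrightarrow> (\<forall>p P. pext p P \<longrightarrow> \<phi> (cl V p) = cf (P \<gamma>))"

text \<open>The coordinates of \<gamma> are the images of the coordinate functions; since g is zero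
  in the coordinate ring, \<gamma> satisfies the equation of V.\<close>

lemma alg_hom_point:
  assumes "alg_hom_coord_ring V \<phi>"
  shows "\<exists>\<gamma>. finv \<gamma> \<and> gK \<gamma> = 0 \<and> at_point \<gamma> \<phi>"
proof -
  have in_ring: "p \<in> polyfun \<Longrightarrow> cl V p \<in> coord_ring V" for p by (simp add: coord_ring_cl)
  have hom: "\<And>p. p \<in> polyfun \<Longrightarrow> \<phi> (cl V p) \<in> puiseux"
    "\<And>p q. p \<in> polyfun \<Longrightarrow> q \<in> polyfun \<Longrightarrow> \<phi> (cl V (\<lambda>x. p x + q x)) = padd (\<phi> (cl V p)) (\<phi> (cl V q))"
    "\<And>p q. p \<in> polyfun \<Longrightarrow> q \<in> polyfun \<Longrightarrow> \<phi> (cl V (\<lambda>x. p x * q x)) = pmul (\<phi> (cl V p)) (\<phi> (cl V q))"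
    "\<And>r. \<phi> (cl V (\<lambda>x. r)) = pconst r"
    using assms in_ring unfolding alg_hom_coord_ring_def ring_hom_into_puiseux_def rf_const_cl
    by (auto simp flip: rf_add_cl rf_mult_cl)
  have "\<forall>i. \<exists>x. fin x \<and> cf x = \<phi> (cl V (\<lambda>x. x $ i))" using hom(1)[OF pf_coord] puiseux_in_puis by blast
  then obtain c where c: "\<And>i. fin (c i)" "\<And>i. cf (c i) = \<phi> (cl V (\<lambda>x. x $ i))" by metis
  define \<gamma> where "\<gamma> = (\<chi> i. c i)"
  have ap: "\<phi> (cl V p) = cf (P \<gamma>)" if "pext p P" for p P
    using that
  proof (induction rule: pext.induct)
    case (pext_const c)
    show ?case by (simp add: hom(4) cf_rk)
  next
    case (pext_coord i)
    show ?case by (simp add: \<gamma>_def c)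
  next
    case (pext_add f P g Q)
    have "\<phi> (cl V (\<lambda>x. f x + g x)) = padd (\<phi> (cl V f)) (\<phi> (cl V g))"
      by (rule hom(2)) (use pext_add pext_polyfun in blast)+
    then show ?case unfolding pext_add.IH by (simp only: cf_padd)
  next
    case (pext_mult f P g Q)
    have "\<phi> (cl V (\<lambda>x. f x * g x)) = pmul (\<phi> (cl V f)) (\<phi> (cl V g))"
      by (rule hom(3)) (use pext_mult pext_polyfun in blast)+
    then show ?case unfolding pext_mult.IH by (simp only: cf_mult)
  qed
  have "cl V g = cl V (\<lambda>x. 0)"
    by (rule cl_cong[OF pf_const[of 1]]) (use nonempty Vg in auto)
  then have "cf (gK \<gamma>) = cf (rk 0)" using ap[OF gext] ap[OF pext_const[of 0]] by simp
  then have "gK \<gamma> = 0" using cf_inject by fastforce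
  moreover have "finv \<gamma>" by (simp add: finv_def \<gamma>_def c)
  ultimately show ?thesis using ap unfolding at_point_def by blast
qed

text \<open>Both values are limits of quotients with denominator 1 that agree on V, so uniqueness of
  limits applies.\<close>

lemma pext_eq_on_V:
  assumes "pext p P" "pext p' P'" "cl V p = cl V p'" "gK \<gamma> = 0"
  shows "P \<gamma> = P' \<gamma>"
proof -
  have poly: "p \<in> polyfun" "p' \<in> polyfun" using assms pext_polyfun by auto
  have E: "ext_rep p P (\<lambda>_. rk 1)" "ext_rep p' P' (\<lambda>_. rk 1)"
    unfolding ext_rep_def using regul_poly[OF poly(1)] regul_poly[OF poly(2)] assms(1,2) pext_const by blast+
  show ?thesis
    by (rule lim_unique[OF E _ assms(4) lim_poly[OF assms(1,4)] lim_poly[OF assms(2,4)]])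
      (use cl_continuous_inj[OF assms(3)] polyfun_continuous_on poly in blast)
qed

lemma point_alg_hom:
  assumes \<gamma>: "finv \<gamma>" "gK \<gamma> = 0"
  shows "\<exists>\<phi>. alg_hom_coord_ring V \<phi> \<and> at_point \<gamma> \<phi>"
proof -
  define \<phi> where "\<phi> c = cf (SOME y. \<exists>p P. pext p P \<and> c = cl V p \<and> y = P \<gamma>)" for c
  have ap: "\<phi> (cl V p) = cf (P \<gamma>)" if "pext p P" for p P
  proof -
    have "(SOME y. \<exists>p' P'. pext p' P' \<and> cl V p = cl V p' \<and> y = P' \<gamma>) = P \<gamma>"
      by (rule some_equality) (use that pext_eq_on_V \<gamma>(2) in \<open>blast+\<close>)
    then show ?thesis by (simp add: \<phi>_def)
  qed
  have "alg_hom_coord_ring V \<phi>"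
    unfolding alg_hom_coord_ring_def ring_hom_into_puiseux_def coord_ring_cl rf_const_cl
  proof (intro conjI ballI allI)
    show "\<phi> (cl V (\<lambda>x. 1)) = pconst 1" "\<And>r. \<phi> (cl V (\<lambda>x. r)) = pconst r"
      using ap[OF pext_const] by (simp_all only: cf_rk)
    fix c assume "c \<in> cl V ` polyfun"
    then obtain p P where p: "c = cl V p" "pext p P" using pext_ex by blast
    show "\<phi> c \<in> puiseux" using ap[OF p(2)] p(1) pext_fin[OF p(2) \<gamma>(1)] fin_iff_puiseux by simp
    fix d assume "d \<in> cl V ` polyfun"
    then obtain q Q where q: "d = cl V q" "pext q Q" using pext_ex by blast
    show "\<phi> (rf_add c d) = padd (\<phi> c) (\<phi> d)"
      unfolding p(1) q(1) rf_add_cl ap[OF p(2)] ap[OF q(2)] ap[OF pext_add[OF p(2) q(2)]] by (rule cf_padd)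
    show "\<phi> (rf_mult c d) = pmul (\<phi> c) (\<phi> d)"
      unfolding p(1) q(1) rf_mult_cl ap[OF p(2)] ap[OF q(2)] ap[OF pext_mult[OF p(2) q(2)]] by (rule cf_mult)
  qed
  then show ?thesis using ap unfolding at_point_def by blast
qed

text \<open>Each class is sent to the limit at \<gamma> of a representing quotient. Uniqueness of
  limits makes this independent of the representative, and compatibility of limits with sums and
  products makes it a homomorphism.\<close>

lemma extension_exists:
  assumes \<gamma>: "finv \<gamma>" "gK \<gamma> = 0"
  shows "\<exists>\<psi>. ring_hom_into_puiseux V (R0 V) \<psi> \<and> at_point \<gamma> \<psi>"
proof -
  define val where "val c y \<longleftrightarrow> (\<exists>F P Q. c = cl V F \<and> ext_rep F P Q \<and> lim_at gK P Q \<gamma> y)" for c y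
  have cont: "continuous_on V F" if "ext_rep F P Q" for F P Q using that by (auto simp: ext_rep_def regul_rep_def)
  have uniq: "y = y'" if y: "val c y" "val c y'" for c y y'
  proof -
    obtain F P Q F' P' Q' where F: "c = cl V F" "ext_rep F P Q" "lim_at gK P Q \<gamma> y"
      "c = cl V F'" "ext_rep F' P' Q'" "lim_at gK P' Q' \<gamma> y'" using y unfolding val_def by blast
    show ?thesis
    proof (rule lim_unique[OF F(2,5) _ \<gamma>(2) F(3,6)])
      have "cl V F = cl V F'" using F by simp
      then show "F x = F' x" if "x \<in> V" for x
        using cl_continuous_inj cont[OF F(2)] cont[OF F(5)] that by blast
    qed
  qed
  define \<psi> where "\<psi> c = cf (SOME y. val c y)" for c
  have psi: "\<psi> c = cf y" if "val c y" for c y unfolding \<psi>_def using uniq that by (metis someI)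
  have ap: "\<psi> (cl V p) = cf (P \<gamma>)" if "pext p P" for p P
  proof (rule psi)
    have "ext_rep p P (\<lambda>_. rk 1)" unfolding ext_rep_def
      using regul_poly[OF pext_polyfun[OF that]] that pext_const by blast
    then show "val (cl V p) (P \<gamma>)" unfolding val_def using lim_poly[OF that \<gamma>(2)] by blast
  qed
  have ex: "\<exists>F P Q y. c = cl V F \<and> regul V F \<and> ext_rep F P Q \<and> lim_at gK P Q \<gamma> y" if "c \<in> R0 V" for c
  proof -
    obtain F where F: "c = cl V F" "regul V F" using \<open>c \<in> R0 V\<close> unfolding R0_cl by blast
    obtain P Q where PQ: "ext_rep F P Q" using ext_rep_ex[OF F(2)] by blast
    then show ?thesis using F lim_ex[OF PQ \<gamma>(2)] by blast
  qed
  have "ring_hom_into_puiseux V (R0 V) \<psi>"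
    unfolding ring_hom_into_puiseux_def
  proof (intro conjI ballI)
    show "\<psi> (rf_const V 1) = pconst 1" unfolding rf_const_cl using ap[OF pext_const[of 1]] by (simp only: cf_rk)
    fix c assume "c \<in> R0 V"
    then obtain F P Q y where F: "c = cl V F" "regul V F" "ext_rep F P Q" "lim_at gK P Q \<gamma> y" using ex by blast
    then have yc: "\<psi> c = cf y" by (intro psi) (auto simp: val_def)
    show "\<psi> c \<in> puiseux" using yc lim_st(1)[OF F(3) \<gamma> F(4)] fin_iff_puiseux by simp
    fix d assume "d \<in> R0 V"
    then obtain F' P' Q' y' where F': "d = cl V F'" "regul V F'" "ext_rep F' P' Q'" "lim_at gK P' Q' \<gamma> y'" using ex by blast
    then have yd: "\<psi> d = cf y'" by (intro psi) (auto simp: val_def)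
    obtain P1 Q1 where s: "ext_rep (\<lambda>x. F x + F' x) P1 Q1" using ext_rep_ex regul_intros(2) F(2) F'(2) by blast
    have "val (rf_add c d) (y + y')" unfolding F(1) F'(1) rf_add_cl val_def
      using lim_add[OF F(3) F'(3) s _ \<gamma>(2) F(4) F'(4)] s by blast
    then show "\<psi> (rf_add c d) = padd (\<psi> c) (\<psi> d)" using psi yc yd cf_padd by simp
    obtain P2 Q2 where m: "ext_rep (\<lambda>x. F x * F' x) P2 Q2" using ext_rep_ex regul_intros(3) F(2) F'(2) by blast
    have "val (rf_mult c d) (y * y')" unfolding F(1) F'(1) rf_mult_cl val_def
      using lim_mult[OF F(3) F'(3) m _ \<gamma>(2) F(4) F'(4)] m by blast
    then show "\<psi> (rf_mult c d) = pmul (\<psi> c) (\<psi> d)" using psi yc yd cf_mult by simp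
  qed
  then show ?thesis using ap unfolding at_point_def by blast
qed

section \<open>Uniqueness of the extension\<close>

definition khom :: "puis^'n \<Rightarrow> ((real^'n \<Rightarrow> real) \<Rightarrow> puis) \<Rightarrow> bool" where
  "khom \<gamma> h \<longleftrightarrow> (\<forall>F. regul V F \<longrightarrow> fin (h F)) \<and>
    (\<forall>F G. regul V F \<longrightarrow> regul V G \<longrightarrow> h (\<lambda>x. F x + G x) = h F + h G \<and> h (\<lambda>x. F x * G x) = h F * h G) \<and>
    (\<forall>p P. pext p P \<longrightarrow> h p = P \<gamma>) \<and>
    (\<forall>F G. regul V F \<longrightarrow> regul V G \<longrightarrow> (\<forall>x\<in>V. F x = G x) \<longrightarrow> h F = h G)"

lemma khomD:
  assumes "khom \<gamma> h"
  shows "regul V F \<Longrightarrow> fin (h F)" "regul V F \<Longrightarrow> regul V G \<Longrightarrow> h (\<lambda>x. F x + G x) = h F + h G"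
    "regul V F \<Longrightarrow> regul V G \<Longrightarrow> h (\<lambda>x. F x * G x) = h F * h G" "pext p P \<Longrightarrow> h p = P \<gamma>"
    "regul V F \<Longrightarrow> regul V G \<Longrightarrow> (\<And>x. x \<in> V \<Longrightarrow> F x = G x) \<Longrightarrow> h F = h G"
  using assms unfolding khom_def by blast+

lemma regul_power: "regul V F \<Longrightarrow> regul V (\<lambda>x. F x ^ n)"
  by (induction n) (auto intro: regul_intros pf_const)

lemma khom_power: "khom \<gamma> h \<Longrightarrow> regul V F \<Longrightarrow> h (\<lambda>x. F x ^ n) = h F ^ n"
proof (induction n)
  case 0
  then show ?case using khomD(4)[OF 0(1) pext_const[of 1]] by simp
next
  case (Suc n)
  then show ?case using khomD(3)[OF Suc.prems(1) Suc.prems(2) regul_power[OF Suc.prems(2)]] by simp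
qed

text \<open>Replaces classes by functions and coefficient functions by field elements, so that
  identities on V can be pushed through a homomorphism term by term.\<close>

lemma hom_khom:
  assumes \<psi>: "ring_hom_into_puiseux V (R0 V) \<psi>" and ap: "at_point \<gamma> \<psi>"
  shows "\<exists>h. khom \<gamma> h \<and> (\<forall>F. regul V F \<longrightarrow> \<psi> (cl V F) = cf (h F))"
proof -
  have R: "cl V F \<in> R0 V" if "regul V F" for F using that R0_cl by blast
  have "\<forall>F. \<exists>y. regul V F \<longrightarrow> fin y \<and> cf y = \<psi> (cl V F)"
    using \<psi> R puiseux_in_puis unfolding ring_hom_into_puiseux_def by blast
  then obtain h where h: "\<And>F. regul V F \<Longrightarrow> fin (h F)" "\<And>F. regul V F \<Longrightarrow> cf (h F) = \<psi> (cl V F)" by metis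
  have "khom \<gamma> h" unfolding khom_def
  proof (intro conjI allI impI)
    fix F assume F: "regul V F"
    show "fin (h F)" using h F by blast
    fix G assume G: "regul V G"
    have "cf (h (\<lambda>x. F x + G x)) = padd (cf (h F)) (cf (h G))"
      using \<psi> R[OF F] R[OF G] h(2)[OF regul_intros(2)[OF F G]] h(2)[OF F] h(2)[OF G]
      unfolding ring_hom_into_puiseux_def rf_add_cl[symmetric] by simp
    then show "h (\<lambda>x. F x + G x) = h F + h G" by (intro cf_inject) (simp only: cf_padd)
    have "cf (h (\<lambda>x. F x * G x)) = pmul (cf (h F)) (cf (h G))"
      using \<psi> R[OF F] R[OF G] h(2)[OF regul_intros(3)[OF F G]] h(2)[OF F] h(2)[OF G]
      unfolding ring_hom_into_puiseux_def rf_mult_cl[symmetric] by simp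
    then show "h (\<lambda>x. F x * G x) = h F * h G" by (intro cf_inject) (simp only: cf_mult)
    assume eq: "\<forall>x\<in>V. F x = G x"
    have "cl V F = cl V G" by (rule cl_cong[OF pf_const[of 1]]) (use eq nonempty in auto)
    then show "h F = h G" using h(2)[OF F] h(2)[OF G] by (intro cf_inject) simp
  next
    fix p :: "real^'n \<Rightarrow> real" and P assume p: "pext p P"
    have "regul V p" using regul_intros(1) pext_polyfun[OF p] by blast
    then have "cf (h p) = cf (P \<gamma>)" using h(2) ap p unfolding at_point_def by simp
    then show "h p = P \<gamma>" by (rule cf_inject)
  qed
  then show ?thesis using h(2) by metis
qed

lemma dsq_poly: "(\<lambda>x. dsq x x0) \<in> polyfun"
  unfolding dsq_def by (intro polyfun_sum polyfun_power polyfun_diff pf_coord pf_const)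

lemma dsq_nonneg: "dsq x (y :: real^'n) \<ge> 0" and dsq_zero: "dsq x y = 0 \<longleftrightarrow> x = (y :: real^'n)"
  by (simp_all add: dsq_dist)

text \<open>The quotient is dominated by a power of H away from x0, and by Lojasiewicz near x0.\<close>
lemma quotient_regul:
  assumes R: "regul_rep V H p q" and w: "w \<in> polyfun" "\<And>x. w x \<ge> 0" and x0: "x0 \<in> V" "w x0 = 0" and rho: "\<rho> > 0"
    and z: "\<And>x. x \<in> V \<Longrightarrow> dsq x x0 \<le> \<rho> \<Longrightarrow> w x = 0 \<Longrightarrow> H x = 0"
    and N: "N \<ge> 1" and d: "d > 0" and loj: "\<And>x. x \<in> V \<Longrightarrow> dsq x x0 \<le> \<rho> \<Longrightarrow> 0 < w x \<Longrightarrow> w x < d \<Longrightarrow> H x ^ (2 * N) < w x"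
    and nz: "\<exists>x\<in>V. H x \<noteq> 0"
  shows "\<exists>k. regul V k \<and> (\<forall>x\<in>V. k x * (w x + (H x)\<^sup>2 * dsq x x0 ^ M) = H x ^ (2 * N + 2))"
proof -
  have cH: "continuous_on V H" and pq: "p \<in> polyfun" "q \<in> polyfun" "\<exists>x\<in>V. q x \<noteq> 0" and Hq: "\<And>x. x \<in> V \<Longrightarrow> H x * q x = p x"
    using R by (auto simp: regul_rep_def)
  define rr where "rr x = dsq x x0 ^ M" for x
  have rp: "rr \<in> polyfun" unfolding rr_def[abs_def] by (intro polyfun_power dsq_poly)
  have r0: "rr x \<ge> 0" for x by (simp add: rr_def dsq_nonneg)
  define den where "den x = w x + (H x)\<^sup>2 * rr x" for x
  \<comment> \<open>Where the denominator vanishes so does H (\<open>Hden\<close>), hence the value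
    0 keeps the identity k den = H^(2 N + 2) valid on all of V.\<close>
  define k where "k x = (if den x = 0 then 0 else H x ^ (2 * N + 2) / den x)" for x
  have den0: "den x \<ge> 0" for x using w(2)[of x] r0[of x] by (simp add: den_def)
  have He: "H x ^ (2 * N + 2) = H x ^ (2 * N) * (H x)\<^sup>2" for x by (simp only: power_add)
  have ev: "H x ^ (2 * N) \<ge> 0" for x by (simp add: power_mult)
  have k0: "k x \<ge> 0" for x unfolding k_def He using ev[of x] den0[of x] by (simp add: divide_nonneg_nonneg)
  have Hx0: "H x0 = 0" using z[OF x0(1) _ x0(2)] rho by (simp add: dsq_dist)
  have Hden: "H x = 0" if x: "x \<in> V" "den x = 0" for x
  proof (rule ccontr)
    assume n: "H x \<noteq> 0"
    have "w x \<ge> 0" "(H x)\<^sup>2 * rr x \<ge> 0" using w(2) r0 by auto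
    then have "(H x)\<^sup>2 * rr x = 0" using x(2) unfolding den_def by linarith
    then have "dsq x x0 = 0" using n by (auto simp: rr_def)
    then show False using n Hx0 dsq_zero by simp
  qed
  have cD: "continuous_on V den" unfolding den_def
    by (intro continuous_intros cH polyfun_continuous_on w rp)
  have cw: "continuous_on V w" "continuous_on V (\<lambda>x. dsq x x0)"
    using polyfun_continuous_on w(1) dsq_poly by blast+
  have "(k \<longlongrightarrow> k x1) (at x1 within V)" if x1: "x1 \<in> V" for x1
  proof (cases "den x1 = 0")
    case False
    have l1: "(den \<longlongrightarrow> den x1) (at x1 within V)" "(H \<longlongrightarrow> H x1) (at x1 within V)"
      using cD cH x1 by (auto simp: continuous_on_def)
    have lim: "((\<lambda>x. H x ^ (2 * N + 2) / den x) \<longlongrightarrow> H x1 ^ (2 * N + 2) / den x1) (at x1 within V)"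
      using l1 False by (intro tendsto_intros)
    have "\<forall>\<^sub>F x in at x1 within V. den x \<noteq> 0" using l1(1) False by (rule tendsto_imp_eventually_ne)
    then have ev: "\<forall>\<^sub>F x in at x1 within V. H x ^ (2 * N + 2) / den x = k x" by eventually_elim (simp add: k_def)
    have "k x1 = H x1 ^ (2 * N + 2) / den x1" using False by (simp add: k_def)
    then show ?thesis using Lim_transform_eventually[OF lim ev] by (simp only:)
  next
    case True
    have H1: "H x1 = 0" using Hden x1 True by blast
    have lH: "(H \<longlongrightarrow> 0) (at x1 within V)" using cH x1 H1 by (auto simp: continuous_on_def)
    have "(k \<longlongrightarrow> 0) (at x1 within V)"
    proof (cases "x1 = x0")
      case True
      have "(w \<longlongrightarrow> 0) (at x1 within V)" "((\<lambda>x. dsq x x0) \<longlongrightarrow> 0) (at x1 within V)"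
        using cw x1 x0 True by (auto simp: continuous_on_def dsq_dist)
      then have "\<forall>\<^sub>F x in at x1 within V. w x < d" "\<forall>\<^sub>F x in at x1 within V. dsq x x0 < \<rho>"
        using d rho order_tendstoD(2) by blast+
      moreover have "\<forall>\<^sub>F x in at x1 within V. x \<in> V" by (simp add: eventually_at_filter)
      ultimately have "\<forall>\<^sub>F x in at x1 within V. norm (k x) \<le> (H x)\<^sup>2"
      proof eventually_elim
        case (elim x)
        show ?case
        proof (cases "w x = 0")
          case True
          then have "H x = 0" using z[of x] elim by simp
          then show ?thesis by (simp add: k_def)
        next
          case False
          then have wx: "w x > 0" using w(2)[of x] by simp
          then have "H x ^ (2 * N) \<le> w x" using loj[of x] elim by simp
          also have "w x \<le> den x" using r0[of x] by (simp add: den_def)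
          finally have le: "H x ^ (2 * N) \<le> den x" .
          have "den x > 0" using wx r0[of x] by (simp add: den_def add_pos_nonneg)
          then have "k x = H x ^ (2 * N) / den x * (H x)\<^sup>2" unfolding k_def He by simp
          also have "\<dots> \<le> 1 * (H x)\<^sup>2" using le \<open>den x > 0\<close> by (intro mult_right_mono) auto
          finally show ?thesis using k0[of x] by simp
        qed
      qed
      moreover have "((\<lambda>x. (H x)\<^sup>2) \<longlongrightarrow> 0) (at x1 within V)" using tendsto_power[OF lH, of 2] by simp
      ultimately show ?thesis by (rule Lim_null_comparison)
    next
      case ne: False
      have l: "((\<lambda>x. rr x) \<longlongrightarrow> rr x1) (at x1 within V)"
        using polyfun_continuous_on[OF rp, of V] x1 by (auto simp: continuous_on_def)
      have r1: "rr x1 > 0" using ne by (simp add: rr_def dsq_dist)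
      then have "\<forall>\<^sub>F x in at x1 within V. rr x > 0" using order_tendstoD(1)[OF l] by blast
      then have "\<forall>\<^sub>F x in at x1 within V. norm (k x) \<le> H x ^ (2 * N) / rr x"
      proof eventually_elim
        case (elim x)
        show ?case
        proof (cases "H x = 0")
          case True
          then show ?thesis using N by (simp add: k_def power_0_left)
        next
          case False
          then have hr: "(H x)\<^sup>2 * rr x > 0" using elim by simp
          have le: "(H x)\<^sup>2 * rr x \<le> den x" using w(2)[of x] by (simp add: den_def)
          have "k x = H x ^ (2 * N + 2) / den x" using hr le by (simp add: k_def)
          also have "\<dots> \<le> H x ^ (2 * N + 2) / ((H x)\<^sup>2 * rr x)"
            using le hr ev[of x] unfolding He by (intro divide_left_mono) auto
          also have "\<dots> = H x ^ (2 * N) / rr x" unfolding He using False by simp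
          finally show ?thesis using k0[of x] by simp
        qed
      qed
      moreover have "((\<lambda>x. H x ^ (2 * N) / rr x) \<longlongrightarrow> 0 ^ (2 * N) / rr x1) (at x1 within V)"
        using r1 by (intro tendsto_intros lH l) auto
      ultimately show ?thesis using N by (intro Lim_null_comparison[of k "\<lambda>x. H x ^ (2 * N) / rr x"]) (auto simp: power_0_left)
    qed
    then show ?thesis using True by (simp add: k_def)
  qed
  then have ck: "continuous_on V k" by (simp add: continuous_on_def)
  have eq: "k x * den x = H x ^ (2 * N + 2)" if "x \<in> V" for x
    using Hden[OF that] by (cases "den x = 0") (simp_all add: k_def)
  \<comment> \<open>The denominator of k after multiplication by q^(2 N + 2), in which H q has been
    replaced by p.\<close>
  define qk where "qk x = (w x * (q x)\<^sup>2 + (p x)\<^sup>2 * rr x) * q x ^ (2 * N)" for x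
  have "regul_rep V k (\<lambda>x. p x ^ (2 * N + 2)) qk"
    unfolding regul_rep_def
  proof (intro conjI ballI)
    show "continuous_on V k" by fact
    show "(\<lambda>x. p x ^ (2 * N + 2)) \<in> polyfun" "qk \<in> polyfun"
      unfolding qk_def[abs_def] by (intro pf_add pf_mult polyfun_power pq w rp)+
    show "k x * qk x = p x ^ (2 * N + 2)" if x: "x \<in> V" for x
    proof -
      have "qk x = den x * q x ^ (2 * N + 2)"
        unfolding qk_def den_def Hq[OF x, symmetric] by (simp add: power_add algebra_simps power2_eq_square)
      then have "k x * qk x = H x ^ (2 * N + 2) * q x ^ (2 * N + 2)" using eq[OF x] by simp
      then show ?thesis using Hq[OF x] by (simp only: power_mult_distrib[symmetric])
    qed
    \<comment> \<open>Otherwise H would vanish on the nonzero locus of q and, by density,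
      everywhere.\<close>
    have "\<exists>x\<in>V. H x \<noteq> 0 \<and> q x \<noteq> 0"
    proof (rule ccontr)
      assume "\<not> ?thesis"
      then have "H x = 0" if "x \<in> V" for x
        by (intro continuous_eqI[of H "\<lambda>_. 0" q x] cH continuous_on_const pq that) blast
      then show False using nz by blast
    qed
    then obtain x where x: "x \<in> V" "H x \<noteq> 0" "q x \<noteq> 0" by blast
    have "x \<noteq> x0" using x Hx0 by auto
    then have "rr x > 0" by (simp add: rr_def dsq_dist)
    moreover have "p x \<noteq> 0" using Hq[OF x(1)] x by auto
    ultimately have "w x * (q x)\<^sup>2 + (p x)\<^sup>2 * rr x > 0" using w(2)[of x] by (intro add_nonneg_pos) auto
    then show "\<exists>x\<in>V. qk x \<noteq> 0" using x unfolding qk_def by (intro bexI[of _ x]) auto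
  qed
  then show ?thesis using eq unfolding regul_def den_def rr_def by blast
qed

text \<open>If r has order v > 0, every finite multiple of r^M has order at least M v, so a nonzero
  z would have arbitrarily large order.\<close>

lemma infinitely_divisible:
  assumes r: "fin r" "st r = 0" and k: "\<And>M. M \<ge> 1 \<Longrightarrow> \<exists>k. fin k \<and> k * r ^ M = z"
  shows "z = 0"
proof (rule ccontr)
  assume z: "z \<noteq> 0"
  then have r0: "r \<noteq> 0" using k[of 1] by auto
  obtain v where v: "cf r v \<noteq> 0" "\<And>q. q < v \<Longrightarrow> cf r q = 0" using puis_first_coeff[OF r0] by blast
  have "v > 0" using v(1) r by (metis fin_def linorder_neqE)
  obtain u where u: "cf z u \<noteq> 0" using puis_first_coeff[OF z] by blast
  obtain M :: nat where M: "u / v < of_nat M" using reals_Archimedean2 by blast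
  define M' where "M' = Suc M"
  have Mv: "u < of_nat M' * v" using M \<open>v > 0\<close> by (simp add: M'_def field_simps) 
  obtain k where k: "fin k" "k * r ^ M' = z" using k[of M'] by (auto simp: M'_def)
  define s where "s = tpow (- v) * r"
  have "fin s" using v(2) by (auto simp: s_def fin_def cf_tpow_mult)
  have "r = tpow v * s" by (rule puis_eqI) (simp add: s_def cf_tpow_mult)
  then have "z = tpow (of_nat M' * v) * (k * s ^ M')" using k(2) by (simp add: power_mult_distrib tpow_power mult_ac)
  moreover have "fin (k * s ^ M')" using k(1) \<open>fin s\<close> fin_st_power fin_st_ops(2) by blast
  ultimately have "cf z u = 0" using Mv by (simp add: cf_tpow_mult fin_def)
  then show False using u by simp
qed

text \<open>The continuous quotient is sent to a finite series K with K (h H)^2 R^M = (h H)^(2 N +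
  2), where R is the infinitesimal squared distance of \<gamma> from its residue point. Cancelling
  (h H)^2 makes (h H)^(2 N) divisible by every power of R.\<close>

lemma khom_zero:
  assumes h: "khom \<gamma> h" and \<gamma>: "finv \<gamma>" "gK \<gamma> = 0" and R: "regul_rep V H p q"
    and w: "pext w W" "\<And>x. w x \<ge> 0" "W \<gamma> = 0" and rho: "\<rho> > 0"
    and z: "\<And>x. x \<in> V \<Longrightarrow> dsq x (stv \<gamma>) \<le> \<rho> \<Longrightarrow> w x = 0 \<Longrightarrow> H x = 0"
  shows "h H = 0"
proof (cases "\<exists>x\<in>V. H x \<noteq> 0")
  case False
  have "regul V H" using R regul_def by blast
  then have "h H = h (\<lambda>x. 0)" using False by (intro khomD(5)[OF h _ regul_intros(1)[OF pf_const]]) auto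
  then show ?thesis using khomD(4)[OF h pext_const[of 0]] by simp
next
  case nz: True
  define x0 where "x0 = stv \<gamma>"
  have x0: "x0 \<in> V" "w x0 = 0" using stv_in_V[OF \<gamma>] pext_fin[OF w(1) \<gamma>(1)] w(3) by (auto simp: x0_def)
  have wp: "w \<in> polyfun" using pext_polyfun[OF w(1)] .
  have rH: "regul V H" and rw: "regul V w" using R regul_def regul_intros(1)[OF wp] by blast+
  have z': "x \<in> V \<Longrightarrow> dsq x x0 \<le> \<rho> \<Longrightarrow> w x = 0 \<Longrightarrow> H x = 0" for x using z by (simp add: x0_def)
  obtain N d where N: "N \<ge> 1" and d: "d > 0" and loj: "\<And>x. x \<in> V \<Longrightarrow> dsq x x0 \<le> \<rho> \<Longrightarrow> 0 < w x \<Longrightarrow> w x < d \<Longrightarrow> H x ^ (2 * N) < w x"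
    using lojasiewicz[OF R wp w(2) x0 rho z'] by blast
  obtain Rk where Rk: "pext (\<lambda>x. dsq x x0) Rk" using pext_ex[OF dsq_poly] by blast
  have rd: "regul V (\<lambda>x. dsq x x0)" using regul_intros(1)[OF dsq_poly] .
  have fr: "fin (Rk \<gamma>)" "st (Rk \<gamma>) = 0" using pext_fin[OF Rk \<gamma>(1)] by (auto simp: x0_def dsq_dist)
  show ?thesis
  proof (rule ccontr)
    assume nH: "h H \<noteq> 0"
    have "h H ^ (2 * N) = 0"
    proof (rule infinitely_divisible[OF fr])
      fix M :: nat assume "M \<ge> 1"
      obtain k where k: "regul V k" "\<And>x. x \<in> V \<Longrightarrow> k x * (w x + (H x)\<^sup>2 * dsq x x0 ^ M) = H x ^ (2 * N + 2)"
        using quotient_regul[OF R wp w(2) x0 rho z' N d loj nz] by blast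
      have r1: "regul V (\<lambda>x. (H x)\<^sup>2)" "regul V (\<lambda>x. dsq x x0 ^ M)" using regul_power rH rd by blast+
      have r2: "regul V (\<lambda>x. (H x)\<^sup>2 * dsq x x0 ^ M)" using regul_intros(3)[OF r1] .
      have r3: "regul V (\<lambda>x. w x + (H x)\<^sup>2 * dsq x x0 ^ M)" using regul_intros(2)[OF rw r2] .
      have "h (\<lambda>x. k x * (w x + (H x)\<^sup>2 * dsq x x0 ^ M)) = h (\<lambda>x. H x ^ (2 * N + 2))"
        by (rule khomD(5)[OF h regul_intros(3)[OF k(1) r3] regul_power[OF rH]]) (rule k(2))
      then have "h k * (W \<gamma> + (h H)\<^sup>2 * Rk \<gamma> ^ M) = h H ^ (2 * N + 2)"
        unfolding khomD(3)[OF h k(1) r3] khomD(2)[OF h rw r2] khomD(3)[OF h r1] khom_power[OF h rH] khom_power[OF h rd]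
          khomD(4)[OF h w(1)] khomD(4)[OF h Rk] .
      then have "(h k * Rk \<gamma> ^ M) * (h H)\<^sup>2 = h H ^ (2 * N) * (h H)\<^sup>2"
        unfolding w(3) power_add by (simp only: add_0 mult_ac)
      then have "h k * Rk \<gamma> ^ M = h H ^ (2 * N)" using nH by simp
      then show "\<exists>k. fin k \<and> k * Rk \<gamma> ^ M = h H ^ (2 * N)" using khomD(1)[OF h k(1)] by blast
    qed
    then show False using nH by simp
  qed
qed

text \<open>\<open>B\<close> and \<open>A\<close> are the j-th derivatives of q and p evaluated at
  \<gamma>. No homomorphism enters into them, so all extensions take the value A / B on F.\<close>

lemma unique_value:
  assumes \<gamma>: "finv \<gamma>" "gK \<gamma> = 0" and F: "regul V F"
  shows "\<exists>A B. B \<noteq> 0 \<and> (\<forall>h. khom \<gamma> h \<longrightarrow> h F * B = A)"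
proof -
  obtain p q where R: "regul_rep V F p q" using F regul_def by blast
  then have cF: "continuous_on V F" and pq: "p \<in> polyfun" "q \<in> polyfun" "\<exists>x\<in>V. q x \<noteq> 0" and Fq: "\<And>x. x \<in> V \<Longrightarrow> F x * q x = p x"
    by (auto simp: regul_rep_def)
  define x0 where "x0 = stv \<gamma>"
  have x0: "x0 \<in> V" using stv_in_V[OF \<gamma>] by (simp add: x0_def)
  obtain T r X \<Psi> U \<Delta> D where "chart V x0 T r X \<Psi> U \<Delta> D" using chart_exists[OF algV ns x0] by blast
  then interpret c: chart V x0 T r X \<Psi> U \<Delta> D .
  \<comment> \<open>Otherwise the identity theorem would make q vanish on V near x0, against
    density.\<close>
  have "\<exists>e\<in>T. \<exists>j. (D e ^^ j) q x0 \<noteq> 0"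
  proof (rule ccontr)
    assume no: "\<not> ?thesis"
    obtain x where x: "x \<in> V" "x \<in> U" "q x \<noteq> 0" using dense[OF pq(2,3) x0 c.openU c.x0U] by blast
    have y: "\<Psi> x \<in> T" "\<Psi> x \<in> ball 0 r" "X (\<Psi> x) = x" using c.VT x c.XPsi by auto
    have "q (X (0 + \<Psi> x)) = 0"
      by (rule c.chart_identity[OF pq(2)]) (use no y c.r c.X0 in auto)
    then show False using y x by simp
  qed
  then obtain e j0 where e: "e \<in> T" "(D e ^^ j0) q x0 \<noteq> 0" by blast
  have "\<forall>i. \<exists>Q. pext ((D e ^^ i) q) Q" using pext_ex c.Dk_poly[OF pq(2)] by blast
  then obtain QQ where QQ: "\<And>i. pext ((D e ^^ i) q) (QQ i)" by metis
  have "st (QQ j0 \<gamma>) \<noteq> 0" using pext_fin[OF QQ \<gamma>(1)] e(2) by (simp add: x0_def)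
  then have ex: "\<exists>j. QQ j \<gamma> \<noteq> 0" by (intro exI[of _ j0]) auto
  \<comment> \<open>The least order of a derivative of q that is nonzero at \<gamma>; one exists
    because the derivative of order \<open>j0\<close> is nonzero already at the residue point.
    Vanishing of the lower ones at \<gamma> itself, not just at x0, is what gives w = 0
    there.\<close>
  define j where "j = (LEAST j. QQ j \<gamma> \<noteq> 0)"
  have j: "QQ j \<gamma> \<noteq> 0" "\<And>i. i < j \<Longrightarrow> QQ i \<gamma> = 0"
    unfolding j_def using LeastI_ex[OF ex] not_less_Least by blast+
  define a b where "a = (D e ^^ j) p" and "b = (D e ^^ j) q"
  have ab: "a \<in> polyfun" "b \<in> polyfun" using c.Dk_poly pq by (auto simp: a_def b_def)
  obtain A where A: "pext a A" using pext_ex ab by blast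
  have B: "pext b (QQ j)" using QQ b_def by simp
  define w where "w n x = (\<Sum>i<n. ((D e ^^ i) q x)\<^sup>2)" for n x
  define W where "W n x = (\<Sum>i<n. (QQ i x)\<^sup>2)" for n x
  have wW: "pext (w n) (W n)" for n
  proof (induction n)
    case 0
    show ?case using pext_const[of 0] by (simp add: w_def[abs_def] W_def[abs_def])
  next
    case (Suc n)
    show ?case using pext_add[OF Suc pext_mult[OF QQ[of n] QQ[of n]]]
      by (simp add: w_def[abs_def] W_def[abs_def] power2_eq_square)
  qed
  have w0: "w j x \<ge> 0" for x by (auto simp: w_def intro: sum_nonneg)
  have W0: "W j \<gamma> = 0" using j(2) by (simp add: W_def)
  obtain \<rho> where \<rho>: "\<rho> > 0" "cball x0 \<rho> \<subseteq> U" using c.openU c.x0U open_contains_cball by metis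
  define H where "H x = b x * F x + (- 1) * a x" for x
  have z: "H x = 0" if x: "x \<in> V" "dsq x (stv \<gamma>) \<le> \<rho>\<^sup>2" "w j x = 0" for x
  proof -
    have "(dist x x0)\<^sup>2 \<le> \<rho>\<^sup>2" using x(2) by (simp add: x0_def dsq_dist)
    then have "dist x x0 \<le> \<rho>" by (rule power2_le_imp_le) (use \<rho>(1) in simp)
    then have xU: "x \<in> U" using \<rho>(2) by (auto simp: subset_iff dist_commute)
    have "(D e ^^ i) q x = 0" if "i < j" for i
    proof -
      have "\<forall>i\<in>{..<j}. ((D e ^^ i) q x)\<^sup>2 = 0"
        using x(3) unfolding w_def by (subst (asm) sum_nonneg_eq_0_iff) auto
      then show ?thesis using that by simp
    qed
    then have "F x * b x = a x" unfolding a_def b_def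
      using c.chart_lhopital[OF pq(1,2) cF Fq e(1) x(1) xU] by blast
    then show ?thesis by (simp add: H_def mult.commute)
  qed
  have ra: "regul V (\<lambda>x. - 1 * a x)" and rb: "regul V b" and rbF: "regul V (\<lambda>x. b x * F x)"
    using regul_intros(1)[OF pf_mult[OF pf_const[of "- 1"] ab(1)]] regul_intros(1)[OF ab(2)]
      regul_intros(3)[OF regul_intros(1)[OF ab(2)] F] by blast+
  have rH: "regul V H" unfolding H_def[abs_def] using regul_intros(2)[OF rbF ra] .
  then obtain pH qH where RH: "regul_rep V H pH qH" using regul_def by blast
  have "h F * QQ j \<gamma> = A \<gamma>" if h: "khom \<gamma> h" for h
  proof -
    have "h H = 0"
      by (rule khom_zero[OF h \<gamma> RH wW[of j] w0 W0, of "\<rho>\<^sup>2"]) (use \<rho>(1) z in auto)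
    moreover have "h H = QQ j \<gamma> * h F + rk (-1) * A \<gamma>"
      unfolding H_def[abs_def] khomD(2)[OF h rbF ra] khomD(3)[OF h rb F] khomD(4)[OF h B]
        khomD(4)[OF h pext_mult[OF pext_const[of "-1"] A]] ..
    ultimately show ?thesis by (simp add: mult.commute)
  qed
  then show ?thesis using j(1) by blast
qed

lemma agree_at_point:
  assumes "at_point \<gamma> \<phi>"
  shows "(\<forall>c\<in>coord_ring V. \<psi> c = \<phi> c) \<longleftrightarrow> at_point \<gamma> \<psi>"
proof
  assume l: "\<forall>c\<in>coord_ring V. \<psi> c = \<phi> c"
  show "at_point \<gamma> \<psi>" unfolding at_point_def
  proof (intro allI impI)
    fix p :: "real^'n \<Rightarrow> real" and P assume p: "pext p P"
    have "cl V p \<in> coord_ring V" using pext_polyfun[OF p] by (simp add: coord_ring_cl)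
    then show "\<psi> (cl V p) = cf (P \<gamma>)" using l assms p unfolding at_point_def by simp
  qed
next
  assume r: "at_point \<gamma> \<psi>"
  show "\<forall>c\<in>coord_ring V. \<psi> c = \<phi> c"
  proof
    fix c assume "c \<in> coord_ring V"
    then obtain p P where "c = cl V p" "pext p P" using pext_ex unfolding coord_ring_cl by blast
    then show "\<psi> c = \<phi> c" using r assms unfolding at_point_def by simp
  qed
qed

theorem R0_subst_prop: "subst_prop V (R0 V)"
  unfolding subst_prop_def
proof (intro allI impI)
  fix \<phi> assume \<phi>: "alg_hom_coord_ring V \<phi>"
  obtain \<gamma> where \<gamma>: "finv \<gamma>" "gK \<gamma> = 0" "at_point \<gamma> \<phi>" using alg_hom_point[OF \<phi>] by blast
  obtain \<psi> where \<psi>: "ring_hom_into_puiseux V (R0 V) \<psi>" "at_point \<gamma> \<psi>" using extension_exists[OF \<gamma>(1,2)] by blast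
  have agree: "(\<forall>c\<in>coord_ring V. \<psi>' c = \<phi> c) \<longleftrightarrow> at_point \<gamma> \<psi>'" for \<psi>'
    using agree_at_point[OF \<gamma>(3)] .
  show "\<exists>\<psi>. ring_hom_into_puiseux V (R0 V) \<psi> \<and> (\<forall>c\<in>coord_ring V. \<psi> c = \<phi> c) \<and>
        (\<forall>\<psi>'. ring_hom_into_puiseux V (R0 V) \<psi>' \<and> (\<forall>c\<in>coord_ring V. \<psi>' c = \<phi> c) \<longrightarrow> (\<forall>c\<in>R0 V. \<psi>' c = \<psi> c))"
  proof (intro exI[of _ \<psi>] conjI allI impI ballI)
    show "ring_hom_into_puiseux V (R0 V) \<psi>" by fact
    show "\<And>c. c \<in> coord_ring V \<Longrightarrow> \<psi> c = \<phi> c" using agree \<psi>(2) by blast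
    fix \<psi>' c assume \<psi>': "ring_hom_into_puiseux V (R0 V) \<psi>' \<and> (\<forall>c\<in>coord_ring V. \<psi>' c = \<phi> c)" and c: "c \<in> R0 V"
    obtain F where F: "c = cl V F" "regul V F" using c unfolding R0_cl by blast
    obtain h where h: "khom \<gamma> h" "\<psi> (cl V F) = cf (h F)" using hom_khom[OF \<psi>] F(2) by blast
    have "at_point \<gamma> \<psi>'" using agree \<psi>' by blast
    then obtain h' where h': "khom \<gamma> h'" "\<psi>' (cl V F) = cf (h' F)" using hom_khom[of \<psi>' \<gamma>] \<psi>' F(2) by blast
    obtain A B where AB: "B \<noteq> 0" "\<And>h. khom \<gamma> h \<Longrightarrow> h F * B = A" using unique_value[OF \<gamma>(1,2) F(2)] by blast
    have "h F = h' F" using AB(2)[OF h(1)] AB(2)[OF h'(1)] AB(1) by (metis mult_cancel_right)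
    then show "\<psi>' c = \<psi> c" using h h' F by simp
  qed
qed

section \<open>Subrings with the substitution property\<close>

lemma subring_hom_quotient:
  assumes B: "is_subring_RV V B" and \<psi>: "ring_hom_into_puiseux V B \<psi>" and ap: "at_point \<gamma> \<psi>"
    and p: "pext p P" and q: "pext q Q" "\<exists>x\<in>V. q x \<noteq> 0" and c: "c \<in> B" "c = cl V (\<lambda>x. p x / q x)"
  shows "\<exists>y. fin y \<and> cf y = \<psi> c \<and> y * Q \<gamma> = P \<gamma>"
proof -
  have "\<psi> c \<in> puiseux" using \<psi> c(1) by (auto simp: ring_hom_into_puiseux_def)
  then obtain y where y: "fin y" "cf y = \<psi> c" using puiseux_in_puis by blast
  have qB: "cl V q \<in> B" using B pext_polyfun[OF q(1)] unfolding is_subring_RV_def coord_ring_cl by blast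
  have "rf_mult c (cl V q) = cl V p"
    unfolding c(2) rf_mult_cl by (rule cl_cong[OF pext_polyfun[OF q(1)] q(2)]) auto
  then have "\<psi> (cl V p) = pmul (\<psi> c) (\<psi> (cl V q))"
    using \<psi> c(1) qB unfolding ring_hom_into_puiseux_def by metis
  then have "cf (P \<gamma>) = cf (y * Q \<gamma>)" using ap p q y(2) unfolding at_point_def by (simp add: cf_mult)
  then have "y * Q \<gamma> = P \<gamma>" using cf_inject by metis
  then show ?thesis using y by blast
qed

text \<open>Taking residues turns an extension along the arc \<gamma> into one along the constant
  arc at its residue point, where uniqueness can be applied.\<close>

lemma subring_hom_residue:
  assumes B: "is_subring_RV V B" and \<psi>: "ring_hom_into_puiseux V B \<psi>" and ap: "at_point \<gamma> \<psi>" and \<gamma>: "finv \<gamma>" "gK \<gamma> = 0"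
  shows "ring_hom_into_puiseux V B (\<lambda>c. pconst (\<psi> c 0)) \<and> at_point (rkv (stv \<gamma>)) (\<lambda>c. pconst (\<psi> c 0))"
proof
  have val: "\<exists>y. fin y \<and> cf y = \<psi> c" if "c \<in> B" for c
    using \<psi> that puiseux_in_puis by (auto simp: ring_hom_into_puiseux_def)
  have cfrk: "cf (rk a) = pconst a" for a by (rule cf_rk)
  show "ring_hom_into_puiseux V B (\<lambda>c. pconst (\<psi> c 0))"
    unfolding ring_hom_into_puiseux_def
  proof (intro conjI ballI)
    show "pconst (\<psi> (rf_const V 1) 0) = pconst 1" using \<psi> by (simp add: ring_hom_into_puiseux_def pconst_def)
    fix c assume c: "c \<in> B"
    obtain y where y: "fin y" "cf y = \<psi> c" using val[OF c] by blast
    show "pconst (\<psi> c 0) \<in> puiseux" using fin_iff_puiseux[of "rk (\<psi> c 0)"] by (simp add: cf_rk)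
    fix d assume d: "d \<in> B"
    obtain z where z: "fin z" "cf z = \<psi> d" using val[OF d] by blast
    have "\<psi> (rf_add c d) = cf (y + z)" using \<psi> c d y z by (simp add: ring_hom_into_puiseux_def cf_padd)
    then have "\<psi> (rf_add c d) 0 = \<psi> c 0 + \<psi> d 0" using y z by simp
    then show "pconst (\<psi> (rf_add c d) 0) = padd (pconst (\<psi> c 0)) (pconst (\<psi> d 0))"
      by (simp add: cfrk[symmetric] cf_padd[symmetric])
    have "\<psi> (rf_mult c d) = cf (y * z)" using \<psi> c d y z by (simp add: ring_hom_into_puiseux_def cf_mult)
    then have "\<psi> (rf_mult c d) 0 = \<psi> c 0 * \<psi> d 0" using y z fin_st_ops(5)[OF y(1) z(1)] by simp
    then show "pconst (\<psi> (rf_mult c d) 0) = pmul (pconst (\<psi> c 0)) (pconst (\<psi> d 0))"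
      by (simp add: cfrk[symmetric] cf_mult[symmetric])
  qed
  show "at_point (rkv (stv \<gamma>)) (\<lambda>c. pconst (\<psi> c 0))"
    unfolding at_point_def
  proof (intro allI impI)
    fix p :: "real^'n \<Rightarrow> real" and P assume p: "pext p P"
    then have "\<psi> (cl V p) 0 = p (stv \<gamma>)" using ap pext_fin[OF p \<gamma>(1)] unfolding at_point_def by simp
    then show "pconst (\<psi> (cl V p) 0) = cf (P (rkv (stv \<gamma>)))" using pext_rkv[OF p] by (simp add: cf_rk)
  qed
qed

theorem subst_prop_subset_R0:
  assumes B: "is_subring_RV V B" and sp: "subst_prop V B"
  shows "B \<subseteq> R0 V"
proof
  fix c assume cB: "c \<in> B"
  have ext: "\<exists>\<psi>. ring_hom_into_puiseux V B \<psi> \<and> at_point \<gamma> \<psi> \<and>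
      (\<forall>\<psi>'. ring_hom_into_puiseux V B \<psi>' \<longrightarrow> at_point \<gamma> \<psi>' \<longrightarrow> (\<forall>c\<in>B. \<psi>' c = \<psi> c))"
    if g: "finv \<gamma>" "gK \<gamma> = 0" for \<gamma>
  proof -
    obtain \<phi> where \<phi>: "alg_hom_coord_ring V \<phi>" "at_point \<gamma> \<phi>" using point_alg_hom[OF g] by blast
    have "\<exists>\<psi>. ring_hom_into_puiseux V B \<psi> \<and> (\<forall>c\<in>coord_ring V. \<psi> c = \<phi> c) \<and>
        (\<forall>\<psi>'. ring_hom_into_puiseux V B \<psi>' \<and> (\<forall>c\<in>coord_ring V. \<psi>' c = \<phi> c) \<longrightarrow> (\<forall>c\<in>B. \<psi>' c = \<psi> c))"
      using sp \<phi>(1) unfolding subst_prop_def by simp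
    then show ?thesis unfolding agree_at_point[OF \<phi>(2)] by blast
  qed
  obtain p q where pq: "c = ratfun_class V p q" "p \<in> polyfun" "q \<in> polyfun" "\<exists>x\<in>V. q x \<noteq> 0"
    using B cB unfolding is_subring_RV_def RV_def by blast
  have c: "c = cl V (\<lambda>x. p x / q x)" using pq ratfun_class_cl by simp
  obtain P Q where PQ: "pext p P" "pext q Q" using pext_ex pq by blast
  have rkv: "finv (rkv x)" "gK (rkv x) = 0" if "x \<in> V" for x
    using that Vg pext_rkv[OF gext, of x] by (auto simp: finv_def rkv_def)
  have "\<forall>x\<in>V. \<exists>\<psi>. ring_hom_into_puiseux V B \<psi> \<and> at_point (rkv x) \<psi> \<and>
      (\<forall>\<psi>'. ring_hom_into_puiseux V B \<psi>' \<longrightarrow> at_point (rkv x) \<psi>' \<longrightarrow> (\<forall>c\<in>B. \<psi>' c = \<psi> c))"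
    using ext rkv by blast
  then obtain \<psi> where \<psi>: "\<And>x. x \<in> V \<Longrightarrow> ring_hom_into_puiseux V B (\<psi> x)" "\<And>x. x \<in> V \<Longrightarrow> at_point (rkv x) (\<psi> x)"
    "\<And>x \<psi>'. x \<in> V \<Longrightarrow> ring_hom_into_puiseux V B \<psi>' \<Longrightarrow> at_point (rkv x) \<psi>' \<Longrightarrow> \<psi>' c = \<psi> x c"
    using bchoice[of V "\<lambda>x \<psi>. ring_hom_into_puiseux V B \<psi> \<and> at_point (rkv x) \<psi> \<and>
      (\<forall>\<psi>'. ring_hom_into_puiseux V B \<psi>' \<longrightarrow> at_point (rkv x) \<psi>' \<longrightarrow> (\<forall>c\<in>B. \<psi>' c = \<psi> c))"] cB by blast
  \<comment> \<open>The value of c at x: the constant term of its image under the extension along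
    the constant arc x.\<close>
  define G where "G x = \<psi> x c 0" for x
  have Gpq: "G x * q x = p x" if x: "x \<in> V" for x
  proof -
    obtain y where y: "fin y" "cf y = \<psi> x c" "y * Q (rkv x) = P (rkv x)"
      using subring_hom_quotient[OF B \<psi>(1,2)[OF x] PQ pq(4) cB c] by blast
    then have "y * rk (q x) = rk (p x)" unfolding pext_rkv[OF PQ(1)] pext_rkv[OF PQ(2)] by blast
    then have "st y * q x = p x" using fin_st_ops(5)[OF y(1) fin_rk[of "q x"]] by simp
    then show ?thesis using y(2) by (simp add: G_def)
  qed
  \<comment> \<open>Only points with q nonzero are compared at first, since there G is the quotient
    p/q of polynomials and a failure of continuity is a formula to which curve selection
    applies.\<close>
  have lim: "\<exists>d>0. \<forall>z\<in>V. dist z x < d \<longrightarrow> q z \<noteq> 0 \<longrightarrow> \<bar>G z - G x\<bar> < e" if x: "x \<in> V" and e: "e > 0" for x e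
  proof (rule ccontr)
    assume no: "\<not> ?thesis"
    have "\<exists>z\<in>V. dsq z x < d \<and> q z \<noteq> 0 \<and> e\<^sup>2 * (q z)\<^sup>2 \<le> (p z - G x * q z)\<^sup>2" if d: "d > 0" for d
    proof -
      obtain z where z: "z \<in> V" "dist z x < sqrt d" "q z \<noteq> 0" "\<bar>G z - G x\<bar> \<ge> e"
        using no d by (metis not_less real_sqrt_gt_0_iff)
      have "(dist z x)\<^sup>2 < (sqrt d)\<^sup>2" using z(2) by (intro power_strict_mono) auto
      then have "dsq z x < d" using d by (simp add: dsq_dist)
      moreover have "e\<^sup>2 \<le> \<bar>G z - G x\<bar>\<^sup>2" using z(4) e by (intro power_mono) auto
      then have "e\<^sup>2 * (q z)\<^sup>2 \<le> (G z - G x)\<^sup>2 * (q z)\<^sup>2" by (intro mult_right_mono) auto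
      then have "e\<^sup>2 * (q z)\<^sup>2 \<le> (p z - G x * q z)\<^sup>2"
        unfolding Gpq[OF z(1), symmetric] by (simp add: power_mult_distrib[symmetric] left_diff_distrib)
      ultimately show ?thesis using z by blast
    qed
    then obtain \<gamma> where \<gamma>: "finv \<gamma>" "gK \<gamma> = 0" "stv \<gamma> = x" "Q \<gamma> \<noteq> 0" "rk (e\<^sup>2) * (Q \<gamma>)\<^sup>2 \<le> (P \<gamma> - rk (G x) * Q \<gamma>)\<^sup>2"
      using curve_selection[OF PQ x, of "e\<^sup>2" "G x"] e by auto
    obtain \<theta> where \<theta>: "ring_hom_into_puiseux V B \<theta>" "at_point \<gamma> \<theta>" using ext[OF \<gamma>(1,2)] by blast
    obtain y where y: "fin y" "cf y = \<theta> c" "y * Q \<gamma> = P \<gamma>"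
      using subring_hom_quotient[OF B \<theta> PQ pq(4) cB c] by blast
    \<comment> \<open>Uniqueness along the constant arc at x. It makes y - G x infinitesimal,
      against the inequality carried by \<gamma>.\<close>
    have "pconst (\<theta> c 0) = \<psi> x c"
      using \<psi>(3)[OF x, of "\<lambda>c. pconst (\<theta> c 0)"] subring_hom_residue[OF B \<theta> \<gamma>(1,2)] \<gamma>(3) by simp
    then have "G x = \<theta> c 0" by (metis G_def pconst_def)
    then have sty: "st y = G x" using y(2) by simp
    have "rk (e\<^sup>2) * (Q \<gamma>)\<^sup>2 \<le> (y - rk (G x))\<^sup>2 * (Q \<gamma>)\<^sup>2"
      using \<gamma>(5) unfolding y(3)[symmetric] by (simp add: power_mult_distrib[symmetric] left_diff_distrib)
    then have le: "rk (e\<^sup>2) \<le> (y - rk (G x))\<^sup>2" using \<gamma>(4) by (simp del: rk_power)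
    have f: "fin (y - rk (G x))" "st (y - rk (G x)) = 0" using y(1) sty fin_st_ops(4)[OF y(1) fin_rk[of "G x"]] by auto
    have "(y - rk (G x))\<^sup>2 < rk (e\<^sup>2)"
      by (rule st_less_imp) (use fin_st_power[OF f(1), of 2] f(2) e in auto)
    then show False using le by simp
  qed
  \<comment> \<open>Zeros of q are included by density: close to x1 there is a z with q z nonzero,
    and G z is near both G x and G x1.\<close>
  have "continuous_on V G"
    unfolding continuous_on_iff
  proof (intro ballI allI impI)
    fix x e assume x: "x \<in> V" and e: "(0::real) < e"
    obtain d where d: "d > 0" "\<And>z. z \<in> V \<Longrightarrow> dist z x < d \<Longrightarrow> q z \<noteq> 0 \<Longrightarrow> \<bar>G z - G x\<bar> < e / 2"
      using lim[OF x, of "e / 2"] e by auto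
    have "dist (G x1) (G x) < e" if x1: "x1 \<in> V" "dist x1 x < d" for x1
    proof -
      obtain d1 where d1: "d1 > 0" "\<And>z. z \<in> V \<Longrightarrow> dist z x1 < d1 \<Longrightarrow> q z \<noteq> 0 \<Longrightarrow> \<bar>G z - G x1\<bar> < e / 2"
        using lim[OF x1(1), of "e / 2"] e by auto
      obtain z where z: "z \<in> V" "z \<in> ball x d \<inter> ball x1 d1" "q z \<noteq> 0"
        using dense[OF pq(3,4) x1(1), of "ball x d \<inter> ball x1 d1"] x1 d1(1) by (auto simp: dist_commute)
      have "\<bar>G z - G x\<bar> < e / 2" "\<bar>G z - G x1\<bar> < e / 2" using d(2)[OF z(1)] d1(2)[OF z(1)] z by (auto simp: dist_commute)
      then show ?thesis unfolding dist_real_def by linarith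
    qed
    then show "\<exists>d>0. \<forall>x'\<in>V. dist x' x < d \<longrightarrow> dist (G x') (G x) < e" using d(1) by blast
  qed
  then have "regul V G" unfolding regul_def regul_rep_def using pq Gpq by blast
  moreover have "c = cl V G"
    unfolding c by (rule cl_cong[OF pq(3,4)]) (use Gpq in \<open>simp add: field_simps\<close>)
  ultimately show "c \<in> R0 V" unfolding R0_cl by blast
qed

end

theorem theorem3p7:
  fixes V :: "(real^'n::finite) set"
  assumes "algebraic_set V" and "irreducible_alg V" and "nonsingular V"
  shows "subst_prop V (R0 V) \<and>
    (\<forall>B. is_subring_RV V B \<and> subst_prop V B \<longrightarrow> B \<subseteq> R0 V)"
proof -
  obtain g where g: "g \<in> polyfun" "V = {x. g x = 0}" using algebraic_set_hypersurface[OF assms(1)] by blast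
  obtain gK where gK: "pext g gK" using pext_ex[OF g(1)] by blast
  interpret puiseux_variety V g gK
    by unfold_locales (use assms g gK in auto)
  show ?thesis using R0_subst_prop subst_prop_subset_R0 by blast
qed

end
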